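(* Let $q\in\{1,3\}$. There exists an algorithm which, given as input a $1$-vertex triangulation $\mathfrak{T}$ with $n$ tetrahedra of a closed $3$-manifold with first Betti number $\beta_1(\mathfrak{T},\mathbb{Z}_2)$, computes the Turaev-Viro invariant $\mathrm{TV}_{4,q}(\mathfrak{T})$ in running time $O(2^{\beta_1(\mathfrak{T},\mathbb{Z}_2)}\, n^3)$ and with $O(n^2)$ space requirements.
   Context: Triangulations. A (generalised) triangulation $\mathfrak{T}$ of a closed $3$-manifold $M$ is a collection of $n$ abstract tetrahedra together with $2n$ gluing maps identifying their $4n$ triangular faces in pairs such that the underlying topological space is homeomorphic to $M$. Vertices, edges and triangles of $\mathfrak{T}$ are the equivalence classes of vertices, edges and triangles of the tetrahedra under the gluings; $V,E,F,T$ denote the sets of vertices, edges, triangles and tetrahedra of $\mathfrak{T}$. The triangulation is a $1$-vertex triangulation if $|V|=1$. $\beta_1(\mathfrak{T},\mathbb{Z}_2)$ is the dimension over $\mathbb{Z}_2=\mathbb{Z}/2\mathbb{Z}$ of the first homology group with $\mathbb{Z}_2$ coefficients. Admissible colourings. For an integer $r\ge 3$, $\mathrm{Adm}(\mathfrak{T},r)$ is the set of maps $\theta: E\to\{0,\tfrac12,1,\dots,\tfrac{r-2}{2}\}$ such that for every triangle of $\mathfrak{T}$ with edges $e_1,e_2,e_3$: $\theta(e_1)+\theta(e_2)+\theta(e_3)\in\mathbb{Z}$; $\theta(e_i)\le\theta(e_j)+\theta(e_k)$ for $\{i,j,k\}=\{1,2,3\}$; and $\theta(e_1)+\theta(e_2)+\theta(e_3)\le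 r-2$. Weights ($r=4$, $0<q<8$, $\gcd(4,q)=1$). Let $\zeta=e^{i\pi q/4}$, $[k]=(\zeta^k-\zeta^{-k})/(\zeta-\zeta^{-1})$ for $k\ge1$, $[0]=1$, and $[k]!=[k][k-1]\cdots[0]$. For $\theta\in\mathrm{Adm}(\mathfrak{T},4)$: each vertex $w$ has weight $|w|_\theta=|\zeta-\zeta^{-1}|^2/8=\tfrac14$; an edge $e$ of colour $i$ has weight $|e|_\theta=(-1)^{2i}[2i+1]$; a triangle $f$ with edge colours $i,j,k$ has weight $$|f|_\theta=(-1)^{i+j+k}\frac{[i+j-k]!\,[i+k-j]!\,[j+k-i]!}{[i+j+k+1]!}.$$ For a tetrahedron $t$ with edge colours $i_0,\dots,i_5$, labelled so that its triangles have colours $(i_0,i_1,i_3),(i_0,i_2,i_4),(i_1,i_2,i_5),(i_3,i_4,i_5)$ and its opposite edge pairs have colours $(i_0,i_5),(i_1,i_4),(i_2,i_3)$, $$|t|_\theta=\sum_{s}\frac{(-1)^s[s+1]!}{\tau(s)\,\kappa(s)},$$ where $\tau(s)=[s-i_0-i_1-i_3]!\,[s-i_0-i_2-i_4]!\,[s-i_1-i_2-i_5]!\,[s-i_3-i_4-i_5]!$, $\kappa(s)=[i_0+i_1+i_4+i_5-s]!\,[i_0+i_2+i_3+i_5-s]!\,[i_1+i_2+i_3+i_4-s]!$, and $s$ ranges over all integers for which all bracket-factorial arguments in $\tau(s),\kappa(s)$ are non-negative. The weight of $\theta$ is $|\mathfrak{T}|_\theta=\prod_{w\in V}|w|_\theta\prod_{e\in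 E}|e|_\theta\prod_{f\in F}|f|_\theta\prod_{t\in T}|t|_\theta$, and $\mathrm{TV}_{4,q}(\mathfrak{T})=\sum_{\theta\in\mathrm{Adm}(\mathfrak{T},4)}|\mathfrak{T}|_\theta$. Computational convention. Up to the constant vertex weight factor $\tfrac14$ (which may be omitted), all computations are done in $\mathbb{Z}[\sqrt2]$, with $\sqrt2$ represented symbolically and arithmetic operations counted as constant time. *)

theory Defs
  imports
    "HOL-Analysis.Analysis"
    "HOL-Homology.Simplices"
    "HOL-Library.Z2"
    "HOL-Library.Function_Algebras"
begin

text \<open>
  The tetrahedra are numbered by \<open>0, \<dots>, tets T - 1\<close>, the vertices of each one by \<open>0, \<dots>, 3\<close>, and
  face \<open>f\<close> of a tetrahedron is the one opposite its vertex \<open>f\<close>.  Face \<open>f\<close> of \<open>t\<close> is glued to the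
  tetrahedron \<open>nbr T t f\<close>; the permutation \<open>gperm T t f\<close> sends each vertex of that face to the
  vertex it is glued to, and \<open>f\<close> to the number of the partner face.
\<close>

record triangulation =
  tets :: nat
  nbr :: "nat \<Rightarrow> nat \<Rightarrow> nat"
  gperm :: "nat \<Rightarrow> nat \<Rightarrow> nat \<Rightarrow> nat"

text \<open>The face gluings form a fixed point free involution on the \<open>4 * tets T\<close> faces.\<close>

definition gluing :: "triangulation \<Rightarrow> bool" where
  "gluing T \<longleftrightarrow>
    (\<forall>t<tets T. \<forall>f<4.
       let u = nbr T t f; p = gperm T t f in
         u < tets T \<and> p permutes {..<4} \<and> (u, p f) \<noteq> (t, f) \<and>
         nbr T u (p f) = t \<and> gperm T u (p f) = inv_into UNIV p)"

definition equiv_generated :: "'a rel \<Rightarrow> 'a rel" where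
  "equiv_generated r = (r \<union> r\<inverse>)\<^sup>*"

definition quotient_topology :: "'a topology \<Rightarrow> 'a rel \<Rightarrow> 'a set topology" where
  "quotient_topology X R =
    topology (\<lambda>U. U \<subseteq> topspace X // R \<and> openin X {x \<in> topspace X. R `` {x} \<in> U})"

lemma openin_quotient_topology:
  "openin (quotient_topology X R) U \<longleftrightarrow>
    U \<subseteq> topspace X // R \<and> openin X {x \<in> topspace X. R `` {x} \<in> U}"
proof -
  have "istopology (\<lambda>U. U \<subseteq> topspace X // R \<and> openin X {x \<in> topspace X. R `` {x} \<in> U})"
    unfolding istopology_def
  proof (intro conjI allI impI; (elim conjE)?)
    fix S U
    assume "openin X {x \<in> topspace X. R `` {x} \<in> S}" "openin X {x \<in> topspace X. R `` {x} \<in> U}"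
    then have "openin X ({x \<in> topspace X. R `` {x} \<in> S} \<inter> {x \<in> topspace X. R `` {x} \<in> U})"
      by (rule openin_Int)
    also have "\<dots> = {x \<in> topspace X. R `` {x} \<in> S \<inter> U}" by auto
    finally show "openin X {x \<in> topspace X. R `` {x} \<in> S \<inter> U}" .
  next
    fix K
    assume K: "\<forall>U\<in>K. U \<subseteq> topspace X // R \<and> openin X {x \<in> topspace X. R `` {x} \<in> U}"
    then have "openin X (\<Union>U\<in>K. {x \<in> topspace X. R `` {x} \<in> U})" by blast
    also have "(\<Union>U\<in>K. {x \<in> topspace X. R `` {x} \<in> U}) = {x \<in> topspace X. R `` {x} \<in> \<Union>K}"
      by auto
    finally show "openin X {x \<in> topspace X. R `` {x} \<in> \<Union>K}" .
    show "\<Union>K \<subseteq> topspace X // R" using K by blast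
  qed auto
  then show ?thesis
    unfolding quotient_topology_def by (simp add: topology_inverse')
qed

lemma topspace_quotient_topology: "topspace (quotient_topology X R) = topspace X // R"
proof -
  have "{x \<in> topspace X. R `` {x} \<in> topspace X // R} = topspace X"
    by (auto simp: quotient_def)
  then have "openin (quotient_topology X R) (topspace X // R)"
    by (simp add: openin_quotient_topology)
  moreover have "topspace (quotient_topology X R) \<subseteq> topspace X // R"
    by (meson openin_quotient_topology openin_topspace)
  ultimately show ?thesis
    using openin_subset by blast
qed

lemma quotient_map_quotient_topology:
  "quotient_map X (quotient_topology X R) (\<lambda>x. R `` {x})"
  unfolding quotient_map_def
  by (auto simp: topspace_quotient_topology openin_quotient_topology quotient_def)

text \<open>
  Points of the \<open>t\<close>-th tetrahedron are pairs of \<open>t\<close> and barycentric coordinates; a gluing map is the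
  affine extension of its action on the vertices.
\<close>

definition underlying_space :: "triangulation \<Rightarrow> (nat \<times> (nat \<Rightarrow> real)) set topology" where
  "underlying_space T =
    quotient_topology
      (sum_topology (\<lambda>_. subtopology (powertop_real UNIV) (standard_simplex 3)) {..<tets T})
      (equiv_generated
        {((t, x), (nbr T t f, x \<circ> inv_into UNIV (gperm T t f))) | t f x.
           t < tets T \<and> f < 4 \<and> x \<in> standard_simplex 3 \<and> x f = 0})"

text \<open>Second countability is implied, since compactness leaves finitely many charts.\<close>

definition closed_3_manifold :: "'a topology \<Rightarrow> bool" where
  "closed_3_manifold X \<longleftrightarrow> compact_space X \<and> Hausdorff_space X \<and>
    (\<forall>x\<in>topspace X. \<exists>U (V :: (real^3) set). openin X U \<and> x \<in> U \<and> open V \<and>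
       subtopology X U homeomorphic_space top_of_set V)"

definition triangulates_closed_3_manifold :: "triangulation \<Rightarrow> bool" where
  "triangulates_closed_3_manifold T \<longleftrightarrow> gluing T \<and> closed_3_manifold (underlying_space T)"

text \<open>
  The face of \<open>t\<close> spanned by a set \<open>A\<close> of vertices is represented as \<open>(t, A)\<close>; cells of the
  triangulation are classes of such pairs.
\<close>

type_synonym tri_cell = "(nat \<times> nat set) set"

definition cell :: "triangulation \<Rightarrow> nat \<Rightarrow> nat set \<Rightarrow> tri_cell" where
  "cell T t A =
    equiv_generated
      {((u, B), (nbr T u f, gperm T u f ` B)) | u f B.
         u < tets T \<and> f < 4 \<and> B \<subseteq> {..<4} \<and> f \<notin> B} `` {(t, A)}"

definition cells :: "triangulation \<Rightarrow> nat \<Rightarrow> tri_cell set" where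
  "cells T d = {cell T t A | t A. t < tets T \<and> A \<subseteq> {..<4} \<and> card A = Suc d}"

definition one_vertex :: "triangulation \<Rightarrow> bool" where
  "one_vertex T \<longleftrightarrow> card (cells T 0) = 1"

definition chains :: "triangulation \<Rightarrow> nat \<Rightarrow> (tri_cell \<Rightarrow> bit) set" where
  "chains T d = {x. \<forall>c. c \<notin> cells T d \<longrightarrow> x c = 0}"

text \<open>
  A cell may meet the same codimension-one cell along several of its faces, and these are counted
  with multiplicity.  The count does not depend on the chosen representative.
\<close>

definition incidence :: "triangulation \<Rightarrow> tri_cell \<Rightarrow> tri_cell \<Rightarrow> bit" where
  "incidence T c d =
    (case (SOME r. r \<in> c) of (t, A) \<Rightarrow> of_nat (card {a \<in> A. cell T t (A - {a}) = d}))"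

definition boundary :: "triangulation \<Rightarrow> nat \<Rightarrow> (tri_cell \<Rightarrow> bit) \<Rightarrow> (tri_cell \<Rightarrow> bit)" where
  "boundary T k x d =
    (if d \<in> cells T (k - 1) then \<Sum>c\<in>cells T k. incidence T c d * x c else 0)"

definition bit_scale :: "bit \<Rightarrow> ('a \<Rightarrow> bit) \<Rightarrow> ('a \<Rightarrow> bit)" where
  "bit_scale a x = (\<lambda>c. a * x c)"

lemma vector_space_bit_scale: "vector_space bit_scale"
  by unfold_locales (auto simp: bit_scale_def fun_eq_iff algebra_simps)

text \<open>The dimension of one-cycles modulo one-boundaries.\<close>

definition betti1 :: "triangulation \<Rightarrow> nat" where
  "betti1 T =
    vector_space.dim bit_scale {x \<in> chains T 1. boundary T 1 x = 0}
    - vector_space.dim bit_scale (boundary T 2 ` chains T 2)"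

definition colours :: "nat \<Rightarrow> real set" where
  "colours r = {real k / 2 | k. k + 2 \<le> r}"

abbreviation edge_colour ::
  "triangulation \<Rightarrow> (tri_cell \<Rightarrow> real) \<Rightarrow> nat \<Rightarrow> nat \<Rightarrow> nat \<Rightarrow> real" where
  "edge_colour T \<theta> t a b \<equiv> \<theta> (cell T t {a, b})"

text \<open>As \<open>(a, b, c)\<close> ranges over ordered triples, all three triangle inequalities are imposed.\<close>

definition Adm :: "triangulation \<Rightarrow> nat \<Rightarrow> (tri_cell \<Rightarrow> real) set" where
  "Adm T r = {\<theta> \<in> cells T 1 \<rightarrow>\<^sub>E colours r.
    \<forall>t<tets T. \<forall>a<4. \<forall>b<4. \<forall>c<4. distinct [a, b, c] \<longrightarrow>
      (let i = edge_colour T \<theta> t a b; j = edge_colour T \<theta> t a c; k = edge_colour T \<theta> t b c in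
         i + j + k \<in> \<int> \<and> i \<le> j + k \<and> i + j + k \<le> real r - 2)}"

definition zeta :: "nat \<Rightarrow> complex" where
  "zeta q = exp (\<i> * of_real pi * of_nat q / 4)"

definition bracket :: "nat \<Rightarrow> nat \<Rightarrow> complex" where
  "bracket q k =
    (if k = 0 then 1
     else (zeta q ^ k - inverse (zeta q) ^ k) / (zeta q - inverse (zeta q)))"

text \<open>
  The arguments below are non-negative integers given as real numbers.  The factorial includes the
  factor \<open>bracket q 0 = 1\<close>.
\<close>

definition bracket_fact :: "nat \<Rightarrow> real \<Rightarrow> complex" where
  "bracket_fact q x = (\<Prod>k\<le>nat \<lfloor>x\<rfloor>. bracket q k)"

definition sign_pow :: "real \<Rightarrow> complex" where
  "sign_pow x = (- 1) ^ nat \<lfloor>x\<rfloor>"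

definition vertex_weight :: "nat \<Rightarrow> complex" where
  "vertex_weight q = of_real ((cmod (zeta q - inverse (zeta q)))\<^sup>2 / 8)"

definition edge_weight :: "nat \<Rightarrow> real \<Rightarrow> complex" where
  "edge_weight q i = sign_pow (2 * i) * bracket q (nat \<lfloor>2 * i + 1\<rfloor>)"

definition colour_triple_weight :: "nat \<Rightarrow> real \<Rightarrow> real \<Rightarrow> real \<Rightarrow> complex" where
  "colour_triple_weight q i j k =
    sign_pow (i + j + k)
    * (bracket_fact q (i + j - k) * bracket_fact q (i + k - j) * bracket_fact q (j + k - i))
    / bracket_fact q (i + j + k + 1)"

definition triangle_weight ::
  "triangulation \<Rightarrow> nat \<Rightarrow> (tri_cell \<Rightarrow> real) \<Rightarrow> tri_cell \<Rightarrow> complex" where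
  "triangle_weight T q \<theta> F =
    (THE w. \<exists>t a b c. t < tets T \<and> a < 4 \<and> b < 4 \<and> c < 4 \<and> distinct [a, b, c] \<and>
       F = cell T t {a, b, c} \<and>
       w = colour_triple_weight q
             (edge_colour T \<theta> t a b) (edge_colour T \<theta> t a c) (edge_colour T \<theta> t b c))"

definition colour_sextuple_weight ::
  "nat \<Rightarrow> real \<Rightarrow> real \<Rightarrow> real \<Rightarrow> real \<Rightarrow> real \<Rightarrow> real \<Rightarrow> complex" where
  "colour_sextuple_weight q i0 i1 i2 i3 i4 i5 =
    (let taus = [i0 + i1 + i3, i0 + i2 + i4, i1 + i2 + i5, i3 + i4 + i5];
         kappas = [i0 + i1 + i4 + i5, i0 + i2 + i3 + i5, i1 + i2 + i3 + i4]
     in \<Sum>s\<in>{s :: int. (\<forall>x\<in>set taus. x \<le> of_int s) \<and> (\<forall>y\<in>set kappas. of_int s \<le> y)}.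
          sign_pow (of_int s) * bracket_fact q (of_int s + 1)
          / ((\<Prod>x\<leftarrow>taus. bracket_fact q (of_int s - x))
             * (\<Prod>y\<leftarrow>kappas. bracket_fact q (y - of_int s))))"

definition tet_weight :: "triangulation \<Rightarrow> nat \<Rightarrow> (tri_cell \<Rightarrow> real) \<Rightarrow> nat \<Rightarrow> complex" where
  "tet_weight T q \<theta> t =
    colour_sextuple_weight q
      (edge_colour T \<theta> t 0 1) (edge_colour T \<theta> t 0 2) (edge_colour T \<theta> t 0 3)
      (edge_colour T \<theta> t 1 2) (edge_colour T \<theta> t 1 3) (edge_colour T \<theta> t 2 3)"

definition colouring_weight :: "triangulation \<Rightarrow> nat \<Rightarrow> (tri_cell \<Rightarrow> real) \<Rightarrow> complex" where
  "colouring_weight T q \<theta> =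
    (\<Prod>w\<in>cells T 0. vertex_weight q) * (\<Prod>e\<in>cells T 1. edge_weight q (\<theta> e))
    * (\<Prod>F\<in>cells T 2. triangle_weight T q \<theta> F) * (\<Prod>t<tets T. tet_weight T q \<theta> t)"

text \<open>The parameter \<open>r\<close> of the invariant is \<open>4\<close>, as in the weights above.\<close>

definition TV4 :: "nat \<Rightarrow> triangulation \<Rightarrow> complex" where
  "TV4 q T = (\<Sum>\<theta>\<in>Adm T 4. colouring_weight T q \<theta>)"

datatype zsqrt2 = ZSqrt2 int int

fun zvalue :: "zsqrt2 \<Rightarrow> real" where
  "zvalue (ZSqrt2 a b) = of_int a + of_int b * sqrt 2"

fun zadd :: "zsqrt2 \<Rightarrow> zsqrt2 \<Rightarrow> zsqrt2" where
  "zadd (ZSqrt2 a b) (ZSqrt2 c d) = ZSqrt2 (a + c) (b + d)"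

fun zsub :: "zsqrt2 \<Rightarrow> zsqrt2 \<Rightarrow> zsqrt2" where
  "zsub (ZSqrt2 a b) (ZSqrt2 c d) = ZSqrt2 (a - c) (b - d)"

fun zmul :: "zsqrt2 \<Rightarrow> zsqrt2 \<Rightarrow> zsqrt2" where
  "zmul (ZSqrt2 a b) (ZSqrt2 c d) = ZSqrt2 (a * c + 2 * b * d) (a * d + b * c)"

text \<open>
  Memory consists of arrays of machine words and arrays of numbers \<open>a + b * sqrt 2\<close>.  Programs are
  finite and mention finitely many arrays.  The results of all word operations are reduced modulo
  \<open>2 ^ w\<close> (with truncated subtraction).  Numbers of the second kind are exact, and there is no way
  to test them or to turn them into words, so that only words control the computation.
\<close>

type_synonym state = "(nat \<Rightarrow> nat \<Rightarrow> nat) \<times> (nat \<Rightarrow> nat \<Rightarrow> zsqrt2)"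

datatype arr = WArr nat | ZArr nat

type_synonym loc = "arr \<times> nat"

datatype wexp =
    WConst nat
  | WGet nat wexp
  | WAdd wexp wexp
  | WSub wexp wexp
  | WMul wexp wexp

datatype bexp =
    BEq wexp wexp
  | BLess wexp wexp
  | BNot bexp
  | BAnd bexp bexp

datatype zexp =
    ZConst zsqrt2
  | ZGet nat wexp
  | ZAdd zexp zexp
  | ZSub zexp zexp
  | ZMul zexp zexp

datatype com =
    Skip
  | WPut nat wexp wexp
  | ZPut nat wexp zexp
  | Seq com com
  | Cond bexp com com
  | While bexp com

fun weval :: "nat \<Rightarrow> state \<Rightarrow> wexp \<Rightarrow> nat" where
  "weval w s (WConst k) = k mod 2 ^ w"
| "weval w s (WGet a e) = fst s a (weval w s e)"
| "weval w s (WAdd e f) = (weval w s e + weval w s f) mod 2 ^ w"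
| "weval w s (WSub e f) = (weval w s e - weval w s f) mod 2 ^ w"
| "weval w s (WMul e f) = (weval w s e * weval w s f) mod 2 ^ w"

fun beval :: "nat \<Rightarrow> state \<Rightarrow> bexp \<Rightarrow> bool" where
  "beval w s (BEq e f) \<longleftrightarrow> weval w s e = weval w s f"
| "beval w s (BLess e f) \<longleftrightarrow> weval w s e < weval w s f"
| "beval w s (BNot b) \<longleftrightarrow> \<not> beval w s b"
| "beval w s (BAnd b c) \<longleftrightarrow> beval w s b \<and> beval w s c"

fun zeval :: "nat \<Rightarrow> state \<Rightarrow> zexp \<Rightarrow> zsqrt2" where
  "zeval w s (ZConst z) = z"
| "zeval w s (ZGet a e) = snd s a (weval w s e)"
| "zeval w s (ZAdd e f) = zadd (zeval w s e) (zeval w s f)"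
| "zeval w s (ZSub e f) = zsub (zeval w s e) (zeval w s f)"
| "zeval w s (ZMul e f) = zmul (zeval w s e) (zeval w s f)"

text \<open>Every operator, constant and memory access costs one unit of time.\<close>

fun wcost :: "wexp \<Rightarrow> nat" where
  "wcost (WConst k) = 1"
| "wcost (WGet a e) = Suc (wcost e)"
| "wcost (WAdd e f) = Suc (wcost e + wcost f)"
| "wcost (WSub e f) = Suc (wcost e + wcost f)"
| "wcost (WMul e f) = Suc (wcost e + wcost f)"

fun bcost :: "bexp \<Rightarrow> nat" where
  "bcost (BEq e f) = Suc (wcost e + wcost f)"
| "bcost (BLess e f) = Suc (wcost e + wcost f)"
| "bcost (BNot b) = Suc (bcost b)"
| "bcost (BAnd b c) = Suc (bcost b + bcost c)"

fun zcost :: "zexp \<Rightarrow> nat" where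
  "zcost (ZConst z) = 1"
| "zcost (ZGet a e) = Suc (wcost e)"
| "zcost (ZAdd e f) = Suc (zcost e + zcost f)"
| "zcost (ZSub e f) = Suc (zcost e + zcost f)"
| "zcost (ZMul e f) = Suc (zcost e + zcost f)"

fun wlocs :: "nat \<Rightarrow> state \<Rightarrow> wexp \<Rightarrow> loc set" where
  "wlocs w s (WConst k) = {}"
| "wlocs w s (WGet a e) = insert (WArr a, weval w s e) (wlocs w s e)"
| "wlocs w s (WAdd e f) = wlocs w s e \<union> wlocs w s f"
| "wlocs w s (WSub e f) = wlocs w s e \<union> wlocs w s f"
| "wlocs w s (WMul e f) = wlocs w s e \<union> wlocs w s f"

fun blocs :: "nat \<Rightarrow> state \<Rightarrow> bexp \<Rightarrow> loc set" where
  "blocs w s (BEq e f) = wlocs w s e \<union> wlocs w s f"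
| "blocs w s (BLess e f) = wlocs w s e \<union> wlocs w s f"
| "blocs w s (BNot b) = blocs w s b"
| "blocs w s (BAnd b c) = blocs w s b \<union> blocs w s c"

fun zlocs :: "nat \<Rightarrow> state \<Rightarrow> zexp \<Rightarrow> loc set" where
  "zlocs w s (ZConst z) = {}"
| "zlocs w s (ZGet a e) = insert (ZArr a, weval w s e) (wlocs w s e)"
| "zlocs w s (ZAdd e f) = zlocs w s e \<union> zlocs w s f"
| "zlocs w s (ZSub e f) = zlocs w s e \<union> zlocs w s f"
| "zlocs w s (ZMul e f) = zlocs w s e \<union> zlocs w s f"

fun wupd :: "state \<Rightarrow> nat \<Rightarrow> nat \<Rightarrow> nat \<Rightarrow> state" where
  "wupd (W, Z) a i v = (W(a := (W a)(i := v)), Z)"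

fun zupd :: "state \<Rightarrow> nat \<Rightarrow> nat \<Rightarrow> zsqrt2 \<Rightarrow> state" where
  "zupd (W, Z) a i v = (W, Z(a := (Z a)(i := v)))"

text \<open>
  \<open>exec w c s m L s'\<close>: with word length \<open>w\<close>, program \<open>c\<close> started in \<open>s\<close> halts in \<open>s'\<close> after time \<open>m\<close>,
  having read or written exactly the memory locations in \<open>L\<close>.
\<close>

inductive exec :: "nat \<Rightarrow> com \<Rightarrow> state \<Rightarrow> nat \<Rightarrow> loc set \<Rightarrow> state \<Rightarrow> bool" for w where
  Skip: "exec w Skip s 1 {} s"
| WPut: "exec w (WPut a e f) s (Suc (wcost e + wcost f))
           (insert (WArr a, weval w s e) (wlocs w s e \<union> wlocs w s f))
           (wupd s a (weval w s e) (weval w s f))"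
| ZPut: "exec w (ZPut a e f) s (Suc (wcost e + zcost f))
           (insert (ZArr a, weval w s e) (wlocs w s e \<union> zlocs w s f))
           (zupd s a (weval w s e) (zeval w s f))"
| Seq: "exec w c s m K s' \<Longrightarrow> exec w d s' m' L s'' \<Longrightarrow>
         exec w (Seq c d) s (Suc (m + m')) (K \<union> L) s''"
| CondTrue: "beval w s b \<Longrightarrow> exec w c s m L s' \<Longrightarrow>
         exec w (Cond b c d) s (Suc (bcost b + m)) (blocs w s b \<union> L) s'"
| CondFalse: "\<not> beval w s b \<Longrightarrow> exec w d s m L s' \<Longrightarrow>
         exec w (Cond b c d) s (Suc (bcost b + m)) (blocs w s b \<union> L) s'"
| WhileFalse: "\<not> beval w s b \<Longrightarrow>
         exec w (While b c) s (Suc (bcost b)) (blocs w s b) s"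
| WhileTrue: "beval w s b \<Longrightarrow> exec w c s m K s' \<Longrightarrow> exec w (While b c) s' m' L s'' \<Longrightarrow>
         exec w (While b c) s (Suc (bcost b + m + m')) (blocs w s b \<union> K \<union> L) s''"

lemma exec_deterministic:
  "exec w c s m L s' \<Longrightarrow> exec w c s m' L' s'' \<Longrightarrow> m' = m \<and> L' = L \<and> s'' = s'"
proof (induction arbitrary: m' L' s'' rule: exec.induct)
  case (Seq c s m K s' d n L t)
  from Seq.prems show ?case by cases (use Seq.IH in blast)
next
  case (CondTrue s b c m L s' d)
  from CondTrue.prems show ?case by cases (use CondTrue in blast)+
next
  case (CondFalse s b d m L s' c)
  from CondFalse.prems show ?case by cases (use CondFalse in blast)+
next
  case (WhileFalse s b c)
  from WhileFalse.prems show ?case by cases (use WhileFalse in blast)+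
next
  case (WhileTrue s b c m K s' n L t)
  from WhileTrue.prems show ?case by cases (use WhileTrue in blast)+
qed (erule exec.cases; simp)+

text \<open>Each array occupies all cells up to the largest index used in it.\<close>

definition space_used :: "loc set \<Rightarrow> nat" where
  "space_used L = (\<Sum>a\<in>fst ` L. Suc (Max {i. (a, i) \<in> L}))"

text \<open>
  Words of \<open>k\<close> times the number of binary digits of \<open>n\<close>: for each fixed \<open>k\<close>, a word holds
  \<open>O(log n)\<close> bits.
\<close>

definition word_length :: "nat \<Rightarrow> nat \<Rightarrow> nat" where
  "word_length k n = k * nat \<lceil>log 2 (real n + 1)\<rceil>"

text \<open>
  Input format: the number of tetrahedra, the table of neighbours and the table of gluing
  permutations.  All other memory is zero, in particular outside the tables, so that the
  values of \<open>nbr\<close> and \<open>gperm\<close> at meaningless arguments are not visible to a program.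
\<close>

definition input_state :: "triangulation \<Rightarrow> state" where
  "input_state T =
    (\<lambda>a i.
       if a = 0 \<and> i = 0 then tets T
       else if a = 1 \<and> i < 4 * tets T then nbr T (i div 4) (i mod 4)
       else if a = 2 \<and> i < 16 * tets T then gperm T (i div 16) (i div 4 mod 4) (i mod 4)
       else 0,
     \<lambda>a i. ZSqrt2 0 0)"

text \<open>
  Weights of triangles may be \<open>1 / sqrt 2\<close> up to sign, hence the weight of a single colouring is in
  general not in $\mathbb{Z}[\sqrt 2]$, even without its factor \<open>1 / 4\<close>.  The value is therefore
  represented by a numerator \<open>z\<close> in $\mathbb{Z}[\sqrt 2]$ and a word \<open>e\<close>, the exponent of a
  denominator \<open>sqrt 2 ^ e\<close>; the vertex factor \<open>1 / 4\<close> is omitted from the output.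
\<close>

definition output_value :: "state \<Rightarrow> real" where
  "output_value s = (let z = snd s 0 0; e = fst s 0 0 in zvalue z / sqrt 2 ^ e)"

end

theory Submission
  imports Defs
begin

text \<open>
  Why the theorem holds.  An edge colour is \<open>0\<close>, \<open>1/2\<close> or \<open>1\<close>; it is written as \<open>(\<alpha> e + 2 x e) / 2\<close>
  with \<open>\<alpha>\<close> and \<open>x\<close> valued in the field of two elements and \<open>x e = 0\<close> wherever \<open>\<alpha> e = 1\<close>.  Admissibility at
  a triangle then says that \<open>\<alpha>\<close> adds up to zero along its edges and, if \<open>\<alpha>\<close> vanishes on all three of
  them, that \<open>x\<close> does so too (\<open>admissible3_colour\<close>).  Hence \<open>\<alpha>\<close> ranges over the one-cocycles.  With a
  single vertex every one-chain is a cycle, and since the cocycles are the annihilator of the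
  boundaries, there are exactly \<open>2 ^ betti1 T\<close> of them (\<open>card_cocycles\<close>).  This is where the
  exponential factor comes from.

  For a fixed cocycle the remaining sum is computable in cubic time.  The weight of each cell is a
  constant that depends on \<open>\<alpha>\<close> only, times a sign whose exponent is a polynomial of degree at most
  two in \<open>x\<close> (\<open>colour_triple_weight_colour\<close>, \<open>colour_sextuple_weight_colour\<close>).  The linear conditions
  on \<open>x\<close> are expressed by further summation variables: summing \<open>(-1)^(l * b)\<close> over \<open>l\<close> gives \<open>2\<close> if
  \<open>b = 0\<close> and \<open>0\<close> otherwise.  So the sum over \<open>x\<close> is a Gauss sum, the sum of \<open>(-1)^(Q y)\<close> over all vectors
  \<open>y\<close>, where \<open>Q\<close> is a polynomial of degree two in \<open>36 n\<close> variables (\<open>TV4_gauss_sum\<close>).  Such a sum is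
  evaluated by removing one variable at a time (\<open>gauss_insert_no_pivot\<close>, \<open>gauss_insert_pivot\<close>).  The
  two values of the removed variable contribute with the relative sign \<open>(-1)^\<lambda>\<close>, where \<open>\<lambda>\<close> is affine
  in the other variables, so that only the solutions of \<open>\<lambda> = 0\<close> survive.  If \<open>\<lambda>\<close> is constant, the sum
  is doubled or vanishes; otherwise \<open>\<lambda> = 0\<close> is solved for another variable, which amounts to adding a
  matrix of rank one to the coefficients of \<open>Q\<close>.  Each removal costs \<open>O(n^2)\<close>.

  The program labels the edges, computes a basis of the cocycles by elimination, and then runs
  through all cocycles with a binary counter, adding up their Gauss sums.  Its largest arrays are
  square matrices of size \<open>O(n)\<close>.  Apart from the loop over the cocycles it consists of counting loops
  that are nested at most three deep and run over ranges of length \<open>O(n)\<close>, and \<open>exec_compile\<close> turns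
  the nesting depth into a time bound and the range of the indices into a space bound.

  The division by a power of two that the multipliers require, and the weights \<open>1 / [2]\<close> of triangles
  with half-integral edges, are moved into the exponent \<open>48 n\<close> of the output: a multiplier for a
  slot gives a factor \<open>2\<close>, and the pieces belonging to a face are scaled by \<open>4\<close>, which together is
  \<open>2 ^ (16 n) * 4 ^ (4 n) = sqrt 2 ^ (48 n)\<close>.
\<close>

section \<open>Structured programs with bounded loops\<close>

text \<open>
  Programs whose only loops count upwards: \<open>SFor a b c\<close> runs \<open>c\<close> with the word \<open>a[0]\<close> taking the values
  \<open>0, \<dots>, b[0] - 1\<close>.  The number of iterations is then bounded by the largest word in memory, so the
  running time can be read off the nesting depth of the loops.
\<close>

datatype stm =
    SSkip
  | SW nat wexp wexp
  | SZ nat wexp zexp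
  | SSeq stm stm
  | SIf bexp stm stm
  | SFor nat nat stm

abbreviation V :: "nat \<Rightarrow> wexp" where "V a \<equiv> WGet a (WConst 0)"

primrec compile :: "stm \<Rightarrow> com" where
  "compile SSkip = Skip"
| "compile (SW a e f) = WPut a e f"
| "compile (SZ a e f) = ZPut a e f"
| "compile (SSeq c d) = Seq (compile c) (compile d)"
| "compile (SIf b c d) = Cond b (compile c) (compile d)"
| "compile (SFor a b c) =
    Seq (WPut a (WConst 0) (WConst 0))
      (While (BLess (V a) (V b)) (Seq (compile c) (WPut a (WConst 0) (WAdd (V a) (WConst 1)))))"

text \<open>
  Evaluation without reduction modulo the word size.  Correctness of the programs is proved for these
  exact values, and \<open>weval_ieval\<close> transfers it to long enough words.
\<close>

primrec ieval :: "state \<Rightarrow> wexp \<Rightarrow> nat" where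
  "ieval s (WConst k) = k"
| "ieval s (WGet a e) = fst s a (ieval s e)"
| "ieval s (WAdd e f) = ieval s e + ieval s f"
| "ieval s (WSub e f) = ieval s e - ieval s f"
| "ieval s (WMul e f) = ieval s e * ieval s f"

primrec ibeval :: "state \<Rightarrow> bexp \<Rightarrow> bool" where
  "ibeval s (BEq e f) \<longleftrightarrow> ieval s e = ieval s f"
| "ibeval s (BLess e f) \<longleftrightarrow> ieval s e < ieval s f"
| "ibeval s (BNot b) \<longleftrightarrow> \<not> ibeval s b"
| "ibeval s (BAnd b c) \<longleftrightarrow> ibeval s b \<and> ibeval s c"

primrec izeval :: "state \<Rightarrow> zexp \<Rightarrow> zsqrt2" where
  "izeval s (ZConst z) = z"
| "izeval s (ZGet a e) = snd s a (ieval s e)"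
| "izeval s (ZAdd e f) = zadd (izeval s e) (izeval s f)"
| "izeval s (ZSub e f) = zsub (izeval s e) (izeval s f)"
| "izeval s (ZMul e f) = zmul (izeval s e) (izeval s f)"

text \<open>
  An exponent such that \<open>M ^ wsize e\<close> bounds the value of \<open>e\<close> and of all its parts, for \<open>M \<ge> 2\<close> and a
  memory with entries at most \<open>M\<close>.  The numeral \<open>k\<close> counts \<open>Suc k\<close> because \<open>k < 2 ^ Suc k\<close>.
\<close>

primrec wsize :: "wexp \<Rightarrow> nat" where
  "wsize (WConst k) = Suc k"
| "wsize (WGet a e) = Suc (wsize e)"
| "wsize (WAdd e f) = wsize e + wsize f"
| "wsize (WSub e f) = wsize e + wsize f"
| "wsize (WMul e f) = wsize e + wsize f"

primrec bsize :: "bexp \<Rightarrow> nat" where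
  "bsize (BEq e f) = wsize e + wsize f"
| "bsize (BLess e f) = wsize e + wsize f"
| "bsize (BNot b) = bsize b"
| "bsize (BAnd b c) = bsize b + bsize c"

primrec zsize :: "zexp \<Rightarrow> nat" where
  "zsize (ZConst z) = 1"
| "zsize (ZGet a e) = wsize e"
| "zsize (ZAdd e f) = zsize e + zsize f"
| "zsize (ZSub e f) = zsize e + zsize f"
| "zsize (ZMul e f) = zsize e + zsize f"

text \<open>
  The loop contributes \<open>5\<close> for its own expressions: the comparison of the counter with its bound has
  size \<open>4\<close>, and the increment of the counter together with the address has size \<open>5\<close>.
\<close>

primrec ssize :: "stm \<Rightarrow> nat" where
  "ssize SSkip = 0"
| "ssize (SW a e f) = wsize e + wsize f"
| "ssize (SZ a e f) = wsize e + zsize f"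
| "ssize (SSeq c d) = ssize c + ssize d"
| "ssize (SIf b c d) = bsize b + ssize c + ssize d"
| "ssize (SFor a b c) = ssize c + 5"

primrec warrs :: "wexp \<Rightarrow> arr set" where
  "warrs (WConst k) = {}"
| "warrs (WGet a e) = insert (WArr a) (warrs e)"
| "warrs (WAdd e f) = warrs e \<union> warrs f"
| "warrs (WSub e f) = warrs e \<union> warrs f"
| "warrs (WMul e f) = warrs e \<union> warrs f"

primrec barrs :: "bexp \<Rightarrow> arr set" where
  "barrs (BEq e f) = warrs e \<union> warrs f"
| "barrs (BLess e f) = warrs e \<union> warrs f"
| "barrs (BNot b) = barrs b"
| "barrs (BAnd b c) = barrs b \<union> barrs c"

primrec zarrs :: "zexp \<Rightarrow> arr set" where
  "zarrs (ZConst z) = {}"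
| "zarrs (ZGet a e) = insert (ZArr a) (warrs e)"
| "zarrs (ZAdd e f) = zarrs e \<union> zarrs f"
| "zarrs (ZSub e f) = zarrs e \<union> zarrs f"
| "zarrs (ZMul e f) = zarrs e \<union> zarrs f"

primrec sarrs :: "stm \<Rightarrow> arr set" where
  "sarrs SSkip = {}"
| "sarrs (SW a e f) = insert (WArr a) (warrs e \<union> warrs f)"
| "sarrs (SZ a e f) = insert (ZArr a) (warrs e \<union> zarrs f)"
| "sarrs (SSeq c d) = sarrs c \<union> sarrs d"
| "sarrs (SIf b c d) = barrs b \<union> sarrs c \<union> sarrs d"
| "sarrs (SFor a b c) = {WArr a, WArr b} \<union> sarrs c"

text \<open>
  All memory accesses in an expression use indices below \<open>B\<close>.
\<close>

primrec wok :: "nat \<Rightarrow> state \<Rightarrow> wexp \<Rightarrow> bool" where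
  "wok B s (WConst k) \<longleftrightarrow> True"
| "wok B s (WGet a e) \<longleftrightarrow> wok B s e \<and> ieval s e < B"
| "wok B s (WAdd e f) \<longleftrightarrow> wok B s e \<and> wok B s f"
| "wok B s (WSub e f) \<longleftrightarrow> wok B s e \<and> wok B s f"
| "wok B s (WMul e f) \<longleftrightarrow> wok B s e \<and> wok B s f"

primrec bok :: "nat \<Rightarrow> state \<Rightarrow> bexp \<Rightarrow> bool" where
  "bok B s (BEq e f) \<longleftrightarrow> wok B s e \<and> wok B s f"
| "bok B s (BLess e f) \<longleftrightarrow> wok B s e \<and> wok B s f"
| "bok B s (BNot b) \<longleftrightarrow> bok B s b"
| "bok B s (BAnd b c) \<longleftrightarrow> bok B s b \<and> bok B s c"

primrec zok :: "nat \<Rightarrow> state \<Rightarrow> zexp \<Rightarrow> bool" where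
  "zok B s (ZConst z) \<longleftrightarrow> True"
| "zok B s (ZGet a e) \<longleftrightarrow> wok B s e \<and> ieval s e < B"
| "zok B s (ZAdd e f) \<longleftrightarrow> zok B s e \<and> zok B s f"
| "zok B s (ZSub e f) \<longleftrightarrow> zok B s e \<and> zok B s f"
| "zok B s (ZMul e f) \<longleftrightarrow> zok B s e \<and> zok B s f"

primrec wmods :: "stm \<Rightarrow> nat set" where
  "wmods SSkip = {}"
| "wmods (SW a e f) = {a}"
| "wmods (SZ a e f) = {}"
| "wmods (SSeq c d) = wmods c \<union> wmods d"
| "wmods (SIf b c d) = wmods c \<union> wmods d"
| "wmods (SFor a b c) = insert a (wmods c)"

primrec zmods :: "stm \<Rightarrow> nat set" where
  "zmods SSkip = {}"
| "zmods (SW a e f) = {}"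
| "zmods (SZ a e f) = {a}"
| "zmods (SSeq c d) = zmods c \<union> zmods d"
| "zmods (SIf b c d) = zmods c \<union> zmods d"
| "zmods (SFor a b c) = zmods c"

text \<open>
  The loop bound is a memory cell, so it must survive the body of the loop.
\<close>

primrec wf_stm :: "stm \<Rightarrow> bool" where
  "wf_stm SSkip \<longleftrightarrow> True"
| "wf_stm (SW a e f) \<longleftrightarrow> True"
| "wf_stm (SZ a e f) \<longleftrightarrow> True"
| "wf_stm (SSeq c d) \<longleftrightarrow> wf_stm c \<and> wf_stm d"
| "wf_stm (SIf b c d) \<longleftrightarrow> wf_stm c \<and> wf_stm d"
| "wf_stm (SFor a b c) \<longleftrightarrow> wf_stm c \<and> a \<noteq> b \<and> b \<notin> wmods c"

primrec loop_depth :: "stm \<Rightarrow> nat" where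
  "loop_depth SSkip = 0"
| "loop_depth (SW a e f) = 0"
| "loop_depth (SZ a e f) = 0"
| "loop_depth (SSeq c d) = max (loop_depth c) (loop_depth d)"
| "loop_depth (SIf b c d) = max (loop_depth c) (loop_depth d)"
| "loop_depth (SFor a b c) = Suc (loop_depth c)"

text \<open>
  The coefficient in the time bound \<open>scost c * M ^ loop_depth c\<close>.  A loop adds \<open>13\<close> units of time per
  iteration and \<open>10\<close> once; with at most \<open>M\<close> iterations and \<open>M \<ge> 2\<close> this is at most \<open>22 * M\<close>.
\<close>

primrec scost :: "stm \<Rightarrow> nat" where
  "scost SSkip = 1"
| "scost (SW a e f) = Suc (wcost e + wcost f)"
| "scost (SZ a e f) = Suc (wcost e + zcost f)"
| "scost (SSeq c d) = Suc (scost c + scost d)"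
| "scost (SIf b c d) = Suc (bcost b + scost c + scost d)"
| "scost (SFor a b c) = scost c + 22"

text \<open>
  The state at the beginning of iteration \<open>i\<close>, with the counter already set.
\<close>

primrec iter :: "(state \<Rightarrow> state) \<Rightarrow> nat \<Rightarrow> state \<Rightarrow> nat \<Rightarrow> state" where
  "iter F a s 0 = wupd s a 0 0"
| "iter F a s (Suc i) = wupd (F (iter F a s i)) a 0 (Suc i)"

primrec sem :: "stm \<Rightarrow> state \<Rightarrow> state" where
  "sem SSkip = (\<lambda>s. s)"
| "sem (SW a e f) = (\<lambda>s. wupd s a (ieval s e) (ieval s f))"
| "sem (SZ a e f) = (\<lambda>s. zupd s a (ieval s e) (izeval s f))"
| "sem (SSeq c d) = (\<lambda>s. sem d (sem c s))"
| "sem (SIf b c d) = (\<lambda>s. if ibeval s b then sem c s else sem d s)"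
| "sem (SFor a b c) = (\<lambda>s. iter (sem c) a s (fst s b 0))"

text \<open>
  Indices stay below \<open>B\<close>, stored words stay at most \<open>M\<close>, and loop bodies leave their counter as they found
  it.  These conditions are evaluated along the exact semantics \<open>sem\<close>.
\<close>

primrec safe :: "nat \<Rightarrow> nat \<Rightarrow> stm \<Rightarrow> state \<Rightarrow> bool" where
  "safe B M SSkip = (\<lambda>s. True)"
| "safe B M (SW a e f) = (\<lambda>s. wok B s e \<and> wok B s f \<and> ieval s e < B \<and> ieval s f \<le> M)"
| "safe B M (SZ a e f) = (\<lambda>s. wok B s e \<and> zok B s f \<and> ieval s e < B)"
| "safe B M (SSeq c d) = (\<lambda>s. safe B M c s \<and> safe B M d (sem c s))"
| "safe B M (SIf b c d) =
    (\<lambda>s. bok B s b \<and> (if ibeval s b then safe B M c s else safe B M d s))"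
| "safe B M (SFor a b c) =
    (\<lambda>s. 0 < B \<and> (\<forall>i<fst s b 0. safe B M c (iter (sem c) a s i) \<and> fst (sem c (iter (sem c) a s i)) a 0 = i))"

lemma fst_wupd [simp]: "fst (wupd s a i v) = (fst s)(a := (fst s a)(i := v))"
  by (cases s) simp

lemma snd_wupd [simp]: "snd (wupd s a i v) = snd s"
  by (cases s) simp

lemma fst_zupd [simp]: "fst (zupd s a i v) = fst s"
  by (cases s) simp

lemma snd_zupd [simp]: "snd (zupd s a i v) = (snd s)(a := (snd s a)(i := v))"
  by (cases s) simp

lemma sem_frame:
  "a \<notin> wmods c \<Longrightarrow> fst (sem c s) a = fst s a"
  "a \<notin> zmods c \<Longrightarrow> snd (sem c s) a = snd s a"
proof (induction c arbitrary: s)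
  case (SFor x b c)
  { case 1
    have "fst (iter (sem c) x s i) a = fst s a" for i
      by (induction i) (use 1 SFor in auto)
    then show ?case by simp }
  { case 2
    have "snd (iter (sem c) x s i) a = snd s a" for i
      by (induction i) (use 2 SFor in auto)
    then show ?case by simp }
qed auto

lemma iter_counter: "fst (iter F a s i) a 0 = i"
  by (cases i) auto

lemma iter_frame:
  "x \<notin> insert a (wmods c) \<Longrightarrow> fst (iter (sem c) a s i) x = fst s x"
  "x \<notin> zmods c \<Longrightarrow> snd (iter (sem c) a s i) x = snd s x"
  by (induction i) (auto simp: sem_frame)

definition mem_le :: "nat \<Rightarrow> state \<Rightarrow> bool" where
  "mem_le M s \<longleftrightarrow> (\<forall>a i. fst s a i \<le> M)"

lemma mem_le_wupd: "mem_le M s \<Longrightarrow> v \<le> M \<Longrightarrow> mem_le M (wupd s a i v)"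
  by (simp add: mem_le_def)

lemma mem_le_zupd: "mem_le M s \<Longrightarrow> mem_le M (zupd s a i v)"
  by (simp add: mem_le_def)

lemma wsize_pos: "0 < wsize e"
  by (induction e) auto

lemma add_le_power: 
  fixes M :: nat assumes "2 \<le> M" "0 < i" "0 < j" "x \<le> M ^ i" "y \<le> M ^ j" shows "x + y \<le> M ^ (i + j)"
proof -
  have "M \<le> M ^ i" "M \<le> M ^ j" using assms by (simp_all add: self_le_power)
  then have "2 \<le> M ^ i" "2 \<le> M ^ j" using assms by linarith+
  then obtain u v where "M ^ i = 2 + u" "M ^ j = 2 + v" by (metis le_iff_add)
  then have "M ^ i + M ^ j \<le> M ^ i * M ^ j" by (simp add: algebra_simps)
  then show ?thesis using assms by (simp add: power_add)
qed

lemma ieval_le: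
  assumes "2 \<le> M" "mem_le M s" shows "ieval s e \<le> M ^ wsize e"
proof (induction e)
  case (WConst k)
  have "k < 2 ^ Suc k" by (induction k) auto
  also have "2 ^ Suc k \<le> M ^ Suc k" using assms(1) by (rule power_mono) simp
  finally show ?case by simp
next
  case (WGet a e)
  have "fst s a (ieval s e) \<le> M" using assms(2) by (simp add: mem_le_def)
  also have "M \<le> M ^ Suc (wsize e)" using assms(1) by (simp add: self_le_power)
  finally show ?case by simp
next
  case (WAdd e f) then show ?case using assms(1) by (simp add: add_le_power wsize_pos)
next
  case (WSub e f)
  have "ieval s (WSub e f) \<le> M ^ wsize e" using WSub by simp
  also have "\<dots> \<le> M ^ (wsize e + wsize f)" using assms by (simp add: power_increasing)
  finally show ?case by simp
next
  case (WMul e f) then show ?case by (simp add: power_add mult_mono)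
qed

lemma power_less_mono_exp:
  fixes M :: nat assumes "M ^ j < c" "i \<le> j" "2 \<le> M" shows "M ^ i < c"
  using assms by (meson le_less_trans one_le_numeral order_trans power_increasing)

lemma weval_ieval:
  assumes "2 \<le> M" "mem_le M s" "M ^ wsize e < 2 ^ w"
  shows "weval w s e = ieval s e"
  using assms(3)
proof (induction e)
  case (WConst k)
  then show ?case using ieval_le[OF assms(1,2), of "WConst k"] by simp
next
  case (WGet a e)
  then show ?case using power_less_mono_exp[OF WGet.prems, of "wsize e"] assms(1) by simp
next
  case (WAdd e f)
  have "M ^ wsize e < 2 ^ w" "M ^ wsize f < 2 ^ w"
    using power_less_mono_exp[OF WAdd.prems] assms(1) by simp_all
  then show ?case using WAdd ieval_le[OF assms(1,2), of "WAdd e f"] by simp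
next
  case (WSub e f)
  have "M ^ wsize e < 2 ^ w" "M ^ wsize f < 2 ^ w"
    using power_less_mono_exp[OF WSub.prems] assms(1) by simp_all
  then show ?case using WSub ieval_le[OF assms(1,2), of "WSub e f"] by simp
next
  case (WMul e f)
  have "M ^ wsize e < 2 ^ w" "M ^ wsize f < 2 ^ w"
    using power_less_mono_exp[OF WMul.prems] assms(1) by simp_all
  then show ?case using WMul ieval_le[OF assms(1,2), of "WMul e f"] by simp
qed

lemma beval_ibeval:
  assumes "2 \<le> M" "mem_le M s" "M ^ bsize b < 2 ^ w"
  shows "beval w s b = ibeval s b"
  using assms(3)
proof (induction b)
  case (BEq e f)
  have "M ^ wsize e < 2 ^ w" "M ^ wsize f < 2 ^ w"
    using power_less_mono_exp[OF BEq] assms(1) by simp_all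
  then show ?case using weval_ieval[OF assms(1,2)] by simp
next
  case (BLess e f)
  have "M ^ wsize e < 2 ^ w" "M ^ wsize f < 2 ^ w"
    using power_less_mono_exp[OF BLess] assms(1) by simp_all
  then show ?case using weval_ieval[OF assms(1,2)] by simp
next
  case (BAnd b c)
  have "M ^ bsize b < 2 ^ w" "M ^ bsize c < 2 ^ w"
    using power_less_mono_exp[OF BAnd.prems] assms(1) by simp_all
  then show ?case using BAnd by simp
qed simp

lemma zeval_izeval:
  assumes "2 \<le> M" "mem_le M s" "M ^ zsize z < 2 ^ w"
  shows "zeval w s z = izeval s z"
  using assms(3)
proof (induction z)
  case (ZAdd b c)
  have "M ^ zsize b < 2 ^ w" "M ^ zsize c < 2 ^ w"
    using power_less_mono_exp[OF ZAdd.prems] assms(1) by simp_all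
  then show ?case using ZAdd by simp
next
  case (ZSub b c)
  have "M ^ zsize b < 2 ^ w" "M ^ zsize c < 2 ^ w"
    using power_less_mono_exp[OF ZSub.prems] assms(1) by simp_all
  then show ?case using ZSub by simp
next
  case (ZMul b c)
  have "M ^ zsize b < 2 ^ w" "M ^ zsize c < 2 ^ w"
    using power_less_mono_exp[OF ZMul.prems] assms(1) by simp_all
  then show ?case using ZMul by simp
qed (use weval_ieval[OF assms(1,2)] in simp_all)

lemma wlocs_subset:
  assumes "2 \<le> M" "mem_le M s" "M ^ wsize e < 2 ^ w" "wok B s e"
  shows "wlocs w s e \<subseteq> warrs e \<times> {..<B}"
  using assms(3,4)
proof (induction e)
  case (WGet a e)
  have "M ^ wsize e < 2 ^ w"
    using power_less_mono_exp[OF WGet.prems(1)] assms(1) by simp_all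
  then show ?case using WGet weval_ieval[OF assms(1,2), of e w] by auto
next
  case (WAdd e f)
  have "M ^ wsize e < 2 ^ w" "M ^ wsize f < 2 ^ w"
    using power_less_mono_exp[OF WAdd.prems(1)] assms(1) by simp_all
  then show ?case using WAdd by auto
next
  case (WSub e f)
  have "M ^ wsize e < 2 ^ w" "M ^ wsize f < 2 ^ w"
    using power_less_mono_exp[OF WSub.prems(1)] assms(1) by simp_all
  then show ?case using WSub by auto
next
  case (WMul e f)
  have "M ^ wsize e < 2 ^ w" "M ^ wsize f < 2 ^ w"
    using power_less_mono_exp[OF WMul.prems(1)] assms(1) by simp_all
  then show ?case using WMul by auto
qed simp

lemma blocs_subset:
  assumes "2 \<le> M" "mem_le M s" "M ^ bsize b < 2 ^ w" "bok B s b"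
  shows "blocs w s b \<subseteq> barrs b \<times> {..<B}"
  using assms(3,4)
proof (induction b)
  case (BEq e f)
  have "M ^ wsize e < 2 ^ w" "M ^ wsize f < 2 ^ w"
    using power_less_mono_exp[OF BEq(1)] assms(1) by simp_all
  then show ?case using wlocs_subset[OF assms(1,2)] BEq by fastforce
next
  case (BLess e f)
  have "M ^ wsize e < 2 ^ w" "M ^ wsize f < 2 ^ w"
    using power_less_mono_exp[OF BLess(1)] assms(1) by simp_all
  then show ?case using wlocs_subset[OF assms(1,2)] BLess by fastforce
next
  case (BAnd b c)
  have "M ^ bsize b < 2 ^ w" "M ^ bsize c < 2 ^ w"
    using power_less_mono_exp[OF BAnd.prems(1)] assms(1) by simp_all
  then show ?case using BAnd by auto
qed simp

lemma zlocs_subset: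
  assumes "2 \<le> M" "mem_le M s" "M ^ zsize z < 2 ^ w" "zok B s z"
  shows "zlocs w s z \<subseteq> zarrs z \<times> {..<B}"
  using assms(3,4)
proof (induction z)
  case (ZGet a e)
  then show ?case using wlocs_subset[OF assms(1,2)] weval_ieval[OF assms(1,2)] by fastforce
next
  case (ZAdd b c)
  have "M ^ zsize b < 2 ^ w" "M ^ zsize c < 2 ^ w"
    using power_less_mono_exp[OF ZAdd.prems(1)] assms(1) by simp_all
  then show ?case using ZAdd by auto
next
  case (ZSub b c)
  have "M ^ zsize b < 2 ^ w" "M ^ zsize c < 2 ^ w"
    using power_less_mono_exp[OF ZSub.prems(1)] assms(1) by simp_all
  then show ?case using ZSub by auto
next
  case (ZMul b c)
  have "M ^ zsize b < 2 ^ w" "M ^ zsize c < 2 ^ w"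
    using power_less_mono_exp[OF ZMul.prems(1)] assms(1) by simp_all
  then show ?case using ZMul by auto
qed simp

lemma le_mult_power:
  fixes M :: nat assumes "1 \<le> M" "i \<le> j" "m \<le> K * M ^ i" shows "m \<le> K * M ^ j"
  using assms by (meson le_trans mult_le_mono2 power_increasing)

text \<open>
  The link between structured programs and the machine.  With entries at most \<open>M\<close> and words long enough
  for \<open>M ^ ssize c\<close>, no operation overflows, hence the machine follows the exact semantics.  The number
  of iterations of each loop is a word and so at most \<open>M\<close>, which gives one factor \<open>M\<close> per nesting level.
\<close>

theorem exec_compile:
  assumes M: "2 \<le> M"
  shows "\<lbrakk>wf_stm c; safe B M c s; mem_le M s; M ^ ssize c < 2 ^ w\<rbrakk> \<Longrightarrow>
    mem_le M (sem c s) \<and> (\<exists>m L. exec w (compile c) s m L (sem c s) \<and>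
      m \<le> scost c * M ^ loop_depth c \<and> L \<subseteq> sarrs c \<times> {..<B})"
proof (induction c arbitrary: s)
  case SSkip
  then show ?case using exec.Skip[of w s] by fastforce
next
  case (SW a e f)
  have sz: "M ^ wsize e < 2 ^ w" "M ^ wsize f < 2 ^ w"
    using power_less_mono_exp[OF SW.prems(4)] M by simp_all
  note ev = weval_ieval[OF M SW.prems(3) sz(1)] weval_ieval[OF M SW.prems(3) sz(2)]
  have "exec w (compile (SW a e f)) s (Suc (wcost e + wcost f))
      (insert (WArr a, weval w s e) (wlocs w s e \<union> wlocs w s f)) (sem (SW a e f) s)"
    using exec.WPut[of w a e f s] by (simp add: ev)
  moreover have "insert (WArr a, weval w s e) (wlocs w s e \<union> wlocs w s f)
      \<subseteq> sarrs (SW a e f) \<times> {..<B}"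
    using wlocs_subset[OF M SW.prems(3) sz(1)] wlocs_subset[OF M SW.prems(3) sz(2)] SW.prems(2) ev
    by auto
  ultimately show ?case using SW.prems mem_le_wupd by (fastforce intro: exI)
next
  case (SZ a e f)
  have sz: "M ^ wsize e < 2 ^ w" "M ^ zsize f < 2 ^ w"
    using power_less_mono_exp[OF SZ.prems(4)] M by simp_all
  note ev = weval_ieval[OF M SZ.prems(3) sz(1)] zeval_izeval[OF M SZ.prems(3) sz(2)]
  have "exec w (compile (SZ a e f)) s (Suc (wcost e + zcost f))
      (insert (ZArr a, weval w s e) (wlocs w s e \<union> zlocs w s f)) (sem (SZ a e f) s)"
    using exec.ZPut[of w a e f s] by (simp add: ev)
  moreover have "insert (ZArr a, weval w s e) (wlocs w s e \<union> zlocs w s f)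
      \<subseteq> sarrs (SZ a e f) \<times> {..<B}"
    using wlocs_subset[OF M SZ.prems(3) sz(1)] zlocs_subset[OF M SZ.prems(3) sz(2)] SZ.prems(2) ev
    by auto
  ultimately show ?case using SZ.prems mem_le_zupd by (fastforce intro: exI)
next
  case (SSeq c d)
  have sz: "M ^ ssize c < 2 ^ w" "M ^ ssize d < 2 ^ w"
    using power_less_mono_exp[OF SSeq.prems(4)] M by simp_all
  from SSeq.IH(1)[of s] SSeq.prems sz obtain m K where 1: "mem_le M (sem c s)"
    "exec w (compile c) s m K (sem c s)" "m \<le> scost c * M ^ loop_depth c"
    "K \<subseteq> sarrs c \<times> {..<B}" by auto
  from SSeq.IH(2)[of "sem c s"] SSeq.prems sz 1 obtain m' L where 2: "mem_le M (sem d (sem c s))"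
    "exec w (compile d) (sem c s) m' L (sem d (sem c s))" "m' \<le> scost d * M ^ loop_depth d"
    "L \<subseteq> sarrs d \<times> {..<B}" by auto
  have "m \<le> scost c * M ^ loop_depth (SSeq c d)" "m' \<le> scost d * M ^ loop_depth (SSeq c d)"
    using le_mult_power[OF _ _ 1(3), of "loop_depth (SSeq c d)"]
      le_mult_power[OF _ _ 2(3), of "loop_depth (SSeq c d)"] M by auto
  moreover have "1 \<le> M ^ loop_depth (SSeq c d)" using M by simp
  ultimately have "Suc (m + m') \<le> scost (SSeq c d) * M ^ loop_depth (SSeq c d)"
    by (simp add: algebra_simps)
  moreover have "K \<union> L \<subseteq> sarrs (SSeq c d) \<times> {..<B}" using 1 2 by auto
  ultimately show ?case using exec.Seq[OF 1(2) 2(2)] 2(1) by auto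
next
  case (SIf b c d)
  have sz: "M ^ bsize b < 2 ^ w" "M ^ ssize c < 2 ^ w" "M ^ ssize d < 2 ^ w"
    using power_less_mono_exp[OF SIf.prems(4)] M by simp_all
  note ev = beval_ibeval[OF M SIf.prems(3) sz(1)]
  have bl: "blocs w s b \<subseteq> barrs b \<times> {..<B}"
    using blocs_subset[OF M SIf.prems(3) sz(1)] SIf.prems(2) by auto
  have one: "1 \<le> M ^ loop_depth (SIf b c d)" using M by simp
  then have one': "bcost b \<le> bcost b * M ^ loop_depth (SIf b c d)" by simp
  show ?case
  proof (cases "ibeval s b")
    case True
    from SIf.IH(1)[of s] SIf.prems sz True obtain m K where 1: "mem_le M (sem c s)"
      "exec w (compile c) s m K (sem c s)" "m \<le> scost c * M ^ loop_depth c"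
      "K \<subseteq> sarrs c \<times> {..<B}" by auto
    have "m \<le> scost c * M ^ loop_depth (SIf b c d)"
      using le_mult_power[OF _ _ 1(3), of "loop_depth (SIf b c d)"] M by auto
    with one one' have "Suc (bcost b + m) \<le> scost (SIf b c d) * M ^ loop_depth (SIf b c d)"
      unfolding scost.simps mult_Suc add_mult_distrib by linarith
    moreover have "blocs w s b \<union> K \<subseteq> sarrs (SIf b c d) \<times> {..<B}" using 1 bl by auto
    ultimately show ?thesis using exec.CondTrue[OF _ 1(2), of b "compile d"] True 1 ev by auto
  next
    case False
    from SIf.IH(2)[of s] SIf.prems sz False obtain m K where 1: "mem_le M (sem d s)"
      "exec w (compile d) s m K (sem d s)" "m \<le> scost d * M ^ loop_depth d"
      "K \<subseteq> sarrs d \<times> {..<B}" by auto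
    have "m \<le> scost d * M ^ loop_depth (SIf b c d)"
      using le_mult_power[OF _ _ 1(3), of "loop_depth (SIf b c d)"] M by auto
    with one one' have "Suc (bcost b + m) \<le> scost (SIf b c d) * M ^ loop_depth (SIf b c d)"
      unfolding scost.simps mult_Suc add_mult_distrib by linarith
    moreover have "blocs w s b \<union> K \<subseteq> sarrs (SIf b c d) \<times> {..<B}" using 1 bl by auto
    ultimately show ?thesis using exec.CondFalse[OF _ 1(2), of b "compile c"] False 1 ev by auto
  qed
next
  case (SFor a b c)
  define S where "S = iter (sem c) a s"
  define N where "N = fst s b 0"
  (* D bounds the cost of one iteration: the body, 5 for the test, 6 for the increment, 2 for the composition *)
  define D where "D = scost c * M ^ loop_depth c + 13"
  let ?X = "sarrs (SFor a b c) \<times> {..<B}"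
  let ?W = "While (BLess (V a) (V b)) (Seq (compile c) (WPut a (WConst 0) (WAdd (V a) (WConst 1))))"
  have sz: "M ^ ssize c < 2 ^ w" "M ^ 5 < 2 ^ w"
    using power_less_mono_exp[OF SFor.prems(4)] M by simp_all
  then have sz': "M ^ i < 2 ^ w" if "i \<le> 5" for i
    using power_less_mono_exp[OF sz(2)] that M by simp
  have B: "0 < B" and wf: "wf_stm c" "a \<noteq> b" "b \<notin> wmods c"
    and sf: "\<And>i. i < N \<Longrightarrow> safe B M c (S i) \<and> fst (sem c (S i)) a 0 = i"
    using SFor.prems by (auto simp: S_def N_def)
  have NM: "N \<le> M" using SFor.prems(3) by (simp add: mem_le_def N_def)
  have Sa: "fst (S i) a 0 = i" for i by (simp add: S_def iter_counter)
  have Sb: "fst (S i) b 0 = N" for i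
    using wf iter_frame(1)[of b a c s i] by (simp add: S_def N_def)
  have mem: "i \<le> N \<Longrightarrow> mem_le M (S i)" for i
  proof (induction i)
    case 0 then show ?case using SFor.prems(3) by (simp add: S_def mem_le_wupd)
  next
    case (Suc i)
    then have "mem_le M (sem c (S i))" using SFor.IH[of "S i"] wf sf[of i] sz by simp
    then show ?case using Suc.prems NM by (simp add: S_def mem_le_wupd)
  qed
  have "2 ^ 1 \<le> M ^ 1" using M by simp
  then have w2: "2 < (2::nat) ^ w" using sz'[of 2] M power_mono[of 2 M 2] by simp
  have loop: "i \<le> N \<Longrightarrow> \<exists>m L. exec w ?W (S i) m L (S N) \<and> m \<le> (N - i) * D + 6 \<and> L \<subseteq> ?X" for i
  proof (induction i rule: inc_induct)
    case base
    have "exec w ?W (S N) (Suc (bcost (BLess (V a) (V b)))) (blocs w (S N) (BLess (V a) (V b))) (S N)"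
      by (rule exec.WhileFalse) (simp add: Sa Sb)
    moreover have "blocs w (S N) (BLess (V a) (V b)) \<subseteq> ?X" using B by simp
    ultimately show ?case by (fastforce intro: exI)
  next
    case (step i)
    from step.IH obtain m' L' where 2: "exec w ?W (S (Suc i)) m' L' (S N)"
      "m' \<le> (N - Suc i) * D + 6" "L' \<subseteq> ?X" by auto
    from SFor.IH[of "S i"] wf sf[of i] step sz mem[of i] obtain m L where
      1: "mem_le M (sem c (S i))" "exec w (compile c) (S i) m L (sem c (S i))"
      "m \<le> scost c * M ^ loop_depth c" "L \<subseteq> sarrs c \<times> {..<B}" by auto
    let ?s = "sem c (S i)"
    have sa: "fst ?s a 0 = i" using sf step by simp
    have iw: "Suc i < 2 ^ w" using step NM sz'[of 1] M by auto
    then have w1: "(1::nat) mod 2 ^ w = 1" by (cases "w = 0") auto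
    have "exec w (WPut a (WConst 0) (WAdd (V a) (WConst 1))) ?s (Suc (1 + 4)) {(WArr a, 0)} (S (Suc i))"
      using exec.WPut[of w a "WConst 0" "WAdd (V a) (WConst 1)" ?s] iw w1 sa
      by (simp add: S_def eval_nat_numeral)
    note 3 = exec.WhileTrue[OF _ exec.Seq[OF 1(2) this] 2(1)]
    have "exec w ?W (S i) (Suc (bcost (BLess (V a) (V b)) + (Suc (m + Suc (1 + 4))) + m'))
      (blocs w (S i) (BLess (V a) (V b)) \<union> (L \<union> {(WArr a, 0)}) \<union> L') (S N)"
      by (rule 3) (use step in \<open>simp add: Sa Sb\<close>)
    moreover have "blocs w (S i) (BLess (V a) (V b)) \<union> (L \<union> {(WArr a, 0)}) \<union> L' \<subseteq> ?X"
      using B 1 2 by auto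
    moreover have "(N - i) * D + 6 = D + ((N - Suc i) * D + 6)" using step
      by (metis Suc_diff_Suc add.assoc mult_Suc)
    then have "Suc (bcost (BLess (V a) (V b)) + (Suc (m + Suc (1 + 4))) + m') \<le> (N - i) * D + 6"
      using 1(3) 2(2) by (simp add: D_def)
    ultimately show ?case by blast
  qed
  obtain m L where 4: "exec w ?W (S 0) m L (S N)" "m \<le> N * D + 6" "L \<subseteq> ?X"
    using loop[of 0] by auto
  have "exec w (WPut a (WConst 0) (WConst 0)) s (Suc (1 + 1)) {(WArr a, 0)} (S 0)"
    using exec.WPut[of w a "WConst 0" "WConst 0" s] by (simp add: S_def)
  from exec.Seq[OF this 4(1)]
  have run: "exec w (compile (SFor a b c)) s (Suc (Suc (1 + 1) + m)) ({(WArr a, 0)} \<union> L) (sem (SFor a b c) s)"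
    by (simp add: S_def N_def)
  let ?P = "M ^ Suc (loop_depth c)"
  have "M \<le> ?P" using M by simp
  moreover have "N * D \<le> M * D" using NM by (rule mult_le_mono1)
  moreover have "M * D = scost c * ?P + 13 * M" by (simp add: D_def algebra_simps)
  moreover have "scost (SFor a b c) * M ^ loop_depth (SFor a b c) = scost c * ?P + 22 * ?P"
    by (simp only: scost.simps loop_depth.simps add_mult_distrib)
  ultimately have "Suc (Suc (1 + 1) + m) \<le> scost (SFor a b c) * M ^ loop_depth (SFor a b c)"
    using 4(2) M by linarith
  moreover have "{(WArr a, 0)} \<union> L \<subseteq> ?X" using 4(3) B by auto
  moreover have "mem_le M (sem (SFor a b c) s)" using mem[of N] by (simp add: S_def N_def)
  ultimately show ?case using run by blast
qed

text \<open>
  Correctness is proved backwards through the program text, with the frame condition \<open>agree\<close> standing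
  for everything that a loop does not touch.
\<close>

definition wp :: "nat \<Rightarrow> nat \<Rightarrow> stm \<Rightarrow> (state \<Rightarrow> bool) \<Rightarrow> state \<Rightarrow> bool" where
  "wp B M c Q s \<longleftrightarrow> safe B M c s \<and> Q (sem c s)"

lemma wp_simps [simp]:
  "wp B M SSkip Q s \<longleftrightarrow> Q s"
  "wp B M (SW a e f) Q s \<longleftrightarrow> wok B s e \<and> wok B s f \<and> ieval s e < B \<and> ieval s f \<le> M
     \<and> Q (wupd s a (ieval s e) (ieval s f))"
  "wp B M (SZ a e z) Q s \<longleftrightarrow> wok B s e \<and> zok B s z \<and> ieval s e < B
     \<and> Q (zupd s a (ieval s e) (izeval s z))"
  "wp B M (SSeq c d) Q s \<longleftrightarrow> wp B M c (wp B M d Q) s"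
  "wp B M (SIf b c d) Q s \<longleftrightarrow> bok B s b \<and> (if ibeval s b then wp B M c Q s else wp B M d Q s)"
  by (auto simp: wp_def)

definition agree :: "nat set \<Rightarrow> nat set \<Rightarrow> state \<Rightarrow> state \<Rightarrow> bool" where
  "agree A C s s' \<longleftrightarrow> (\<forall>x. x \<notin> A \<longrightarrow> fst s' x = fst s x) \<and> (\<forall>x. x \<notin> C \<longrightarrow> snd s' x = snd s x)"

lemma wp_mono:
  assumes "wp B M c P s" "\<And>s'. agree (wmods c) (zmods c) s s' \<Longrightarrow> P s' \<Longrightarrow> Q s'"
  shows "wp B M c Q s"
  using assms by (auto simp: wp_def agree_def sem_frame)

text \<open>
  The invariant rule for loops.  Besides the invariant, each step may use that only the counter and the
  arrays written by the body have changed since the loop was entered.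
\<close>

lemma wp_For:
  assumes "0 < B" "a \<notin> wmods c" "a \<noteq> b" "b \<notin> wmods c"
    and init: "I 0 (wupd s a 0 0)"
    and step: "\<And>i s'. i < fst s b 0 \<Longrightarrow> agree (insert a (wmods c)) (zmods c) s s' \<Longrightarrow> fst s' a 0 = i \<Longrightarrow>
      I i s' \<Longrightarrow> wp B M c (\<lambda>s''. I (Suc i) (wupd s'' a 0 (Suc i))) s'"
    and post: "\<And>s'. agree (insert a (wmods c)) (zmods c) s s' \<Longrightarrow> I (fst s b 0) s' \<Longrightarrow> Q s'"
  shows "wp B M (SFor a b c) Q s"
proof -
  define S where "S = iter (sem c) a s"
  have ag: "agree (insert a (wmods c)) (zmods c) s (S i)" for i
    using iter_frame(1)[of _ a c s i] iter_frame(2)[of _ c a s i] by (simp add: agree_def S_def)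
  have Sa: "fst (S i) a 0 = i" for i by (simp add: S_def iter_counter)
  have I: "i \<le> fst s b 0 \<Longrightarrow> I i (S i)" for i
  proof (induction i)
    case 0 then show ?case using init by (simp add: S_def)
  next
    case (Suc i)
    then have "wp B M c (\<lambda>s''. I (Suc i) (wupd s'' a 0 (Suc i))) (S i)"
      using step[OF _ ag Sa] by simp
    then show ?case by (simp add: wp_def S_def)
  qed
  have "safe B M c (S i) \<and> fst (sem c (S i)) a 0 = i" if "i < fst s b 0" for i
    using step[OF that ag Sa] I[of i] that assms(2) Sa[of i] by (simp add: wp_def sem_frame)
  moreover have "Q (S (fst s b 0))" using post[OF ag] I by simp
  ultimately show ?thesis using assms(1) by (simp add: wp_def S_def)
qed

primrec seqs :: "stm list \<Rightarrow> stm" where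
  "seqs [] = SSkip"
| "seqs (c # cs) = SSeq c (seqs cs)"

lemma seqs_simps:
  "wmods (seqs cs) = (\<Union>c\<in>set cs. wmods c)"
  "zmods (seqs cs) = (\<Union>c\<in>set cs. zmods c)"
  "wf_stm (seqs cs) \<longleftrightarrow> (\<forall>c\<in>set cs. wf_stm c)"
  "loop_depth (seqs cs) \<le> d \<longleftrightarrow> (\<forall>c\<in>set cs. loop_depth c \<le> d)"
  "finite (sarrs (seqs cs)) \<longleftrightarrow> (\<forall>c\<in>set cs. finite (sarrs c))"
  by (induction cs) auto

text \<open>
  The invariant of a program unrolled along a list is indexed by the part of the list that has been
  processed.
\<close>

lemma wp_seqs:
  assumes init: "I [] s"
    and step: "\<And>ys x zs s'. xs = ys @ x # zs \<Longrightarrow> agree (wmods (seqs (map f xs))) (zmods (seqs (map f xs))) s s' \<Longrightarrow>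
       I ys s' \<Longrightarrow> wp B M (f x) (I (ys @ [x])) s'"
    and post: "\<And>s'. agree (wmods (seqs (map f xs))) (zmods (seqs (map f xs))) s s' \<Longrightarrow> I xs s' \<Longrightarrow> Q s'"
  shows "wp B M (seqs (map f xs)) Q s"
proof -
  have "wp B M (seqs (map f zs)) Q s'"
    if "xs = ys @ zs" "agree (wmods (seqs (map f xs))) (zmods (seqs (map f xs))) s s'" "I ys s'" for ys zs s'
    using that
  proof (induction zs arbitrary: ys s')
    case Nil then show ?case using post by simp
  next
    case (Cons x zs)
    have "wp B M (f x) (I (ys @ [x])) s'" using step[OF Cons.prems] .
    then show ?case unfolding list.map seqs.simps wp_simps
    proof (rule wp_mono)
      fix s'' assume 1: "agree (wmods (f x)) (zmods (f x)) s' s''" "I (ys @ [x]) s''"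
      have "agree (wmods (seqs (map f xs))) (zmods (seqs (map f xs))) s s''"
        using 1(1) Cons.prems(1,2) by (auto simp: agree_def seqs_simps)
      then show "wp B M (seqs (map f zs)) Q s''"
        using Cons.IH[of "ys @ [x]" s''] Cons.prems(1) 1(2) by simp
    qed
  qed
  from this[of "[]" xs s] init show ?thesis by (simp add: agree_def)
qed

lemma agree_mono: "agree A C s s' \<Longrightarrow> A \<subseteq> A' \<Longrightarrow> C \<subseteq> C' \<Longrightarrow> agree A' C' s s'"
  by (auto simp: agree_def)

text \<open>
  The frame is given by explicit sets here, so that it need not be computed from the program text.
\<close>

lemma wp_For_agree:
  assumes "wmods c \<subseteq> A" "zmods c \<subseteq> C" "a \<notin> A" "b \<notin> insert a A" "0 < B"
    and init: "I 0 (wupd s a 0 0)"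
    and step: "\<And>i s'. i < fst s b 0 \<Longrightarrow> agree (insert a A) C s s' \<Longrightarrow> fst s' a 0 = i \<Longrightarrow>
      I i s' \<Longrightarrow> wp B M c (\<lambda>s''. I (Suc i) (wupd s'' a 0 (Suc i))) s'"
    and post: "\<And>s'. agree (insert a A) C s s' \<Longrightarrow> I (fst s b 0) s' \<Longrightarrow> Q s'"
  shows "wp B M (SFor a b c) Q s"
proof (rule wp_For[where I = I])
  have ag: "agree (insert a A) C s s'" if "agree (insert a (wmods c)) (zmods c) s s'" for s'
    using that by (rule agree_mono) (use assms(1,2) in auto)
  show "wp B M c (\<lambda>s''. I (Suc i) (wupd s'' a 0 (Suc i))) s'"
    if "i < fst s b 0" "agree (insert a (wmods c)) (zmods c) s s'" "fst s' a 0 = i" "I i s'" for i s'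
    using that by (intro step ag)
  show "Q s'" if "agree (insert a (wmods c)) (zmods c) s s'" "I (fst s b 0) s'" for s'
    using that by (intro post ag)
qed (use assms in auto)

lemma wp_seqs_agree:
  assumes sub: "\<And>x. x \<in> set xs \<Longrightarrow> wmods (f x) \<subseteq> A" "\<And>x. x \<in> set xs \<Longrightarrow> zmods (f x) \<subseteq> C"
    and init: "I [] s"
    and step: "\<And>ys x zs s'. xs = ys @ x # zs \<Longrightarrow> agree A C s s' \<Longrightarrow> I ys s' \<Longrightarrow> wp B M (f x) (I (ys @ [x])) s'"
    and post: "\<And>s'. agree A C s s' \<Longrightarrow> I xs s' \<Longrightarrow> Q s'"
  shows "wp B M (seqs (map f xs)) Q s"
proof (rule wp_seqs[where I = I])
  have ag: "agree A C s s'" if "agree (wmods (seqs (map f xs))) (zmods (seqs (map f xs))) s s'" for s'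
    using that by (rule agree_mono) (use sub in \<open>auto simp: seqs_simps\<close>)
  show "wp B M (f x) (I (ys @ [x])) s'"
    if "xs = ys @ x # zs" "agree (wmods (seqs (map f xs))) (zmods (seqs (map f xs))) s s'" "I ys s'" for ys x zs s'
    using step[OF that(1) ag[OF that(2)] that(3)] .
  show "Q s'" if "agree (wmods (seqs (map f xs))) (zmods (seqs (map f xs))) s s'" "I xs s'" for s'
    using that by (intro post ag)
qed (rule init)

section \<open>Functions with values in the field of two elements\<close>

(* Sums over the field need the ring operations, not the bit operations they unfold to. *)
declare add_bit_eq_xor [simp del] mult_bit_eq_and [simp del] power_bit_unfold [simp del]

lemma bit_add_self [simp]: "(b::bit) + b = 0"
  by (cases b) auto

lemma ex_bit: "(\<exists>b::bit. P b) \<longleftrightarrow> P 0 \<or> P 1"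
  by (metis bit.exhaust)

definition bitfun :: "'a set \<Rightarrow> ('a \<Rightarrow> bit) set" where
  "bitfun S = {x. \<forall>i. i \<notin> S \<longrightarrow> x i = 0}"

lemma bitfun_empty: "bitfun {} = {\<lambda>_. 0}"
  by (auto simp: bitfun_def)

lemma bit_cases: "(b::bit) = 0 \<or> b = 1"
  by (cases b) auto

lemma bitfun_insert:
  assumes "a \<notin> S"
  shows "bitfun (insert a S) = bitfun S \<union> (\<lambda>x. x(a := 1)) ` bitfun S"
proof (intro equalityI subsetI)
  fix x assume x: "x \<in> bitfun (insert a S)"
  show "x \<in> bitfun S \<union> (\<lambda>x. x(a := 1)) ` bitfun S"
  proof (cases "x a = 0")
    case True
    then have "x \<in> bitfun S" using x by (auto simp: bitfun_def)
    then show ?thesis ..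
  next
    case False
    then have "x = (x(a := 0))(a := 1)" by (auto simp: fun_eq_iff)
    moreover have "x(a := 0) \<in> bitfun S" using x by (auto simp: bitfun_def)
    ultimately show ?thesis by blast
  qed
qed (auto simp: bitfun_def)

lemma inj_on_upd_bitfun: "a \<notin> S \<Longrightarrow> inj_on (\<lambda>x. x(a := c)) (bitfun S)"
  by (auto simp: inj_on_def bitfun_def fun_eq_iff) metis

lemma finite_bitfun: "finite S \<Longrightarrow> finite (bitfun S)"
  by (induction S rule: finite_induct) (auto simp: bitfun_empty bitfun_insert)

lemma sum_bitfun_insert:
  assumes "finite S" "a \<notin> S"
  shows "(\<Sum>x\<in>bitfun (insert a S). f x) = (\<Sum>x\<in>bitfun S. f x + f (x(a := 1)))"
proof -
  have "bitfun S \<inter> (\<lambda>x. x(a := 1)) ` bitfun S = {}"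
    using assms(2) by (auto simp: bitfun_def)
  then show ?thesis
    using assms by (simp add: bitfun_insert finite_bitfun sum.union_disjoint
        sum.reindex[OF inj_on_upd_bitfun] sum.distrib)
qed

lemma card_bitfun: "finite S \<Longrightarrow> card (bitfun S) = 2 ^ card S"
proof (induction S rule: finite_induct)
  case (insert a S)
  then show ?case
    using sum_bitfun_insert[of S a "\<lambda>_. 1::nat"] by simp
qed (simp add: bitfun_empty)

text \<open>
  A vector on a disjoint union is uniquely a sum of vectors supported on the two parts.
\<close>

lemma sum_bitfun_Un:
  assumes "finite S" "finite S'" "S \<inter> S' = {}"
  shows "(\<Sum>z\<in>bitfun (S \<union> S'). f z) = (\<Sum>x\<in>bitfun S. \<Sum>y\<in>bitfun S'. f (\<lambda>i. x i + y i))"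
  using assms(2,3)
proof (induction S' arbitrary: f rule: finite_induct)
  case (insert a S')
  have "(\<Sum>z\<in>bitfun (S \<union> insert a S'). f z) = (\<Sum>z\<in>bitfun (S \<union> S'). f z + f (z(a := 1)))"
    using sum_bitfun_insert[of "S \<union> S'" a f] insert assms by simp
  also have "\<dots> = (\<Sum>x\<in>bitfun S. \<Sum>y\<in>bitfun S'.
      f (\<lambda>i. x i + y i) + f ((\<lambda>i. x i + y i)(a := 1)))"
    using insert by simp
  also have "\<dots> = (\<Sum>x\<in>bitfun S. \<Sum>y\<in>bitfun (insert a S'). f (\<lambda>i. x i + y i))"
  proof (rule sum.cong[OF refl])
    fix x assume x: "x \<in> bitfun S"
    have "(\<lambda>i. x i + y i)(a := 1) = (\<lambda>i. x i + (y(a := 1)) i)" if "y \<in> bitfun S'" for y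
      using x insert.prems that by (auto simp: bitfun_def fun_eq_iff)
    then show "(\<Sum>y\<in>bitfun S'. f (\<lambda>i. x i + y i) + f ((\<lambda>i. x i + y i)(a := 1)))
        = (\<Sum>y\<in>bitfun (insert a S'). f (\<lambda>i. x i + y i))"
      using insert by (subst sum_bitfun_insert) auto
  qed
  finally show ?case .
qed (simp add: bitfun_empty)

lemma sum_bitfun_prod:
  fixes g :: "'a \<Rightarrow> bit \<Rightarrow> 'b :: comm_semiring_1"
  assumes "finite S"
  shows "(\<Sum>y\<in>bitfun S. \<Prod>i\<in>S. g i (y i)) = (\<Prod>i\<in>S. g i 0 + g i 1)"
  using assms
proof (induction S rule: finite_induct)
  case (insert a S)
  have "(\<Sum>y\<in>bitfun (insert a S). \<Prod>i\<in>insert a S. g i (y i))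
      = (\<Sum>y\<in>bitfun S. (g a 0 + g a 1) * (\<Prod>i\<in>S. g i (y i)))"
  proof (subst sum_bitfun_insert, goal_cases)
    case 3
    show ?case
    proof (rule sum.cong[OF refl])
      fix y assume "y \<in> bitfun S"
      then have "y a = 0" using insert by (simp add: bitfun_def)
      moreover have "(\<Prod>i\<in>S. g i ((y(a := 1)) i)) = (\<Prod>i\<in>S. g i (y i))"
        by (rule prod.cong) (use insert in auto)
      ultimately show "(\<Prod>i\<in>insert a S. g i (y i)) + (\<Prod>i\<in>insert a S. g i ((y(a := 1)) i))
          = (g a 0 + g a 1) * (\<Prod>i\<in>S. g i (y i))"
        using insert by (simp add: algebra_simps)
    qed
  qed (use insert in auto)
  then show ?case using insert by (simp add: sum_distrib_left[symmetric])
qed (simp add: bitfun_empty)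

lemma bij_betw_bitfun_reindex:
  assumes "bij_betw h R C"
  shows "bij_betw (\<lambda>x e. if e \<in> C then x (inv_into R h e) else 0) (bitfun R) (bitfun C)"
proof (rule bij_betw_byWitness[where f' = "\<lambda>x i. if i \<in> R then x (h i) else 0"])
  show "\<forall>x\<in>bitfun R. (\<lambda>i. if i \<in> R then (if h i \<in> C then x (inv_into R h (h i)) else 0) else 0) = x"
    using assms by (auto simp: bitfun_def fun_eq_iff bij_betw_def)
  show "\<forall>x\<in>bitfun C. (\<lambda>e. if e \<in> C then (if inv_into R h e \<in> R then x (h (inv_into R h e)) else 0) else 0) = x"
    using assms by (auto simp: bitfun_def fun_eq_iff bij_betw_def inv_into_into f_inv_into_f)
qed (auto simp: bitfun_def)

lemma bitfun_add: "x \<in> bitfun S \<Longrightarrow> y \<in> bitfun S \<Longrightarrow> (\<lambda>i. x i + y i) \<in> bitfun S"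
  by (simp add: bitfun_def)

text \<open>
  The nontrivial additive character of the field with two elements.
\<close>

definition sg :: "bit \<Rightarrow> real" where
  "sg b = (if b = 0 then 1 else - 1)"

lemma sg_simps [simp]: "sg 0 = 1" "sg 1 = - 1"
  by (simp_all add: sg_def)

lemma sg_add: "sg (a + b) = sg a * sg b"
  by (cases a; cases b) auto

section \<open>Gauss sums of quadratic forms\<close>

text \<open>
  The matrix need not be symmetric: only the sums \<open>A i j + A j i\<close> matter for \<open>i \<noteq> j\<close>, and since
  \<open>y i * y i = y i\<close>, the diagonal contributes linear terms.
\<close>

definition qf :: "(nat \<Rightarrow> nat \<Rightarrow> bit) \<Rightarrow> nat set \<Rightarrow> (nat \<Rightarrow> bit) \<Rightarrow> bit" where
  "qf A S y = (\<Sum>i\<in>S. \<Sum>j\<in>S. A i j * y i * y j)"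

text \<open>
  Fixing \<open>y 0 = 1\<close> turns a quadratic form into a polynomial with linear and constant part: row and column
  \<open>0\<close> hold the linear terms and \<open>A 0 0\<close> is the constant.
\<close>

definition gauss :: "(nat \<Rightarrow> nat \<Rightarrow> bit) \<Rightarrow> nat set \<Rightarrow> real" where
  "gauss A S = (\<Sum>y\<in>bitfun (S - {0}). sg (qf A S (y(0 := 1))))"

text \<open>
  Coefficients of the affine function by which the form changes when \<open>y u\<close> goes from \<open>0\<close> to \<open>1\<close>.  The
  diagonal entry \<open>A u u\<close> is the constant term and is therefore put at coordinate \<open>0\<close>.
\<close>

definition lf :: "(nat \<Rightarrow> nat \<Rightarrow> bit) \<Rightarrow> nat \<Rightarrow> nat \<Rightarrow> bit" where
  "lf A u j = A u j + A j u + (if j = 0 then A u u else 0)"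

lemma qf_cong: "(\<And>i. i \<in> S \<Longrightarrow> y i = z i) \<Longrightarrow> qf A S y = qf A S z"
  by (simp add: qf_def)

lemma bit_idem: "(b::bit) * b = b"
  by (cases b) auto

lemma qf_insert:
  assumes "finite S" "u \<notin> S" "0 \<in> S" "y 0 = 1"
  shows "qf A (insert u S) y = qf A S y + y u * (\<Sum>j\<in>S. lf A u j * y j)"
proof -
  have "(\<Sum>j\<in>S. (if j = 0 then A u u else 0) * y j) = (\<Sum>j\<in>S. if j = 0 then A u u else 0)"
    by (rule sum.cong) (use assms in auto)
  also have "\<dots> = A u u" using assms by simp
  finally have d: "(\<Sum>j\<in>S. (if j = 0 then A u u else 0) * y j) = A u u" .
  have "qf A (insert u S) y = A u u * (y u * y u) + (\<Sum>j\<in>S. A u j * y u * y j)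
      + ((\<Sum>i\<in>S. A i u * y i * y u) + qf A S y)"
    using assms by (simp add: qf_def sum.distrib algebra_simps)
  also have "\<dots> = qf A S y + y u * ((\<Sum>j\<in>S. A u j * y j) + (\<Sum>j\<in>S. A j u * y j) + A u u)"
    by (simp add: bit_idem algebra_simps sum_distrib_left)
  also have "\<dots> = qf A S y + y u * (\<Sum>j\<in>S. lf A u j * y j)"
    by (simp add: lf_def distrib_right sum.distrib d)
  finally show ?thesis .
qed

lemma gauss_insert:
  assumes "finite S" "v \<notin> S" "0 \<in> S"
  shows "gauss A (insert v S) = (\<Sum>y\<in>bitfun (S - {0}).
    sg (qf A S (y(0 := 1))) * (1 + sg (\<Sum>j\<in>S. lf A v j * (y(0 := 1)) j)))"
proof -
  have ne: "v \<noteq> 0" using assms(2,3) by metis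
  then have "insert v S - {0} = insert v (S - {0})" by auto
  then have "gauss A (insert v S) = (\<Sum>y\<in>bitfun (S - {0}).
      sg (qf A (insert v S) (y(0 := 1))) + sg (qf A (insert v S) ((y(v := 1))(0 := 1))))"
    unfolding gauss_def using assms by (simp add: sum_bitfun_insert)
  also have "\<dots> = (\<Sum>y\<in>bitfun (S - {0}).
    sg (qf A S (y(0 := 1))) * (1 + sg (\<Sum>j\<in>S. lf A v j * (y(0 := 1)) j)))"
  proof (rule sum.cong[OF refl])
    fix y assume "y \<in> bitfun (S - {0})"
    then have yv: "y v = 0" using assms by (simp add: bitfun_def)
    have "qf A S ((y(v := 1))(0 := 1)) = qf A S (y(0 := 1))"
      by (rule qf_cong) (use assms in auto)
    moreover have "(\<Sum>j\<in>S. lf A v j * ((y(v := 1))(0 := 1)) j) = (\<Sum>j\<in>S. lf A v j * (y(0 := 1)) j)"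
      by (rule sum.cong) (use assms in auto)
    ultimately show "sg (qf A (insert v S) (y(0 := 1))) + sg (qf A (insert v S) ((y(v := 1))(0 := 1)))
      = sg (qf A S (y(0 := 1))) * (1 + sg (\<Sum>j\<in>S. lf A v j * (y(0 := 1)) j))"
      using assms ne yv by (simp add: qf_insert sg_add algebra_simps)
  qed
  finally show ?thesis .
qed

text \<open>
  If the relative sign of the two values of \<open>y v\<close> is constant, the two halves of the sum are equal or
  cancel.
\<close>

lemma gauss_insert_no_pivot:
  assumes "finite S" "v \<notin> S" "0 \<in> S" "\<And>j. j \<in> S \<Longrightarrow> j \<noteq> 0 \<Longrightarrow> lf A v j = 0"
  shows "gauss A (insert v S) = (if lf A v 0 = 0 then 2 * gauss A S else 0)"
proof -
  have "(\<Sum>j\<in>S. lf A v j * (y(0 := 1)) j) = lf A v 0" for y :: "nat \<Rightarrow> bit"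
  proof -
    have "(\<Sum>j\<in>S. lf A v j * (y(0 := 1)) j) = (\<Sum>j\<in>S. if j = 0 then lf A v 0 else 0)"
      by (rule sum.cong) (use assms in auto)
    then show ?thesis using assms by simp
  qed
  then have "gauss A (insert v S) = (\<Sum>y\<in>bitfun (S - {0}).
    sg (qf A S (y(0 := 1))) * (1 + sg (lf A v 0)))"
    using gauss_insert[OF assms(1-3)] by simp
  then show ?thesis
    by (cases "lf A v 0") (auto simp: gauss_def sum_distrib_left mult.commute)
qed

text \<open>
  Let \<open>\<lambda>\<close> be the affine function \<open>lf A v\<close>.  The sum over \<open>y v\<close> leaves twice the sum over the
  solutions of \<open>\<lambda> = 0\<close>.  Since \<open>u\<close> occurs in \<open>\<lambda>\<close>, this equation determines \<open>y u\<close> as the sum \<open>l\<close> of the other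
  terms, and inserting it into the form adds the product of \<open>l\<close> and \<open>lf A u\<close>.  The new form does not
  involve \<open>y u\<close> any more; keeping \<open>u\<close> as a free variable accounts for the factor two.
\<close>

lemma gauss_insert_pivot:
  assumes "finite S" "v \<notin> S" "0 \<in> S" "u \<in> S" "u \<noteq> 0" "lf A v u = 1"
    and A': "\<And>j k. j \<in> S \<Longrightarrow> k \<in> S \<Longrightarrow>
      A' j k = (if j = u \<or> k = u then 0 else A j k + lf A v j * lf A u k)"
  shows "gauss A (insert v S) = gauss A' S"
proof -
  define S' where "S' = S - {u}"
  have S: "S = insert u S'" "u \<notin> S'" "finite S'" "0 \<in> S'"
    using assms by (auto simp: S'_def)
  have S0: "S - {0} = insert u (S' - {0})" using S assms by auto
  define l where "l y = (\<Sum>j\<in>S'. lf A v j * y j)" for y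
  define m where "m y = (\<Sum>j\<in>S'. lf A u j * y j)" for y
  have upd: "l ((y(u := b))(0 := 1)) = l (y(0 := 1))" "m ((y(u := b))(0 := 1)) = m (y(0 := 1))"
    "qf C S' ((y(u := b))(0 := 1)) = qf C S' (y(0 := 1))" for y b C
    unfolding l_def m_def using S
    by (auto intro!: sum.cong qf_cong)
  have q: "qf A S y = qf A S' y + y u * m y" if "y 0 = 1" for y
    using qf_insert[of S' u y A] S that by (simp add: m_def)
  have lin: "(\<Sum>j\<in>S. lf A v j * y j) = y u + l y" for y
    using S assms(6) by (simp add: l_def)
  have q': "qf A' S y = qf A S' y + l y * m y" for y
  proof -
    have "qf A' S y = qf A' S' y" using S A' by (simp add: qf_def)
    also have "\<dots> = (\<Sum>i\<in>S'. \<Sum>j\<in>S'. A i j * y i * y j + (lf A v i * y i) * (lf A u j * y j))"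
      unfolding qf_def using S A' by (auto intro!: sum.cong simp: algebra_simps)
    also have "\<dots> = qf A S' y + l y * m y"
      by (simp add: sum.distrib qf_def l_def m_def sum_product)
    finally show ?thesis .
  qed
  (* p, l and m are the form on the remaining variables and the two affine functions without y u *)
  have key: "sg (p + 0 * m) * (1 + sg (0 + l)) + sg (p + 1 * m) * (1 + sg (1 + l)) = 2 * sg (p + l * m)"
    for p l m :: bit
    by (cases l; cases m; cases p) auto
  have "gauss A (insert v S) = (\<Sum>y\<in>bitfun (S' - {0}). 2 * sg (qf A' S (y(0 := 1))))"
    unfolding gauss_insert[OF assms(1-3)] S0
  proof (subst sum_bitfun_insert, goal_cases)
    case 3
    show ?case
    proof (rule sum.cong[OF refl])
      fix y assume y: "y \<in> bitfun (S' - {0})"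
      then have "y u = 0" using S by (simp add: bitfun_def)
      then show "sg (qf A S (y(0 := 1))) * (1 + sg (\<Sum>j\<in>S. lf A v j * (y(0 := 1)) j)) +
          sg (qf A S ((y(u := 1))(0 := 1))) * (1 + sg (\<Sum>j\<in>S. lf A v j * ((y(u := 1))(0 := 1)) j))
          = 2 * sg (qf A' S (y(0 := 1)))"
        using key[of "qf A S' (y(0 := 1))" "m (y(0 := 1))" "l (y(0 := 1))"] assms(5)
        by (simp del: fun_upd_apply add: q lin q' upd fun_upd_same fun_upd_other)
    qed
  qed (use S in auto)
  moreover have "gauss A' S = (\<Sum>y\<in>bitfun (S' - {0}). 2 * sg (qf A' S (y(0 := 1))))"
    unfolding gauss_def S0
  proof (subst sum_bitfun_insert, goal_cases)
    case 3
    show ?case by (rule sum.cong[OF refl]) (simp add: q' upd)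
  qed (use S in auto)
  ultimately show ?thesis by simp
qed

lemma gauss_singleton: "gauss A {0} = sg (A 0 0)"
  by (simp add: gauss_def qf_def bitfun_empty)

section \<open>Parametrised solution sets\<close>

definition comb :: "('r \<Rightarrow> 'i \<Rightarrow> bit) \<Rightarrow> 'r set \<Rightarrow> ('r \<Rightarrow> bit) \<Rightarrow> 'i \<Rightarrow> bit" where
  "comb R I c i = (\<Sum>r\<in>I. c r * R r i)"

text \<open>
  The rows \<open>R r\<close> with \<open>r \<in> I\<close> form a basis of \<open>X\<close>.  Writing this as a bijection between coefficient
  vectors and \<open>X\<close> is what the enumeration of \<open>X\<close> needs.
\<close>

definition parametrises :: "('r \<Rightarrow> 'i \<Rightarrow> bit) \<Rightarrow> 'r set \<Rightarrow> ('i \<Rightarrow> bit) set \<Rightarrow> bool" where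
  "parametrises R I X \<longleftrightarrow> bij_betw (comb R I) (bitfun I) X"

lemma parametrises_unit:
  assumes "bij_betw h I S" "finite I" "\<And>r i. r \<in> I \<Longrightarrow> R r i = (if i = h r then 1 else 0)"
  shows "parametrises R I (bitfun S)"
proof -
  have "comb R I c i = (if i \<in> S then c (inv_into I h i) else 0)" if "c \<in> bitfun I" for c i
  proof -
    have inj: "inj_on h I" and im: "h ` I = S" using assms by (auto simp: bij_betw_def)
    have "comb R I c i = (\<Sum>r\<in>I. if i = h r then c r else 0)"
      unfolding comb_def by (rule sum.cong) (use assms in auto)
    also have "\<dots> = (if i \<in> S then c (inv_into I h i) else 0)"
    proof (cases "i \<in> S")
      case True
      then obtain r where r: "r \<in> I" "i = h r" using im by auto
      then have "(\<Sum>r'\<in>I. if i = h r' then c r' else 0) = (\<Sum>r'\<in>I. if r' = r then c r' else 0)"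
        using inj by (auto intro!: sum.cong dest: inj_onD)
      then show ?thesis using r True assms inj by simp
    next
      case False
      then have "\<And>r. r \<in> I \<Longrightarrow> i \<noteq> h r" using im by auto
      then show ?thesis using False by simp
    qed
    finally show ?thesis .
  qed
  then have "comb R I c = (\<lambda>i. if i \<in> S then c (inv_into I h i) else 0)" if "c \<in> bitfun I" for c
    using that by (auto simp: fun_eq_iff)
  then show ?thesis unfolding parametrises_def
    using bij_betw_bitfun_reindex[OF assms(1)] by (simp cong: bij_betw_cong)
qed

lemma parametrises_reindex:
  assumes "parametrises R I X" "bij_betw h J I" "\<And>r. r \<in> J \<Longrightarrow> R' r = R (h r)"
  shows "parametrises R' J X"
proof -
  let ?g = "\<lambda>c e. if e \<in> I then c (inv_into J h e) else 0"
  have "comb R' J c = comb R I (?g c)" for c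
  proof
    fix i
    have "comb R I (?g c) i = (\<Sum>r\<in>J. ?g c (h r) * R (h r) i)"
      unfolding comb_def by (rule sum.reindex_bij_betw[OF assms(2), symmetric])
    also have "\<dots> = comb R' J c i"
      unfolding comb_def using assms(2,3) by (auto intro!: sum.cong simp: bij_betw_def)
    finally show "comb R' J c i = comb R I (?g c) i" by simp
  qed
  then have eq: "comb R' J = comb R I \<circ> ?g" by auto
  show ?thesis
    using assms(1) bij_betw_bitfun_reindex[OF assms(2)] unfolding parametrises_def eq
    by (rule bij_betw_trans[rotated])
qed

text \<open>
  One step of elimination.  If the functional \<open>\<phi>\<close> is nonzero on the basis vector \<open>R p\<close>, adding \<open>R p\<close> to
  all other basis vectors on which \<open>\<phi>\<close> is nonzero and dropping \<open>R p\<close> gives a basis of the kernel of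
  \<open>\<phi>\<close>.  The coefficient of \<open>R p\<close> in an element of the kernel is determined by the other ones.
\<close>

lemma parametrises_inter:
  assumes par: "parametrises R I X" and "finite I" "p \<in> I"
    and lin: "\<And>c. \<phi> (comb R I c) = (\<Sum>r\<in>I. c r * u r)"
    and up: "u p = 1"
    and R': "\<And>r i. r \<in> I \<Longrightarrow> r \<noteq> p \<Longrightarrow> R' r i = R r i + u r * R p i"
  shows "parametrises R' (I - {p}) {x \<in> X. \<phi> x = (0::bit)}"
proof -
  let ?J = "I - {p}"
  let ?ext = "\<lambda>d. d(p := \<Sum>r\<in>?J. d r * u r)"
  have split: "(\<Sum>r\<in>I. f r) = f p + (\<Sum>r\<in>?J. f r)" for f :: "_ \<Rightarrow> bit"
    using assms by (simp add: sum.remove)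
  have eq: "comb R' ?J = comb R I \<circ> ?ext"
  proof (intro ext)
    fix d i
    have "comb R' ?J d i = (\<Sum>r\<in>?J. d r * R r i) + (\<Sum>r\<in>?J. d r * u r) * R p i"
      unfolding comb_def sum_distrib_right sum.distrib[symmetric]
      by (rule sum.cong) (use R' in \<open>auto simp: algebra_simps\<close>)
    also have "\<dots> = comb R I (?ext d) i"
      unfolding comb_def split by (simp add: add.commute)
    finally show "comb R' ?J d i = (comb R I \<circ> ?ext) d i" by simp
  qed
  let ?K = "{c \<in> bitfun I. (\<Sum>r\<in>I. c r * u r) = 0}"
  have "bij_betw ?ext (bitfun ?J) ?K"
  proof (rule bij_betw_byWitness[where f' = "\<lambda>c. c(p := 0)"])
    show "\<forall>d\<in>bitfun ?J. (?ext d)(p := 0) = d" by (auto simp: bitfun_def fun_eq_iff)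
    have "(\<Sum>r\<in>?J. c r * u r) = c p" if "(\<Sum>r\<in>I. c r * u r) = 0" for c
      using that up unfolding split by (cases "c p"; cases "\<Sum>r\<in>?J. c r * u r") auto
    then show "\<forall>c\<in>?K. ?ext (c(p := 0)) = c" by (auto simp: fun_eq_iff)
    show "?ext ` bitfun ?J \<subseteq> ?K"
      using up assms(3) by (auto simp: split bitfun_def)
    show "(\<lambda>c. c(p := 0)) ` ?K \<subseteq> bitfun ?J" by (auto simp: bitfun_def)
  qed
  moreover have "bij_betw (comb R I) ?K {x \<in> X. \<phi> x = 0}"
    using par lin unfolding parametrises_def bij_betw_def
    by (auto simp: inj_on_def image_iff)
  ultimately show ?thesis unfolding parametrises_def eq by (rule bij_betw_trans)
qed

lemma card_parametrises: "parametrises R I X \<Longrightarrow> finite I \<Longrightarrow> card X = 2 ^ card I"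
  unfolding parametrises_def by (metis bij_betw_same_card card_bitfun)

section \<open>Annihilators\<close>

text \<open>
  Translation by an element with \<open>\<phi> c = 1\<close> permutes \<open>B\<close> and changes all signs.
\<close>

lemma character_sum:
  fixes \<phi> :: "('a \<Rightarrow> bit) \<Rightarrow> bit"
  assumes "finite B" "\<And>b c. b \<in> B \<Longrightarrow> c \<in> B \<Longrightarrow> (\<lambda>i. b i + c i) \<in> B"
    "\<And>b c. \<phi> (\<lambda>i. b i + c i) = \<phi> b + \<phi> c"
  shows "(\<Sum>b\<in>B. sg (\<phi> b)) = (if \<forall>b\<in>B. \<phi> b = 0 then card B else 0)"
proof (cases "\<forall>b\<in>B. \<phi> b = 0")
  case False
  then obtain c where c: "c \<in> B" "\<phi> c = 1" using bit_cases by metis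
  have "bij_betw (\<lambda>b i. b i + c i) B B"
    by (rule bij_betw_byWitness[where f' = "\<lambda>b i. b i + c i"])
      (use assms(2) c in \<open>auto simp: add.assoc\<close>)
  then have "(\<Sum>b\<in>B. sg (\<phi> b)) = (\<Sum>b\<in>B. sg (\<phi> (\<lambda>i. b i + c i)))"
    by (rule sum.reindex_bij_betw[symmetric])
  also have "\<dots> = - (\<Sum>b\<in>B. sg (\<phi> b))"
    by (simp add: assms(3) sg_add c sum_negf)
  finally have "(\<Sum>b\<in>B. sg (\<phi> b)) = 0" by simp
  then show ?thesis by (simp only: if_not_P[OF False] of_nat_0)
qed simp

text \<open>
  Double counting: the sum of \<open>(-1)^(a \<bullet> b)\<close> over all vectors \<open>a\<close> and all \<open>b \<in> B\<close> equals the left side when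
  \<open>b\<close> is summed first, and the right side when \<open>a\<close> is summed first.
\<close>

lemma card_annihilator:
  assumes "finite C" "B \<subseteq> bitfun C" "\<And>b c. b \<in> B \<Longrightarrow> c \<in> B \<Longrightarrow> (\<lambda>i. b i + c i) \<in> B"
    "(\<lambda>_. 0) \<in> B"
  shows "card B * card {a \<in> bitfun C. \<forall>b\<in>B. (\<Sum>e\<in>C. a e * b e) = 0} = 2 ^ card C"
proof -
  let ?p = "\<lambda>a b. \<Sum>e\<in>C. a e * (b e :: bit)"
  let ?A = "{a \<in> bitfun C. \<forall>b\<in>B. ?p a b = 0}"
  have finC: "finite (bitfun C)" using assms by (simp add: finite_bitfun)
  then have finB: "finite B" using assms(2) by (rule finite_subset[rotated])
  have addr: "?p a (\<lambda>i. b i + c i) = ?p a b + ?p a c" for a b c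
    by (simp add: distrib_left sum.distrib)
  have addl: "?p (\<lambda>i. a i + b i) c = ?p a c + ?p b c" for a b c
    by (simp add: distrib_right sum.distrib)
  have "(\<Sum>a\<in>bitfun C. \<Sum>b\<in>B. sg (?p a b)) = (\<Sum>a\<in>bitfun C. if a \<in> ?A then real (card B) else 0)"
  proof (rule sum.cong[OF refl])
    fix a assume "a \<in> bitfun C"
    then have "a \<in> ?A \<longleftrightarrow> (\<forall>b\<in>B. ?p a b = 0)" by blast
    moreover have "(\<Sum>b\<in>B. sg (?p a b)) = real (if \<forall>b\<in>B. ?p a b = 0 then card B else 0)"
      by (rule character_sum[of B "?p a", OF finB assms(3) addr])
    ultimately show "(\<Sum>b\<in>B. sg (?p a b)) = (if a \<in> ?A then real (card B) else 0)"
      by (simp only: if_distrib[of real] of_nat_0)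
  qed
  also have "\<dots> = real (card B * card ?A)"
    using finC by (simp add: sum.If_cases Int_def conj_commute mult.commute)
  finally have 1: "(\<Sum>a\<in>bitfun C. \<Sum>b\<in>B. sg (?p a b)) = real (card B * card ?A)" .
  have "(\<Sum>a\<in>bitfun C. \<Sum>b\<in>B. sg (?p a b)) = (\<Sum>b\<in>B. \<Sum>a\<in>bitfun C. sg (?p a b))"
    by (rule sum.swap)
  also have "\<dots> = (\<Sum>b\<in>B. if b = (\<lambda>_. 0) then 2 ^ card C else 0)"
  proof (rule sum.cong[OF refl])
    fix b assume b: "b \<in> B"
    have ex: "\<exists>a\<in>bitfun C. ?p a b \<noteq> 0" if ne: "b \<noteq> (\<lambda>_. 0)"
    proof -
      from ne obtain e where e: "b e \<noteq> 0" unfolding fun_eq_iff by blast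
      then have eC: "e \<in> C" using subsetD[OF assms(2) b] unfolding bitfun_def by blast
      have "?p (\<lambda>i. if i = e then 1 else 0) b = (\<Sum>i\<in>C. if i = e then b i else 0)"
        by (rule sum.cong) auto
      also have "\<dots> = b e" using eC assms by simp
      finally have "?p (\<lambda>i. if i = e then 1 else 0) b \<noteq> 0" using e by simp
      then show ?thesis using eC by (intro bexI[of _ "\<lambda>i. if i = e then 1 else 0"]) (auto simp: bitfun_def)
    qed
    have "(\<Sum>a\<in>bitfun C. sg (?p a b)) = (if \<forall>a\<in>bitfun C. ?p a b = 0 then card (bitfun C) else 0)"
      by (rule character_sum[of "bitfun C" "\<lambda>a. ?p a b", OF finC bitfun_add addl])
    also have "\<dots> = (if b = (\<lambda>_. 0) then 2 ^ card C else 0)"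
    proof (cases "b = (\<lambda>_. 0)")
      case False
      then have "\<not> (\<forall>a\<in>bitfun C. ?p a b = 0)" using ex by blast
      then show ?thesis using False by (simp only: if_False of_nat_0)
    qed (simp add: card_bitfun assms(1))
    finally show "(\<Sum>a\<in>bitfun C. sg (?p a b)) = (if b = (\<lambda>_. 0) then 2 ^ card C else 0)"
      by simp
  qed
  also have "\<dots> = 2 ^ card C" using finB assms(4) by simp
  finally have "real (card B * card ?A) = real (2 ^ card C)" using 1 by simp
  then show ?thesis by (simp only: of_nat_eq_iff)
qed

interpretation bitvs: vector_space bit_scale
  by (rule vector_space_bit_scale)

lemma card_span_independent:
  assumes "finite B" "bitvs.independent B"
  shows "finite (bitvs.span B) \<and> card (bitvs.span B) = 2 ^ card B"
  using assms
proof (induction B rule: finite_induct)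
  case (insert a B)
  then have ind: "bitvs.independent B" "a \<notin> bitvs.span B"
    by (auto simp: bitvs.independent_insert split: if_splits)
  have bs: "bit_scale 0 x = 0" "bit_scale 1 x = x" for x :: "'a \<Rightarrow> bit"
    by (auto simp: bit_scale_def fun_eq_iff)
  have mem: "x \<in> bitvs.span (insert a B) \<longleftrightarrow> x \<in> bitvs.span B \<or> x - a \<in> bitvs.span B" for x
    by (simp add: bitvs.span_insert ex_bit bs)
  have eq: "bitvs.span (insert a B) = bitvs.span B \<union> (\<lambda>x. x + a) ` bitvs.span B"
  proof (rule Set.set_eqI)
    fix x
    have "x - a \<in> U \<longleftrightarrow> x \<in> (\<lambda>x. x + a) ` U" for U :: "('a \<Rightarrow> bit) set"
    proof
      assume "x - a \<in> U"
      then show "x \<in> (\<lambda>x. x + a) ` U" by (rule image_eqI[rotated]) (rule diff_add_cancel[symmetric])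
    next
      assume "x \<in> (\<lambda>x. x + a) ` U"
      then obtain y where y: "y \<in> U" "x = y + a" by (rule imageE)
      have "x - a = y" unfolding y(2) by (rule add_diff_cancel_right')
      with y(1) show "x - a \<in> U" by simp
    qed
    then show "x \<in> bitvs.span (insert a B) \<longleftrightarrow> x \<in> bitvs.span B \<union> (\<lambda>x. x + a) ` bitvs.span B"
      unfolding Un_iff mem by blast
  qed
  have disj: "bitvs.span B \<inter> (\<lambda>x. x + a) ` bitvs.span B = {}"
  proof (rule ccontr)
    assume "bitvs.span B \<inter> (\<lambda>x. x + a) ` bitvs.span B \<noteq> {}"
    then obtain y where y: "y \<in> bitvs.span B" "y + a \<in> bitvs.span B" by blast
    have "(y + a) - y \<in> bitvs.span B" by (rule bitvs.span_diff[OF y(2) y(1)])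
    with ind(2) show False unfolding add_diff_cancel_left' by contradiction
  qed
  have "card ((\<lambda>x. x + a) ` bitvs.span B) = card (bitvs.span B)"
    by (rule card_image) (rule inj_on_add')
  moreover have fin: "finite (bitvs.span B)" "card (bitvs.span B) = 2 ^ card B"
    using insert.IH[OF ind(1)] by blast+
  ultimately have "card (bitvs.span (insert a B)) = 2 ^ card B + 2 ^ card B"
    unfolding eq using card_Un_disjoint[OF fin(1) finite_imageI[OF fin(1)] disj] by argo
  moreover have "finite (bitvs.span (insert a B))"
    unfolding eq using fin(1) finite_imageI[OF fin(1)] by (rule finite_UnI)
  moreover have "(2::nat) ^ card B + 2 ^ card B = 2 ^ card (insert a B)"
    using insert.hyps by simp
  ultimately show ?case by argo
qed (auto simp: bitvs.span_empty)

text \<open>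
  A vector space of dimension \<open>d\<close> over the field of two elements has \<open>2 ^ d\<close> elements.  This lets
  Betti numbers be computed by counting.
\<close>

lemma card_subspace:
  assumes "bitvs.subspace U" "finite U"
  shows "card U = 2 ^ bitvs.dim U"
proof -
  obtain B where B: "B \<subseteq> U" "bitvs.independent B" "U \<subseteq> bitvs.span B" "card B = bitvs.dim U"
    using bitvs.basis_exists by blast
  have "bitvs.span B = U" using B(3) bitvs.span_minimal[OF B(1) assms(1)] by (rule subset_antisym[rotated])
  moreover have "finite B" using B(1) assms(2) by (rule finite_subset)
  ultimately show ?thesis using card_span_independent[OF _ B(2)] B(4) by simp
qed

section \<open>Binary numbers\<close>

definition binval :: "nat \<Rightarrow> (nat \<Rightarrow> bit) \<Rightarrow> nat" where
  "binval L c = (\<Sum>i<L. if c i = 1 then 2 ^ i else 0)"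

lemma binval_less: "binval L c < 2 ^ L"
  by (induction L) (auto simp: binval_def)

lemma binval_inj: "binval L c = binval L d \<Longrightarrow> i < L \<Longrightarrow> c i = d i"
proof (induction L)
  case (Suc L)
  have S: "binval (Suc L) x = binval L x + (if x L = 1 then 2 ^ L else 0)" for x
    by (simp add: binval_def)
  have "c L = d L" using Suc.prems(1) binval_less[of L c] binval_less[of L d] bit_cases[of "c L"]
      bit_cases[of "d L"] by (auto simp: S split: if_splits)
  then show ?case using Suc by (auto simp: S less_Suc_eq)
qed simp

lemma bij_betw_binval: "bij_betw (binval L) (bitfun {..<L}) {..<2 ^ L}"
proof -
  have inj: "inj_on (binval L) (bitfun {..<L})"
  proof (rule inj_onI)
    fix c d assume "c \<in> bitfun {..<L}" "d \<in> bitfun {..<L}" "binval L c = binval L d"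
    then show "c = d" using binval_inj[of L c d] by (auto simp: bitfun_def fun_eq_iff) (metis not_less)
  qed
  have "binval L ` bitfun {..<L} = {..<2 ^ L}"
    by (rule card_subset_eq) (auto simp: binval_less card_image[OF inj] card_bitfun)
  with inj show ?thesis by (simp add: bij_betw_def)
qed

section \<open>Cells of a triangulation\<close>

definition face_steps :: "triangulation \<Rightarrow> (nat \<times> nat set) rel" where
  "face_steps T = {((u, B), (nbr T u f, gperm T u f ` B)) | u f B.
     u < tets T \<and> f < 4 \<and> B \<subseteq> {..<4} \<and> f \<notin> B}"

locale glued =
  fixes T :: triangulation
  assumes gluing: "gluing T"
begin

lemma gluing_props:
  assumes "t < tets T" "f < 4"
  shows "nbr T t f < tets T" "gperm T t f permutes {..<4}"
    "(nbr T t f, gperm T t f f) \<noteq> (t, f)" "nbr T (nbr T t f) (gperm T t f f) = t"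
    "gperm T (nbr T t f) (gperm T t f f) = inv_into UNIV (gperm T t f)"
  using gluing[unfolded gluing_def Let_def, rule_format, OF assms] by blast+

lemma gperm_less: "t < tets T \<Longrightarrow> f < 4 \<Longrightarrow> a < 4 \<Longrightarrow> gperm T t f a < 4"
  using permutes_in_image[OF gluing_props(2)] by simp

lemma inj_gperm: "t < tets T \<Longrightarrow> f < 4 \<Longrightarrow> inj (gperm T t f)"
  by (rule permutes_inj[OF gluing_props(2)])

text \<open>
  The gluing of the partner face is the inverse permutation, so steps can be reversed.
\<close>

lemma sym_face_steps: "(x, y) \<in> face_steps T \<Longrightarrow> (y, x) \<in> face_steps T"
proof -
  assume "(x, y) \<in> face_steps T"
  then obtain u f B where 1: "x = (u, B)" "y = (nbr T u f, gperm T u f ` B)"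
    "u < tets T" "f < 4" "B \<subseteq> {..<4}" "f \<notin> B" by (auto simp: face_steps_def)
  note g = gluing_props[OF 1(3,4)]
  have inj: "inj (gperm T u f)" using inj_gperm 1 by simp
  have "gperm T u f ` B \<subseteq> {..<4}" using gperm_less[OF 1(3,4)] 1(5) by auto
  moreover have "gperm T u f f \<notin> gperm T u f ` B" using inj 1(6) by (auto dest: injD)
  moreover have "inv_into UNIV (gperm T u f) ` gperm T u f ` B = B"
    using inj by (simp add: image_image)
  moreover have "gperm T u f f < 4" using gperm_less[OF 1(3,4,4)] .
  then have "((nbr T u f, gperm T u f ` B), (nbr T (nbr T u f) (gperm T u f f),
      gperm T (nbr T u f) (gperm T u f f) ` gperm T u f ` B)) \<in> face_steps T"
    using calculation g(1) unfolding face_steps_def by blast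
  ultimately have "((nbr T u f, gperm T u f ` B), (u, B)) \<in> face_steps T"
    unfolding g(4,5) by simp
  then show ?thesis using 1 by simp
qed

lemma equiv_generated_face_steps: "equiv_generated (face_steps T) = (face_steps T)\<^sup>*"
proof -
  have "face_steps T \<union> (face_steps T)\<inverse> = face_steps T" using sym_face_steps by auto
  then show ?thesis by (simp add: equiv_generated_def)
qed

lemma cell_def': "cell T t A = (face_steps T)\<^sup>* `` {(t, A)}"
  unfolding cell_def face_steps_def[symmetric] equiv_generated_face_steps ..

lemma sym_rtrancl_face_steps: "sym ((face_steps T)\<^sup>*)"
  by (rule sym_rtrancl, rule symI, rule sym_face_steps)

lemma cell_eq_iff: "cell T t A = cell T u B \<longleftrightarrow> ((t, A), (u, B)) \<in> (face_steps T)\<^sup>*"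
proof
  assume "cell T t A = cell T u B"
  moreover have "(u, B) \<in> cell T u B" by (simp add: cell_def')
  ultimately have "(u, B) \<in> cell T t A" by simp
  then show "((t, A), (u, B)) \<in> (face_steps T)\<^sup>*" unfolding cell_def' by simp
next
  assume 1: "((t, A), (u, B)) \<in> (face_steps T)\<^sup>*"
  then have 2: "((u, B), (t, A)) \<in> (face_steps T)\<^sup>*" by (rule symD[OF sym_rtrancl_face_steps])
  show "cell T t A = cell T u B"
    unfolding cell_def' using 1 2 by (auto intro: rtrancl_trans)
qed

lemma mem_cell_iff: "(u, B) \<in> cell T t A \<longleftrightarrow> cell T t A = cell T u B"
  unfolding cell_eq_iff unfolding cell_def' by simp

lemma cell_step:
  assumes "t < tets T" "f < 4" "A \<subseteq> {..<4}" "f \<notin> A"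
  shows "cell T (nbr T t f) (gperm T t f ` A) = cell T t A"
proof -
  have "((t, A), (nbr T t f, gperm T t f ` A)) \<in> face_steps T"
    using assms by (auto simp: face_steps_def)
  then show ?thesis unfolding cell_eq_iff[symmetric] by (metis cell_eq_iff r_into_rtrancl)
qed

text \<open>
  The principle behind all statements about cells: a quantity attached to faces of tetrahedra that is
  preserved by every gluing map takes the same value at all representatives of a cell.
\<close>

lemma cell_invariant:
  assumes "cell T t A = cell T u B"
    and step: "\<And>t f A. t < tets T \<Longrightarrow> f < 4 \<Longrightarrow> A \<subseteq> {..<4} \<Longrightarrow> f \<notin> A \<Longrightarrow>
      g (nbr T t f) (gperm T t f ` A) = g t A"
  shows "g u B = g t A"
proof -
  from assms(1) have "((t, A), (u, B)) \<in> (face_steps T)\<^sup>*" by (simp add: cell_eq_iff)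
  then show ?thesis
  proof (induction "(u, B)" arbitrary: u B rule: rtrancl_induct)
    case (step y)
    then show ?case by (cases y) (auto simp: face_steps_def assms(2))
  qed simp
qed

lemma card_gperm_image:
  "t < tets T \<Longrightarrow> f < 4 \<Longrightarrow> card (gperm T t f ` A) = card A"
  by (rule card_image) (rule inj_on_subset[OF inj_gperm subset_UNIV])

lemma cell_eq_props:
  assumes "cell T t A = cell T u B" "t < tets T" "A \<subseteq> {..<4}"
  shows "u < tets T" "B \<subseteq> {..<4}" "card B = card A"
proof -
  have "(u < tets T \<and> B \<subseteq> {..<4}) = (t < tets T \<and> A \<subseteq> {..<4})"
    using assms(1)
  proof (rule cell_invariant[where g = "\<lambda>u B. u < tets T \<and> B \<subseteq> {..<4}"])
    fix t f A assume 1: "t < tets T" "f < 4" "A \<subseteq> {..<4::nat}" "f \<notin> A"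
    then show "(nbr T t f < tets T \<and> gperm T t f ` A \<subseteq> {..<4}) = (t < tets T \<and> A \<subseteq> {..<4})"
      using gluing_props(1) gperm_less by blast
  qed
  then show "u < tets T" "B \<subseteq> {..<4}" using assms by auto
  show "card B = card A"
    using assms(1) by (rule cell_invariant) (rule card_gperm_image)
qed

lemma cell_in_cells_iff:
  assumes "t < tets T" "A \<subseteq> {..<4}"
  shows "cell T t A \<in> cells T d \<longleftrightarrow> card A = Suc d"
proof
  assume "cell T t A \<in> cells T d"
  then obtain u B where "cell T t A = cell T u B" "card B = Suc d" unfolding cells_def by blast
  then show "card A = Suc d" using cell_eq_props(3)[OF _ assms] by simp
next
  assume "card A = Suc d"
  then show "cell T t A \<in> cells T d" using assms unfolding cells_def by blast
qed

lemma finite_cells: "finite (cells T d)"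
proof -
  have "cells T d \<subseteq> (\<lambda>(t, A). cell T t A) ` ({..<tets T} \<times> Pow {..<4})"
    unfolding cells_def by auto
  then show ?thesis by (rule finite_subset) auto
qed

text \<open>
  A gluing map carries the facets of a face to the facets of its image and preserves their cells.
\<close>

lemma sum_facets_invariant:
  fixes g :: "tri_cell \<Rightarrow> 'b :: comm_monoid_add"
  assumes "cell T t A = cell T u B"
  shows "(\<Sum>b\<in>B. g (cell T u (B - {b}))) = (\<Sum>a\<in>A. g (cell T t (A - {a})))"
  using assms
proof (rule cell_invariant)
  fix t f A assume 1: "t < tets T" "f < 4" "A \<subseteq> {..<4::nat}" "f \<notin> A"
  have inj: "inj (gperm T t f)" using 1 inj_gperm by simp
  have "(\<Sum>b\<in>gperm T t f ` A. g (cell T (nbr T t f) (gperm T t f ` A - {b})))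
      = (\<Sum>a\<in>A. g (cell T (nbr T t f) (gperm T t f ` A - {gperm T t f a})))"
    by (subst sum.reindex) (use inj in \<open>auto simp: inj_on_def dest: injD\<close>)
  also have "\<dots> = (\<Sum>a\<in>A. g (cell T t (A - {a})))"
  proof (rule sum.cong[OF refl])
    fix a
    have "gperm T t f ` A - {gperm T t f a} = gperm T t f ` (A - {a})"
      using inj by (auto dest: injD)
    moreover have "cell T (nbr T t f) (gperm T t f ` (A - {a})) = cell T t (A - {a})"
      by (rule cell_step) (use 1 in auto)
    ultimately show "g (cell T (nbr T t f) (gperm T t f ` A - {gperm T t f a})) = g (cell T t (A - {a}))"
      by simp
  qed
  finally show "(\<Sum>b\<in>gperm T t f ` A. g (cell T (nbr T t f) (gperm T t f ` A - {b})))
      = (\<Sum>a\<in>A. g (cell T t (A - {a})))" .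
qed

text \<open>
  The representative of the cell that the definition chooses can be replaced by any other one.
\<close>

lemma incidence_cell:
  assumes "finite A"
  shows "incidence T (cell T t A) d = (\<Sum>a\<in>A. if cell T t (A - {a}) = d then 1 else 0)"
proof -
  define r where "r = (SOME r. r \<in> cell T t A)"
  obtain u B where r: "r = (u, B)" by (cases r)
  have "(t, A) \<in> cell T t A" by (simp add: mem_cell_iff)
  then have "r \<in> cell T t A" unfolding r_def by (rule someI)
  then have eq: "cell T t A = cell T u B" by (simp add: r mem_cell_iff)
  have "card B = card A \<and> (finite B \<longleftrightarrow> finite A)"
  proof -
    have "(finite B \<longleftrightarrow> finite A)"
      using cell_invariant[OF eq, of "\<lambda>_ A. finite A"] inj_gperm
      by (metis finite_imageD finite_imageI inj_on_subset subset_UNIV)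
    moreover have "card B = card A"
      using eq by (rule cell_invariant) (rule card_gperm_image)
    ultimately show ?thesis by simp
  qed
  then have "finite B" using assms by simp
  then have "of_nat (card {b \<in> B. cell T u (B - {b}) = d})
      = (\<Sum>b\<in>B. if cell T u (B - {b}) = d then 1 else (0::bit))"
    by (simp add: sum.If_cases Int_def)
  also have "\<dots> = (\<Sum>a\<in>A. if cell T t (A - {a}) = d then 1 else 0)"
    using sum_facets_invariant[OF eq, of "\<lambda>c. if c = d then 1 else (0::bit)"] .
  finally show ?thesis
    unfolding incidence_def r_def[symmetric] r by simp
qed

lemma sum_incidence:
  assumes "t < tets T" "A \<subseteq> {..<4}" "card A = Suc (Suc d)"
  shows "(\<Sum>c\<in>cells T d. incidence T (cell T t A) c * x c) = (\<Sum>a\<in>A. x (cell T t (A - {a})))"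
proof -
  have fin: "finite A" using assms(3) card.infinite by force
  have "(\<Sum>c\<in>cells T d. incidence T (cell T t A) c * x c)
      = (\<Sum>c\<in>cells T d. \<Sum>a\<in>A. if cell T t (A - {a}) = c then x c else 0)"
    by (rule sum.cong[OF refl]) (simp add: incidence_cell[OF fin] sum_distrib_right if_distrib[of "\<lambda>z. z * _"] cong: if_cong)
  also have "\<dots> = (\<Sum>a\<in>A. \<Sum>c\<in>cells T d. if cell T t (A - {a}) = c then x c else 0)"
    by (rule sum.swap)
  also have "\<dots> = (\<Sum>a\<in>A. x (cell T t (A - {a})))"
  proof (rule sum.cong[OF refl])
    fix a assume "a \<in> A"
    then have "cell T t (A - {a}) \<in> cells T d"
      using assms fin by (subst cell_in_cells_iff) auto
    then show "(\<Sum>c\<in>cells T d. if cell T t (A - {a}) = c then x c else 0) = x (cell T t (A - {a}))"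
      by (simp add: finite_cells)
  qed
  finally show ?thesis .
qed

section \<open>Cocycles and the first Betti number\<close>

definition cocycles :: "(tri_cell \<Rightarrow> bit) set" where
  "cocycles = {\<alpha> \<in> bitfun (cells T 1). \<forall>t<tets T. \<forall>A. A \<subseteq> {..<4} \<longrightarrow> card A = 3 \<longrightarrow>
     (\<Sum>a\<in>A. \<alpha> (cell T t (A - {a}))) = 0}"

lemma chains_eq: "chains T d = bitfun (cells T d)"
  by (simp add: chains_def bitfun_def)

text \<open>
  With one vertex both ends of every edge are the same cell, and they cancel.
\<close>

lemma boundary_1_zero:
  assumes "one_vertex T"
  shows "boundary T 1 x = 0"
proof
  fix d
  obtain v where v: "cells T 0 = {v}" using assms by (auto simp: one_vertex_def card_1_singleton_iff)
  have "incidence T c d = 0" if "c \<in> cells T 1" "d \<in> cells T 0" for c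
  proof -
    from that(1) obtain t A where A: "c = cell T t A" "t < tets T" "A \<subseteq> {..<4}" "card A = 2"
      by (auto simp: cells_def numeral_2_eq_2)
    then have fin: "finite A" using finite_subset by blast
    have "cell T t (A - {a}) = d" if "a \<in> A" for a
    proof -
      have "cell T t (A - {a}) \<in> cells T 0"
        using A that fin by (subst cell_in_cells_iff) auto
      then show ?thesis using v \<open>d \<in> cells T 0\<close> by simp
    qed
    then have "incidence T c d = (\<Sum>a\<in>A. 1)"
      unfolding A(1) incidence_cell[OF fin] by (intro sum.cong) auto
    then show ?thesis using A(4) by simp
  qed
  then show "boundary T 1 x d = 0 d" unfolding boundary_def by simp
qed

lemma boundary_add: "boundary T k (\<lambda>i. x i + y i) = (\<lambda>i. boundary T k x i + boundary T k y i)"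
proof
  show "boundary T k (\<lambda>i. x i + y i) d = boundary T k x d + boundary T k y d" for d
    by (cases "d \<in> cells T (k - 1)") (simp_all only: boundary_def distrib_left sum.distrib if_True if_False add_0)
qed

text \<open>
  The coboundary is the transpose of the boundary: pairing \<open>\<alpha>\<close> with the boundary of a single triangle
  gives the sum of \<open>\<alpha>\<close> along that triangle.
\<close>

lemma cocycles_eq_annihilator:
  "cocycles = {a \<in> bitfun (cells T 1). \<forall>b\<in>boundary T 2 ` bitfun (cells T 2).
     (\<Sum>e\<in>cells T 1. a e * b e) = 0}"
proof -
  let ?co = "\<lambda>\<alpha> c. \<Sum>e\<in>cells T 1. incidence T c e * \<alpha> e"
  have pair: "(\<Sum>e\<in>cells T 1. \<alpha> e * boundary T 2 y e) = (\<Sum>c\<in>cells T 2. y c * ?co \<alpha> c)" for \<alpha> y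
  proof -
    have "(\<Sum>e\<in>cells T 1. \<alpha> e * boundary T 2 y e)
        = (\<Sum>e\<in>cells T 1. \<Sum>c\<in>cells T 2. y c * (incidence T c e * \<alpha> e))"
      by (rule sum.cong[OF refl]) (simp add: boundary_def sum_distrib_left mult_ac)
    also have "\<dots> = (\<Sum>c\<in>cells T 2. y c * ?co \<alpha> c)"
      by (subst sum.swap) (simp add: sum_distrib_left)
    finally show ?thesis .
  qed
  have e1: "(\<forall>b\<in>boundary T 2 ` bitfun (cells T 2). (\<Sum>e\<in>cells T 1. \<alpha> e * b e) = 0)
      \<longleftrightarrow> (\<forall>c\<in>cells T 2. ?co \<alpha> c = 0)" for \<alpha>
  proof
    assume L: "\<forall>b\<in>boundary T 2 ` bitfun (cells T 2). (\<Sum>e\<in>cells T 1. \<alpha> e * b e) = 0"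
    show "\<forall>c\<in>cells T 2. ?co \<alpha> c = 0"
    proof
      fix c assume c: "c \<in> cells T 2"
      let ?y = "\<lambda>c'. if c' = c then 1 else (0::bit)"
      have "?y \<in> bitfun (cells T 2)" using c by (simp add: bitfun_def)
      then have "(\<Sum>c'\<in>cells T 2. ?y c' * ?co \<alpha> c') = 0" using L unfolding pair[symmetric] by blast
      moreover have "(\<Sum>c'\<in>cells T 2. ?y c' * ?co \<alpha> c') = (\<Sum>c'\<in>cells T 2. if c' = c then ?co \<alpha> c' else 0)"
        by (rule sum.cong) auto
      ultimately show "?co \<alpha> c = 0" using c finite_cells by simp
    qed
  next
    assume "\<forall>c\<in>cells T 2. ?co \<alpha> c = 0"
    then have "(\<Sum>e\<in>cells T 1. \<alpha> e * boundary T 2 y e) = 0" for y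
      unfolding pair by (simp del: One_nat_def)
    then show "\<forall>b\<in>boundary T 2 ` bitfun (cells T 2). (\<Sum>e\<in>cells T 1. \<alpha> e * b e) = 0"
      by blast
  qed
  have e2: "(\<forall>c\<in>cells T 2. ?co \<alpha> c = 0) \<longleftrightarrow> (\<forall>t<tets T. \<forall>A. A \<subseteq> {..<4} \<longrightarrow> card A = 3 \<longrightarrow>
     (\<Sum>a\<in>A. \<alpha> (cell T t (A - {a}))) = 0)" for \<alpha>
  proof -
    have co: "?co \<alpha> (cell T t A) = (\<Sum>a\<in>A. \<alpha> (cell T t (A - {a})))"
      if "t < tets T" "A \<subseteq> {..<4}" "card A = 3" for t A
      by (rule sum_incidence) (use that in auto)
    have card3: "card A = Suc 2 \<longleftrightarrow> card A = 3" for A :: "nat set" by simp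
    show ?thesis (is "?L \<longleftrightarrow> ?R")
    proof
      assume L: ?L
      show ?R
      proof (intro allI impI)
        fix t A assume 1: "t < tets T" "A \<subseteq> {..<4::nat}" "card A = 3"
        then have "cell T t A \<in> cells T 2" unfolding cells_def card3 by blast
        then show "(\<Sum>a\<in>A. \<alpha> (cell T t (A - {a}))) = 0" using L co[OF 1] by simp
      qed
    next
      assume R: ?R
      show ?L
      proof
        fix c assume "c \<in> cells T 2"
        then obtain t A where 1: "c = cell T t A" "t < tets T" "A \<subseteq> {..<4}" "card A = 3"
          unfolding cells_def card3 by blast
        then show "?co \<alpha> c = 0" using R co[OF 1(2-4)] by simp
      qed
    qed
  qed
  show ?thesis unfolding cocycles_def e1 e2 ..
qed

text \<open>
  All one-chains are cycles, so \<open>betti1 T\<close> is the number of edges minus the rank of the boundary of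
  triangles, and the annihilator of the boundaries has the complementary dimension.
\<close>

theorem card_cocycles:
  assumes "one_vertex T"
  shows "card cocycles = 2 ^ betti1 T"
proof -
  let ?B = "boundary T 2 ` bitfun (cells T 2)" and ?C = "bitfun (cells T 1)"
  have sub: "?B \<subseteq> ?C" by (auto simp: bitfun_def boundary_def)
  have zero: "(\<lambda>_. 0) \<in> ?B"
    by (rule image_eqI[of _ _ "\<lambda>_. 0"]) (auto simp: boundary_def bitfun_def)
  have add: "(\<lambda>i. b i + c i) \<in> ?B" if "b \<in> ?B" "c \<in> ?B" for b c
    using that by (auto simp: boundary_add[symmetric] intro!: imageI bitfun_add)
  have ssp: "bitvs.subspace U" if "(\<lambda>_. 0) \<in> U" "\<And>b c. b \<in> U \<Longrightarrow> c \<in> U \<Longrightarrow> (\<lambda>i. b i + c i) \<in> U" for U :: "(tri_cell \<Rightarrow> bit) set"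
  proof (rule bitvs.subspaceI)
    show "0 \<in> U" using that(1) by (simp add: zero_fun_def)
    show "x + y \<in> U" if "x \<in> U" "y \<in> U" for x y
      using \<open>\<And>b c. b \<in> U \<Longrightarrow> c \<in> U \<Longrightarrow> (\<lambda>i. b i + c i) \<in> U\<close>[OF that] by (simp add: plus_fun_def)
    show "bit_scale c x \<in> U" if "x \<in> U" for c x
      using that \<open>(\<lambda>_. 0) \<in> U\<close> by (cases c) (simp_all add: bit_scale_def)
  qed
  have finC: "finite ?C" by (simp add: finite_bitfun finite_cells)
  then have finB: "finite ?B" using sub finite_subset by blast
  have "card ?B * card cocycles = 2 ^ card (cells T 1)"
    unfolding cocycles_eq_annihilator
    by (rule card_annihilator[OF finite_cells sub add zero])
  moreover have "card ?B = 2 ^ bitvs.dim ?B"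
    by (rule card_subspace[OF ssp[OF zero add] finB])
  ultimately have eq: "2 ^ bitvs.dim ?B * card cocycles = 2 ^ card (cells T 1)"
    by (simp only:)
  have "(\<lambda>_. 0) \<in> ?C" by (simp add: bitfun_def)
  then have "card ?C = 2 ^ bitvs.dim ?C"
    by (rule card_subspace[OF ssp[OF _ bitfun_add] finC])
  then have "(2::nat) ^ bitvs.dim ?C = 2 ^ card (cells T 1)"
    by (simp only: card_bitfun[OF finite_cells])
  then have "bitvs.dim ?C = card (cells T 1)" by (simp only: power_inject_exp one_less_numeral_iff semiring_norm)
  moreover have "{x \<in> chains T 1. boundary T 1 x = 0} = ?C"
    unfolding boundary_1_zero[OF assms] chains_eq by blast
  ultimately have b: "betti1 T = card (cells T 1) - bitvs.dim ?B"
    unfolding betti1_def chains_eq by (simp only:)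
  have "(2::nat) ^ bitvs.dim ?B dvd 2 ^ card (cells T 1)" using eq by (metis dvd_triv_left)
  then have le: "bitvs.dim ?B \<le> card (cells T 1)" by (simp add: dvd_power_iff_le)
  then have "(2::nat) ^ card (cells T 1) = 2 ^ bitvs.dim ?B * 2 ^ betti1 T"
    unfolding b by (simp add: power_add[symmetric])
  then show ?thesis using eq by simp
qed

section \<open>Triangles as pairs of faces\<close>

text \<open>
  Every triangle of the triangulation is a pair of glued faces.  The face with the smaller number
  \<open>4 * t + f\<close> represents the pair, so that a product over triangles becomes a product over faces that
  a program can test one by one.
\<close>

definition leading_face :: "nat \<Rightarrow> nat \<Rightarrow> bool" where
  "leading_face t f \<longleftrightarrow> 4 * t + f < 4 * nbr T t f + gperm T t f f"

lemma subset_4_card_3: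
  assumes "A \<subseteq> {..<4::nat}" "card A = 3"
  obtains f where "f < 4" "A = {..<4} - {f}"
proof -
  have "card ({..<4} - A) = 1" using assms by (subst card_Diff_subset) (auto intro: finite_subset)
  then obtain f where f: "{..<4} - A = {f}" by (auto simp: card_1_singleton_iff)
  then have "A = {..<4} - {f}" "f < 4" using assms by auto
  then show ?thesis using that by blast
qed

lemma gperm_image_face:
  assumes "t < tets T" "f < 4"
  shows "gperm T t f ` ({..<4} - {f}) = {..<4} - {gperm T t f f}"
  using gluing_props(2)[OF assms] inj_gperm[OF assms] by (simp add: image_set_diff permutes_image)

lemma face_step_face:
  assumes "t < tets T" "f < 4"
  shows "((t, {..<4} - {f}), z) \<in> face_steps T \<longleftrightarrow> z = (nbr T t f, {..<4} - {gperm T t f f})"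
proof
  assume "((t, {..<4} - {f}), z) \<in> face_steps T"
  then obtain f' where f': "f' < 4" "f' \<notin> {..<4} - {f}"
    "z = (nbr T t f', gperm T t f' ` ({..<4} - {f}))" unfolding face_steps_def by blast
  then have "f' = f" by simp
  then show "z = (nbr T t f, {..<4} - {gperm T t f f})" using f'(3) gperm_image_face[OF assms] by simp
next
  assume z: "z = (nbr T t f, {..<4} - {gperm T t f f})"
  have "((t, {..<4} - {f}), (nbr T t f, gperm T t f ` ({..<4} - {f}))) \<in> face_steps T"
    using assms unfolding face_steps_def by blast
  then show "((t, {..<4} - {f}), z) \<in> face_steps T" unfolding gperm_image_face[OF assms] z .
qed

text \<open>
  A face of a tetrahedron takes part in exactly one gluing, so its class has two elements.
\<close>

lemma cell_face:
  assumes "t < tets T" "f < 4"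
  shows "cell T t ({..<4} - {f}) =
    {(t, {..<4} - {f}), (nbr T t f, {..<4} - {gperm T t f f})}"
proof -
  let ?x = "(t, {..<4} - {f})" and ?y = "(nbr T t f, {..<4} - {gperm T t f f})"
  note g = gluing_props[OF assms]
  have u: "nbr T t f < tets T" "gperm T t f f < 4" using g gperm_less[OF assms assms(2)] by auto
  have x: "(?x, z) \<in> face_steps T \<longleftrightarrow> z = ?y" for z by (rule face_step_face[OF assms])
  have "inv_into UNIV (gperm T t f) (gperm T t f f) = f" using inj_gperm[OF assms] by simp
  then have y: "(?y, z) \<in> face_steps T \<longleftrightarrow> z = ?x" for z
    using face_step_face[OF u, of z] unfolding g(4,5) by simp
  have "z = ?x \<or> z = ?y" if "(?x, z) \<in> (face_steps T)\<^sup>*" for z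
    using that by (induction rule: rtrancl_induct) (use x y in auto)
  moreover have "(?x, ?y) \<in> (face_steps T)\<^sup>*" using x by blast
  ultimately show ?thesis unfolding cell_def' by blast
qed

lemma bij_leading_faces:
  "bij_betw (\<lambda>(t, f). cell T t ({..<4} - {f})) {(t, f). t < tets T \<and> f < 4 \<and> leading_face t f} (cells T 2)"
proof (rule bij_betw_imageI)
  let ?S = "{(t, f). t < tets T \<and> f < 4 \<and> leading_face t f}"
  have diff: "f = f'" if "f < 4" "{..<4} - {f} = {..<4} - {f'}" for f f' :: nat
    using that by (metis Diff_iff lessThan_iff singletonI singletonD)
  show "inj_on (\<lambda>(t, f). cell T t ({..<4} - {f})) ?S"
  proof (rule inj_onI, clarify)
    fix t f t' f'
    assume 1: "t < tets T" "f < 4" "leading_face t f" and 2: "t' < tets T" "f' < 4" "leading_face t' f'"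
      and "cell T t ({..<4} - {f}) = cell T t' ({..<4} - {f'})"
    then have "(t', {..<4} - {f'}) \<in> cell T t ({..<4} - {f})" by (simp add: mem_cell_iff)
    then have "t' = t \<and> f' = f \<or> t' = nbr T t f \<and> f' = gperm T t f f"
      unfolding cell_face[OF 1(1,2)] using diff 2(2) by blast
    then show "t = t' \<and> f = f'"
    proof
      assume 3: "t' = nbr T t f \<and> f' = gperm T t f f"
      have "inv_into UNIV (gperm T t f) (gperm T t f f) = f" using inj_gperm[OF 1(1,2)] by simp
      then have "4 * t' + f' < 4 * t + f"
        using 2(3) 3 gluing_props(4,5)[OF 1(1,2)] unfolding leading_face_def by simp
      then show ?thesis using 1(3) 3 unfolding leading_face_def by simp
    qed simp
  qed
  show "(\<lambda>(t, f). cell T t ({..<4} - {f})) ` ?S = cells T 2"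
  proof (intro subset_antisym subsetI)
    fix c assume "c \<in> (\<lambda>(t, f). cell T t ({..<4} - {f})) ` ?S"
    then obtain t f where "c = cell T t ({..<4} - {f})" "t < tets T" "f < 4" by auto
    then show "c \<in> cells T 2" by (subst \<open>c = _\<close>, subst cell_in_cells_iff) auto
  next
    fix c assume "c \<in> cells T 2"
    then obtain t A where "c = cell T t A" "t < tets T" "A \<subseteq> {..<4}" "card A = 3"
      by (auto simp: cells_def)
    then obtain f where c: "c = cell T t ({..<4} - {f})" "t < tets T" "f < 4"
      using subset_4_card_3 by metis
    let ?u = "nbr T t f" and ?g = "gperm T t f f"
    note g = gluing_props[OF c(2,3)]
    show "c \<in> (\<lambda>(t, f). cell T t ({..<4} - {f})) ` ?S"
    proof (cases "leading_face t f")
      case True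
      then have "(t, f) \<in> ?S" using c by simp
      then show ?thesis using c(1) by (intro image_eqI[of _ _ "(t, f)"]) simp_all
    next
      case False
      have u: "?u < tets T" "?g < 4" using g gperm_less[OF c(2,3,3)] by auto
      have "4 * ?u + ?g \<noteq> 4 * t + f"
      proof
        assume "4 * ?u + ?g = 4 * t + f"
        then have "?u = t \<and> ?g = f" using u(2) c(3) by presburger
        then show False using g(3) by simp
      qed
      moreover have "inv_into UNIV (gperm T t f) ?g = f" using inj_gperm[OF c(2,3)] by simp
      ultimately have "leading_face ?u ?g"
        using False unfolding leading_face_def g(4,5) by simp
      moreover have "cell T ?u ({..<4} - {?g}) = c"
        using cell_step[OF c(2,3), of "{..<4} - {f}"] unfolding gperm_image_face[OF c(2,3)] c(1) by auto
      ultimately show ?thesis using u by (intro image_eqI[of _ _ "(?u, ?g)"]) auto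
    qed
  qed
qed

end

section \<open>Weights of colourings\<close>

text \<open>
  The value \<open>[2] = \<zeta> + 1 / \<zeta>\<close>, the only irrational number among the quantum integers that occur.  Its
  sign is the only dependence of the weights on \<open>q\<close>.
\<close>

definition bracket2 :: "nat \<Rightarrow> real" where
  "bracket2 q = (if q = 1 then sqrt 2 else - sqrt 2)"

lemma bracket2_square: "bracket2 q * bracket2 q = 2"
  by (simp add: bracket2_def)

lemma bracket2_nonzero: "bracket2 q \<noteq> 0"
  by (simp add: bracket2_def)

text \<open>
  For both values of \<open>q\<close> the real and the imaginary part have square \<open>1/2\<close>; they differ in the sign of the
  real part only.
\<close>

lemma zeta_rectangular:
  assumes "q \<in> {1, 3}"
  obtains b where "zeta q = Complex (bracket2 q / 2) b" "b * b = 1 / 2"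
proof -
  have z: "zeta q = Complex (cos (pi * q / 4)) (sin (pi * q / 4))"
    unfolding zeta_def by (simp add: exp_eq_polar complex_eq_iff cis.sel Re_exp Im_exp)
  have c: "cos (pi * 3 / 4) = - (sqrt 2 / 2)" "sin (pi * 3 / 4) = sqrt 2 / 2"
  proof -
    have "pi * 3 / 4 = pi - pi / 4" by simp
    then show "cos (pi * 3 / 4) = - (sqrt 2 / 2)" "sin (pi * 3 / 4) = sqrt 2 / 2"
      using cos_45 sin_45 by (simp_all only: cos_pi_minus sin_pi_minus)
  qed
  have "zeta q = Complex (bracket2 q / 2) (sqrt 2 / 2)"
    using assms c by (auto simp: z bracket2_def cos_45 sin_45 mult.commute)
  then show ?thesis by (rule that) simp
qed

text \<open>
  \<open>[3] = [2]\<^sup>2 - 1 = 1\<close> is the special feature of \<open>r = 4\<close>: up to signs, all weights become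
  powers of \<open>[2]\<close>.
\<close>

lemma bracket_values:
  assumes "q \<in> {1, 3}"
  shows "bracket q 0 = 1" "bracket q (Suc 0) = 1" "bracket q 2 = of_real (bracket2 q)" "bracket q 3 = 1"
    "vertex_weight q = 1 / 4"
proof -
  obtain b where z: "zeta q = Complex (bracket2 q / 2) b" and b: "b * b = 1 / 2"
    using zeta_rectangular[OF assms] .
  let ?a = "bracket2 q / 2"
  have a: "?a * ?a = 1 / 2" using bracket2_square[of q] by simp
  have bne: "b \<noteq> 0" using b by auto
  have "Complex ?a b * Complex ?a (- b) = 1"
    using a b by (simp add: complex_eq_iff)
  then have inv: "inverse (zeta q) = Complex ?a (- b)"
    unfolding z by (rule inverse_unique)
  have zi: "zeta q * inverse (zeta q) = 1"
    using \<open>Complex ?a b * Complex ?a (- b) = 1\<close> by (simp only: z inv[unfolded z])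
  have diff: "zeta q - inverse (zeta q) = Complex 0 (2 * b)" and sum: "zeta q + inverse (zeta q) = of_real (bracket2 q)"
    unfolding inv unfolding z by (simp_all add: complex_eq_iff)
  have dne: "zeta q - inverse (zeta q) \<noteq> 0" unfolding diff using bne by (simp add: complex_eq_iff)
  show "bracket q 0 = 1" "bracket q (Suc 0) = 1" using dne by (simp_all add: bracket_def)
  let ?z = "zeta q" and ?w = "inverse (zeta q)"
  have "?z ^ 2 - ?w ^ 2 = (?z + ?w) * (?z - ?w)" by (simp add: power2_eq_square algebra_simps)
  then show "bracket q 2 = of_real (bracket2 q)" using dne by (simp add: bracket_def sum)
  have "?z ^ 3 - ?w ^ 3 = ((?z + ?w) * (?z + ?w) - ?z * ?w) * (?z - ?w)"
    by (simp add: power3_eq_cube algebra_simps)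
  also have "\<dots> = ?z - ?w"
    unfolding sum zi using bracket2_square[of q] by (simp flip: of_real_mult)
  finally show "bracket q 3 = 1" using dne by (simp add: bracket_def)
  have "(cmod (Complex 0 (2 * b)))\<^sup>2 = 2" unfolding cmod_power2 using b by (simp add: power2_eq_square)
  then show "vertex_weight q = 1 / 4" unfolding vertex_weight_def diff by simp
qed

lemma bracket_fact_values:
  assumes "q \<in> {1, 3}"
  shows "bracket_fact q 0 = 1" "bracket_fact q 1 = 1" "bracket_fact q 2 = of_real (bracket2 q)"
    "bracket_fact q 3 = of_real (bracket2 q)"
  using bracket_values(1-4)[OF assms]
  by (simp_all add: bracket_fact_def numeral_2_eq_2 numeral_3_eq_3)

lemma sign_pow_values: "sign_pow 0 = 1" "sign_pow 1 = - 1" "sign_pow 2 = 1"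
  by (simp_all add: sign_pow_def)

text \<open>
  A colour as a pair of bits: \<open>a\<close> tells whether it is half-integral, and \<open>x\<close> distinguishes \<open>0\<close> from \<open>1\<close>.
\<close>

definition colour :: "bit \<Rightarrow> bit \<Rightarrow> real" where
  "colour a x = (if a = 1 then 1 / 2 else if x = 1 then 1 else 0)"

lemma colours_4: "colours 4 = {0, 1 / 2, 1}"
proof -
  have "{k. k + 2 \<le> 4} = {0, 1, 2 :: nat}" by auto
  moreover have "colours 4 = (\<lambda>k. real k / 2) ` {k. k + 2 \<le> 4}" by (auto simp: colours_def)
  ultimately show ?thesis by simp
qed

lemma edge_weight_colour:
  assumes "q \<in> {1, 3}"
  shows "edge_weight q (colour a x) = of_real (if a = 1 then - bracket2 q else 1)"
  using bracket_values[OF assms] sign_pow_values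
  by (auto simp: edge_weight_def colour_def numeral_3_eq_3 numeral_2_eq_2)

lemma half_not_Ints: "1 / 2 \<notin> (\<int> :: real set)" "3 / 2 \<notin> (\<int> :: real set)" "5 / 2 \<notin> (\<int> :: real set)"
proof -
  have *: "real_of_int k = x / 2 \<Longrightarrow> x = real_of_int (2 * k)" for x k by simp
  { fix m k :: int assume "odd m" "real_of_int k = real_of_int m / 2"
    then have "m = 2 * k" by linarith
    then have False using \<open>odd m\<close> by simp }
  note this[of 1] this[of 3] this[of 5]
  then show "1 / 2 \<notin> (\<int> :: real set)" "3 / 2 \<notin> (\<int> :: real set)" "5 / 2 \<notin> (\<int> :: real set)"
    by (auto elim!: Ints_cases)
qed

definition admissible3 :: "real \<Rightarrow> real \<Rightarrow> real \<Rightarrow> bool" where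
  "admissible3 i j k \<longleftrightarrow> i + j + k \<in> \<int> \<and> i \<le> j + k \<and> j \<le> i + k \<and> k \<le> i + j \<and> i + j + k \<le> 2"

text \<open>
  The triangle inequalities and the bound \<open>r - 2 = 2\<close> exclude exactly the integral triples with an odd
  number of ones; with two half-integral edges the third one may be \<open>0\<close> or \<open>1\<close>.
\<close>

lemma admissible3_colour:
  assumes "a = 1 \<Longrightarrow> x = 0" "b = 1 \<Longrightarrow> y = 0" "c = 1 \<Longrightarrow> z = 0"
  shows "admissible3 (colour a x) (colour b y) (colour c z) \<longleftrightarrow>
    a + b + c = 0 \<and> (a = 0 \<and> b = 0 \<and> c = 0 \<longrightarrow> x + y + z = 0)"
  using assms half_not_Ints
  by (cases a; cases b; cases c; cases x; cases y; cases z)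
    (simp_all add: admissible3_def colour_def)

lemma colour_triple_weight_colour:
  assumes q: "q \<in> {1, 3}" and "a = 1 \<Longrightarrow> x = 0" "b = 1 \<Longrightarrow> y = 0" "c = 1 \<Longrightarrow> z = 0"
    and "a + b + c = 0" "a = 0 \<and> b = 0 \<and> c = 0 \<longrightarrow> x + y + z = 0"
  shows "colour_triple_weight q (colour a x) (colour b y) (colour c z) =
    of_real (sg (x + y + z) * (if a = 0 \<and> b = 0 \<and> c = 0 then 1 else - 1 / bracket2 q))"
  using assms(2-) bracket_fact_values[OF q] sign_pow_values bracket2_nonzero[of q]
  by (cases a; cases b; cases c; cases x; cases y; cases z)
    (simp_all add: colour_triple_weight_def colour_def)

text \<open>
  When the largest lower bound for the summation index coincides with the smallest upper bound, a
  single term remains.  This is so for every admissible colouring with colours at most \<open>1\<close>.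
\<close>

lemma colour_sextuple_weight_single:
  fixes m :: nat and i0 i1 i2 i3 i4 i5 :: real
  assumes "\<forall>x\<in>{i0 + i1 + i3, i0 + i2 + i4, i1 + i2 + i5, i3 + i4 + i5}. x \<le> m"
    "\<forall>y\<in>{i0 + i1 + i4 + i5, i0 + i2 + i3 + i5, i1 + i2 + i3 + i4}. m \<le> y"
    "\<exists>x\<in>{i0 + i1 + i3, i0 + i2 + i4, i1 + i2 + i5, i3 + i4 + i5}. x = m"
    "\<exists>y\<in>{i0 + i1 + i4 + i5, i0 + i2 + i3 + i5, i1 + i2 + i3 + i4}. m = y"
  shows "colour_sextuple_weight q i0 i1 i2 i3 i4 i5 =
    sign_pow m * bracket_fact q (m + 1) /
     ((bracket_fact q (m - (i0 + i1 + i3)) * bracket_fact q (m - (i0 + i2 + i4)) *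
       bracket_fact q (m - (i1 + i2 + i5)) * bracket_fact q (m - (i3 + i4 + i5))) *
      (bracket_fact q (i0 + i1 + i4 + i5 - m) * bracket_fact q (i0 + i2 + i3 + i5 - m) *
       bracket_fact q (i1 + i2 + i3 + i4 - m)))"
proof -
  let ?S = "{s :: int. (\<forall>x\<in>set [i0 + i1 + i3, i0 + i2 + i4, i1 + i2 + i5, i3 + i4 + i5]. x \<le> of_int s)
    \<and> (\<forall>y\<in>set [i0 + i1 + i4 + i5, i0 + i2 + i3 + i5, i1 + i2 + i3 + i4]. of_int s \<le> y)}"
  have "?S = {int m}"
  proof (rule Set.set_eqI)
    fix s
    show "s \<in> ?S \<longleftrightarrow> s \<in> {int m}"
    proof
      assume "s \<in> ?S"
      then have "real m \<le> of_int s" "of_int s \<le> real m" using assms(3,4) by auto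
      then show "s \<in> {int m}" by simp
    next
      assume "s \<in> {int m}"
      then show "s \<in> ?S" using assms(1,2) by simp
    qed
  qed
  then show ?thesis unfolding colour_sextuple_weight_def Let_def by (simp add: mult.assoc add.commute)
qed

text \<open>
  The sum of the first two elementary symmetric polynomials.  It is the quadratic polynomial in the
  integral colours of a tetrahedron whose parity is the sign of its weight.
\<close>

definition sext_sign :: "bit \<Rightarrow> bit \<Rightarrow> bit \<Rightarrow> bit \<Rightarrow> bit \<Rightarrow> bit \<Rightarrow> bit" where
  "sext_sign x0 x1 x2 x3 x4 x5 = x0 + x1 + x2 + x3 + x4 + x5
     + x0 * (x1 + x2 + x3 + x4 + x5) + x1 * (x2 + x3 + x4 + x5) + x2 * (x3 + x4 + x5)
     + x3 * (x4 + x5) + x4 * x5"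

lemma bit_sum3_zero_iff: "(a::bit) + b + c = 0 \<longleftrightarrow> c = a + b"
  by (cases a; cases b; cases c) auto

text \<open>
  The half-integral edges of a tetrahedron form one of eight cocycles: none, the three edges at a
  vertex (four ways), or a quadrilateral (three ways).  In each case the integral colours have at most
  three degrees of freedom, and the finitely many values are compared.
\<close>

lemma colour_sextuple_weight_colour:
  assumes q: "q \<in> {1, 3}"
    and x: "a0 = 1 \<Longrightarrow> x0 = 0" "a1 = 1 \<Longrightarrow> x1 = 0" "a2 = 1 \<Longrightarrow> x2 = 0"
      "a3 = 1 \<Longrightarrow> x3 = 0" "a4 = 1 \<Longrightarrow> x4 = 0" "a5 = 1 \<Longrightarrow> x5 = 0"
    and a: "a0 + a1 + a3 = 0" "a0 + a2 + a4 = 0" "a1 + a2 + a5 = 0" "a3 + a4 + a5 = 0"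
    and xx: "a0 = 0 \<and> a1 = 0 \<and> a3 = 0 \<longrightarrow> x0 + x1 + x3 = 0" "a0 = 0 \<and> a2 = 0 \<and> a4 = 0 \<longrightarrow> x0 + x2 + x4 = 0"
      "a1 = 0 \<and> a2 = 0 \<and> a5 = 0 \<longrightarrow> x1 + x2 + x5 = 0" "a3 = 0 \<and> a4 = 0 \<and> a5 = 0 \<longrightarrow> x3 + x4 + x5 = 0"
  shows "colour_sextuple_weight q (colour a0 x0) (colour a1 x1) (colour a2 x2)
      (colour a3 x3) (colour a4 x4) (colour a5 x5) =
    of_real (sg (sext_sign x0 x1 x2 x3 x4 x5) *
      (if a0 = 0 \<and> a1 = 0 \<and> a2 = 0 \<and> a3 = 0 \<and> a4 = 0 \<and> a5 = 0 then 1 else - bracket2 q))"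
proof -
  (* the only summation index that contributes *)
  define m :: nat where "m = (if x0 = 0 \<and> x1 = 0 \<and> x2 = 0 \<and> x3 = 0 \<and> x4 = 0 \<and> x5 = 0
    then (if a0 = 0 \<and> a1 = 0 \<and> a2 = 0 \<and> a3 = 0 \<and> a4 = 0 \<and> a5 = 0 then 0 else 1) else 2)"
  note facts = x xx bracket_fact_values[OF q] sign_pow_values bracket2_nonzero[of q] bracket2_square[of q]
  note rule = trans[OF colour_sextuple_weight_single[of _ _ _ _ _ _ m]]
  note defs = m_def colour_def sext_sign_def
  have a': "a3 = a0 + a1" "a4 = a0 + a2" "a5 = a1 + a2"
    using a by (simp_all add: bit_sum3_zero_iff)
  consider "a0 = 0" "a1 = 0" "a2 = 0" "a3 = 0" "a4 = 0" "a5 = 0"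
    | "a0 = 1" "a1 = 1" "a2 = 1" "a3 = 0" "a4 = 0" "a5 = 0"
    | "a0 = 1" "a1 = 0" "a2 = 0" "a3 = 1" "a4 = 1" "a5 = 0"
    | "a0 = 0" "a1 = 1" "a2 = 0" "a3 = 1" "a4 = 0" "a5 = 1"
    | "a0 = 0" "a1 = 0" "a2 = 1" "a3 = 0" "a4 = 1" "a5 = 1"
    | "a0 = 1" "a1 = 1" "a2 = 0" "a3 = 0" "a4 = 1" "a5 = 1"
    | "a0 = 1" "a1 = 0" "a2 = 1" "a3 = 1" "a4 = 0" "a5 = 1"
    | "a0 = 0" "a1 = 1" "a2 = 1" "a3 = 1" "a4 = 1" "a5 = 0"
    unfolding a' by (cases a0; cases a1; cases a2) simp_all
  then show ?thesis
  proof cases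
    case 1
    then have "x3 = x0 + x1" "x4 = x0 + x2" "x5 = x1 + x2" using xx by (simp_all add: bit_sum3_zero_iff)
    then show ?thesis using facts(11-) unfolding 1
      by (intro rule; cases x0; cases x1; cases x2; simp add: defs 1)
  next
    case 2
    then have "x0 = 0" "x1 = 0" "x2 = 0" "x5 = x3 + x4" using x xx by (simp_all add: bit_sum3_zero_iff)
    then show ?thesis using facts(11-) unfolding 2
      by (intro rule; cases x3; cases x4; simp add: defs 2)
  next
    case 3
    then have "x0 = 0" "x3 = 0" "x4 = 0" "x5 = x1 + x2" using x xx by (simp_all add: bit_sum3_zero_iff)
    then show ?thesis using facts(11-) unfolding 3
      by (intro rule; cases x1; cases x2; simp add: defs 3)
  next
    case 4
    then have "x1 = 0" "x3 = 0" "x5 = 0" "x4 = x0 + x2" using x xx by (simp_all add: bit_sum3_zero_iff)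
    then show ?thesis using facts(11-) unfolding 4
      by (intro rule; cases x0; cases x2; simp add: defs 4)
  next
    case 5
    then have "x2 = 0" "x4 = 0" "x5 = 0" "x3 = x0 + x1" using x xx by (simp_all add: bit_sum3_zero_iff)
    then show ?thesis using facts(11-) unfolding 5
      by (intro rule; cases x0; cases x1; simp add: defs 5)
  next
    case 6
    then have "x0 = 0" "x1 = 0" "x4 = 0" "x5 = 0" using x by simp_all
    then show ?thesis using facts(11-) unfolding 6
      by (intro rule; cases x2; cases x3; simp add: defs 6)
  next
    case 7
    then have "x0 = 0" "x2 = 0" "x3 = 0" "x5 = 0" using x by simp_all
    then show ?thesis using facts(11-) unfolding 7
      by (intro rule; cases x1; cases x4; simp add: defs 7)
  next
    case 8
    then have "x1 = 0" "x2 = 0" "x3 = 0" "x4 = 0" using x by simp_all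
    then show ?thesis using facts(11-) unfolding 8
      by (intro rule; cases x0; cases x5; simp add: defs 8)
  qed
qed

section \<open>Colourings as pairs of functions with values in the field of two elements\<close>

definition face_vertices :: "nat \<Rightarrow> nat \<times> nat \<times> nat" where
  "face_vertices f = (if f = 0 then (1, 2, 3) else if f = 1 then (0, 2, 3)
     else if f = 2 then (0, 1, 3) else (0, 1, 2))"

definition face_edges :: "nat \<Rightarrow> (nat \<times> nat) list" where
  "face_edges f = (case face_vertices f of (a, b, c) \<Rightarrow> [(a, b), (a, c), (b, c)])"

text \<open>
  The order of the six colours in the weight of a tetrahedron.
\<close>

definition tet_edges :: "(nat \<times> nat) list" where
  "tet_edges = [(0, 1), (0, 2), (0, 3), (1, 2), (1, 3), (2, 3)]"

text \<open>
  An edge of a tetrahedron is addressed by an ordered pair of vertices.  Including the diagonal pairs,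
  which address nothing, makes this number computable by additions and multiplications alone.
\<close>

definition slot :: "nat \<Rightarrow> nat \<Rightarrow> nat \<Rightarrow> nat" where
  "slot t a b = 16 * t + 4 * a + b"

lemma face_cases:
  assumes "f < (4::nat)" obtains "f = 0" | "f = 1" | "f = 2" | "f = 3"
  using assms by linarith

lemma face_vertices:
  assumes "f < 4" "face_vertices f = (a, b, c)"
  shows "{..<4} - {f} = {a, b, c}" "distinct [a, b, c]" "a < 4" "b < 4" "c < 4"
  using assms by (auto elim!: face_cases simp: face_vertices_def)

context glued
begin

text \<open>
  The choices of \<open>0\<close> or \<open>1\<close> on the edges with integral colour, once the half-integral edges are given
  by \<open>\<alpha>\<close>.
\<close>

definition refinements :: "(tri_cell \<Rightarrow> bit) \<Rightarrow> (tri_cell \<Rightarrow> bit) set" where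
  "refinements \<alpha> = {x \<in> bitfun (cells T 1). (\<forall>e. \<alpha> e = 1 \<longrightarrow> x e = 0) \<and>
     (\<forall>t<tets T. \<forall>A. A \<subseteq> {..<4} \<longrightarrow> card A = 3 \<longrightarrow>
        (\<forall>a\<in>A. \<alpha> (cell T t (A - {a})) = 0) \<longrightarrow> (\<Sum>a\<in>A. x (cell T t (A - {a}))) = 0)}"

definition colouring :: "(tri_cell \<Rightarrow> bit) \<Rightarrow> (tri_cell \<Rightarrow> bit) \<Rightarrow> tri_cell \<Rightarrow> real" where
  "colouring \<alpha> x = restrict (\<lambda>e. colour (\<alpha> e) (x e)) (cells T 1)"

lemma edge_in_cells:
  "t < tets T \<Longrightarrow> a < 4 \<Longrightarrow> b < 4 \<Longrightarrow> a \<noteq> b \<Longrightarrow> cell T t {a, b} \<in> cells T 1"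
  by (subst cell_in_cells_iff) auto

lemma sum_facets_triple:
  assumes "distinct [a, b, c]"
  shows "(\<Sum>z\<in>{a, b, c}. g (cell T t ({a, b, c} - {z}))) =
    g (cell T t {a, b}) + g (cell T t {a, c}) + (g (cell T t {b, c}) :: 'b :: comm_monoid_add)"
proof -
  have "{a, b, c} - {a} = {b, c}" "{a, b, c} - {b} = {a, c}" "{a, b, c} - {c} = {a, b}"
    using assms by auto
  then show ?thesis using assms by (simp add: ac_simps)
qed

lemma ball_facets_triple:
  assumes "distinct [a, b, c]"
  shows "(\<forall>z\<in>{a, b, c}. P (cell T t ({a, b, c} - {z}))) \<longleftrightarrow>
    P (cell T t {a, b}) \<and> P (cell T t {a, c}) \<and> P (cell T t {b, c})"
proof -
  have "{a, b, c} - {a} = {b, c}" "{a, b, c} - {b} = {a, c}" "{a, b, c} - {c} = {a, b}"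
    using assms by auto
  then show ?thesis by auto
qed

lemma all_triples:
  "(\<forall>A. A \<subseteq> {..<4::nat} \<longrightarrow> card A = 3 \<longrightarrow> P A) \<longleftrightarrow>
   (\<forall>a<4. \<forall>b<4. \<forall>c<4. distinct [a, b, c] \<longrightarrow> P {a, b, c})"
proof
  assume L: "\<forall>A. A \<subseteq> {..<4::nat} \<longrightarrow> card A = 3 \<longrightarrow> P A"
  show "\<forall>a<4. \<forall>b<4. \<forall>c<4. distinct [a, b, c] \<longrightarrow> P {a, b, c}"
  proof (intro allI impI)
    fix a b c :: nat assume "a < 4" "b < 4" "c < 4" "distinct [a, b, c]"
    then have "{a, b, c} \<subseteq> {..<4}" "card {a, b, c} = 3" by auto
    then show "P {a, b, c}" using L by blast
  qed
next
  assume R: "\<forall>a<4. \<forall>b<4. \<forall>c<4. distinct [a, b, c] \<longrightarrow> P {a, b, c}"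
  show "\<forall>A. A \<subseteq> {..<4::nat} \<longrightarrow> card A = 3 \<longrightarrow> P A"
  proof (intro allI impI)
    fix A :: "nat set" assume A: "A \<subseteq> {..<4}" "card A = 3"
    then obtain a b c where abc: "A = {a, b, c}" "a \<noteq> b" "a \<noteq> c" "b \<noteq> c" by (auto simp: card_3_iff)
    then have "a < 4" "b < 4" "c < 4" "distinct [a, b, c]" using A(1) by auto
    then show "P A" using R abc(1) by blast
  qed
qed

lemma cocycles_iff:
  "\<alpha> \<in> cocycles \<longleftrightarrow> \<alpha> \<in> bitfun (cells T 1) \<and> (\<forall>t<tets T. \<forall>a<4. \<forall>b<4. \<forall>c<4. distinct [a, b, c] \<longrightarrow>
    \<alpha> (cell T t {a, b}) + \<alpha> (cell T t {a, c}) + \<alpha> (cell T t {b, c}) = 0)"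
  unfolding cocycles_def all_triples mem_Collect_eq
  by (simp only: sum_facets_triple cong: imp_cong)

lemma refinements_iff:
  "x \<in> refinements \<alpha> \<longleftrightarrow> x \<in> bitfun (cells T 1) \<and> (\<forall>e. \<alpha> e = 1 \<longrightarrow> x e = 0) \<and>
    (\<forall>t<tets T. \<forall>a<4. \<forall>b<4. \<forall>c<4. distinct [a, b, c] \<longrightarrow>
    \<alpha> (cell T t {a, b}) = 0 \<and> \<alpha> (cell T t {a, c}) = 0 \<and> \<alpha> (cell T t {b, c}) = 0 \<longrightarrow>
    x (cell T t {a, b}) + x (cell T t {a, c}) + x (cell T t {b, c}) = 0)"
  unfolding refinements_def all_triples mem_Collect_eq
  by (simp only: sum_facets_triple ball_facets_triple[where P = "\<lambda>e. \<alpha> e = 0"] cong: imp_cong)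

lemma Adm_4_iff:
  "\<theta> \<in> Adm T 4 \<longleftrightarrow> \<theta> \<in> cells T 1 \<rightarrow>\<^sub>E {0, 1 / 2, 1} \<and>
    (\<forall>t<tets T. \<forall>a<4. \<forall>b<4. \<forall>c<4. distinct [a, b, c] \<longrightarrow>
      admissible3 (\<theta> (cell T t {a, b})) (\<theta> (cell T t {a, c})) (\<theta> (cell T t {b, c})))"
    (is "_ \<longleftrightarrow> _ \<and> ?R")
proof -
  let ?L = "\<forall>t<tets T. \<forall>a<4. \<forall>b<4. \<forall>c<4. distinct [a, b, c] \<longrightarrow>
      (let i = edge_colour T \<theta> t a b; j = edge_colour T \<theta> t a c; k = edge_colour T \<theta> t b c in
         i + j + k \<in> \<int> \<and> i \<le> j + k \<and> i + j + k \<le> real 4 - 2)"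
  have "?L \<longleftrightarrow> ?R"
  proof
    assume L: ?L
    show ?R
    proof (intro allI impI)
      fix t a b c :: nat assume 1: "t < tets T" "a < 4" "b < 4" "c < 4" "distinct [a, b, c]"
      have c: "{b, a} = {a, b}" "{c, a} = {a, c}" "{c, b} = {b, c}" by auto
      show "admissible3 (\<theta> (cell T t {a, b})) (\<theta> (cell T t {a, c})) (\<theta> (cell T t {b, c}))"
        using L[rule_format, of t a b c] L[rule_format, of t a c b] L[rule_format, of t b c a] 1
        by (simp add: Let_def admissible3_def c add_ac)
    qed
  next
    assume R: ?R
    show ?L
    proof (intro allI impI)
      fix t a b c :: nat assume 1: "t < tets T" "a < 4" "b < 4" "c < 4" "distinct [a, b, c]"
      show "let i = edge_colour T \<theta> t a b; j = edge_colour T \<theta> t a c; k = edge_colour T \<theta> t b c in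
         i + j + k \<in> \<int> \<and> i \<le> j + k \<and> i + j + k \<le> real 4 - 2"
        using R[rule_format, OF 1] by (simp add: Let_def admissible3_def)
    qed
  qed
  then show ?thesis unfolding Adm_def mem_Collect_eq colours_4 by blast
qed

lemma colour_cases: "colour a x \<in> {0, 1 / 2, 1}"
  by (simp add: colour_def)

text \<open>
  The inverse map reads off where a colouring is \<open>1/2\<close> and where it is \<open>1\<close>; admissibility translates
  triangle by triangle.
\<close>

lemma bij_colouring:
  "bij_betw (\<lambda>(\<alpha>, x). colouring \<alpha> x) (SIGMA \<alpha>:cocycles. refinements \<alpha>) (Adm T 4)"
proof (rule bij_betw_byWitness[where f' = "\<lambda>\<theta>. (\<lambda>e. if e \<in> cells T 1 \<and> \<theta> e = 1 / 2 then 1 else 0,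
    \<lambda>e. if e \<in> cells T 1 \<and> \<theta> e = 1 then 1 else 0)"])
  let ?C = "cells T 1"
  let ?f = "\<lambda>(\<alpha>, x). colouring \<alpha> x"
  let ?a = "\<lambda>\<theta> e. if e \<in> ?C \<and> \<theta> e = 1 / 2 then 1 else (0::bit)"
  let ?x = "\<lambda>\<theta> e. if e \<in> ?C \<and> \<theta> e = 1 then 1 else (0::bit)"
  have val: "colour (?a \<theta> e) (?x \<theta> e) = \<theta> e" if "\<theta> \<in> ?C \<rightarrow>\<^sub>E {0, 1 / 2, 1}" "e \<in> ?C" for \<theta> e
    using PiE_mem[OF that] that(2) by (auto simp: colour_def)
  show "\<forall>p\<in>SIGMA \<alpha>:cocycles. refinements \<alpha>. (?a (?f p), ?x (?f p)) = p"
  proof (clarify, intro conjI ext)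
    fix \<alpha> x e assume 1: "\<alpha> \<in> cocycles" "x \<in> refinements \<alpha>"
    then have "e \<notin> ?C \<Longrightarrow> \<alpha> e = 0 \<and> x e = 0" "\<alpha> e = 1 \<Longrightarrow> x e = 0"
      by (simp_all add: cocycles_def refinements_def bitfun_def)
    then show "?a (colouring \<alpha> x) e = \<alpha> e" "?x (colouring \<alpha> x) e = x e"
      by (cases "e \<in> ?C"; cases "\<alpha> e"; cases "x e"; simp add: colouring_def colour_def)+
  qed
  show "\<forall>\<theta>\<in>Adm T 4. ?f (?a \<theta>, ?x \<theta>) = \<theta>"
  proof
    fix \<theta> assume "\<theta> \<in> Adm T 4"
    then have 1: "\<theta> \<in> ?C \<rightarrow>\<^sub>E {0, 1 / 2, 1}" by (simp only: Adm_4_iff)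
    show "?f (?a \<theta>, ?x \<theta>) = \<theta>"
    proof
      fix e show "?f (?a \<theta>, ?x \<theta>) e = \<theta> e"
      proof (cases "e \<in> ?C")
        case True
        then show ?thesis using val[OF 1 True] by (simp only: colouring_def split restrict_def if_True)
      next
        case False
        then show ?thesis using PiE_arb[OF 1 False] by (simp only: colouring_def split restrict_def if_False)
      qed
    qed
  qed
  have adm: "admissible3 (colour (\<alpha> (cell T t {a, b})) (x (cell T t {a, b}))) (colour (\<alpha> (cell T t {a, c})) (x (cell T t {a, c})))
      (colour (\<alpha> (cell T t {b, c})) (x (cell T t {b, c}))) \<longleftrightarrow>
      \<alpha> (cell T t {a, b}) + \<alpha> (cell T t {a, c}) + \<alpha> (cell T t {b, c}) = 0 \<and>
      (\<alpha> (cell T t {a, b}) = 0 \<and> \<alpha> (cell T t {a, c}) = 0 \<and> \<alpha> (cell T t {b, c}) = 0 \<longrightarrow>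
    x (cell T t {a, b}) + x (cell T t {a, c}) + x (cell T t {b, c}) = 0)"
    if "\<forall>e. \<alpha> e = 1 \<longrightarrow> x e = 0" for \<alpha> x t a b c
    by (rule admissible3_colour) (use that in auto)
  show "?f ` (SIGMA \<alpha>:cocycles. refinements \<alpha>) \<subseteq> Adm T 4"
  proof clarify
    fix \<alpha> x assume 1: "\<alpha> \<in> cocycles" "x \<in> refinements \<alpha>"
    have "colouring \<alpha> x \<in> ?C \<rightarrow>\<^sub>E {0, 1 / 2, 1}" 
      unfolding colouring_def restrict_PiE_iff using colour_cases by blast
    moreover have "admissible3 (colouring \<alpha> x (cell T t {a, b})) (colouring \<alpha> x (cell T t {a, c}))
       (colouring \<alpha> x (cell T t {b, c}))"
      if "t < tets T" "a < 4" "b < 4" "c < 4" "distinct [a, b, c]" for t a b c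
    proof -
      have "cell T t {a, b} \<in> ?C" "cell T t {a, c} \<in> ?C" "cell T t {b, c} \<in> ?C"
        using that edge_in_cells by auto
      then show ?thesis
        using adm[of \<alpha> x t a b c] 1 that unfolding cocycles_iff refinements_iff
        by (simp add: colouring_def)
    qed
    ultimately show "colouring \<alpha> x \<in> Adm T 4" unfolding Adm_4_iff by blast
  qed
  show "(\<lambda>\<theta>. (?a \<theta>, ?x \<theta>)) ` Adm T 4 \<subseteq> (SIGMA \<alpha>:cocycles. refinements \<alpha>)"
  proof clarify
    fix \<theta> assume "\<theta> \<in> Adm T 4"
    then have 1: "\<theta> \<in> ?C \<rightarrow>\<^sub>E {0, 1 / 2, 1}"
      and 2: "\<And>t a b c. t < tets T \<Longrightarrow> a < 4 \<Longrightarrow> b < 4 \<Longrightarrow> c < 4 \<Longrightarrow> distinct [a, b, c] \<Longrightarrow>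
      admissible3 (\<theta> (cell T t {a, b})) (\<theta> (cell T t {a, c})) (\<theta> (cell T t {b, c}))"
      by (simp_all only: Adm_4_iff)
    have disj: "\<forall>e. ?a \<theta> e = 1 \<longrightarrow> ?x \<theta> e = 0" by simp
    have 3: "?a \<theta> (cell T t {a, b}) + ?a \<theta> (cell T t {a, c}) + ?a \<theta> (cell T t {b, c}) = 0 \<and>
      (?a \<theta> (cell T t {a, b}) = 0 \<and> ?a \<theta> (cell T t {a, c}) = 0 \<and> ?a \<theta> (cell T t {b, c}) = 0 \<longrightarrow>
    ?x \<theta> (cell T t {a, b}) + ?x \<theta> (cell T t {a, c}) + ?x \<theta> (cell T t {b, c}) = 0)"
      if t: "t < tets T" "a < 4" "b < 4" "c < 4" "distinct [a, b, c]" for t a b c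
    proof -
      have c: "cell T t {a, b} \<in> ?C" "cell T t {a, c} \<in> ?C" "cell T t {b, c} \<in> ?C"
        using t edge_in_cells by auto
      show ?thesis using 2[OF t]
        unfolding adm[OF disj, symmetric] val[OF 1 c(1)] val[OF 1 c(2)] val[OF 1 c(3)] .
    qed
    have "?a \<theta> \<in> bitfun ?C" "?x \<theta> \<in> bitfun ?C" by (simp_all add: bitfun_def)
    then have "?a \<theta> \<in> cocycles" "?x \<theta> \<in> refinements (?a \<theta>)"
      unfolding cocycles_iff refinements_iff using 3 disj by blast+
    then show "?a \<theta> \<in> cocycles \<and> ?x \<theta> \<in> refinements (?a \<theta>)" ..
  qed
qed

lemma finite_cocycles: "finite cocycles"
  by (rule finite_subset[OF _ finite_bitfun[OF finite_cells]]) (auto simp: cocycles_def)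

lemma finite_refinements: "finite (refinements \<alpha>)"
  by (rule finite_subset[OF _ finite_bitfun[OF finite_cells]]) (auto simp: refinements_def)

text \<open>
  The condition that all three edges are integral is a vanishing sum of natural numbers: in this form
  its independence of the representative is another instance of \<open>sum_facets_invariant\<close>.
\<close>

definition tri_value :: "real \<Rightarrow> (tri_cell \<Rightarrow> bit) \<Rightarrow> (tri_cell \<Rightarrow> bit) \<Rightarrow> nat \<Rightarrow> nat set \<Rightarrow> real" where
  "tri_value s \<alpha> x t A = sg (\<Sum>a\<in>A. x (cell T t (A - {a}))) *
     (if (\<Sum>a\<in>A. if \<alpha> (cell T t (A - {a})) = 0 then 0 else 1 :: nat) = 0 then 1 else - 1 / s)"

lemma tri_value_triple:
  assumes "distinct [a, b, c]"
  shows "tri_value s \<alpha> x t {a, b, c} =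
    sg (x (cell T t {a, b}) + x (cell T t {a, c}) + x (cell T t {b, c})) *
    (if \<alpha> (cell T t {a, b}) = 0 \<and> \<alpha> (cell T t {a, c}) = 0 \<and> \<alpha> (cell T t {b, c}) = 0 then 1 else - 1 / s)"
  unfolding tri_value_def sum_facets_triple[OF assms, where g = x]
    sum_facets_triple[OF assms, where g = "\<lambda>e. if \<alpha> e = 0 then 0 else 1 :: nat"]
  by (rule arg_cong2[where f = "(*)", OF refl]) simp

definition tet_value :: "real \<Rightarrow> (tri_cell \<Rightarrow> bit) \<Rightarrow> (tri_cell \<Rightarrow> bit) \<Rightarrow> nat \<Rightarrow> real" where
  "tet_value s \<alpha> x t =
     sg (sext_sign (x (cell T t {0, 1})) (x (cell T t {0, 2})) (x (cell T t {0, 3}))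
        (x (cell T t {1, 2})) (x (cell T t {1, 3})) (x (cell T t {2, 3}))) *
     (if \<alpha> (cell T t {0, 1}) = 0 \<and> \<alpha> (cell T t {0, 2}) = 0 \<and> \<alpha> (cell T t {0, 3}) = 0 \<and>
         \<alpha> (cell T t {1, 2}) = 0 \<and> \<alpha> (cell T t {1, 3}) = 0 \<and> \<alpha> (cell T t {2, 3}) = 0 then 1 else - s)"

lemma colouring_triple:
  assumes "\<alpha> \<in> cocycles" "x \<in> refinements \<alpha>" "t < tets T" "a < 4" "b < 4" "c < 4" "distinct [a, b, c]"
  shows "\<alpha> (cell T t {a, b}) + \<alpha> (cell T t {a, c}) + \<alpha> (cell T t {b, c}) = 0"
    "\<alpha> (cell T t {a, b}) = 0 \<and> \<alpha> (cell T t {a, c}) = 0 \<and> \<alpha> (cell T t {b, c}) = 0 \<longrightarrow>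
    x (cell T t {a, b}) + x (cell T t {a, c}) + x (cell T t {b, c}) = 0"
  using assms unfolding cocycles_iff refinements_iff by blast+

lemma colouring_edge:
  "t < tets T \<Longrightarrow> a < 4 \<Longrightarrow> b < 4 \<Longrightarrow> a \<noteq> b \<Longrightarrow>
   colouring \<alpha> x (cell T t {a, b}) = colour (\<alpha> (cell T t {a, b})) (x (cell T t {a, b}))"
  using edge_in_cells by (simp add: colouring_def)

text \<open>
  The weight of a triangle is well defined because its value depends on sums over its edges only, which
  are the same for all representatives.
\<close>

lemma triangle_weight_colouring:
  assumes q: "q \<in> {1, 3}" and ax: "\<alpha> \<in> cocycles" "x \<in> refinements \<alpha>"
    and A: "t < tets T" "A \<subseteq> {..<4}" "card A = 3"
  shows "triangle_weight T q (colouring \<alpha> x) (cell T t A) = of_real (tri_value (bracket2 q) \<alpha> x t A)"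
proof -
  let ?\<theta> = "colouring \<alpha> x"
  have disj: "\<alpha> e = 1 \<Longrightarrow> x e = 0" for e using ax(2) by (simp add: refinements_iff)
  have val: "colour_triple_weight q (edge_colour T ?\<theta> u a b) (edge_colour T ?\<theta> u a c) (edge_colour T ?\<theta> u b c)
      = of_real (tri_value (bracket2 q) \<alpha> x u {a, b, c})"
    if u: "u < tets T" "a < 4" "b < 4" "c < 4" "distinct [a, b, c]" for u a b c
  proof -
    have e: "?\<theta> (cell T u {a, b}) = colour (\<alpha> (cell T u {a, b})) (x (cell T u {a, b}))"
      "?\<theta> (cell T u {a, c}) = colour (\<alpha> (cell T u {a, c})) (x (cell T u {a, c}))"
      "?\<theta> (cell T u {b, c}) = colour (\<alpha> (cell T u {b, c})) (x (cell T u {b, c}))"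
      using u by (simp_all add: colouring_edge)
    show ?thesis
      unfolding e tri_value_triple[OF u(5)]
      by (rule colour_triple_weight_colour[OF q disj disj disj colouring_triple[OF ax u]])
  qed
  obtain a b c where "A = {a, b, c}" "a \<noteq> b" "a \<noteq> c" "b \<noteq> c" using A(3) by (auto simp: card_3_iff)
  then have abc: "A = {a, b, c}" "a < 4" "b < 4" "c < 4" "distinct [a, b, c]" using A(2) by auto
  show ?thesis
    unfolding triangle_weight_def
  proof (rule the_equality)
    show "\<exists>u a b c. u < tets T \<and> a < 4 \<and> b < 4 \<and> c < 4 \<and> distinct [a, b, c] \<and>
       cell T t A = cell T u {a, b, c} \<and>
       complex_of_real (tri_value (bracket2 q) \<alpha> x t A) = colour_triple_weight q
             (edge_colour T ?\<theta> u a b) (edge_colour T ?\<theta> u a c) (edge_colour T ?\<theta> u b c)"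
      using val[OF A(1) abc(2-5)] A(1) abc by metis
    fix w
    assume "\<exists>u a b c. u < tets T \<and> a < 4 \<and> b < 4 \<and> c < 4 \<and> distinct [a, b, c] \<and>
       cell T t A = cell T u {a, b, c} \<and> w = colour_triple_weight q
             (edge_colour T ?\<theta> u a b) (edge_colour T ?\<theta> u a c) (edge_colour T ?\<theta> u b c)"
    then obtain u a b c where u: "u < tets T" "a < 4" "b < 4" "c < 4" "distinct [a, b, c]"
       "cell T t A = cell T u {a, b, c}" "w = colour_triple_weight q
             (edge_colour T ?\<theta> u a b) (edge_colour T ?\<theta> u a c) (edge_colour T ?\<theta> u b c)"
      by blast
    have "tri_value (bracket2 q) \<alpha> x u {a, b, c} = tri_value (bracket2 q) \<alpha> x t A"
      unfolding tri_value_def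
      sum_facets_invariant[OF u(6), where g = x]
      sum_facets_invariant[OF u(6), where g = "\<lambda>e. if \<alpha> e = 0 then 0 else 1 :: nat"] ..
    then show "w = of_real (tri_value (bracket2 q) \<alpha> x t A)"
      unfolding u(7) val[OF u(1-5)] by simp
  qed
qed

lemma tet_weight_colouring:
  assumes q: "q \<in> {1, 3}" and ax: "\<alpha> \<in> cocycles" "x \<in> refinements \<alpha>" and t: "t < tets T"
  shows "tet_weight T q (colouring \<alpha> x) t = of_real (tet_value (bracket2 q) \<alpha> x t)"
proof -
  have disj: "\<alpha> e = 1 \<Longrightarrow> x e = 0" for e using ax(2) by (simp add: refinements_iff)
  note tr = colouring_triple[OF ax t]
  have tri: "\<alpha> (cell T t {0, 1}) + \<alpha> (cell T t {0, 2}) + \<alpha> (cell T t {1, 2}) = 0"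
    "\<alpha> (cell T t {0, 1}) + \<alpha> (cell T t {0, 3}) + \<alpha> (cell T t {1, 3}) = 0"
    "\<alpha> (cell T t {0, 2}) + \<alpha> (cell T t {0, 3}) + \<alpha> (cell T t {2, 3}) = 0"
    "\<alpha> (cell T t {1, 2}) + \<alpha> (cell T t {1, 3}) + \<alpha> (cell T t {2, 3}) = 0"
    "\<alpha> (cell T t {0, 1}) = 0 \<and> \<alpha> (cell T t {0, 2}) = 0 \<and> \<alpha> (cell T t {1, 2}) = 0 \<longrightarrow>
      x (cell T t {0, 1}) + x (cell T t {0, 2}) + x (cell T t {1, 2}) = 0"
    "\<alpha> (cell T t {0, 1}) = 0 \<and> \<alpha> (cell T t {0, 3}) = 0 \<and> \<alpha> (cell T t {1, 3}) = 0 \<longrightarrow>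
      x (cell T t {0, 1}) + x (cell T t {0, 3}) + x (cell T t {1, 3}) = 0"
    "\<alpha> (cell T t {0, 2}) = 0 \<and> \<alpha> (cell T t {0, 3}) = 0 \<and> \<alpha> (cell T t {2, 3}) = 0 \<longrightarrow>
      x (cell T t {0, 2}) + x (cell T t {0, 3}) + x (cell T t {2, 3}) = 0"
    "\<alpha> (cell T t {1, 2}) = 0 \<and> \<alpha> (cell T t {1, 3}) = 0 \<and> \<alpha> (cell T t {2, 3}) = 0 \<longrightarrow>
      x (cell T t {1, 2}) + x (cell T t {1, 3}) + x (cell T t {2, 3}) = 0"
    by (rule tr; simp)+
  have e: "colouring \<alpha> x (cell T t {0, 1}) = colour (\<alpha> (cell T t {0, 1})) (x (cell T t {0, 1}))"
    "colouring \<alpha> x (cell T t {0, 2}) = colour (\<alpha> (cell T t {0, 2})) (x (cell T t {0, 2}))"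
    "colouring \<alpha> x (cell T t {0, 3}) = colour (\<alpha> (cell T t {0, 3})) (x (cell T t {0, 3}))"
    "colouring \<alpha> x (cell T t {1, 2}) = colour (\<alpha> (cell T t {1, 2})) (x (cell T t {1, 2}))"
    "colouring \<alpha> x (cell T t {1, 3}) = colour (\<alpha> (cell T t {1, 3})) (x (cell T t {1, 3}))"
    "colouring \<alpha> x (cell T t {2, 3}) = colour (\<alpha> (cell T t {2, 3})) (x (cell T t {2, 3}))"
    by (rule colouring_edge[OF t]; simp)+
  show ?thesis
    unfolding tet_weight_def tet_value_def e
    by (rule colour_sextuple_weight_colour[OF q disj disj disj disj disj disj tri])
qed

definition colouring_value :: "real \<Rightarrow> (tri_cell \<Rightarrow> bit) \<Rightarrow> (tri_cell \<Rightarrow> bit) \<Rightarrow> real" where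
  "colouring_value s \<alpha> x = (\<Prod>e\<in>cells T 1. if \<alpha> e = 1 then - s else 1) *
    (\<Prod>(t, f)\<in>{(t, f). t < tets T \<and> f < 4 \<and> leading_face t f}. tri_value s \<alpha> x t ({..<4} - {f})) *
    (\<Prod>t<tets T. tet_value s \<alpha> x t)"

lemma colouring_weight_colouring:
  assumes q: "q \<in> {1, 3}" and v: "one_vertex T" and ax: "\<alpha> \<in> cocycles" "x \<in> refinements \<alpha>"
  shows "colouring_weight T q (colouring \<alpha> x) = of_real (1 / 4 * colouring_value (bracket2 q) \<alpha> x)"
proof -
  have "(\<Prod>w\<in>cells T 0. vertex_weight q) = 1 / 4"
    using v bracket_values(5)[OF q] by (simp add: one_vertex_def)
  moreover have "(\<Prod>e\<in>cells T 1. edge_weight q (colouring \<alpha> x e))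
      = of_real (\<Prod>e\<in>cells T 1. if \<alpha> e = 1 then - bracket2 q else 1)"
    unfolding of_real_prod
    by (rule prod.cong[OF refl]) (simp only: colouring_def restrict_def if_True edge_weight_colour[OF q])
  moreover have "(\<Prod>F\<in>cells T 2. triangle_weight T q (colouring \<alpha> x) F)
      = of_real (\<Prod>(t, f)\<in>{(t, f). t < tets T \<and> f < 4 \<and> leading_face t f}.
          tri_value (bracket2 q) \<alpha> x t ({..<4} - {f}))"
    unfolding of_real_prod prod.reindex_bij_betw[OF bij_leading_faces, symmetric]
  proof (rule prod.cong[OF refl], clarify)
    fix t f assume "t < tets T" "f < (4::nat)"
    then show "triangle_weight T q (colouring \<alpha> x) (cell T t ({..<4} - {f}))
        = of_real (tri_value (bracket2 q) \<alpha> x t ({..<4} - {f}))"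
      by (intro triangle_weight_colouring q ax) auto
  qed
  moreover have "(\<Prod>t<tets T. tet_weight T q (colouring \<alpha> x) t)
      = of_real (\<Prod>t<tets T. tet_value (bracket2 q) \<alpha> x t)"
    unfolding of_real_prod by (rule prod.cong[OF refl]) (simp add: tet_weight_colouring[OF q ax])
  ultimately show ?thesis
    unfolding colouring_weight_def colouring_value_def by (simp add: mult_ac)
qed

theorem TV4_cocycle_sum:
  assumes q: "q \<in> {1, 3}" and v: "one_vertex T"
  shows "TV4 q T = of_real (1 / 4 * (\<Sum>\<alpha>\<in>cocycles. \<Sum>x\<in>refinements \<alpha>. colouring_value (bracket2 q) \<alpha> x))"
proof -
  have "TV4 q T = (\<Sum>(\<alpha>, x)\<in>(SIGMA \<alpha>:cocycles. refinements \<alpha>). colouring_weight T q (colouring \<alpha> x))"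
    unfolding TV4_def sum.reindex_bij_betw[OF bij_colouring, symmetric] by (simp add: case_prod_beta)
  also have "\<dots> = (\<Sum>\<alpha>\<in>cocycles. \<Sum>x\<in>refinements \<alpha>. colouring_weight T q (colouring \<alpha> x))"
    by (rule sum.Sigma[symmetric]) (auto simp: finite_cocycles finite_refinements)
  also have "\<dots> = (\<Sum>\<alpha>\<in>cocycles. \<Sum>x\<in>refinements \<alpha>. of_real (1 / 4 * colouring_value (bracket2 q) \<alpha> x))"
    by (intro sum.cong refl colouring_weight_colouring[OF q v])
  finally show ?thesis by (simp only: of_real_sum sum_distrib_left)
qed

section \<open>Edges represented by labels\<close>

definition edge_rep :: "(nat \<Rightarrow> nat) \<Rightarrow> nat \<Rightarrow> nat \<times> nat \<Rightarrow> nat" where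
  "edge_rep lab t p = lab (slot t (fst p) (snd p))"

definition edge_reps :: "(nat \<Rightarrow> nat) \<Rightarrow> nat set" where
  "edge_reps lab = {i. i < 16 * tets T \<and> lab i = i}"

text \<open>
  Edges are represented by numbers of slots: \<open>lab\<close> sends each slot to the representative of its edge, the
  representatives are the fixed points of \<open>lab\<close>, and \<open>h\<close> sends a representative to its edge.
\<close>

definition labelling :: "(nat \<Rightarrow> nat) \<Rightarrow> (nat \<Rightarrow> tri_cell) \<Rightarrow> bool" where
  "labelling lab h \<longleftrightarrow> bij_betw h (edge_reps lab) (cells T 1) \<and>
     (\<forall>t<tets T. \<forall>a<4. \<forall>b<4. a \<noteq> b \<longrightarrow>
        lab (slot t a b) \<in> edge_reps lab \<and> h (lab (slot t a b)) = cell T t {a, b})"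

definition face_sum :: "(nat \<Rightarrow> nat) \<Rightarrow> (nat \<Rightarrow> bit) \<Rightarrow> nat \<Rightarrow> nat \<Rightarrow> bit" where
  "face_sum lab x t f = (\<Sum>p\<leftarrow>face_edges f. x (edge_rep lab t p))"

definition integral_face :: "(nat \<Rightarrow> nat) \<Rightarrow> (nat \<Rightarrow> bit) \<Rightarrow> nat \<Rightarrow> nat \<Rightarrow> bool" where
  "integral_face lab \<alpha> t f \<longleftrightarrow> (\<forall>p\<in>set (face_edges f). \<alpha> (edge_rep lab t p) = 0)"

definition tet_sign :: "(nat \<Rightarrow> nat) \<Rightarrow> (nat \<Rightarrow> bit) \<Rightarrow> nat \<Rightarrow> bit" where
  "tet_sign lab x t = (let y = \<lambda>a b. x (edge_rep lab t (a, b)) in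
     sext_sign (y 0 1) (y 0 2) (y 0 3) (y 1 2) (y 1 3) (y 2 3))"

definition integral_tet :: "(nat \<Rightarrow> nat) \<Rightarrow> (nat \<Rightarrow> bit) \<Rightarrow> nat \<Rightarrow> bool" where
  "integral_tet lab \<alpha> t \<longleftrightarrow> (\<forall>p\<in>set tet_edges. \<alpha> (edge_rep lab t p) = 0)"

text \<open>
  Cocycles, with edges replaced by their representing slots.
\<close>

definition slot_cocycles :: "(nat \<Rightarrow> nat) \<Rightarrow> (nat \<Rightarrow> bit) set" where
  "slot_cocycles lab = {\<alpha> \<in> bitfun (edge_reps lab). \<forall>t<tets T. \<forall>f<4. face_sum lab \<alpha> t f = 0}"

definition slot_refinements :: "(nat \<Rightarrow> nat) \<Rightarrow> (nat \<Rightarrow> bit) \<Rightarrow> (nat \<Rightarrow> bit) set" where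
  "slot_refinements lab \<alpha> = {x \<in> bitfun (edge_reps lab). (\<forall>i. \<alpha> i = 1 \<longrightarrow> x i = 0) \<and>
     (\<forall>t<tets T. \<forall>f<4. integral_face lab \<alpha> t f \<longrightarrow> face_sum lab x t f = 0)}"

text \<open>
  The weight of the colouring given by \<open>\<alpha>\<close> and \<open>x\<close>, without the vertex factor, in terms of data that a
  program can read from its tables.
\<close>

definition slot_value :: "real \<Rightarrow> (nat \<Rightarrow> nat) \<Rightarrow> (nat \<Rightarrow> bit) \<Rightarrow> (nat \<Rightarrow> bit) \<Rightarrow> real" where
  "slot_value s lab \<alpha> x = (\<Prod>i\<in>edge_reps lab. if \<alpha> i = 1 then - s else 1) *
    (\<Prod>(t, f)\<in>{(t, f). t < tets T \<and> f < 4 \<and> leading_face t f}.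
       sg (face_sum lab x t f) * (if integral_face lab \<alpha> t f then 1 else - 1 / s)) *
    (\<Prod>t<tets T. sg (tet_sign lab x t) * (if integral_tet lab \<alpha> t then 1 else - s))"

text \<open>
  A function on representatives, viewed as a function on edges.
\<close>

definition spread :: "(nat \<Rightarrow> nat) \<Rightarrow> (nat \<Rightarrow> tri_cell) \<Rightarrow> (nat \<Rightarrow> bit) \<Rightarrow> tri_cell \<Rightarrow> bit" where
  "spread lab h x e = (if e \<in> cells T 1 then x (inv_into (edge_reps lab) h e) else 0)"

context
  fixes lab :: "nat \<Rightarrow> nat" and h :: "nat \<Rightarrow> tri_cell"
  assumes lab: "labelling lab h"
begin

lemma bij_h: "bij_betw h (edge_reps lab) (cells T 1)"
  using lab by (simp only: labelling_def)

lemma bij_spread: "bij_betw (spread lab h) (bitfun (edge_reps lab)) (bitfun (cells T 1))"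
  using bij_betw_bitfun_reindex[OF bij_h] by (simp only: spread_def[abs_def])

lemma spread_edge:
  assumes "t < tets T" "a < 4" "b < 4" "a \<noteq> b"
  shows "spread lab h x (cell T t {a, b}) = x (edge_rep lab t (a, b))"
proof -
  have l: "lab (slot t a b) \<in> edge_reps lab" "h (lab (slot t a b)) = cell T t {a, b}"
    using lab assms unfolding labelling_def by blast+
  have "inv_into (edge_reps lab) h (cell T t {a, b}) = lab (slot t a b)"
    unfolding l(2)[symmetric] by (rule inv_into_f_f[OF bij_betw_imp_inj_on[OF bij_h] l(1)])
  then show ?thesis using edge_in_cells[OF assms] by (simp add: spread_def edge_rep_def)
qed

lemma face_sum_spread:
  assumes "t < tets T" "f < 4"
  shows "(\<Sum>a\<in>{..<4} - {f}. spread lab h x (cell T t ({..<4} - {f} - {a}))) = face_sum lab x t f"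
proof -
  obtain a b c where v: "face_vertices f = (a, b, c)" by (cases "face_vertices f")
  note fv = face_vertices[OF assms(2) v]
  show ?thesis
    unfolding fv(1) sum_facets_triple[OF fv(2)]
    using fv assms(1) by (simp add: spread_edge face_sum_def face_edges_def v add_ac)
qed

lemma integral_face_spread:
  assumes "t < tets T" "f < 4"
  shows "(\<forall>a\<in>{..<4} - {f}. spread lab h \<alpha> (cell T t ({..<4} - {f} - {a})) = 0) \<longleftrightarrow> integral_face lab \<alpha> t f"
proof -
  obtain a b c where v: "face_vertices f = (a, b, c)" by (cases "face_vertices f")
  note fv = face_vertices[OF assms(2) v]
  show ?thesis
    unfolding fv(1) ball_facets_triple[OF fv(2), where P = "\<lambda>e. spread lab h \<alpha> e = 0"]
    using fv assms(1) by (simp add: spread_edge integral_face_def face_edges_def v)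
qed

lemma all_faces:
  "(\<forall>A. A \<subseteq> {..<4::nat} \<longrightarrow> card A = 3 \<longrightarrow> P A) \<longleftrightarrow> (\<forall>f<4. P ({..<4} - {f}))"
proof
  assume L: "\<forall>A. A \<subseteq> {..<4::nat} \<longrightarrow> card A = 3 \<longrightarrow> P A"
  show "\<forall>f<4. P ({..<4} - {f})"
  proof (intro allI impI)
    fix f :: nat assume "f < 4"
    then have "card ({..<4::nat} - {f}) = 3" by simp
    then show "P ({..<4} - {f})" using L[rule_format, OF Diff_subset] by simp
  qed
next
  assume R: "\<forall>f<4. P ({..<4} - {f})"
  show "\<forall>A. A \<subseteq> {..<4::nat} \<longrightarrow> card A = 3 \<longrightarrow> P A"
  proof (intro allI impI)
    fix A :: "nat set" assume "A \<subseteq> {..<4}" "card A = 3"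
    then obtain f where "f < 4" "A = {..<4} - {f}" by (rule subset_4_card_3)
    then show "P A" using R by simp
  qed
qed

lemma spread_in_cocycles_iff:
  assumes "\<alpha> \<in> bitfun (edge_reps lab)"
  shows "spread lab h \<alpha> \<in> cocycles \<longleftrightarrow> \<alpha> \<in> slot_cocycles lab"
proof -
  have "spread lab h \<alpha> \<in> bitfun (cells T 1)" using bij_spread assms by (rule bij_betwE[rule_format])
  then show ?thesis
    using assms unfolding cocycles_def slot_cocycles_def mem_Collect_eq all_faces
    by (simp only: face_sum_spread simp_thms cong: imp_cong)
qed

lemma spread_in_refinements_iff:
  assumes "x \<in> bitfun (edge_reps lab)" "\<alpha> \<in> bitfun (edge_reps lab)"
  shows "spread lab h x \<in> refinements (spread lab h \<alpha>) \<longleftrightarrow> x \<in> slot_refinements lab \<alpha>"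
proof -
  have 1: "spread lab h x \<in> bitfun (cells T 1)"
    using bij_spread assms(1) by (rule bij_betwE[rule_format])
  have im: "h ` edge_reps lab = cells T 1" and inj: "inj_on h (edge_reps lab)"
    using bij_h by (simp_all only: bij_betw_def)
  have val: "spread lab h z (h i) = z i" if "i \<in> edge_reps lab" for z i
  proof -
    have "h i \<in> cells T 1" using im that by blast
    then show ?thesis using inv_into_f_f[OF inj that] by (simp only: spread_def if_True)
  qed
  have 2: "(\<forall>e. spread lab h \<alpha> e = 1 \<longrightarrow> spread lab h x e = 0) \<longleftrightarrow> (\<forall>i. \<alpha> i = 1 \<longrightarrow> x i = 0)"
  proof
    assume L: "\<forall>e. spread lab h \<alpha> e = 1 \<longrightarrow> spread lab h x e = 0"
    show "\<forall>i. \<alpha> i = 1 \<longrightarrow> x i = 0"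
    proof (intro allI impI)
      fix i assume i: "\<alpha> i = 1"
      then have "i \<in> edge_reps lab" using assms(2) unfolding bitfun_def by force
      then show "x i = 0" using L[rule_format, of "h i"] i by (simp only: val)
    qed
  next
    assume "\<forall>i. \<alpha> i = 1 \<longrightarrow> x i = 0"
    then show "\<forall>e. spread lab h \<alpha> e = 1 \<longrightarrow> spread lab h x e = 0" by (simp add: spread_def)
  qed
  show ?thesis
    using assms(1) 1 2 unfolding refinements_def slot_refinements_def mem_Collect_eq all_faces
    by (simp only: face_sum_spread integral_face_spread simp_thms cong: imp_cong)
qed

lemma colouring_value_spread:
  "colouring_value s (spread lab h \<alpha>) (spread lab h x) = slot_value s lab \<alpha> x"
proof -
  have im: "h ` edge_reps lab = cells T 1" and inj: "inj_on h (edge_reps lab)"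
    using bij_h by (simp_all only: bij_betw_def)
  have "(\<Prod>e\<in>cells T 1. if spread lab h \<alpha> e = 1 then - s else 1)
      = (\<Prod>i\<in>edge_reps lab. if \<alpha> i = 1 then - s else 1)"
    unfolding prod.reindex_bij_betw[OF bij_h, symmetric]
  proof (rule prod.cong[OF refl])
    fix i assume i: "i \<in> edge_reps lab"
    then have "spread lab h \<alpha> (h i) = \<alpha> i"
      using im inv_into_f_f[OF inj i] unfolding spread_def by auto
    then show "(if spread lab h \<alpha> (h i) = 1 then - s else 1) = (if \<alpha> i = 1 then - s else 1)" by simp
  qed
  moreover have "tri_value s (spread lab h \<alpha>) (spread lab h x) t ({..<4} - {f})
      = sg (face_sum lab x t f) * (if integral_face lab \<alpha> t f then 1 else - 1 / s)"
    if "t < tets T" "f < 4" for t f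
    unfolding tri_value_def face_sum_spread[OF that] integral_face_spread[OF that, symmetric] by simp
  then have "(\<Prod>(t, f)\<in>{(t, f). t < tets T \<and> f < 4 \<and> leading_face t f}.
       tri_value s (spread lab h \<alpha>) (spread lab h x) t ({..<4} - {f}))
    = (\<Prod>(t, f)\<in>{(t, f). t < tets T \<and> f < 4 \<and> leading_face t f}.
       sg (face_sum lab x t f) * (if integral_face lab \<alpha> t f then 1 else - 1 / s))"
    by (intro prod.cong refl) auto
  moreover have "(\<Prod>t<tets T. tet_value s (spread lab h \<alpha>) (spread lab h x) t)
      = (\<Prod>t<tets T. sg (tet_sign lab x t) * (if integral_tet lab \<alpha> t then 1 else - s))"
    by (rule prod.cong[OF refl])
      (simp add: tet_value_def spread_edge tet_sign_def integral_tet_def tet_edges_def)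
  ultimately show ?thesis unfolding colouring_value_def slot_value_def by (simp only:)
qed

lemma bij_betw_restrict:
  assumes "bij_betw g X Y" "A \<subseteq> X" "B \<subseteq> Y" "\<And>x. x \<in> X \<Longrightarrow> g x \<in> B \<longleftrightarrow> x \<in> A"
  shows "bij_betw g A B"
proof -
  have "g ` A = B"
  proof
    show "g ` A \<subseteq> B" using assms(2,4) by blast
    show "B \<subseteq> g ` A"
    proof
      fix y assume y: "y \<in> B"
      then obtain x where "x \<in> X" "y = g x" using assms(1,3) unfolding bij_betw_def by blast
      then show "y \<in> g ` A" using assms(4) y by blast
    qed
  qed
  then show ?thesis using assms(1,2) inj_on_subset unfolding bij_betw_def by blast
qed

lemma bij_spread_cocycles: "bij_betw (spread lab h) (slot_cocycles lab) cocycles"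
proof (rule bij_betw_restrict[OF bij_spread])
  show "slot_cocycles lab \<subseteq> bitfun (edge_reps lab)" unfolding slot_cocycles_def by blast
  show "cocycles \<subseteq> bitfun (cells T 1)" unfolding cocycles_def by blast
qed (rule spread_in_cocycles_iff)

lemma bij_spread_refinements:
  assumes "\<alpha> \<in> slot_cocycles lab"
  shows "bij_betw (spread lab h) (slot_refinements lab \<alpha>) (refinements (spread lab h \<alpha>))"
proof (rule bij_betw_restrict[OF bij_spread])
  show "slot_refinements lab \<alpha> \<subseteq> bitfun (edge_reps lab)" unfolding slot_refinements_def by blast
  show "refinements (spread lab h \<alpha>) \<subseteq> bitfun (cells T 1)" unfolding refinements_def by blast
  have "\<alpha> \<in> bitfun (edge_reps lab)" using assms unfolding slot_cocycles_def by blast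
  then show "spread lab h x \<in> refinements (spread lab h \<alpha>) \<longleftrightarrow> x \<in> slot_refinements lab \<alpha>"
    if "x \<in> bitfun (edge_reps lab)" for x
    using spread_in_refinements_iff[OF that] by blast
qed

theorem card_slot_cocycles:
  assumes "one_vertex T"
  shows "card (slot_cocycles lab) = 2 ^ betti1 T"
  using card_cocycles[OF assms] bij_betw_same_card[OF bij_spread_cocycles] by simp

theorem TV4_slot_sum:
  assumes q: "q \<in> {1, 3}" and v: "one_vertex T"
  shows "TV4 q T = of_real (1 / 4 *
    (\<Sum>\<alpha>\<in>slot_cocycles lab. \<Sum>x\<in>slot_refinements lab \<alpha>. slot_value (bracket2 q) lab \<alpha> x))"
proof -
  have "(\<Sum>x\<in>refinements (spread lab h \<alpha>). colouring_value (bracket2 q) (spread lab h \<alpha>) x)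
      = (\<Sum>x\<in>slot_refinements lab \<alpha>. slot_value (bracket2 q) lab \<alpha> x)"
    if "\<alpha> \<in> slot_cocycles lab" for \<alpha>
    unfolding sum.reindex_bij_betw[OF bij_spread_refinements[OF that], symmetric]
      colouring_value_spread ..
  then show ?thesis
    unfolding TV4_cocycle_sum[OF q v] sum.reindex_bij_betw[OF bij_spread_cocycles, symmetric]
    by (simp only: cong: sum.cong)
qed

end

end

section \<open>The sum over refinements as a Gauss sum\<close>

lemma prod_if_all:
  fixes c :: "'a \<Rightarrow> 'b :: comm_semiring_1"
  assumes "finite I"
  shows "(\<Prod>i\<in>I. if P i then c i else 0) = (if \<forall>i\<in>I. P i then \<Prod>i\<in>I. c i else 0)"
  using assms by (induction I rule: finite_induct) auto

lemma prod_mult_4: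
  fixes g :: "nat \<Rightarrow> nat \<Rightarrow> 'a :: comm_monoid_mult"
  shows "(\<Prod>k<4 * n. g (k div 4) (k mod 4)) = (\<Prod>t<n. \<Prod>f<4. g t f)"
proof (induction n)
  case (Suc n)
  have "{..<4 * Suc n} = {..<4 * n} \<union> {4 * n, 4 * n + 1, 4 * n + 2, 4 * n + 3}" by auto
  moreover have "{..<4::nat} = {0, 1, 2, 3}" by auto
  moreover have "(4 * n + 1) div 4 = n" "(4 * n + 2) div 4 = n" "(4 * n + 3) div 4 = n" by presburger+
  moreover have "(4 * n + 1) mod 4 = 1" "(4 * n + 2) mod 4 = 2" "(4 * n + 3) mod 4 = 3" by presburger+
  ultimately show ?case using Suc by (simp add: prod.union_disjoint mult_ac del: mult_Suc_right)
qed simp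

context glued
begin

text \<open>
  The multiplier \<open>l\<close> of slot \<open>i\<close> enforces \<open>x = 0\<close> if the slot is not a representative or its colour is
  half-integral.  Otherwise the summand does not depend on \<open>l\<close>, which yields the same factor two.
\<close>

definition edge_piece :: "real \<Rightarrow> (nat \<Rightarrow> nat) \<Rightarrow> (nat \<Rightarrow> bit) \<Rightarrow> nat \<Rightarrow> bit \<Rightarrow> bit \<Rightarrow> real" where
  "edge_piece s lab \<alpha> i x l = (if lab i = i then (if \<alpha> i = 1 then - s * sg (x * l) else 1) else sg (x * l))"

text \<open>
  The multiplier \<open>m\<close> enforces the parity condition of an integral face.  The weight of the triangle is
  attached to its leading face.  Every face carries an additional factor two, which clears the
  denominator: \<open>2 * (- 1 / s) = - s\<close> because \<open>s * s = 2\<close>.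
\<close>

definition face_piece :: "real \<Rightarrow> (nat \<Rightarrow> nat) \<Rightarrow> (nat \<Rightarrow> bit) \<Rightarrow> (nat \<Rightarrow> bit) \<Rightarrow> nat \<Rightarrow> nat \<Rightarrow> bit \<Rightarrow> real" where
  "face_piece s lab \<alpha> x t f m =
     (if integral_face lab \<alpha> t f then sg (m * face_sum lab x t f) else 1) *
     (if leading_face t f then sg (face_sum lab x t f) * (if integral_face lab \<alpha> t f then 2 else - s) else 2)"

definition tet_piece :: "real \<Rightarrow> (nat \<Rightarrow> nat) \<Rightarrow> (nat \<Rightarrow> bit) \<Rightarrow> (nat \<Rightarrow> bit) \<Rightarrow> nat \<Rightarrow> real" where
  "tet_piece s lab \<alpha> x t = sg (tet_sign lab x t) * (if integral_tet lab \<alpha> t then 1 else - s)"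

text \<open>
  The layout of the variables: \<open>y 0\<close> is the constant \<open>1\<close>, the next \<open>16 n\<close> coordinates are the values \<open>x\<close> at
  the slots, the next \<open>16 n\<close> their multipliers, and the last \<open>4 n\<close> the multipliers of the faces.
\<close>

definition piece_product :: "real \<Rightarrow> (nat \<Rightarrow> nat) \<Rightarrow> (nat \<Rightarrow> bit) \<Rightarrow> (nat \<Rightarrow> bit) \<Rightarrow> real" where
  "piece_product s lab \<alpha> y = (\<Prod>i<16 * tets T. edge_piece s lab \<alpha> i (y (1 + i)) (y (1 + 16 * tets T + i))) *
    (\<Prod>t<tets T. \<Prod>f<4. face_piece s lab \<alpha> (\<lambda>i. y (1 + i)) t f (y (1 + 32 * tets T + (4 * t + f)))) *
    (\<Prod>t<tets T. tet_piece s lab \<alpha> (\<lambda>i. y (1 + i)) t)"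

lemma edge_piece_sum:
  "edge_piece s lab \<alpha> i x 0 + edge_piece s lab \<alpha> i x 1 =
    2 * (if lab i = i \<and> \<alpha> i = 0 \<or> x = 0 then (if lab i = i \<and> \<alpha> i = 1 then - s else 1) else 0)"
  by (cases x; cases "\<alpha> i") (simp_all add: edge_piece_def)

lemma face_piece_sum:
  assumes "s * s = 2"
  shows "face_piece s lab \<alpha> x t f 0 + face_piece s lab \<alpha> x t f 1 =
    4 * (if integral_face lab \<alpha> t f \<longrightarrow> face_sum lab x t f = 0 then
      (if leading_face t f then sg (face_sum lab x t f) * (if integral_face lab \<alpha> t f then 1 else - 1 / s) else 1)
     else 0)"
proof -
  have "s \<noteq> 0" using assms by auto
  then have "s = 2 * (1 / s)" using assms by (simp add: field_simps)
  then show ?thesis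
    by (cases "face_sum lab x t f"; cases "integral_face lab \<alpha> t f"; cases "leading_face t f")
      (simp_all add: face_piece_def)
qed

lemma slot_less: "t < n \<Longrightarrow> a < 4 \<Longrightarrow> b < 4 \<Longrightarrow> slot t a b < 16 * n"
  unfolding slot_def by linarith

lemma bij_betw_bitfun_shift:
  fixes N :: nat
  shows "bij_betw (\<lambda>y i. if i < N then y (1 + i) else 0) (bitfun {1..<1 + N}) (bitfun {..<N})"
  by (rule bij_betw_byWitness[where f' = "\<lambda>x j. if 1 \<le> j \<and> j < 1 + N then x (j - 1) else 0"])
    (auto simp: bitfun_def fun_eq_iff)

text \<open>
  Summing over the multipliers first replaces each piece by an indicator of its condition, with the
  factors \<open>2\<close> and \<open>4\<close> from \<open>edge_piece_sum\<close> and \<open>face_piece_sum\<close>; what is left is the sum over the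
  refinements.
\<close>

lemma sum_piece_product:
  assumes s: "s * s = 2" and lab: "labelling lab h" and labN: "\<And>i. i < 16 * tets T \<Longrightarrow> lab i < 16 * tets T"
    and \<alpha>: "\<alpha> \<in> slot_cocycles lab"
  shows "(\<Sum>y\<in>bitfun {1..<1 + 36 * tets T}. piece_product s lab \<alpha> y) =
    2 ^ (24 * tets T) * (\<Sum>x\<in>slot_refinements lab \<alpha>. slot_value s lab \<alpha> x)"
proof -
  define n where "n = tets T"
  define N where "N = 16 * n"
  let ?X = "{1..<1 + N}" and ?L = "{1 + N..<1 + 2 * N}" and ?M = "{1 + 2 * N..<1 + 36 * n}"
  let ?sh = "\<lambda>y i. if i < N then y (1 + i) else (0::bit)"
  have rep: "edge_rep lab t p < N" if "t < n" "fst p < 4" "snd p < 4" for t p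
    unfolding edge_rep_def N_def n_def by (rule labN, rule slot_less) (use that in \<open>simp_all add: n_def\<close>)
  have fe: "fst p < 4 \<and> snd p < 4" if "p \<in> set (face_edges f)" for f p
    using that by (auto simp: face_edges_def face_vertices_def split: if_splits)
  have fs: "face_sum lab x t f = face_sum lab x' t f" if "t < n" "\<And>i. i < N \<Longrightarrow> x i = x' i" for x x' t f
    unfolding face_sum_def using rep[OF that(1)] fe that(2)
    by (intro arg_cong[where f = sum_list] map_cong refl) blast
  have ts: "tet_sign lab x t = tet_sign lab x' t" if "t < n" "\<And>i. i < N \<Longrightarrow> x i = x' i" for x x' t
    unfolding tet_sign_def Let_def using rep[OF that(1)] that(2) by simp
  have part: "{1..<1 + 36 * n} = ?X \<union> (?L \<union> ?M)" by (auto simp: N_def)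
  (* E, F and G collect the factors of edges, faces and tetrahedra after summing over the multipliers *)
  define E where "E x = (\<Prod>i<N. if lab i = i \<and> \<alpha> i = 0 \<or> x i = 0 then (if lab i = i \<and> \<alpha> i = 1 then - s else 1) else 0)" for x :: "nat \<Rightarrow> bit"
  define F where "F x = (\<Prod>k<4 * n. if integral_face lab \<alpha> (k div 4) (k mod 4) \<longrightarrow> face_sum lab x (k div 4) (k mod 4) = 0 then
      (if leading_face (k div 4) (k mod 4) then sg (face_sum lab x (k div 4) (k mod 4)) *
        (if integral_face lab \<alpha> (k div 4) (k mod 4) then 1 else - 1 / s) else 1) else 0)" for x :: "nat \<Rightarrow> bit"
  define G where "G x = (\<Prod>t<n. tet_piece s lab \<alpha> x t)" for x :: "nat \<Rightarrow> bit"
  have "(\<Sum>y\<in>bitfun {1..<1 + 36 * n}. piece_product s lab \<alpha> y) =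
     (\<Sum>x\<in>bitfun ?X. \<Sum>z\<in>bitfun (?L \<union> ?M). piece_product s lab \<alpha> (\<lambda>i. x i + z i))"
    unfolding part by (rule sum_bitfun_Un) auto
  also have "\<dots> = (\<Sum>x\<in>bitfun ?X. \<Sum>l\<in>bitfun ?L. \<Sum>m\<in>bitfun ?M. piece_product s lab \<alpha> (\<lambda>i. x i + (l i + m i)))"
    by (intro sum.cong refl sum_bitfun_Un) auto
  also have "\<dots> = (\<Sum>x\<in>bitfun ?X. 2 ^ (24 * n) * (E (?sh x) * F (?sh x) * G (?sh x)))"
  proof (rule sum.cong[OF refl])
    fix x assume x: "x \<in> bitfun ?X"
    define ge where "ge j b = edge_piece s lab \<alpha> (j - (1 + N)) (?sh x (j - (1 + N))) b" for j b
    define gf where "gf j b = face_piece s lab \<alpha> (?sh x) ((j - (1 + 2 * N)) div 4) ((j - (1 + 2 * N)) mod 4) b" for j b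
    have pp: "piece_product s lab \<alpha> (\<lambda>i. x i + (l i + m i)) =
        (\<Prod>j\<in>?L. ge j (l j)) * (\<Prod>j\<in>?M. gf j (m j)) * G (?sh x)"
      if l: "l \<in> bitfun ?L" and m: "m \<in> bitfun ?M" for l m
    proof -
      let ?y = "\<lambda>i. x i + (l i + m i)"
      have y1: "?y (1 + i) = ?sh x i" if "i < N" for i
        using x l m that by (simp add: bitfun_def)
      have y2: "?y (1 + N + i) = l (1 + N + i)" if "i < N" for i
        using x l m that by (simp add: bitfun_def)
      have y3: "?y (1 + 2 * N + k) = m (1 + 2 * N + k)" if "k < 4 * n" for k
        using x l m that by (simp add: bitfun_def)
      have "(\<Prod>i<N. edge_piece s lab \<alpha> i (?y (1 + i)) (?y (1 + N + i))) = (\<Prod>i<N. ge (1 + N + i) (l (1 + N + i)))"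
        by (rule prod.cong[OF refl]) (simp only: y1 y2 ge_def lessThan_iff diff_add_inverse)
      also have "\<dots> = (\<Prod>j\<in>?L. ge j (l j))"
        by (rule prod.reindex_bij_betw[where h = "\<lambda>i. 1 + N + i" and S = "{..<N}"],
            rule bij_betw_byWitness[where f' = "\<lambda>j. j - (1 + N)"]) auto
      finally have 1: "(\<Prod>i<N. edge_piece s lab \<alpha> i (?y (1 + i)) (?y (1 + N + i))) = (\<Prod>j\<in>?L. ge j (l j))" .
      have "(\<Prod>t<n. \<Prod>f<4. face_piece s lab \<alpha> (\<lambda>i. ?y (1 + i)) t f (?y (1 + 2 * N + (4 * t + f))))
          = (\<Prod>t<n. \<Prod>f<4. face_piece s lab \<alpha> (?sh x) t f (m (1 + 2 * N + (4 * t + f))))"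
      proof (intro prod.cong refl)
        fix t f assume "t \<in> {..<n}" "f \<in> {..<4::nat}"
        then have tf: "t < n" "4 * t + f < 4 * n" by simp_all
        have "face_sum lab (\<lambda>i. ?y (1 + i)) t f = face_sum lab (?sh x) t f"
          by (rule fs[OF tf(1)]) (rule y1)
        then show "face_piece s lab \<alpha> (\<lambda>i. ?y (1 + i)) t f (?y (1 + 2 * N + (4 * t + f)))
          = face_piece s lab \<alpha> (?sh x) t f (m (1 + 2 * N + (4 * t + f)))"
          unfolding face_piece_def y3[OF tf(2)] by (simp only:)
      qed
      also have "\<dots> = (\<Prod>k<4 * n. face_piece s lab \<alpha> (?sh x) (k div 4) (k mod 4) (m (1 + 2 * N + (4 * (k div 4) + k mod 4))))"
        by (rule prod_mult_4[symmetric])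
      also have "\<dots> = (\<Prod>k<4 * n. gf (1 + 2 * N + k) (m (1 + 2 * N + k)))"
        by (rule prod.cong[OF refl]) (simp only: gf_def diff_add_inverse mult_div_mod_eq)
      also have "\<dots> = (\<Prod>j\<in>?M. gf j (m j))"
        by (rule prod.reindex_bij_betw[where h = "\<lambda>i. 1 + 2 * N + i" and S = "{..<4 * n}"],
            rule bij_betw_byWitness[where f' = "\<lambda>j. j - (1 + 2 * N)"]) (auto simp: N_def)
      finally have 2: "(\<Prod>t<n. \<Prod>f<4. face_piece s lab \<alpha> (\<lambda>i. ?y (1 + i)) t f (?y (1 + 2 * N + (4 * t + f))))
          = (\<Prod>j\<in>?M. gf j (m j))" .
      have "(\<Prod>t<n. tet_piece s lab \<alpha> (\<lambda>i. ?y (1 + i)) t) = G (?sh x)"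
        unfolding G_def
      proof (rule prod.cong[OF refl])
        fix t assume "t \<in> {..<n}"
        then have "tet_sign lab (\<lambda>i. ?y (1 + i)) t = tet_sign lab (?sh x) t"
          by (intro ts y1) simp_all
        then show "tet_piece s lab \<alpha> (\<lambda>i. ?y (1 + i)) t = tet_piece s lab \<alpha> (?sh x) t"
          by (simp only: tet_piece_def)
      qed
      moreover have "16 * tets T = N" "32 * tets T = 2 * N" "tets T = n" by (simp_all add: N_def n_def)
      ultimately show ?thesis using 1 2 unfolding piece_product_def by (simp only:)
    qed
    have "(\<Sum>l\<in>bitfun ?L. \<Sum>m\<in>bitfun ?M. piece_product s lab \<alpha> (\<lambda>i. x i + (l i + m i)))
      = (\<Sum>l\<in>bitfun ?L. \<Sum>m\<in>bitfun ?M. (\<Prod>j\<in>?L. ge j (l j)) * (\<Prod>j\<in>?M. gf j (m j)) * G (?sh x))"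
      by (intro sum.cong refl pp)
    also have "\<dots> = (\<Sum>l\<in>bitfun ?L. \<Prod>j\<in>?L. ge j (l j)) * (\<Sum>m\<in>bitfun ?M. \<Prod>j\<in>?M. gf j (m j)) * G (?sh x)"
      unfolding sum_distrib_right by (simp only: sum_distrib_left sum_distrib_right mult.assoc)
    also have "(\<Sum>l\<in>bitfun ?L. \<Prod>j\<in>?L. ge j (l j)) = (\<Prod>j\<in>?L. ge j 0 + ge j 1)"
      by (rule sum_bitfun_prod) simp
    also have "(\<Prod>j\<in>?L. ge j 0 + ge j 1) = (\<Prod>i<N. ge (1 + N + i) 0 + ge (1 + N + i) 1)"
      by (rule prod.reindex_bij_betw[where h = "\<lambda>i. 1 + N + i" and S = "{..<N}", symmetric],
          rule bij_betw_byWitness[where f' = "\<lambda>j. j - (1 + N)"]) auto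
    also have "\<dots> = 2 ^ N * E (?sh x)"
      by (simp only: ge_def diff_add_inverse edge_piece_sum prod.distrib E_def prod_constant card_lessThan)
    also have "(\<Sum>m\<in>bitfun ?M. \<Prod>j\<in>?M. gf j (m j)) = (\<Prod>j\<in>?M. gf j 0 + gf j 1)"
      by (rule sum_bitfun_prod) simp
    also have "\<dots> = (\<Prod>k<4 * n. gf (1 + 2 * N + k) 0 + gf (1 + 2 * N + k) 1)"
      by (rule prod.reindex_bij_betw[where h = "\<lambda>i. 1 + 2 * N + i" and S = "{..<4 * n}", symmetric],
          rule bij_betw_byWitness[where f' = "\<lambda>j. j - (1 + 2 * N)"]) (auto simp: N_def)
    also have "\<dots> = 4 ^ (4 * n) * F (?sh x)"
      by (simp only: gf_def diff_add_inverse face_piece_sum[OF s] prod.distrib F_def prod_constant card_lessThan)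
    also have "2 ^ N * E (?sh x) * (4 ^ (4 * n) * F (?sh x)) * G (?sh x)
        = 2 ^ (24 * n) * (E (?sh x) * F (?sh x) * G (?sh x))"
    proof -
      have "(4::real) ^ (4 * n) = 2 ^ (8 * n)" using power_mult[of "2::real" 2 "4 * n"] by simp
      moreover have "(2::real) ^ (24 * n) = 2 ^ N * 2 ^ (8 * n)" by (simp add: N_def power_add[symmetric])
      ultimately show ?thesis by (simp only: mult_ac)
    qed
    finally show "(\<Sum>l\<in>bitfun ?L. \<Sum>m\<in>bitfun ?M. piece_product s lab \<alpha> (\<lambda>i. x i + (l i + m i)))
      = 2 ^ (24 * n) * (E (?sh x) * F (?sh x) * G (?sh x))" .
  qed
  also have "\<dots> = 2 ^ (24 * n) * (\<Sum>x\<in>bitfun {..<N}. E x * F x * G x)"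
    unfolding sum_distrib_left[symmetric]
    by (rule arg_cong2[where f = "(*)", OF refl],
        rule sum.reindex_bij_betw[OF bij_betw_bitfun_shift, where g = "\<lambda>x. E x * F x * G x"])
  also have "(\<Sum>x\<in>bitfun {..<N}. E x * F x * G x) = (\<Sum>x\<in>bitfun {..<N}. if x \<in> slot_refinements lab \<alpha> then slot_value s lab \<alpha> x else 0)"
  proof (rule sum.cong[OF refl])
    fix x assume x: "x \<in> bitfun {..<N}"
    have R: "edge_reps lab = {i \<in> {..<N}. lab i = i}" by (auto simp: edge_reps_def N_def n_def)
    have \<alpha>R: "\<alpha> i = 1 \<Longrightarrow> i \<in> edge_reps lab" for i
      using \<alpha> by (force simp: slot_cocycles_def bitfun_def)
    have "(\<forall>i\<in>{..<N}. lab i = i \<and> \<alpha> i = 0 \<or> x i = 0) \<longleftrightarrow> x \<in> bitfun (edge_reps lab) \<and> (\<forall>i. \<alpha> i = 1 \<longrightarrow> x i = 0)"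
      (is "?l \<longleftrightarrow> ?r")
    proof
      assume l: ?l
      have "x i = 0" if "i \<notin> edge_reps lab" for i
        using l x that unfolding R bitfun_def by (cases "i < N") auto
      moreover have "x i = 0" if "\<alpha> i = 1" for i
      proof -
        have "i \<in> {..<N}" using \<alpha>R[OF that] unfolding R by blast
        then have "lab i = i \<and> \<alpha> i = 0 \<or> x i = 0" using l by blast
        then show ?thesis using that by simp
      qed
      ultimately show ?r by (simp add: bitfun_def)
    next
      assume r: ?r
      show ?l
      proof
        fix i assume "i \<in> {..<N}"
        then show "lab i = i \<and> \<alpha> i = 0 \<or> x i = 0"
          using r unfolding R bitfun_def by (cases "\<alpha> i"; cases "lab i = i") auto
      qed
    qed
    then have 1: "E x = (if x \<in> bitfun (edge_reps lab) \<and> (\<forall>i. \<alpha> i = 1 \<longrightarrow> x i = 0)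
        then \<Prod>i<N. if lab i = i \<and> \<alpha> i = 1 then - s else 1 else 0)"
      unfolding E_def prod_if_all[OF finite_lessThan] by (simp only:)
    have "(\<Prod>i<N. if lab i = i \<and> \<alpha> i = 1 then - s else 1) = (\<Prod>i<N. if lab i = i then (if \<alpha> i = 1 then - s else 1) else 1)"
      by (rule prod.cong) auto
    also have "\<dots> = (\<Prod>i\<in>edge_reps lab. if \<alpha> i = 1 then - s else 1)"
      unfolding R by (rule prod.inter_filter[symmetric]) simp
    finally have 2: "(\<Prod>i<N. if lab i = i \<and> \<alpha> i = 1 then - s else 1) = (\<Prod>i\<in>edge_reps lab. if \<alpha> i = 1 then - s else 1)" .
    let ?v = "\<lambda>t f. sg (face_sum lab x t f) * (if integral_face lab \<alpha> t f then 1 else - 1 / s)"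
    let ?c = "\<lambda>t f. integral_face lab \<alpha> t f \<longrightarrow> face_sum lab x t f = 0"
    have "(\<forall>k\<in>{..<4 * n}. ?c (k div 4) (k mod 4)) \<longleftrightarrow> (\<forall>t<n. \<forall>f<4. ?c t f)"
    proof
      assume L: "\<forall>k\<in>{..<4 * n}. ?c (k div 4) (k mod 4)"
      show "\<forall>t<n. \<forall>f<4. ?c t f"
      proof (intro allI impI)
        fix t f :: nat assume "t < n" "f < 4" "integral_face lab \<alpha> t f"
        then show "face_sum lab x t f = 0" using L[rule_format, of "4 * t + f"] by simp
      qed
    qed auto
    then have 3: "F x = (if \<forall>t<n. \<forall>f<4. ?c t f then
        \<Prod>k<4 * n. if leading_face (k div 4) (k mod 4) then ?v (k div 4) (k mod 4) else 1 else 0)"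
      unfolding F_def prod_if_all[OF finite_lessThan] by (simp only:)
    have "(\<Prod>k<4 * n. if leading_face (k div 4) (k mod 4) then ?v (k div 4) (k mod 4) else 1)
        = (\<Prod>t<n. \<Prod>f<4. if leading_face t f then ?v t f else 1)"
      by (rule prod_mult_4)
    also have "\<dots> = (\<Prod>p\<in>{..<n} \<times> {..<4}. if leading_face (fst p) (snd p) then ?v (fst p) (snd p) else 1)"
      by (simp add: prod.cartesian_product case_prod_beta)
    also have "\<dots> = (\<Prod>p\<in>{p \<in> {..<n} \<times> {..<4}. leading_face (fst p) (snd p)}. ?v (fst p) (snd p))"
      by (rule prod.inter_filter[symmetric]) simp
    also have "{p \<in> {..<n} \<times> {..<4}. leading_face (fst p) (snd p)} = {(t, f). t < tets T \<and> f < 4 \<and> leading_face t f}"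
      by (auto simp: n_def)
    finally have 4: "(\<Prod>k<4 * n. if leading_face (k div 4) (k mod 4) then ?v (k div 4) (k mod 4) else 1) =
      (\<Prod>(t, f)\<in>{(t, f). t < tets T \<and> f < 4 \<and> leading_face t f}. ?v t f)"
      by (simp only: case_prod_unfold)
    have 5: "G x = (\<Prod>t<tets T. sg (tet_sign lab x t) * (if integral_tet lab \<alpha> t then 1 else - s))"
      by (simp only: G_def tet_piece_def n_def)
    have 6: "x \<in> slot_refinements lab \<alpha> \<longleftrightarrow> (x \<in> bitfun (edge_reps lab) \<and> (\<forall>i. \<alpha> i = 1 \<longrightarrow> x i = 0)) \<and> (\<forall>t<n. \<forall>f<4. ?c t f)"
      unfolding slot_refinements_def n_def by blast
    have guard: "(if P then a else 0) * (if Q then b else 0) * c = (if P \<and> Q then a * b * c else 0)"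
      for P Q and a b c :: real by simp
    show "E x * F x * G x = (if x \<in> slot_refinements lab \<alpha> then slot_value s lab \<alpha> x else 0)"
      unfolding 1 2 3 4 5 6 slot_value_def by (rule guard)
  qed
  also have "\<dots> = (\<Sum>x\<in>{x \<in> bitfun {..<N}. x \<in> slot_refinements lab \<alpha>}. slot_value s lab \<alpha> x)"
    by (rule sum.inter_filter[symmetric]) (simp add: finite_bitfun)
  also have "{x \<in> bitfun {..<N}. x \<in> slot_refinements lab \<alpha>} = slot_refinements lab \<alpha>"
    by (auto simp: slot_refinements_def bitfun_def edge_reps_def N_def n_def)
  finally show ?thesis by (simp only: n_def)
qed

text \<open>
  One Gauss sum per cocycle.  The function \<open>F\<close> stands for whatever a program computes for these sums.
\<close>

theorem TV4_gauss_sum: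
  assumes q: "q \<in> {1, 3}" and v: "one_vertex T" and lab: "labelling lab h"
    and labN: "\<And>i. i < 16 * tets T \<Longrightarrow> lab i < 16 * tets T"
    and val: "\<And>\<alpha>. \<alpha> \<in> slot_cocycles lab \<Longrightarrow> F \<alpha> = (\<Sum>y\<in>bitfun {1..<1 + 36 * tets T}. piece_product (bracket2 q) lab \<alpha> y)"
  shows "TV4 q T = of_real (1 / 4 * ((\<Sum>\<alpha>\<in>slot_cocycles lab. F \<alpha>) / sqrt 2 ^ (48 * tets T)))"
proof -
  have "sqrt 2 ^ (48 * tets T) = (2::real) ^ (24 * tets T)"
    using power_mult[of "sqrt 2" 2 "24 * tets T"] by simp
  moreover have "F \<alpha> = 2 ^ (24 * tets T) * (\<Sum>x\<in>slot_refinements lab \<alpha>. slot_value (bracket2 q) lab \<alpha> x)"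
    if "\<alpha> \<in> slot_cocycles lab" for \<alpha>
    unfolding val[OF that] by (rule sum_piece_product[OF bracket2_square lab labN that])
  ultimately show ?thesis
    unfolding TV4_slot_sum[OF lab q v] by (simp add: sum_distrib_left[symmetric])
qed

end

section \<open>Labelling the edges\<close>

text \<open>
  The numbers of the word arrays.  A variable is cell \<open>0\<close> of an array of its own, and array \<open>0\<close> holds the
  number \<open>n\<close> of tetrahedra.  \<open>aN\<close> is the number \<open>16 n\<close> of slots, \<open>aD\<close> the size \<open>36 n + 1\<close> of the matrix \<open>aMAT\<close>, \<open>aL\<close>
  the number of rows in \<open>aROWS\<close>; \<open>aCTR\<close> holds the digits of the binary counter, \<open>aALPHA\<close> the current
  cocycle, and \<open>aLF\<close>, \<open>aMF\<close> the affine functions used in one step of the elimination.  The remaining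
  names are loop counters and temporary variables.
\<close>

abbreviation (input) "aNBR \<equiv> 1 :: nat"
abbreviation (input) "aGP \<equiv> 2 :: nat"
abbreviation (input) "aN \<equiv> 3 :: nat"
abbreviation (input) "aD \<equiv> 4 :: nat"
abbreviation (input) "aLAB \<equiv> 5 :: nat"
abbreviation (input) "aT \<equiv> 6 :: nat"
abbreviation (input) "aI \<equiv> 7 :: nat"
abbreviation (input) "aJ \<equiv> 8 :: nat"
abbreviation (input) "aK \<equiv> 9 :: nat"
abbreviation (input) "aX1 \<equiv> 10 :: nat"
abbreviation (input) "aX2 \<equiv> 11 :: nat"
abbreviation (input) "aX3 \<equiv> 12 :: nat"
abbreviation (input) "aROWS \<equiv> 13 :: nat"
abbreviation (input) "aL \<equiv> 14 :: nat"
abbreviation (input) "aPV \<equiv> 15 :: nat"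
abbreviation (input) "aU \<equiv> 16 :: nat"
abbreviation (input) "aCTR \<equiv> 17 :: nat"
abbreviation (input) "aALPHA \<equiv> 18 :: nat"
abbreviation (input) "aMAT \<equiv> 19 :: nat"
abbreviation (input) "aLF \<equiv> 20 :: nat"
abbreviation (input) "aMF \<equiv> 21 :: nat"
abbreviation (input) "aV \<equiv> 22 :: nat"
abbreviation (input) "aPIV \<equiv> 23 :: nat"
abbreviation (input) "aCARRY \<equiv> 24 :: nat"
abbreviation (input) "aDONE \<equiv> 25 :: nat"
abbreviation (input) "aP \<equiv> 26 :: nat"

abbreviation (input) put :: "nat \<Rightarrow> wexp \<Rightarrow> stm" where
  "put a e \<equiv> SW a (WConst 0) e"

definition slotE :: "nat \<Rightarrow> nat \<Rightarrow> wexp" where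
  "slotE a b = WAdd (WMul (WConst 16) (V aT)) (WConst (4 * a + b))"

definition nbrE :: "nat \<Rightarrow> wexp" where
  "nbrE f = WGet aNBR (WAdd (WMul (WConst 4) (V aT)) (WConst f))"

definition gpE :: "nat \<Rightarrow> nat \<Rightarrow> wexp" where
  "gpE f a = WGet aGP (WAdd (WMul (WConst 16) (V aT)) (WConst (4 * f + a)))"

text \<open>
  Both slots of an edge of a tetrahedron start with the number of the ordered one.  Diagonal slots get
  the label of the edge \<open>01\<close>, so that they are never fixed points of the labelling and every label is the
  number of a proper edge slot.
\<close>

definition init_label :: "nat \<times> nat \<Rightarrow> stm" where
  "init_label p = (case p of (a, b) \<Rightarrow> SW aLAB (slotE a b)
     (WAdd (WMul (WConst 16) (V aT)) (WConst (if a = b then 1 else 4 * min a b + max a b))))"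

definition all_pairs :: "(nat \<times> nat) list" where
  "all_pairs = List.product [0, 1, 2, 3] [0, 1, 2, 3]"

definition init_labels :: stm where
  "init_labels = SFor aT 0 (seqs (map init_label all_pairs))"

definition relabel_loop :: stm where
  "relabel_loop = SFor aI aN (SIf (BEq (WGet aLAB (V aI)) (V aX2)) (SW aLAB (V aI) (V aX1)) SSkip)"

text \<open>
  For the gluing of face \<open>f\<close> and its edge \<open>ab\<close>, the label class of the image edge is merged into that
  of \<open>ab\<close>.
\<close>

definition relabel :: "nat \<times> nat \<times> nat \<Rightarrow> stm" where
  "relabel z = (case z of (f, a, b) \<Rightarrow>
     SSeq (put aX1 (WGet aLAB (slotE a b)))
    (SSeq (put aX2 (WGet aLAB (WAdd (WAdd (WMul (WConst 16) (nbrE f)) (WMul (WConst 4) (gpE f a))) (gpE f b))))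
     relabel_loop))"

text \<open>
  All faces \<open>f\<close> of a tetrahedron together with an ordered edge \<open>ab\<close> of that face.
\<close>

definition all_corners :: "(nat \<times> nat \<times> nat) list" where
  "all_corners = filter (\<lambda>(f, a, b). a \<noteq> b \<and> a \<noteq> f \<and> b \<noteq> f) (List.product [0, 1, 2, 3] all_pairs)"

definition label_edges :: stm where
  "label_edges = SSeq init_labels (SFor aT 0 (seqs (map relabel all_corners)))"

lemma set_upto_4: "set [0, 1, 2, 3 :: nat] = {..<4}"
  by auto

lemma set_all_pairs: "set all_pairs = {..<4} \<times> {..<4}"
  unfolding all_pairs_def set_product set_upto_4 ..

lemma set_all_corners: "set all_corners = {(f, a, b). f < 4 \<and> a < 4 \<and> b < 4 \<and> a \<noteq> b \<and> a \<noteq> f \<and> b \<noteq> f}"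
  unfolding all_corners_def set_filter set_product set_upto_4 set_all_pairs by auto

text \<open>
  The bound \<open>M\<close> exceeds every number that the program stores, the largest being the output exponent
  \<open>48 n\<close>, and \<open>B = M * M\<close> exceeds every index, since all matrices have at most \<open>M\<close> rows and columns.
\<close>

locale machine = glued +
  fixes B M :: nat
  assumes tets_pos: "0 < tets T" and M_def: "M = 64 * tets T" and B_def: "B = M * M"
begin

lemma less_B: "x < 64 * tets T \<Longrightarrow> x < B"
proof -
  assume "x < 64 * tets T"
  also have "64 * tets T * 1 \<le> 64 * tets T * (64 * tets T)"
    by (rule mult_le_mono2) (use tets_pos in simp)
  finally show ?thesis by (simp add: B_def M_def)
qed

lemma B_pos [simp]: "0 < B"
  using tets_pos by (simp add: B_def M_def)

lemma index_less_B: "i < k \<Longrightarrow> j < k \<Longrightarrow> k \<le> 64 * tets T \<Longrightarrow> i * k + j < B"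
proof -
  assume 1: "i < k" "j < k" "k \<le> 64 * tets T"
  then have "i * k + j < i * k + k" by simp
  also have "\<dots> = Suc i * k" by simp
  also have "\<dots> \<le> k * k" using 1 by (intro mult_le_mono1) simp
  also have "\<dots> \<le> B" unfolding B_def M_def using 1 by (intro mult_le_mono)
  finally show ?thesis .
qed

definition tables :: "state \<Rightarrow> bool" where
  "tables s \<longleftrightarrow> fst s 0 0 = tets T \<and> fst s aN 0 = 16 * tets T \<and>
    (\<forall>t<tets T. \<forall>f<4. fst s aNBR (4 * t + f) = nbr T t f \<and>
       (\<forall>a<4. fst s aGP (16 * t + (4 * f + a)) = gperm T t f a))"

lemma tables_agree:
  assumes "agree A C s s'" "tables s" "0 \<notin> A" "aN \<notin> A" "aNBR \<notin> A" "aGP \<notin> A"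
  shows "tables s'"
  using assms by (simp add: tables_def agree_def)

lemma slot_eval:
  assumes "fst s aT 0 = t" "t < tets T" "a < 4" "b < 4"
  shows "ieval s (slotE a b) = slot t a b" "wok B s (slotE a b)" "slot t a b < B"
    "slot t a b < 16 * tets T"
proof -
  show l: "slot t a b < 16 * tets T" using assms by (simp add: slot_less)
  then show "slot t a b < B" by (intro less_B) linarith
qed (use assms in \<open>simp_all add: slotE_def slot_def\<close>)

lemma nbr_eval:
  assumes "tables s" "fst s aT 0 = t" "t < tets T" "f < 4"
  shows "ieval s (nbrE f) = nbr T t f" "wok B s (nbrE f)"
proof -
  have "4 * t + f < 64 * tets T" using assms by linarith
  then have "4 * t + f < B" by (rule less_B)
  then show "ieval s (nbrE f) = nbr T t f" "wok B s (nbrE f)"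
    using assms by (simp_all add: nbrE_def tables_def)
qed

lemma gp_eval:
  assumes "tables s" "fst s aT 0 = t" "t < tets T" "f < 4" "a < 4"
  shows "ieval s (gpE f a) = gperm T t f a" "wok B s (gpE f a)"
proof -
  have "16 * t + (4 * f + a) < 64 * tets T" using assms by linarith
  then have "16 * t + (4 * f + a) < B" by (rule less_B)
  then show "ieval s (gpE f a) = gperm T t f a" "wok B s (gpE f a)"
    using assms by (simp_all add: gpE_def tables_def)
qed

text \<open>
  The edge at a slot, decoded from the number of the slot.
\<close>

definition slot_cell :: "nat \<Rightarrow> tri_cell" where
  "slot_cell k = cell T (k div 16) {k div 4 mod 4, k mod 4}"

definition off_diagonal :: "nat \<Rightarrow> bool" where
  "off_diagonal k \<longleftrightarrow> k div 4 mod 4 \<noteq> k mod 4"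

lemma slot_parts:
  assumes "a < 4" "b < 4"
  shows "slot t a b div 16 = t" "slot t a b div 4 mod 4 = a" "slot t a b mod 4 = b"
  using assms unfolding slot_def by presburger+

lemma slot_cell: "a < 4 \<Longrightarrow> b < 4 \<Longrightarrow> slot_cell (slot t a b) = cell T t {a, b}"
  by (simp add: slot_cell_def slot_parts)

lemma off_diagonal: "a < 4 \<Longrightarrow> b < 4 \<Longrightarrow> off_diagonal (slot t a b) \<longleftrightarrow> a \<noteq> b"
  by (simp add: off_diagonal_def slot_parts)

lemma slot_cases:
  assumes "k < 16 * tets T"
  obtains t a b where "t < tets T" "a < 4" "b < 4" "k = slot t a b"
proof
  show "k div 16 < tets T" using assms by (simp add: less_mult_imp_div_less mult.commute)
  show "k = slot (k div 16) (k div 4 mod 4) (k mod 4)"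
  proof -
    have "k div 16 = k div 4 div 4" using div_mult2_eq[of k 4 4] by simp
    then show ?thesis
      unfolding slot_def using div_mult_mod_eq[of "k div 4" 4] div_mult_mod_eq[of k 4] by linarith
  qed
qed auto

text \<open>
  The invariant of the relabelling: labels are numbers of proper edge slots, a proper slot is labelled
  by a slot of the same edge, and both orders of the end points have the same label.
\<close>

definition label_inv :: "(nat \<Rightarrow> nat) \<Rightarrow> bool" where
  "label_inv lab \<longleftrightarrow> (\<forall>k<16 * tets T. lab k < 16 * tets T \<and> off_diagonal (lab k) \<and>
     (off_diagonal k \<longrightarrow> slot_cell (lab k) = slot_cell k)) \<and>
     (\<forall>t<tets T. \<forall>a<4. \<forall>b<4. lab (slot t a b) = lab (slot t b a))"

definition glued_labels :: "(nat \<Rightarrow> nat) \<Rightarrow> nat \<Rightarrow> nat \<times> nat \<times> nat \<Rightarrow> bool" where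
  "glued_labels lab t z \<longleftrightarrow> (case z of (f, a, b) \<Rightarrow>
     lab (slot t a b) = lab (slot (nbr T t f) (gperm T t f a) (gperm T t f b)))"

text \<open>
  Merging never separates slots, so gluings that have been dealt with stay dealt with.
\<close>

definition coarser :: "(nat \<Rightarrow> nat) \<Rightarrow> (nat \<Rightarrow> nat) \<Rightarrow> bool" where
  "coarser lab lab' \<longleftrightarrow> (\<forall>i<16 * tets T. \<forall>j<16 * tets T. lab i = lab j \<longrightarrow> lab' i = lab' j)"

lemma glued_labels_coarser:
  assumes "glued_labels lab t z" "coarser lab lab'" "t < tets T" "z \<in> set all_corners"
  shows "glued_labels lab' t z"
proof -
  obtain f a b where z: "z = (f, a, b)" "f < 4" "a < 4" "b < 4" using assms(4) by (auto simp: set_all_corners)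
  have "slot t a b < 16 * tets T" "slot (nbr T t f) (gperm T t f a) (gperm T t f b) < 16 * tets T"
    using z assms(3) gluing_props(1) gperm_less by (simp_all add: slot_less)
  then show ?thesis using assms(1,2) unfolding glued_labels_def coarser_def z(1) prod.case by blast
qed

lemma label_inv_relabel:
  assumes inv: "label_inv lab" and t: "t < tets T" and z: "(f, a, b) \<in> set all_corners"
    and lab': "\<And>k. k < 16 * tets T \<Longrightarrow> lab' k =
      (if lab k = lab (slot (nbr T t f) (gperm T t f a) (gperm T t f b)) then lab (slot t a b) else lab k)"
  shows "label_inv lab'" "coarser lab lab'" "glued_labels lab' t (f, a, b)"
proof -
  let ?u = "nbr T t f" and ?p = "gperm T t f"
  have z': "f < 4" "a < 4" "b < 4" "a \<noteq> b" "a \<noteq> f" "b \<noteq> f" using z by (auto simp: set_all_corners)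
  have p: "?u < tets T" "?p a < 4" "?p b < 4" "?p a \<noteq> ?p b"
    using t z' gluing_props(1) gperm_less inj_gperm[OF t z'(1)] by (auto dest: injD)
  let ?i = "slot t a b" and ?j = "slot ?u (?p a) (?p b)"
  have ij: "?i < 16 * tets T" "?j < 16 * tets T" "off_diagonal ?i" "off_diagonal ?j"
    using t z' p by (simp_all add: slot_less off_diagonal)
  have "cell T ?u (?p ` {a, b}) = cell T t {a, b}" by (rule cell_step) (use t z' in auto)
  then have eq: "slot_cell ?i = slot_cell ?j" using z' p by (simp add: slot_cell)
  show "coarser lab lab'" by (simp add: coarser_def lab')
  show "glued_labels lab' t (f, a, b)" using ij by (simp add: glued_labels_def lab')
  show "label_inv lab'"
    unfolding label_inv_def
  proof (intro conjI allI impI)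
    fix k assume k: "k < 16 * tets T"
    note I = inv[unfolded label_inv_def, THEN conjunct1, rule_format]
    show "lab' k < 16 * tets T" "off_diagonal (lab' k)" using I[OF k] I[OF ij(1)] by (simp_all add: lab'[OF k])
    assume "off_diagonal k"
    then show "slot_cell (lab' k) = slot_cell k"
      using I[OF k] I[OF ij(1)] I[OF ij(2)] ij eq unfolding lab'[OF k]
      by (cases "lab k = lab ?j") simp_all
  next
    fix t a b :: nat assume "t < tets T" "a < 4" "b < 4"
    then have "lab (slot t a b) = lab (slot t b a)" "slot t a b < 16 * tets T" "slot t b a < 16 * tets T"
      using inv by (simp_all add: label_inv_def slot_less)
    then show "lab' (slot t a b) = lab' (slot t b a)" by (simp add: lab')
  qed
qed

text \<open>
  When all gluings have been dealt with, the set of labels of an edge is invariant under gluing, hence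
  slots of the same edge have the same label.  By the invariant, a label is itself a slot of that
  edge, so it is its own label.
\<close>

lemma labelling_slot_cell:
  assumes inv: "label_inv lab"
    and gl: "\<And>t z. t < tets T \<Longrightarrow> z \<in> set all_corners \<Longrightarrow> glued_labels lab t z"
  shows "labelling lab slot_cell"
proof -
  have I: "lab k < 16 * tets T" "off_diagonal (lab k)" "off_diagonal k \<Longrightarrow> slot_cell (lab k) = slot_cell k"
    if "k < 16 * tets T" for k using inv that by (simp_all add: label_inv_def)
  have sym: "lab (slot t a b) = lab (slot t b a)" if "t < tets T" "a < 4" "b < 4" for t a b
    using inv that by (simp add: label_inv_def)
  let ?g = "\<lambda>t A. {lab (slot t a b) | a b. a \<noteq> b \<and> A = {a, b}}"
  have g: "?g t {a, b} = {lab (slot t a b)}" if "t < tets T" "a < 4" "b < 4" "a \<noteq> b" for t a b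
    using sym[OF that(1-3)] that(4) by (auto simp: doubleton_eq_iff)
  have lab_eq: "lab (slot t a b) = lab (slot u c d)"
    if eq: "cell T t {a, b} = cell T u {c, d}" and "t < tets T" "a < 4" "b < 4" "a \<noteq> b"
      "u < tets T" "c < 4" "d < 4" "c \<noteq> d" for t a b u c d
  proof -
    have "?g u {c, d} = ?g t {a, b}"
      using eq
    proof (rule cell_invariant)
      fix t f A assume 1: "t < tets T" "f < 4" "A \<subseteq> {..<4::nat}" "f \<notin> A"
      let ?u = "nbr T t f" and ?p = "gperm T t f"
      have inj: "inj ?p" using 1 inj_gperm by simp
      have step: "lab (slot ?u (?p a) (?p b)) = lab (slot t a b)" if "a \<noteq> b" "A = {a, b}" for a b
      proof -
        have "(f, a, b) \<in> set all_corners" using 1 that by (auto simp: set_all_corners)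
        then show ?thesis using gl[OF 1(1)] by (auto simp: glued_labels_def)
      qed
      show "?g ?u (?p ` A) = ?g t A"
      proof (intro subset_antisym subsetI)
        fix x assume "x \<in> ?g ?u (?p ` A)"
        then obtain c d where cd: "x = lab (slot ?u c d)" "c \<noteq> d" "?p ` A = {c, d}" by blast
        then obtain a b where ab: "a \<in> A" "b \<in> A" "c = ?p a" "d = ?p b" by blast
        have "A = {a, b}"
        proof
          show "A \<subseteq> {a, b}"
          proof
            fix z assume "z \<in> A"
            then have "?p z \<in> {?p a, ?p b}" using cd(3) ab by blast
            then show "z \<in> {a, b}" using inj by (auto dest: injD)
          qed
        qed (use ab in blast)
        moreover have "a \<noteq> b" using ab cd(2) by blast
        ultimately show "x \<in> ?g t A" using step cd(1) ab by blast
      next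
        fix x assume "x \<in> ?g t A"
        then obtain a b where ab: "x = lab (slot t a b)" "a \<noteq> b" "A = {a, b}" by blast
        then have "x = lab (slot ?u (?p a) (?p b))" "?p a \<noteq> ?p b" "?p ` A = {?p a, ?p b}"
          using step inj by (auto dest: injD)
        then show "x \<in> ?g ?u (?p ` A)" by blast
      qed
    qed
    then show ?thesis using g that by simp
  qed
  have lab_eq': "lab i = lab j" if "i < 16 * tets T" "j < 16 * tets T" "off_diagonal i" "off_diagonal j"
    "slot_cell i = slot_cell j" for i j
  proof -
    note h = that(1,2)
    obtain t a b where 1: "t < tets T" "a < 4" "b < 4" "i = slot t a b"
      by (rule slot_cases[OF h(1)])
    obtain u c d where 2: "u < tets T" "c < 4" "d < 4" "j = slot u c d"
      by (rule slot_cases[OF h(2)])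
    show ?thesis
      unfolding 1(4) 2(4) by (rule lab_eq) (use 1 2 that in \<open>simp_all add: slot_cell off_diagonal\<close>)
  qed
  have rep: "lab (lab k) = lab k" if "k < 16 * tets T" "off_diagonal k" for k
    by (rule lab_eq') (use I[OF that(1)] that in simp_all)
  have reps: "lab (slot t a b) \<in> edge_reps lab \<and> slot_cell (lab (slot t a b)) = cell T t {a, b}"
    if "t < tets T" "a < 4" "b < 4" "a \<noteq> b" for t a b
    using rep[of "slot t a b"] I[of "slot t a b"] that
    by (simp add: slot_less off_diagonal slot_cell edge_reps_def)
  have "bij_betw slot_cell (edge_reps lab) (cells T 1)"
  proof (rule bij_betw_imageI)
    show "inj_on slot_cell (edge_reps lab)"
    proof (rule inj_onI)
      fix i j assume 1: "i \<in> edge_reps lab" "j \<in> edge_reps lab" "slot_cell i = slot_cell j"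
      then have "lab i = i" "lab j = j" "i < 16 * tets T" "j < 16 * tets T" by (simp_all add: edge_reps_def)
      then show "i = j" using lab_eq'[of i j] I(2)[of i] I(2)[of j] 1(3) by simp
    qed
    show "slot_cell ` edge_reps lab = cells T 1"
    proof (intro subset_antisym subsetI)
      fix c assume "c \<in> slot_cell ` edge_reps lab"
      then obtain i where i: "c = slot_cell i" "i < 16 * tets T" "lab i = i" by (auto simp: edge_reps_def)
      then have "off_diagonal i" using I(2)[of i] by simp
      moreover obtain t a b where "t < tets T" "a < 4" "b < 4" "i = slot t a b" by (rule slot_cases[OF i(2)])
      ultimately show "c \<in> cells T 1" using i(1) edge_in_cells by (simp add: slot_cell off_diagonal)
    next
      fix c assume "c \<in> cells T 1"
      then obtain t A where A: "c = cell T t A" "t < tets T" "A \<subseteq> {..<4}" "card A = 2"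
        by (auto simp: cells_def numeral_2_eq_2)
      then obtain a b where ab: "A = {a, b}" "a \<noteq> b" by (auto simp: card_2_iff)
      then have "a < 4" "b < 4" using A(3) by auto
      then show "c \<in> slot_cell ` edge_reps lab"
        using reps[OF A(2)] ab A(1) by (intro image_eqI[of _ _ "lab (slot t a b)"]) simp_all
    qed
  qed
  then show ?thesis unfolding labelling_def using reps by blast
qed

lemma wmods_relabel: "wmods (relabel z) = {aX1, aX2, aI, aLAB}" "zmods (relabel z) = {}"
  by (auto simp: relabel_def relabel_loop_def split: prod.splits)

lemma wmods_relabels: "wmods (seqs (map relabel zs)) \<subseteq> {aX1, aX2, aI, aLAB}" "zmods (seqs (map relabel zs)) = {}"
  by (auto simp: seqs_simps wmods_relabel)

lemma wmods_init_label: "wmods (init_label z) = {aLAB}" "zmods (init_label z) = {}"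
  by (auto simp: init_label_def split: prod.splits)

lemma wmods_init_labels: "wmods (seqs (map init_label zs)) \<subseteq> {aLAB}" "zmods (seqs (map init_label zs)) = {}"
  by (auto simp: seqs_simps wmods_init_label)

lemma wp_relabel:
  assumes tab: "tables s" and t: "fst s aT 0 = t" "t < tets T" and inv: "label_inv (fst s aLAB)"
    and z: "z \<in> set all_corners"
    and Q: "\<And>s'. agree (wmods (relabel z)) (zmods (relabel z)) s s' \<Longrightarrow> label_inv (fst s' aLAB) \<Longrightarrow>
      coarser (fst s aLAB) (fst s' aLAB) \<Longrightarrow> glued_labels (fst s' aLAB) t z \<Longrightarrow> Q s'"
  shows "wp B M (relabel z) Q s"
proof -
  obtain f a b where zz: "z = (f, a, b)" "f < 4" "a < 4" "b < 4" using z by (auto simp: set_all_corners)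
  let ?lab = "fst s aLAB" and ?i = "slot t a b" and ?j = "slot (nbr T t f) (gperm T t f a) (gperm T t f b)"
  have n: "fst s aN 0 = 16 * tets T" using tab by (simp add: tables_def)
  have j: "?j < 16 * tets T" using zz t gluing_props(1) gperm_less by (simp add: slot_less)
  then have jB: "?j < B" by (intro less_B) linarith
  note e1 = slot_eval[OF t zz(3,4)]
  have labM: "?lab k \<le> M" if "k < 16 * tets T" for k
  proof -
    have "?lab k < 16 * tets T" using inv that by (simp add: label_inv_def)
    then show ?thesis by (simp add: M_def)
  qed
  let ?s1 = "wupd s aX1 0 (?lab ?i)"
  let ?s2 = "wupd ?s1 aX2 0 (?lab ?j)"
  have tab1: "tables ?s1" using tab by (simp add: tables_def)
  have "wp B M relabel_loop Q ?s2"
    unfolding relabel_loop_def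
  proof (rule wp_For_agree[where A = "{aLAB}" and C = "{}" and I = "\<lambda>i s'. \<forall>k<16 * tets T. fst s' aLAB k =
      (if k < i \<and> ?lab k = ?lab ?j then ?lab ?i else ?lab k)"])
    fix i s'
    assume 1: "i < fst ?s2 aN 0" "fst s' aI 0 = i"
      and ag: "agree {aI, aLAB} {} ?s2 s'"
      and I: "\<forall>k<16 * tets T. fst s' aLAB k = (if k < i \<and> ?lab k = ?lab ?j then ?lab ?i else ?lab k)"
    have i: "i < 16 * tets T" using 1 n by simp
    then have "i < B" by (intro less_B) linarith
    moreover have "fst s' aX1 0 = ?lab ?i" "fst s' aX2 0 = ?lab ?j" using ag by (simp_all add: agree_def)
    moreover have "fst s' aLAB i = ?lab i" using I i by simp
    ultimately show "wp B M (SIf (BEq (WGet aLAB (V aI)) (V aX2)) (SW aLAB (V aI) (V aX1)) SSkip)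
          (\<lambda>s''. \<forall>k<16 * tets T. fst (wupd s'' aI 0 (Suc i)) aLAB k =
             (if k < Suc i \<and> ?lab k = ?lab ?j then ?lab ?i else ?lab k)) s'"
      using I i 1(2) labM[OF e1(4)] by (auto simp: less_Suc_eq)
  next
    fix s'
    assume ag: "agree {aI, aLAB} {} ?s2 s'"
      and I: "\<forall>k<16 * tets T. fst s' aLAB k = (if k < fst ?s2 aN 0 \<and> ?lab k = ?lab ?j then ?lab ?i else ?lab k)"
    have lab': "fst s' aLAB k = (if ?lab k = ?lab ?j then ?lab ?i else ?lab k)" if "k < 16 * tets T" for k
      using I that n by simp
    show "Q s'"
      by (rule Q; (unfold zz(1))?; (rule label_inv_relabel[OF inv t(2) z[unfolded zz(1)] lab'])?)
        (use ag in \<open>auto simp: agree_def wmods_relabel\<close>)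
  qed simp_all
  moreover have "wok B ?s1 (WAdd (WAdd (WMul (WConst 16) (nbrE f)) (WMul (WConst 4) (gpE f a))) (gpE f b))"
    "ieval ?s1 (WAdd (WAdd (WMul (WConst 16) (nbrE f)) (WMul (WConst 4) (gpE f a))) (gpE f b)) = ?j"
    using nbr_eval[OF tab1, of t f] gp_eval[OF tab1, of t f] zz t by (simp_all add: slot_def)
  ultimately show ?thesis
    using e1 jB j labM by (simp add: relabel_def zz(1) del: wok.simps(3) ieval.simps(3))
qed

lemma wp_label_edges:
  assumes tab: "tables s"
    and Q: "\<And>s'. agree {aX1, aX2, aI, aT, aLAB} {} s s' \<Longrightarrow> label_inv (fst s' aLAB) \<Longrightarrow>
      (\<And>t z. t < tets T \<Longrightarrow> z \<in> set all_corners \<Longrightarrow> glued_labels (fst s' aLAB) t z) \<Longrightarrow> Q s'"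
  shows "wp B M label_edges Q s"
proof -
  (* the initial labels, where 01 is the edge that lends its number to the diagonal slots *)
  define v where "v t a b = (if a = b then slot t 0 1 else slot t (min a b) (max a b))" for t a b
  have n: "fst s 0 0 = tets T" using tab by (simp add: tables_def)
  have 2: "wp B M (SFor aT 0 (seqs (map relabel all_corners))) Q s1"
    if ag1: "agree {aT, aLAB} {} s s1" and inv1: "label_inv (fst s1 aLAB)" for s1
  proof (rule wp_For_agree[where A = "{aX1, aX2, aI, aLAB}" and C = "{}" and I = "\<lambda>t s'. label_inv (fst s' aLAB) \<and>
      (\<forall>t'<t. \<forall>z\<in>set all_corners. glued_labels (fst s' aLAB) t' z)"])
    have tab1: "tables s1" by (rule tables_agree[OF ag1 tab]) auto
    have n1: "fst s1 0 0 = tets T" using tab1 by (simp add: tables_def)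
    fix t s'
    assume t: "t < fst s1 0 0" "fst s' aT 0 = t"
      and ag: "agree {aT, aX1, aX2, aI, aLAB} {} s1 s'"
      and I: "label_inv (fst s' aLAB) \<and> (\<forall>t'<t. \<forall>z\<in>set all_corners. glued_labels (fst s' aLAB) t' z)"
    have tt: "t < tets T" using t n1 by simp
    have tab': "tables s'" by (rule tables_agree[OF ag tab1]) auto
    show "wp B M (seqs (map relabel all_corners)) (\<lambda>s''. label_inv (fst (wupd s'' aT 0 (Suc t)) aLAB) \<and>
      (\<forall>t'<Suc t. \<forall>z\<in>set all_corners. glued_labels (fst (wupd s'' aT 0 (Suc t)) aLAB) t' z)) s'"
    proof (rule wp_seqs_agree[where A = "{aX1, aX2, aI, aLAB}" and C = "{}" and I = "\<lambda>ys s''. label_inv (fst s'' aLAB) \<and>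
        (\<forall>t'<t. \<forall>z\<in>set all_corners. glued_labels (fst s'' aLAB) t' z) \<and> (\<forall>z\<in>set ys. glued_labels (fst s'' aLAB) t z)"])
      fix ys x zs s2
      assume sp: "all_corners = ys @ x # zs"
        and ag2: "agree {aX1, aX2, aI, aLAB} {} s' s2"
        and I2: "label_inv (fst s2 aLAB) \<and> (\<forall>t'<t. \<forall>z\<in>set all_corners. glued_labels (fst s2 aLAB) t' z) \<and>
          (\<forall>z\<in>set ys. glued_labels (fst s2 aLAB) t z)"
      have sub: "set ys \<subseteq> set all_corners" "x \<in> set all_corners" unfolding sp by auto
      have tab2: "tables s2" by (rule tables_agree[OF ag2 tab']) auto
      have t2: "fst s2 aT 0 = t" using ag2 t(2) by (simp add: agree_def)
      show "wp B M (relabel x) (\<lambda>s''. label_inv (fst s'' aLAB) \<and>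
        (\<forall>t'<t. \<forall>z\<in>set all_corners. glued_labels (fst s'' aLAB) t' z) \<and>
        (\<forall>z\<in>set (ys @ [x]). glued_labels (fst s'' aLAB) t z)) s2"
      proof (rule wp_relabel[OF tab2 t2 tt conjunct1[OF I2] sub(2)], intro conjI allI impI ballI)
        fix s3 t' z
        assume c: "coarser (fst s2 aLAB) (fst s3 aLAB)" and new: "glued_labels (fst s3 aLAB) t x"
        { assume "t' < t" "z \<in> set all_corners"
          then show "glued_labels (fst s3 aLAB) t' z"
            using glued_labels_coarser[OF _ c] I2 tt by simp }
        { assume "z \<in> set (ys @ [x])"
          then consider "z \<in> set ys" | "z = x" by auto
          then show "glued_labels (fst s3 aLAB) t z"
          proof cases
            case 1
            then have "z \<in> set all_corners" "glued_labels (fst s2 aLAB) t z" using sub(1) I2 by blast+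
            then show ?thesis using glued_labels_coarser[OF _ c tt] by blast
          qed (use new in simp) }
      qed
    qed (use I in \<open>simp_all add: less_Suc_eq wmods_relabel\<close>)
  next
    fix s'
    assume ag: "agree {aT, aX1, aX2, aI, aLAB} {} s1 s'"
      and I: "label_inv (fst s' aLAB) \<and> (\<forall>t'<fst s1 0 0. \<forall>z\<in>set all_corners. glued_labels (fst s' aLAB) t' z)"
    have "fst s1 0 0 = tets T" using ag1 n by (simp add: agree_def)
    moreover have "agree {aX1, aX2, aI, aT, aLAB} {} s s'"
      using ag ag1 by (simp add: agree_def)
    ultimately show "Q s'" using I by (intro Q) auto
  qed (use inv1 wmods_relabels[of all_corners] in auto)
  have "wp B M init_labels (wp B M (SFor aT 0 (seqs (map relabel all_corners))) Q) s"
    unfolding init_labels_def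
  proof (rule wp_For_agree[where A = "{aLAB}" and C = "{}" and I = "\<lambda>t s'. \<forall>t'<t. \<forall>a<4. \<forall>b<4. fst s' aLAB (slot t' a b) = v t' a b"])
    fix t and s' :: state
    assume t: "t < fst s 0 0" "fst s' aT 0 = t"
      and I: "\<forall>t'<t. \<forall>a<4. \<forall>b<4. fst s' aLAB (slot t' a b) = v t' a b"
    have tt: "t < tets T" using t n by simp
    have sd: "slot t' a b \<noteq> slot t c d" if "(t', a, b) \<noteq> (t, c, d)" "a < 4" "b < 4" "c < 4" "d < 4" for t' a b c d
      using that slot_parts[of a b t'] slot_parts[of c d t] by metis
    show "wp B M (seqs (map init_label all_pairs))
      (\<lambda>s''. \<forall>t'<Suc t. \<forall>a<4. \<forall>b<4. fst (wupd s'' aT 0 (Suc t)) aLAB (slot t' a b) = v t' a b) s'"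
    proof (rule wp_seqs_agree[where A = "{aLAB}" and C = "{}" and I = "\<lambda>ys s''. (\<forall>t'<t. \<forall>a<4. \<forall>b<4. fst s'' aLAB (slot t' a b) = v t' a b) \<and>
        (\<forall>(a, b)\<in>set ys. fst s'' aLAB (slot t a b) = v t a b)"])
      fix ys x zs s2
      assume sp: "all_pairs = ys @ x # zs"
        and ag2: "agree {aLAB} {} s' s2"
        and I2: "(\<forall>t'<t. \<forall>a<4. \<forall>b<4. fst s2 aLAB (slot t' a b) = v t' a b) \<and>
          (\<forall>(a, b)\<in>set ys. fst s2 aLAB (slot t a b) = v t a b)"
      obtain c d where x: "x = (c, d)" by (cases x)
      have "x \<in> set all_pairs" by (simp add: sp)
      then have cd: "c < 4" "d < 4" by (auto simp: x set_all_pairs)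
      have ys: "a < 4 \<and> b < 4" if "(a, b) \<in> set ys" for a b
      proof -
        have "(a, b) \<in> set all_pairs" using that by (simp add: sp)
        then show ?thesis by (simp add: set_all_pairs)
      qed
      have t2: "fst s2 aT 0 = t" using ag2 t(2) by (simp add: agree_def)
      note e = slot_eval[OF t2 tt cd]
      have "min c d < 4" "max c d < 4" using cd by auto
      then have "v t c d < 16 * tets T" unfolding v_def using slot_less[OF tt] by simp
      then have vM: "v t c d \<le> M" by (simp add: M_def)
      let ?e = "WAdd (WMul (WConst 16) (V aT)) (WConst (if c = d then 1 else 4 * min c d + max c d))"
      have ve: "ieval s2 ?e = v t c d"
        using t2 by (simp add: v_def slot_def)
      have body: "init_label x = SW aLAB (slotE c d) ?e" by (simp add: init_label_def x)
      let ?s3 = "wupd s2 aLAB (slot t c d) (v t c d)"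
      have a1: "\<forall>t'<t. \<forall>a<4. \<forall>b<4. fst ?s3 aLAB (slot t' a b) = v t' a b"
      proof (intro allI impI)
        fix t' a b :: nat assume 1: "t' < t" "a < 4" "b < 4"
        then have "slot t' a b \<noteq> slot t c d" using sd[of t' a b c d] cd by simp
        then show "fst ?s3 aLAB (slot t' a b) = v t' a b" using I2 1 by simp
      qed
      have "fst ?s3 aLAB (slot t a b) = v t a b" if "(a, b) \<in> set (ys @ [x])" for a b
      proof (cases "(a, b) = (c, d)")
        case False
        then have 1: "(a, b) \<in> set ys" using that x by auto
        then have "slot t a b \<noteq> slot t c d" using sd[of t a b c d] ys cd False by simp
        then show ?thesis using I2 1 by auto
      qed simp
      then have a2: "\<forall>(a, b)\<in>set (ys @ [x]). fst ?s3 aLAB (slot t a b) = v t a b" by blast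
      show "wp B M (init_label x) (\<lambda>s''. (\<forall>t'<t. \<forall>a<4. \<forall>b<4. fst s'' aLAB (slot t' a b) = v t' a b) \<and>
        (\<forall>(a, b)\<in>set (ys @ [x]). fst s'' aLAB (slot t a b) = v t a b)) s2"
        unfolding body wp_simps(2) ve e(1)
        by (intro conjI; (rule a1 | rule a2 | rule e(2) | rule e(3) | rule vM | simp))
    qed (use I in \<open>auto simp: less_Suc_eq set_all_pairs wmods_init_label\<close>)
  next
    fix s1
    assume ag: "agree {aT, aLAB} {} s s1"
      and I: "\<forall>t'<fst s 0 0. \<forall>a<4. \<forall>b<4. fst s1 aLAB (slot t' a b) = v t' a b"
    have "agree {aT, aLAB} {} s s1"
      using ag by (simp add: agree_def)
    moreover have "label_inv (fst s1 aLAB)"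
      unfolding label_inv_def
    proof (intro conjI allI impI)
      fix k assume "k < 16 * tets T"
      then obtain t a b where k: "t < tets T" "a < 4" "b < 4" "k = slot t a b" by (rule slot_cases)
      have mm: "min a b < 4" "max a b < 4" "a \<noteq> b \<Longrightarrow> min a b \<noteq> max a b"
        using k by (auto simp: min_def max_def)
      have vk: "fst s1 aLAB k = v t a b" using I k n by simp
      show "fst s1 aLAB k < 16 * tets T" unfolding vk v_def using k mm by (simp add: slot_less)
      show "off_diagonal (fst s1 aLAB k)" unfolding vk v_def using k mm by (simp add: off_diagonal)
      assume "off_diagonal k"
      then have "a \<noteq> b" using k by (simp add: off_diagonal)
      moreover have "{min a b, max a b} = {a, b}" by (auto simp: min_def max_def)
      ultimately show "slot_cell (fst s1 aLAB k) = slot_cell k"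
        unfolding vk v_def using k mm by (simp add: slot_cell)
    next
      fix t a b :: nat assume "t < tets T" "a < 4" "b < 4"
      then show "fst s1 aLAB (slot t a b) = fst s1 aLAB (slot t b a)"
        using I n by (simp add: v_def min.commute max.commute)
    qed
    ultimately show "wp B M (SFor aT 0 (seqs (map relabel all_corners))) Q s1" by (rule 2)
  qed (use wmods_init_labels[of all_pairs] in auto)
  then show ?thesis by (simp only: label_edges_def wp_simps)
qed

end

section \<open>A basis of the cocycles\<close>

text \<open>
  A loop that stores \<open>val i\<close> at position \<open>idx i\<close>.  All loops that fill a row, a column or a table have
  this form.  During the loop, positions not yet reached still hold their old values, which allows
  updates in place.
\<close>

lemma wp_map_loop:
  assumes "x \<noteq> b" "A \<noteq> x" "A \<noteq> b" "0 < B" "n = fst s b 0" and inj: "inj_on idx {..<n}"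
    and step: "\<And>i s'. i < n \<Longrightarrow> agree {x, A} {} s s' \<Longrightarrow> fst s' x 0 = i \<Longrightarrow>
      (\<And>k. k \<notin> idx ` {..<i} \<Longrightarrow> fst s' A k = fst s A k) \<Longrightarrow>
      wok B s' ie \<and> wok B s' ve \<and> ieval s' ie = idx i \<and> idx i < B \<and> ieval s' ve = val i \<and> val i \<le> M"
    and post: "\<And>s'. agree {x, A} {} s s' \<Longrightarrow> (\<And>i. i < n \<Longrightarrow> fst s' A (idx i) = val i) \<Longrightarrow>
      (\<And>k. k \<notin> idx ` {..<n} \<Longrightarrow> fst s' A k = fst s A k) \<Longrightarrow> Q s'"
  shows "wp B M (SFor x b (SW A ie ve)) Q s"
proof (rule wp_For_agree[where A = "{A}" and C = "{}" and I = "\<lambda>i s'. (\<forall>j<i. fst s' A (idx j) = val j) \<and>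
    (\<forall>k. k \<notin> idx ` {..<i} \<longrightarrow> fst s' A k = fst s A k)"])
  fix i s'
  assume 1: "i < fst s b 0" "agree {x, A} {} s s'" "fst s' x 0 = i"
    and I: "(\<forall>j<i. fst s' A (idx j) = val j) \<and> (\<forall>k. k \<notin> idx ` {..<i} \<longrightarrow> fst s' A k = fst s A k)"
  have i: "i < n" using 1(1) assms(5) by simp
  have st: "wok B s' ie" "wok B s' ve" "ieval s' ie = idx i" "idx i < B" "ieval s' ve = val i" "val i \<le> M"
    using step[OF i 1(2,3)] I by blast+
  have "idx j \<noteq> idx i" if "j < i" for j
    using inj_onD[OF inj, of j i] that i by auto
  then show "wp B M (SW A ie ve) (\<lambda>s''. (\<forall>j<Suc i. fst (wupd s'' x 0 (Suc i)) A (idx j) = val j) \<and>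
    (\<forall>k. k \<notin> idx ` {..<Suc i} \<longrightarrow> fst (wupd s'' x 0 (Suc i)) A k = fst s A k)) s'"
    using st I assms(2) by (auto simp: less_Suc_eq lessThan_Suc)
next
  fix s' assume "agree {x, A} {} s s'"
    and "(\<forall>j<fst s b 0. fst s' A (idx j) = val j) \<and> (\<forall>k. k \<notin> idx ` {..<fst s b 0} \<longrightarrow> fst s' A k = fst s A k)"
  then show "Q s'" using assms(5) by (intro post) auto
qed (use assms in auto)

text \<open>
  Addition of bits with truncated subtraction, which keeps the value a bit.
\<close>

definition xorE :: "wexp \<Rightarrow> wexp \<Rightarrow> wexp" where
  "xorE e f = WAdd (WSub e f) (WSub f e)"

definition bxor :: "nat \<Rightarrow> nat \<Rightarrow> nat" where
  "bxor a b = (a - b) + (b - a)"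

lemma xorE [simp]:
  "ieval s (xorE e f) = bxor (ieval s e) (ieval s f)"
  "wok B s (xorE e f) \<longleftrightarrow> wok B s e \<and> wok B s f"
  by (auto simp: xorE_def bxor_def)

lemma xor_bits:
  assumes "a \<le> Suc 0" "b \<le> Suc 0"
  shows "bxor a b \<le> Suc 0" "of_nat (bxor a b) = (of_nat a + of_nat b :: bit)"
proof -
  have "a = 0 \<or> a = 1" "b = 0 \<or> b = 1" using assms by auto
  then show "bxor a b \<le> Suc 0" "of_nat (bxor a b) = (of_nat a + of_nat b :: bit)"
    by (auto simp: bxor_def)
qed

lemma of_nat_bit_eq_iff:
  assumes "a \<le> 1"
  shows "(of_nat a :: bit) = 1 \<longleftrightarrow> a = 1" "(of_nat a :: bit) = 0 \<longleftrightarrow> a = 0"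
proof -
  have "a = 0 \<or> a = 1" using assms by auto
  then show "(of_nat a :: bit) = 1 \<longleftrightarrow> a = 1" "(of_nat a :: bit) = 0 \<longleftrightarrow> a = 0" by auto
qed

definition indexE :: "nat \<Rightarrow> wexp \<Rightarrow> wexp \<Rightarrow> wexp" where
  "indexE w e f = WAdd (WMul e (V w)) f"

definition rowE :: "nat \<Rightarrow> nat \<Rightarrow> wexp" where
  "rowE i j = WGet aROWS (indexE aN (V i) (V j))"

definition init_rows :: stm where
  "init_rows = SSeq (put aL (WConst 0))
    (SFor aI aN (SIf (BEq (WGet aLAB (V aI)) (V aI))
      (SSeq (SW aROWS (indexE aN (V aL) (V aI)) (WConst 1)) (put aL (WAdd (V aL) (WConst 1)))) SSkip))"

text \<open>
  The values of a cocycle condition on the basis vectors.  The word \<open>aPV\<close> holds the number of the pivot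
  plus one, so that \<open>0\<close> means that there is none.
\<close>

definition scan_rows :: stm where
  "scan_rows = SFor aI aL (SSeq (SW aU (V aI) (xorE (xorE (rowE aI aX1) (rowE aI aX2)) (rowE aI aX3)))
    (SIf (BEq (WGet aU (V aI)) (WConst 1)) (put aPV (WAdd (V aI) (WConst 1))) SSkip))"

definition add_row :: stm where
  "add_row = SFor aJ aN (SW aROWS (indexE aN (V aI) (V aJ)) (xorE (rowE aI aJ) (rowE aPV aJ)))"

definition add_rows :: stm where
  "add_rows = SFor aI aL (SIf (BAnd (BEq (WGet aU (V aI)) (WConst 1)) (BNot (BEq (V aI) (V aPV)))) add_row SSkip)"

definition copy_row :: stm where
  "copy_row = SFor aJ aN (SW aROWS (indexE aN (V aPV) (V aJ)) (rowE aL aJ))"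

text \<open>
  The pivot row is dropped by moving the last row into its place.
\<close>

definition reduce_rows :: stm where
  "reduce_rows = SSeq (put aPV (WSub (V aPV) (WConst 1))) (SSeq add_rows
     (SSeq (put aL (WSub (V aL) (WConst 1))) copy_row))"

text \<open>
  Imposes the cocycle condition of face \<open>f\<close>.
\<close>

definition eliminate :: "nat \<Rightarrow> stm" where
  "eliminate f = (case face_vertices f of (a, b, c) \<Rightarrow>
     SSeq (put aX1 (WGet aLAB (slotE a b))) (SSeq (put aX2 (WGet aLAB (slotE a c)))
    (SSeq (put aX3 (WGet aLAB (slotE b c))) (SSeq (put aPV (WConst 0)) (SSeq scan_rows
     (SIf (BEq (V aPV) (WConst 0)) SSkip reduce_rows))))))"

definition find_basis :: stm where
  "find_basis = SSeq init_rows (SFor aT 0 (seqs (map eliminate [0, 1, 2, 3])))"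

lemma index_inj: "i < k \<Longrightarrow> j < k \<Longrightarrow> a * k + i = b * k + j \<longleftrightarrow> a = b \<and> i = (j::nat)"
  by (metis div_mult_self3 add.commute div_less add_cancel_left_right mod_mult_self3 mod_less less_nat_zero_code)

context machine
begin

definition rows :: "state \<Rightarrow> nat \<Rightarrow> nat \<Rightarrow> bit" where
  "rows s r i = (if i < 16 * tets T then of_nat (fst s aROWS (r * (16 * tets T) + i)) else 0)"

text \<open>
  The first \<open>aL\<close> rows of the table are a basis of the space \<open>X\<close>.
\<close>

definition rows_inv :: "state \<Rightarrow> (nat \<Rightarrow> bit) set \<Rightarrow> bool" where
  "rows_inv s X \<longleftrightarrow> fst s aL 0 \<le> 16 * tets T \<and>
     (\<forall>r<fst s aL 0. \<forall>i<16 * tets T. fst s aROWS (r * (16 * tets T) + i) \<le> 1) \<and>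
     parametrises (rows s) {..<fst s aL 0} X"

lemma rows_inv_agree:
  assumes "rows_inv s X" "fst s' aL = fst s aL" "fst s' aROWS = fst s aROWS"
  shows "rows_inv s' X"
proof -
  have "rows s' = rows s" by (intro ext) (simp add: rows_def assms(3))
  then show ?thesis using assms by (simp add: rows_inv_def)
qed

lemma row_index:
  "i < 16 * tets T \<Longrightarrow> j < 16 * tets T \<Longrightarrow> i * (16 * tets T) + j < B"
  by (rule index_less_B) auto

lemma small_index: "i < 16 * tets T \<Longrightarrow> i < B" "i \<le> 16 * tets T \<Longrightarrow> i \<le> M" "1 \<le> M"
  using less_B[of i] tets_pos by (simp_all add: M_def)

lemma wp_scan_rows:
  assumes N: "fst s aN 0 = 16 * tets T" and inv: "rows_inv s X"
    and x: "fst s aX1 0 = x1" "fst s aX2 0 = x2" "fst s aX3 0 = x3"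
      "x1 < 16 * tets T" "x2 < 16 * tets T" "x3 < 16 * tets T"
    and pv: "fst s aPV 0 = 0"
    and Q: "\<And>s' u. agree {aI, aU, aPV} {} s s' \<Longrightarrow>
      (\<And>r. r < fst s aL 0 \<Longrightarrow> fst s' aU r = u r \<and> u r \<le> 1 \<and> of_nat (u r) = rows s r x1 + rows s r x2 + rows s r x3) \<Longrightarrow>
      fst s' aPV 0 = 0 \<and> (\<forall>r<fst s aL 0. u r = 0) \<or> (\<exists>p<fst s aL 0. fst s' aPV 0 = Suc p \<and> u p = 1) \<Longrightarrow> Q s'"
  shows "wp B M scan_rows Q s"
proof -
  let ?N = "16 * tets T" and ?L = "fst s aL 0"
  let ?R = "\<lambda>r i. fst s aROWS (r * ?N + i)"
  define u where "u r = bxor (bxor (?R r x1) (?R r x2)) (?R r x3)" for r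
  have L: "?L \<le> ?N" and bits: "\<And>r i. r < ?L \<Longrightarrow> i < ?N \<Longrightarrow> ?R r i \<le> 1"
    using inv by (auto simp: rows_inv_def)
  have u: "u r \<le> 1 \<and> of_nat (u r) = rows s r x1 + rows s r x2 + rows s r x3" if "r < ?L" for r
    using bits[OF that x(4)] bits[OF that x(5)] bits[OF that x(6)] x(4-6)
    by (simp add: u_def rows_def xor_bits)
  show ?thesis
    unfolding scan_rows_def
  proof (rule wp_For_agree[where A = "{aU, aPV}" and C = "{}" and I = "\<lambda>i s'. (\<forall>r<i. fst s' aU r = u r) \<and>
      (fst s' aPV 0 = 0 \<and> (\<forall>r<i. u r = 0) \<or> (\<exists>p<i. fst s' aPV 0 = Suc p \<and> u p = 1))"])
    fix i s'
    assume 1: "i < fst s aL 0" "agree {aI, aU, aPV} {} s s'" "fst s' aI 0 = i"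
      and I: "(\<forall>r<i. fst s' aU r = u r) \<and>
        (fst s' aPV 0 = 0 \<and> (\<forall>r<i. u r = 0) \<or> (\<exists>p<i. fst s' aPV 0 = Suc p \<and> u p = 1))"
    have iN: "i < ?N" using 1(1) L by simp
    have f: "fst s' aROWS = fst s aROWS" "fst s' aN 0 = ?N" "fst s' aX1 0 = x1" "fst s' aX2 0 = x2" "fst s' aX3 0 = x3"
      using 1(2) N x by (simp_all add: agree_def)
    let ?e = "xorE (xorE (rowE aI aX1) (rowE aI aX2)) (rowE aI aX3)"
    have e: "ieval s' ?e = u i" "wok B s' ?e"
      using f 1(3) row_index[OF iN] x by (simp_all add: rowE_def indexE_def u_def)
    have "u i \<le> 1" using u[OF 1(1)] by simp
    then have uM: "u i \<le> M" using small_index(3) by linarith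
    have ui: "u i = 0 \<or> u i = 1" using \<open>u i \<le> 1\<close> by linarith
    have iB: "i < B" "Suc i \<le> M" using iN small_index(1)[OF iN] small_index(2)[of "Suc i"] by simp_all
    show "wp B M (SSeq (SW aU (V aI) ?e) (SIf (BEq (WGet aU (V aI)) (WConst 1)) (put aPV (WAdd (V aI) (WConst 1))) SSkip))
       (\<lambda>s''. (\<forall>r<Suc i. fst (wupd s'' aI 0 (Suc i)) aU r = u r) \<and>
         (fst (wupd s'' aI 0 (Suc i)) aPV 0 = 0 \<and> (\<forall>r<Suc i. u r = 0) \<or>
          (\<exists>p<Suc i. fst (wupd s'' aI 0 (Suc i)) aPV 0 = Suc p \<and> u p = 1))) s'"
      using ui e uM iB 1(3) I by (auto simp: less_Suc_eq)
  next
    fix s'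
    assume "agree {aI, aU, aPV} {} s s'" "(\<forall>r<?L. fst s' aU r = u r) \<and>
        (fst s' aPV 0 = 0 \<and> (\<forall>r<?L. u r = 0) \<or> (\<exists>p<?L. fst s' aPV 0 = Suc p \<and> u p = 1))"
    then show "Q s'" using u by (intro Q[of s' u]) auto
  qed (use pv in auto)
qed

lemma wp_add_rows:
  assumes N: "fst s aN 0 = 16 * tets T" and inv: "rows_inv s X"
    and p: "fst s aPV 0 = p" "p < fst s aL 0"
    and Q: "\<And>s'. agree {aI, aJ, aROWS} {} s s' \<Longrightarrow>
      (\<And>r i. r < fst s aL 0 \<Longrightarrow> i < 16 * tets T \<Longrightarrow> fst s' aROWS (r * (16 * tets T) + i) =
         (if fst s aU r = 1 \<and> r \<noteq> p then bxor (fst s aROWS (r * (16 * tets T) + i)) (fst s aROWS (p * (16 * tets T) + i))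
          else fst s aROWS (r * (16 * tets T) + i))) \<Longrightarrow> Q s'"
  shows "wp B M add_rows Q s"
proof -
  let ?N = "16 * tets T" and ?L = "fst s aL 0"
  let ?R = "\<lambda>s r i. fst s aROWS (r * ?N + i)"
  define new where "new r i = (if fst s aU r = 1 \<and> r \<noteq> p then bxor (?R s r i) (?R s p i) else ?R s r i)" for r i
  have L: "?L \<le> ?N" and bits: "\<And>r i. r < ?L \<Longrightarrow> i < ?N \<Longrightarrow> ?R s r i \<le> 1"
    using inv by (auto simp: rows_inv_def)
  show ?thesis
    unfolding add_rows_def
  proof (rule wp_For_agree[where A = "{aJ, aROWS}" and C = "{}" and I = "\<lambda>i s'.
      (\<forall>r<?L. \<forall>k<?N. ?R s' r k = (if r < i then new r k else ?R s r k))"])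
    fix i s'
    assume 1: "i < fst s aL 0" "agree {aI, aJ, aROWS} {} s s'" "fst s' aI 0 = i"
      and I: "\<forall>r<?L. \<forall>k<?N. ?R s' r k = (if r < i then new r k else ?R s r k)"
    have iN: "i < ?N" "p < ?N" using 1(1) L p(2) by simp_all
    have f: "fst s' aN 0 = ?N" "fst s' aPV 0 = p" "fst s' aU = fst s aU"
      using 1(2) N p by (simp_all add: agree_def)
    have iB: "i < B" using small_index(1)[OF iN(1)] .
    have keep: "\<forall>r<?L. \<forall>k<?N. ?R s' r k = (if r < Suc i then new r k else ?R s r k)"
      if "\<not> (fst s aU i = 1 \<and> i \<noteq> p)"
      using I that by (auto simp: new_def less_Suc_eq)
    have inner: "wp B M add_row (\<lambda>s''. \<forall>r<?L. \<forall>k<?N. ?R (wupd s'' aI 0 (Suc i)) r k =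
        (if r < Suc i then new r k else ?R s r k)) s'" if c: "fst s aU i = 1 \<and> i \<noteq> p"
      unfolding add_row_def
    proof (rule wp_map_loop[where idx = "\<lambda>j. i * ?N + j" and val = "new i" and n = ?N])
      fix j s2
      assume j: "j < ?N" "agree {aJ, aROWS} {} s' s2" "fst s2 aJ 0 = j"
        and un: "\<And>k. k \<notin> (\<lambda>j. i * ?N + j) ` {..<j} \<Longrightarrow> fst s2 aROWS k = fst s' aROWS k"
      have g: "fst s2 aN 0 = ?N" "fst s2 aPV 0 = p" "fst s2 aI 0 = i"
        using j(2) f 1(3) by (simp_all add: agree_def)
      have "?R s2 i j = ?R s' i j" by (rule un) auto
      also have "\<dots> = ?R s i j" using I 1(1) j(1) by simp
      finally have r1: "?R s2 i j = ?R s i j" .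
      have "?R s2 p j = ?R s' p j"
        by (rule un) (use c j(1) in \<open>auto simp: index_inj\<close>)
      also have "\<dots> = ?R s p j" using I p(2) j(1) by (simp add: new_def)
      finally have r2: "?R s2 p j = ?R s p j" .
      have "new i j \<le> 1" using c bits[OF 1(1) j(1)] bits[OF p(2) j(1)] by (simp add: new_def xor_bits)
      then show "wok B s2 (indexE aN (V aI) (V aJ)) \<and> wok B s2 (xorE (rowE aI aJ) (rowE aPV aJ)) \<and>
        ieval s2 (indexE aN (V aI) (V aJ)) = i * ?N + j \<and> i * ?N + j < B \<and>
        ieval s2 (xorE (rowE aI aJ) (rowE aPV aJ)) = new i j \<and> new i j \<le> M"
        using g j(3) r1 r2 row_index[OF iN(1) j(1)] row_index[OF iN(2) j(1)] small_index(3) c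
        by (simp add: indexE_def rowE_def new_def)
    next
      fix s2
      assume ag: "agree {aJ, aROWS} {} s' s2" and v: "\<And>j. j < ?N \<Longrightarrow> ?R s2 i j = new i j"
        and un: "\<And>k. k \<notin> (\<lambda>j. i * ?N + j) ` {..<?N} \<Longrightarrow> fst s2 aROWS k = fst s' aROWS k"
      have "?R s2 r k = ?R s' r k" if "r < ?L" "k < ?N" "r \<noteq> i" for r k
        by (rule un) (use that in \<open>auto simp: index_inj\<close>)
      then show "\<forall>r<?L. \<forall>k<?N. ?R (wupd s2 aI 0 (Suc i)) r k = (if r < Suc i then new r k else ?R s r k)"
        using v I by (auto simp: less_Suc_eq)
    qed (use f in \<open>auto simp: inj_on_def\<close>)
    show "wp B M (SIf (BAnd (BEq (WGet aU (V aI)) (WConst 1)) (BNot (BEq (V aI) (V aPV)))) add_row SSkip)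
      (\<lambda>s''. \<forall>r<?L. \<forall>k<?N. ?R (wupd s'' aI 0 (Suc i)) r k = (if r < Suc i then new r k else ?R s r k)) s'"
      using inner keep f 1(3) iB by (simp only: wp_simps bok.simps wok.simps ibeval.simps ieval.simps) (simp add: if_split)
  next
    fix s' assume "agree {aI, aJ, aROWS} {} s s'"
      "\<forall>r<?L. \<forall>k<?N. ?R s' r k = (if r < ?L then new r k else ?R s r k)"
    then show "Q s'" by (intro Q) (auto simp: new_def)
  qed (auto simp: add_row_def)
qed

lemma wp_copy_row:
  assumes N: "fst s aN 0 = 16 * tets T" and p: "fst s aPV 0 = p" "fst s aL 0 = L" "p < 16 * tets T" "L < 16 * tets T"
    and bits: "\<And>i. i < 16 * tets T \<Longrightarrow> fst s aROWS (L * (16 * tets T) + i) \<le> 1"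
    and Q: "\<And>s'. agree {aJ, aROWS} {} s s' \<Longrightarrow>
      (\<And>r i. i < 16 * tets T \<Longrightarrow> fst s' aROWS (r * (16 * tets T) + i) =
         (if r = p then fst s aROWS (L * (16 * tets T) + i) else fst s aROWS (r * (16 * tets T) + i))) \<Longrightarrow> Q s'"
  shows "wp B M copy_row Q s"
  unfolding copy_row_def
proof (rule wp_map_loop[where idx = "\<lambda>j. p * (16 * tets T) + j" and n = "16 * tets T"
      and val = "\<lambda>i. fst s aROWS (L * (16 * tets T) + i)"])
  let ?N = "16 * tets T"
  fix j s2
  assume j: "j < ?N" "agree {aJ, aROWS} {} s s2" "fst s2 aJ 0 = j"
    and un: "\<And>k. k \<notin> (\<lambda>j. p * ?N + j) ` {..<j} \<Longrightarrow> fst s2 aROWS k = fst s aROWS k"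
  have g: "fst s2 aN 0 = ?N" "fst s2 aPV 0 = p" "fst s2 aL 0 = L"
    using j(2) N p by (simp_all add: agree_def)
  have "fst s2 aROWS (L * ?N + j) = fst s aROWS (L * ?N + j)"
    by (rule un) (use j(1) in \<open>auto simp: index_inj\<close>)
  then show "wok B s2 (indexE aN (V aPV) (V aJ)) \<and> wok B s2 (rowE aL aJ) \<and>
        ieval s2 (indexE aN (V aPV) (V aJ)) = p * ?N + j \<and> p * ?N + j < B \<and>
        ieval s2 (rowE aL aJ) = fst s aROWS (L * ?N + j) \<and> fst s aROWS (L * ?N + j) \<le> M"
    using g j(3) row_index[OF p(3) j(1)] row_index[OF p(4) j(1)] bits[OF j(1)] small_index(3)
    by (simp add: indexE_def rowE_def)
next
  let ?N = "16 * tets T"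
  fix s2
  assume ag: "agree {aJ, aROWS} {} s s2" and v: "\<And>j. j < ?N \<Longrightarrow> fst s2 aROWS (p * ?N + j) = fst s aROWS (L * ?N + j)"
    and un: "\<And>k. k \<notin> (\<lambda>j. p * ?N + j) ` {..<?N} \<Longrightarrow> fst s2 aROWS k = fst s aROWS k"
  show "Q s2"
  proof (rule Q[OF ag])
    fix r i assume i: "i < ?N"
    show "fst s2 aROWS (r * ?N + i) = (if r = p then fst s aROWS (L * ?N + i) else fst s aROWS (r * ?N + i))"
    proof (cases "r = p")
      case False
      have "fst s2 aROWS (r * ?N + i) = fst s aROWS (r * ?N + i)"
        by (rule un) (use False i in \<open>auto simp: index_inj\<close>)
      then show ?thesis using False by simp
    qed (use v[OF i] in simp)
  qed
qed (use N in \<open>auto simp: inj_on_def\<close>)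

text \<open>
  The program carries out \<open>parametrises_inter\<close>, followed by a renumbering of the rows.
\<close>

lemma wp_reduce_rows:
  assumes N: "fst s aN 0 = 16 * tets T" and inv: "rows_inv s X"
    and p: "fst s aPV 0 = Suc p" "p < fst s aL 0"
    and u: "\<And>r. r < fst s aL 0 \<Longrightarrow> fst s aU r \<le> 1" "fst s aU p = 1"
    and lin: "\<And>c. \<phi> (comb (rows s) {..<fst s aL 0} c) = (\<Sum>r<fst s aL 0. c r * of_nat (fst s aU r))"
    and Q: "\<And>s'. agree {aI, aJ, aROWS, aPV, aL} {} s s' \<Longrightarrow> rows_inv s' {x \<in> X. \<phi> x = 0} \<Longrightarrow> Q s'"
  shows "wp B M reduce_rows Q s"
proof -
  let ?N = "16 * tets T" and ?L = "fst s aL 0"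
  have L: "?L \<le> ?N" and bits: "\<And>r i. r < ?L \<Longrightarrow> i < ?N \<Longrightarrow> fst s aROWS (r * ?N + i) \<le> 1"
    and par: "parametrises (rows s) {..<?L} X"
    using inv by (auto simp: rows_inv_def)
  let ?s1 = "wupd s aPV 0 p"
  have inv1: "rows_inv ?s1 X" by (rule rows_inv_agree[OF inv]) simp_all
  have pN: "p < ?N" "?L - 1 < ?N" "p \<le> M" "?L - 1 \<le> M" using p(2) L small_index(2)[of p] small_index(2)[of "?L - 1"] by simp_all
  have "wp B M add_rows (wp B M (SSeq (put aL (WSub (V aL) (WConst 1))) copy_row) Q) ?s1"
  proof (rule wp_add_rows[where p = p])
    fix s2
    assume ag2: "agree {aI, aJ, aROWS} {} ?s1 s2"
      and R2: "\<And>r i. r < fst ?s1 aL 0 \<Longrightarrow> i < ?N \<Longrightarrow> fst s2 aROWS (r * ?N + i) =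
         (if fst ?s1 aU r = 1 \<and> r \<noteq> p then bxor (fst ?s1 aROWS (r * ?N + i)) (fst ?s1 aROWS (p * ?N + i))
          else fst ?s1 aROWS (r * ?N + i))"
    let ?s3 = "wupd s2 aL 0 (?L - 1)"
    have f2: "fst s2 aL 0 = ?L" "fst s2 aPV 0 = p" "fst s2 aN 0 = ?N" using ag2 N by (simp_all add: agree_def)
    have bits2: "fst s2 aROWS (r * ?N + i) \<le> 1" if "r < ?L" "i < ?N" for r i
      using R2[of r i] that bits[OF that] bits[OF p(2) that(2)] by (simp add: xor_bits)
    have rows2: "rows s2 r i = rows s r i + of_nat (fst s aU r) * rows s p i" if "r < ?L" "r \<noteq> p" for r i
    proof (cases "i < ?N")
      case True
      have "fst s aU r = 0 \<or> fst s aU r = 1" using u(1)[OF that(1)] by linarith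
      then show ?thesis
        using R2[of r i] that True bits[OF that(1) True] bits[OF p(2) True] by (auto simp: rows_def xor_bits)
    qed (simp add: rows_def)
    have par2: "parametrises (rows s2) ({..<?L} - {p}) {x \<in> X. \<phi> x = 0}"
      by (rule parametrises_inter[OF par _ _ lin]) (use p(2) u(2) rows2 in auto)
    have "wp B M copy_row Q ?s3"
    proof (rule wp_copy_row[where p = p and L = "?L - 1"])
      fix s4
      assume ag4: "agree {aJ, aROWS} {} ?s3 s4"
        and R4: "\<And>r i. i < ?N \<Longrightarrow> fst s4 aROWS (r * ?N + i) =
         (if r = p then fst ?s3 aROWS ((?L - 1) * ?N + i) else fst ?s3 aROWS (r * ?N + i))"
      have L4: "fst s4 aL 0 = ?L - 1" using ag4 by (simp add: agree_def)
      let ?h = "\<lambda>r. if r = p then ?L - 1 else r"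
      have "bij_betw ?h {..<?L - 1} ({..<?L} - {p})"
      proof (rule bij_betw_imageI)
        show "inj_on ?h {..<?L - 1}" by (auto simp: inj_on_def)
        show "?h ` {..<?L - 1} = {..<?L} - {p}"
        proof (intro subset_antisym subsetI)
          fix r assume r: "r \<in> {..<?L} - {p}"
          show "r \<in> ?h ` {..<?L - 1}"
          proof (cases "r = ?L - 1")
            case True
            then have "p < ?L - 1" using r p(2) by auto
            then show ?thesis using True by (intro image_eqI[of _ _ p]) auto
          next
            case False
            then show ?thesis using r by (intro image_eqI[of _ _ r]) auto
          qed
        qed (use p(2) in auto)
      qed
      moreover have "rows s4 r = rows s2 (?h r)" for r
        using R4 by (auto simp: rows_def fun_eq_iff)
      ultimately have "parametrises (rows s4) {..<?L - 1} {x \<in> X. \<phi> x = 0}"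
        by (intro parametrises_reindex[OF par2])
      moreover have "fst s4 aROWS (r * ?N + i) \<le> 1" if "r < ?L - 1" "i < ?N" for r i
        using R4[OF that(2), of r] bits2[of r i] bits2[of "?L - 1" i] that p(2) by simp
      ultimately have "rows_inv s4 {x \<in> X. \<phi> x = 0}" using L by (simp add: rows_inv_def L4)
      moreover have "agree {aI, aJ, aROWS, aPV, aL} {} s s4" using ag2 ag4 by (simp add: agree_def)
      ultimately show "Q s4" by (intro Q)
    qed (use f2 pN bits2 p(2) in auto)
    then show "wp B M (SSeq (put aL (WSub (V aL) (WConst 1))) copy_row) Q s2"
      using f2 pN by simp
  qed (use N inv1 p in auto)
  then show ?thesis using p pN by (simp add: reduce_rows_def)
qed

definition lab_ok :: "(nat \<Rightarrow> nat) \<Rightarrow> bool" where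
  "lab_ok lab \<longleftrightarrow> (\<forall>k<16 * tets T. lab k < 16 * tets T)"

lemma edge_rep_less:
  "lab_ok lab \<Longrightarrow> t < tets T \<Longrightarrow> a < 4 \<Longrightarrow> b < 4 \<Longrightarrow> edge_rep lab t (a, b) < 16 * tets T"
  by (simp add: lab_ok_def edge_rep_def slot_less)

lemma wp_eliminate:
  assumes tab: "tables s" and inv: "rows_inv s X" and t: "fst s aT 0 = t" "t < tets T" and f: "f < 4"
    and lab: "fst s aLAB = lab" "lab_ok lab"
    and Q: "\<And>s'. agree {aX1, aX2, aX3, aI, aU, aPV, aJ, aROWS, aL} {} s s' \<Longrightarrow>
      rows_inv s' {x \<in> X. face_sum lab x t f = 0} \<Longrightarrow> Q s'"
  shows "wp B M (eliminate f) Q s"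
proof -
  let ?N = "16 * tets T"
  obtain a b c where v: "face_vertices f = (a, b, c)" by (cases "face_vertices f")
  note fv = face_vertices[OF f v]
  let ?x1 = "edge_rep lab t (a, b)" and ?x2 = "edge_rep lab t (a, c)" and ?x3 = "edge_rep lab t (b, c)"
  have x: "?x1 < ?N" "?x2 < ?N" "?x3 < ?N" using edge_rep_less lab t(2) fv by auto
  have xM: "?x1 \<le> M" "?x2 \<le> M" "?x3 \<le> M" using x small_index(2) by auto
  have fs: "face_sum lab y t f = y ?x1 + y ?x2 + y ?x3" for y
    by (simp add: face_sum_def face_edges_def v add.assoc)
  define s1 where "s1 = wupd (wupd (wupd (wupd s aX1 0 ?x1) aX2 0 ?x2) aX3 0 ?x3) aPV 0 0"
  have N: "fst s1 aN 0 = ?N" using tab by (simp add: tables_def s1_def)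
  have inv1: "rows_inv s1 X" by (rule rows_inv_agree[OF inv]) (simp_all add: s1_def)
  let ?L = "fst s1 aL 0"
  have "wp B M scan_rows (wp B M (SIf (BEq (V aPV) (WConst 0)) SSkip reduce_rows) Q) s1"
  proof (rule wp_scan_rows[OF N inv1, of ?x1 ?x2 ?x3])
    fix s2 u
    assume ag2: "agree {aI, aU, aPV} {} s1 s2"
      and u: "\<And>r. r < ?L \<Longrightarrow> fst s2 aU r = u r \<and> u r \<le> 1 \<and> of_nat (u r) = rows s1 r ?x1 + rows s1 r ?x2 + rows s1 r ?x3"
      and alt: "fst s2 aPV 0 = 0 \<and> (\<forall>r<?L. u r = 0) \<or> (\<exists>p<?L. fst s2 aPV 0 = Suc p \<and> u p = 1)"
    have inv2: "rows_inv s2 X" by (rule rows_inv_agree[OF inv1]) (use ag2 in \<open>simp_all add: agree_def\<close>)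
    have "fst s2 aROWS = fst s1 aROWS" using ag2 by (simp add: agree_def)
    then have "rows s2 = rows s1" by (intro ext) (simp add: rows_def)
    then have L2: "fst s2 aL 0 = ?L" "rows s2 = rows s1" using ag2 by (simp_all add: agree_def)
    have lin: "face_sum lab (comb (rows s2) {..<fst s2 aL 0} c) t f = (\<Sum>r<fst s2 aL 0. c r * of_nat (fst s2 aU r))" for c
    proof -
      have "(\<Sum>r<?L. c r * of_nat (fst s2 aU r)) = (\<Sum>r<?L. c r * rows s1 r ?x1 + c r * rows s1 r ?x2 + c r * rows s1 r ?x3)"
        by (rule sum.cong[OF refl]) (use u in \<open>simp add: distrib_left\<close>)
      then show ?thesis unfolding fs L2 comb_def by (simp add: sum.distrib)
    qed
    show "wp B M (SIf (BEq (V aPV) (WConst 0)) SSkip reduce_rows) Q s2"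
    proof (cases "fst s2 aPV 0 = 0")
      case True
      then have zero: "\<And>r. r < ?L \<Longrightarrow> u r = 0" using alt by auto
      have "face_sum lab y t f = 0" if "y \<in> X" for y
      proof -
        have "y \<in> comb (rows s2) {..<fst s2 aL 0} ` bitfun {..<fst s2 aL 0}"
          using inv2 that unfolding rows_inv_def parametrises_def bij_betw_def by simp
        then obtain c where "y = comb (rows s2) {..<fst s2 aL 0} c" by blast
        then have "face_sum lab y t f = (\<Sum>r<?L. c r * of_nat (fst s2 aU r))" using lin L2 by simp
        also have "\<dots> = 0" by (rule sum.neutral) (use u zero in auto)
        finally show ?thesis .
      qed
      then have "{x \<in> X. face_sum lab x t f = 0} = X" by blast
      then have "Q s2" using inv2 ag2 by (intro Q) (simp_all add: agree_def s1_def)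
      then show ?thesis using True by simp
    next
      case False
      then obtain p where p: "p < ?L" "fst s2 aPV 0 = Suc p" "u p = 1" using alt by auto
      have "wp B M reduce_rows Q s2"
      proof (rule wp_reduce_rows[OF _ inv2 p(2) _ _ _ lin])
        fix s4 assume "agree {aI, aJ, aROWS, aPV, aL} {} s2 s4" "rows_inv s4 {x \<in> X. face_sum lab x t f = 0}"
        then show "Q s4" using ag2 by (intro Q) (simp_all add: agree_def s1_def)
      next
        show "fst s2 aN 0 = 16 * tets T" using ag2 N by (simp add: agree_def)
      qed (use p u L2 in auto)
      then show ?thesis using False by simp
    qed
  qed (use x in \<open>simp_all add: s1_def\<close>)
  moreover have "wok B z (slotE d e)" "ieval z (slotE d e) = slot t d e" "slot t d e < B"
    if "d < 4" "e < 4" "fst z aT 0 = t" for z d e using slot_eval[OF that(3) t(2) that(1,2)] by auto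
  ultimately show ?thesis
    using fv t(1) lab xM by (simp add: eliminate_def v s1_def edge_rep_def)
qed

lemma wp_init_rows:
  assumes tab: "tables s" and zero: "fst s aROWS = (\<lambda>_. 0)" and lab: "fst s aLAB = lab" "lab_ok lab"
    and Q: "\<And>s'. agree {aI, aROWS, aL} {} s s' \<Longrightarrow> rows_inv s' (bitfun (edge_reps lab)) \<Longrightarrow> Q s'"
  shows "wp B M init_rows Q s"
proof -
  let ?N = "16 * tets T"
  have N: "fst s aN 0 = ?N" using tab by (simp add: tables_def)
  let ?s1 = "wupd s aL 0 0"
  let ?I = "\<lambda>i s'. \<exists>h. fst s' aL 0 \<le> i \<and> bij_betw h {..<fst s' aL 0} {j. j < i \<and> lab j = j} \<and>
    (\<forall>r k. k < ?N \<longrightarrow> fst s' aROWS (r * ?N + k) = (if r < fst s' aL 0 \<and> k = h r then 1 else 0))"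
  have "wp B M (SFor aI aN (SIf (BEq (WGet aLAB (V aI)) (V aI))
      (SSeq (SW aROWS (indexE aN (V aL) (V aI)) (WConst 1)) (put aL (WAdd (V aL) (WConst 1)))) SSkip)) Q ?s1"
  proof (rule wp_For_agree[where A = "{aROWS, aL}" and C = "{}" and I = ?I])
    show "?I 0 (wupd ?s1 aI 0 0)" using zero by (simp add: bij_betw_def)
  next
    fix i s'
    assume 1: "i < fst ?s1 aN 0" "agree {aI, aROWS, aL} {} ?s1 s'" "fst s' aI 0 = i" and I: "?I i s'"
    have i: "i < ?N" using 1(1) N by simp
    then have iB: "i < B" by (rule small_index(1))
    have f: "fst s' aLAB = lab" "fst s' aN 0 = ?N" using 1(2) lab N by (simp_all add: agree_def)
    let ?L = "fst s' aL 0"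
    obtain h where h: "?L \<le> i" "bij_betw h {..<?L} {j. j < i \<and> lab j = j}"
      "\<And>r k. k < ?N \<Longrightarrow> fst s' aROWS (r * ?N + k) = (if r < ?L \<and> k = h r then 1 else 0)" using I by blast
    have "?L < ?N" using h(1) i by simp
    then have ix: "?L * ?N + i < B" using i by (rule row_index)
    have LM: "Suc ?L \<le> M" using small_index(2)[of "Suc ?L"] \<open>?L < ?N\<close> by simp
    let ?s2 = "wupd (wupd (wupd s' aROWS (?L * ?N + i) 1) aL 0 (Suc ?L)) aI 0 (Suc i)"
    have yes: "?I (Suc i) ?s2" if li: "lab i = i"
    proof (intro exI conjI allI impI)
      let ?h = "h(?L := i)"
      have "bij_betw ?h ({..<?L} \<union> {?L}) ({j. j < i \<and> lab j = j} \<union> {i})"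
        by (rule bij_betw_combine) (use h(2) in \<open>auto simp: bij_betw_def inj_on_def\<close>)
      moreover have "{..<?L} \<union> {?L} = {..<Suc ?L}" "{j. j < i \<and> lab j = j} \<union> {i} = {j. j < Suc i \<and> lab j = j}"
        using li by auto
      ultimately show "bij_betw ?h {..<fst ?s2 aL 0} {j. j < Suc i \<and> lab j = j}" by simp
      show "fst ?s2 aL 0 \<le> Suc i" using h(1) by simp
      fix r k assume k: "k < ?N"
      show "fst ?s2 aROWS (r * ?N + k) = (if r < fst ?s2 aL 0 \<and> k = ?h r then 1 else 0)"
        using h(3)[OF k, of r] k i by (auto simp: index_inj less_Suc_eq)
    qed
    have no: "?I (Suc i) (wupd s' aI 0 (Suc i))" if li: "lab i \<noteq> i"
    proof -
      have "{j. j < Suc i \<and> lab j = j} = {j. j < i \<and> lab j = j}" using li less_Suc_eq by auto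
      then show ?thesis using h by (intro exI[of _ h]) simp
    qed
    show "wp B M (SIf (BEq (WGet aLAB (V aI)) (V aI))
        (SSeq (SW aROWS (indexE aN (V aL) (V aI)) (WConst 1)) (put aL (WAdd (V aL) (WConst 1)))) SSkip)
       (\<lambda>s''. ?I (Suc i) (wupd s'' aI 0 (Suc i))) s'"
    proof (cases "lab i = i")
      case True
      then show ?thesis using yes f 1(3) iB ix LM small_index(3)
        by (simp only: wp_simps bok.simps wok.simps ibeval.simps ieval.simps indexE_def) simp
    next
      case False
      then show ?thesis using no f 1(3) iB
        by (simp only: wp_simps bok.simps wok.simps ibeval.simps ieval.simps indexE_def) simp
    qed
  next
    fix s' assume ag: "agree {aI, aROWS, aL} {} ?s1 s'" and "?I (fst ?s1 aN 0) s'"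
    then obtain h where h: "fst s' aL 0 \<le> ?N" "bij_betw h {..<fst s' aL 0} {j. j < ?N \<and> lab j = j}"
      "\<And>r k. k < ?N \<Longrightarrow> fst s' aROWS (r * ?N + k) = (if r < fst s' aL 0 \<and> k = h r then 1 else 0)"
      using N by auto
    have "rows s' r k = (if k = h r then 1 else 0)" if "r \<in> {..<fst s' aL 0}" for r k
    proof -
      have "h r \<in> {j. j < ?N \<and> lab j = j}" using h(2) that by (rule bij_betw_apply)
      then show ?thesis using h(3) that by (auto simp: rows_def)
    qed
    then have "parametrises (rows s') {..<fst s' aL 0} (bitfun (edge_reps lab))"
      unfolding edge_reps_def by (rule parametrises_unit[OF h(2) finite_lessThan])
    then have "rows_inv s' (bitfun (edge_reps lab))" using h by (simp add: rows_inv_def)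
    moreover have "agree {aI, aROWS, aL} {} s s'" using ag by (simp add: agree_def)
    ultimately show "Q s'" by (intro Q)
  qed auto
  then show ?thesis by (simp add: init_rows_def)
qed

lemma mods_eliminate:
  "wmods (eliminate f) = {aX1, aX2, aX3, aI, aU, aPV, aJ, aROWS, aL}" "zmods (eliminate f) = {}"
  by (auto simp: eliminate_def scan_rows_def reduce_rows_def add_rows_def add_row_def copy_row_def split: prod.splits)

text \<open>
  The elimination starts from the unit vectors of the representatives, a basis of the space of all
  functions on edges, and imposes the conditions of the faces one after the other.
\<close>

lemma wp_find_basis:
  assumes tab: "tables s" and zero: "fst s aROWS = (\<lambda>_. 0)" and lab: "fst s aLAB = lab" "lab_ok lab"
    and Q: "\<And>s'. agree {aT, aX1, aX2, aX3, aI, aU, aPV, aJ, aROWS, aL} {} s s' \<Longrightarrow>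
      rows_inv s' (slot_cocycles lab) \<Longrightarrow> Q s'"
  shows "wp B M find_basis Q s"
proof -
  let ?A = "{aX1, aX2, aX3, aI, aU, aPV, aJ, aROWS, aL}"
  let ?X = "\<lambda>t F. {x \<in> bitfun (edge_reps lab). (\<forall>t'<t. \<forall>f<4. face_sum lab x t' f = 0) \<and> (\<forall>f\<in>F. face_sum lab x t f = 0)}"
  have "wp B M (SFor aT 0 (seqs (map eliminate [0, 1, 2, 3]))) Q s1"
    if ag1: "agree {aI, aROWS, aL} {} s s1" and inv1: "rows_inv s1 (bitfun (edge_reps lab))" for s1
  proof (rule wp_For_agree[where A = ?A and C = "{}" and I = "\<lambda>t s'. rows_inv s' (?X t {})"])
    have tab1: "tables s1" by (rule tables_agree[OF ag1 tab]) auto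
    have lab1: "fst s1 aLAB = lab" using ag1 lab by (simp add: agree_def)
    show "rows_inv (wupd s1 aT 0 0) (?X 0 {})"
      by (rule rows_inv_agree[of s1]) (use inv1 in simp_all)
    { fix t s'
      assume t: "t < fst s1 0 0" "fst s' aT 0 = t" and ag: "agree (insert aT ?A) {} s1 s'"
        and I: "rows_inv s' (?X t {})"
      have tt: "t < tets T" using t tab1 by (simp add: tables_def)
      have tab': "tables s'" by (rule tables_agree[OF ag tab1]) auto
      have lab': "fst s' aLAB = lab" using ag lab1 by (simp add: agree_def)
      show "wp B M (seqs (map eliminate [0, 1, 2, 3])) (\<lambda>s''. rows_inv (wupd s'' aT 0 (Suc t)) (?X (Suc t) {})) s'"
      proof (rule wp_seqs_agree[where A = ?A and C = "{}" and I = "\<lambda>ys s''. rows_inv s'' (?X t (set ys))"])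
        fix ys x zs s2
        assume sp: "[0, 1, 2, 3] = ys @ x # zs" and ag2: "agree ?A {} s' s2" and I2: "rows_inv s2 (?X t (set ys))"
        have "x \<in> set [0, 1, 2, 3]" unfolding sp by simp
        then have x: "x < 4" by auto
        have eq: "{y \<in> ?X t (set ys). face_sum lab y t x = 0} = ?X t (set (ys @ [x]))" by auto
        show "wp B M (eliminate x) (\<lambda>s3. rows_inv s3 (?X t (set (ys @ [x])))) s2"
        proof (rule wp_eliminate[OF _ I2 _ tt x])
          show "tables s2" by (rule tables_agree[OF ag2 tab']) auto
          show "fst s2 aT 0 = t" "fst s2 aLAB = lab" using ag2 t(2) lab' by (simp_all add: agree_def)
          show "lab_ok lab" by (rule lab(2))
          show "rows_inv s3 (?X t (set (ys @ [x])))" if "rows_inv s3 {y \<in> ?X t (set ys). face_sum lab y t x = 0}" for s3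
            using that unfolding eq .
        qed
      next
        fix s2 assume I2: "rows_inv s2 (?X t (set [0, 1, 2, 3]))"
        have "?X t (set [0, 1, 2, 3]) = ?X (Suc t) {}"
          unfolding set_upto_4 by (auto simp: less_Suc_eq)
        then have "rows_inv s2 (?X (Suc t) {})" using I2 by simp
        then show "rows_inv (wupd s2 aT 0 (Suc t)) (?X (Suc t) {})" by (rule rows_inv_agree) simp_all
      qed (use I in \<open>auto simp: mods_eliminate\<close>) }
    fix s' assume ag: "agree (insert aT ?A) {} s1 s'" and I: "rows_inv s' (?X (fst s1 0 0) {})"
    have "?X (fst s1 0 0) {} = slot_cocycles lab" using tab1 by (simp add: tables_def slot_cocycles_def)
    moreover have "agree {aT, aX1, aX2, aX3, aI, aU, aPV, aJ, aROWS, aL} {} s s'"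
      using ag ag1 by (simp add: agree_def)
    ultimately show "Q s'" using I by (intro Q) simp_all
  qed (auto simp: mods_eliminate)
  then have "wp B M init_rows (wp B M (SFor aT 0 (seqs (map eliminate [0, 1, 2, 3]))) Q) s"
    by (rule wp_init_rows[OF tab zero lab])
  then show ?thesis by (simp only: find_basis_def wp_simps)
qed

end

section \<open>The matrix of the quadratic form\<close>

lemma zvalue_zadd: "zvalue (zadd a b) = zvalue a + zvalue b"
  by (cases a; cases b) (simp add: algebra_simps)

lemma zvalue_zmul: "zvalue (zmul a b) = zvalue a * zvalue b"
proof (cases a; cases b)
  fix x y u v assume 1: "a = ZSqrt2 x y" "b = ZSqrt2 u v"
  have "sqrt 2 * (sqrt 2 * r) = 2 * r" for r :: real by (simp flip: mult.assoc)
  then show ?thesis unfolding 1 by (simp add: algebra_simps)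
qed

lemma sg_sum_list: "sg (\<Sum>x\<leftarrow>xs. f x) = (\<Prod>x\<leftarrow>xs. sg (f x))"
  by (induction xs) (simp_all add: sg_add)

lemma wp_SSeq_fun: "wp B M (SSeq c d) Q = wp B M c (wp B M d Q)"
  by (intro ext) simp

text \<open>
  Toggles one coefficient of the form.  As coefficients live in the field of two elements, adding a
  monomial to the exponent is the same as toggling.
\<close>

definition flip :: "wexp \<Rightarrow> wexp \<Rightarrow> stm" where
  "flip e f = SW aMAT (indexE aD e f) (WSub (WConst 1) (WGet aMAT (indexE aD e f)))"

text \<open>
  The number array \<open>1\<close> accumulates the factor in front of the sign.
\<close>

definition scale :: "zsqrt2 \<Rightarrow> stm" where
  "scale c = SZ 1 (WConst 0) (ZMul (ZGet 1 (WConst 0)) (ZConst c))"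

text \<open>
  The coordinate of the value \<open>x\<close> at an edge of the current tetrahedron.
\<close>

definition variableE :: "nat \<times> nat \<Rightarrow> wexp" where
  "variableE p = WAdd (WConst 1) (WGet aLAB (slotE (fst p) (snd p)))"

text \<open>
  The coordinate of the multiplier of face \<open>f\<close> of the current tetrahedron.
\<close>

definition multiplierE :: "nat \<Rightarrow> wexp" where
  "multiplierE f = WAdd (WConst 1) (WAdd (WMul (WConst 32) (V 0)) (WAdd (WMul (WConst 4) (V aT)) (WConst f)))"

primrec all_zero :: "(nat \<times> nat) list \<Rightarrow> bexp" where
  "all_zero [] = BEq (WConst 0) (WConst 0)"
| "all_zero (p # ps) = BAnd (BEq (WGet aALPHA (WGet aLAB (slotE (fst p) (snd p)))) (WConst 0)) (all_zero ps)"

definition clear_matrix :: stm where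
  "clear_matrix = SSeq (SZ 1 (WConst 0) (ZConst (ZSqrt2 1 0)))
    (SFor aI aD (SFor aJ aD (SW aMAT (indexE aD (V aI) (V aJ)) (WConst 0))))"

text \<open>
  The constant \<open>c\<close> is \<open>- [2]\<close> as an element of the ring; both values of \<open>q\<close> use the same program text with
  different constants.
\<close>

definition add_edge :: "zsqrt2 \<Rightarrow> stm" where
  "add_edge c = (let fl = flip (WAdd (WConst 1) (V aI)) (WAdd (WConst 1) (WAdd (V aN) (V aI))) in
     SIf (BEq (WGet aLAB (V aI)) (V aI))
       (SIf (BEq (WGet aALPHA (V aI)) (WConst 1)) (SSeq (scale c) fl) SSkip) fl)"

definition add_face :: "zsqrt2 \<Rightarrow> nat \<Rightarrow> stm" where
  "add_face c f = SSeq
     (SIf (all_zero (face_edges f))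
        (SSeq (put aX1 (WConst 1)) (seqs (map (\<lambda>p. flip (multiplierE f) (variableE p)) (face_edges f))))
        (put aX1 (WConst 0)))
     (SIf (BLess (WAdd (WMul (WConst 4) (V aT)) (WConst f)) (WAdd (WMul (WConst 4) (nbrE f)) (gpE f f)))
        (SSeq (seqs (map (\<lambda>p. flip (WConst 0) (variableE p)) (face_edges f)))
           (SIf (BEq (V aX1) (WConst 1)) (scale (ZSqrt2 2 0)) (scale c)))
        (scale (ZSqrt2 2 0)))"

definition tet_edge_pairs :: "((nat \<times> nat) \<times> nat \<times> nat) list" where
  "tet_edge_pairs = concat (map (\<lambda>i. map (\<lambda>j. (tet_edges ! i, tet_edges ! j)) [Suc i..<6]) [0..<6])"

definition add_tet :: "zsqrt2 \<Rightarrow> stm" where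
  "add_tet c = SSeq (seqs (map (\<lambda>p. flip (WConst 0) (variableE p)) tet_edges))
     (SSeq (seqs (map (\<lambda>z. flip (variableE (fst z)) (variableE (snd z))) tet_edge_pairs))
       (SIf (all_zero tet_edges) SSkip (scale c)))"

definition build_form :: "zsqrt2 \<Rightarrow> stm" where
  "build_form c = SSeq clear_matrix (SSeq (SFor aI aN (add_edge c))
     (SSeq (SFor aT 0 (seqs (map (add_face c) [0, 1, 2, 3]))) (SFor aT 0 (add_tet c))))"

context machine
begin

abbreviation (input) D :: nat where "D \<equiv> 36 * tets T + 1"

definition mat :: "state \<Rightarrow> nat \<Rightarrow> nat \<Rightarrow> bit" where
  "mat s i j = of_nat (fst s aMAT (i * D + j))"

definition acc :: "state \<Rightarrow> real" where
  "acc s = zvalue (snd s 1 0)"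

text \<open>
  The matrix together with the accumulated factor stands for the function \<open>P\<close> of vectors with
  \<open>y 0 = 1\<close>.
\<close>

definition represents :: "state \<Rightarrow> ((nat \<Rightarrow> bit) \<Rightarrow> real) \<Rightarrow> bool" where
  "represents s P \<longleftrightarrow> fst s aD 0 = D \<and> (\<forall>i<D. \<forall>j<D. fst s aMAT (i * D + j) \<le> 1) \<and>
     (\<forall>y. y 0 = 1 \<longrightarrow> acc s * sg (qf (mat s) {..<D} y) = P y)"

lemma matrix_index: "i < D \<Longrightarrow> j < D \<Longrightarrow> i * D + j < B"
  by (rule index_less_B) (use tets_pos in auto)

lemma represents_cong:
  assumes "represents s P" "\<And>y. y 0 = 1 \<Longrightarrow> P y = P' y" shows "represents s P'"
  using assms by (simp add: represents_def)

lemma represents_agree: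
  assumes "represents s P" "fst s' aD = fst s aD" "fst s' aMAT = fst s aMAT" "snd s' 1 = snd s 1"
  shows "represents s' P"
proof -
  have "mat s' = mat s" "acc s' = acc s"
    by (intro ext, simp add: mat_def assms(3), simp only: acc_def assms(4))
  then show ?thesis using assms by (simp add: represents_def)
qed

lemma qf_add: "qf (\<lambda>i j. A i j + A' i j) S y = qf A S y + qf A' S y"
  by (simp add: qf_def distrib_right sum.distrib)

lemma qf_single:
  assumes "finite S" "i \<in> S" "j \<in> S"
  shows "qf (\<lambda>a b. if a = i \<and> b = j then 1 else 0) S y = y i * y j"
proof -
  have "qf (\<lambda>a b. if a = i \<and> b = j then 1 else 0) S y = (\<Sum>a\<in>S. \<Sum>b\<in>S. if b = j then (if a = i then y a * y b else 0) else 0)"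
    unfolding qf_def by (intro sum.cong refl) auto
  also have "\<dots> = (\<Sum>a\<in>S. if a = i then y a * y j else 0)"
    using assms by (intro sum.cong refl) simp
  also have "\<dots> = y i * y j" using assms by simp
  finally show ?thesis .
qed

lemma one_minus_bit: "a \<le> Suc 0 \<Longrightarrow> of_nat (Suc 0 - a) = (of_nat a + 1 :: bit)"
proof -
  assume "a \<le> Suc 0"
  then have "a = 0 \<or> a = 1" by auto
  then show ?thesis by auto
qed

lemma wp_flip:
  assumes rep: "represents s P" and e: "wok B s e" "wok B s f" "ieval s e = i" "ieval s f = j" "i < D" "j < D"
    and Q: "\<And>s'. agree {aMAT} {} s s' \<Longrightarrow> represents s' (\<lambda>y. P y * sg (y i * y j)) \<Longrightarrow> Q s'"
  shows "wp B M (flip e f) Q s"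
proof -
  have Ds: "fst s aD 0 = D" and bits: "\<And>i j. i < D \<Longrightarrow> j < D \<Longrightarrow> fst s aMAT (i * D + j) \<le> 1"
    using rep by (auto simp: represents_def)
  let ?s = "wupd s aMAT (i * D + j) (1 - fst s aMAT (i * D + j))"
  have mat: "mat ?s a b = mat s a b + (if a = i \<and> b = j then 1 else 0)" if "b < D" for a b
    using bits[OF e(5,6)] that index_inj[OF that e(6), of a i] by (simp add: mat_def one_minus_bit)
  have "qf (mat ?s) {..<D} y = qf (mat s) {..<D} y + y i * y j" for y
  proof -
    have "qf (mat ?s) {..<D} y = qf (\<lambda>a b. mat s a b + (if a = i \<and> b = j then 1 else 0)) {..<D} y"
      unfolding qf_def by (intro sum.cong refl) (simp only: mat lessThan_iff)
    then show ?thesis using e(5,6) by (simp only: qf_add qf_single finite_lessThan lessThan_iff)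
  qed
  moreover have "acc ?s = acc s" by (simp add: acc_def)
  ultimately have "represents ?s (\<lambda>y. P y * sg (y i * y j))"
    using rep bits index_inj by (auto simp: represents_def sg_add mult.assoc[symmetric])
  then have "Q ?s" by (intro Q) (simp add: agree_def)
  moreover have "1 - fst s aMAT (i * D + j) \<le> M" using small_index(3) by linarith
  moreover have "ieval s (indexE aD e f) = i * D + j" "wok B s (indexE aD e f)"
    using e Ds by (simp_all add: indexE_def)
  ultimately show ?thesis using matrix_index[OF e(5,6)] by (simp add: flip_def)
qed

lemma wp_scale:
  assumes rep: "represents s P"
    and Q: "\<And>s'. agree {} {1} s s' \<Longrightarrow> represents s' (\<lambda>y. P y * zvalue c) \<Longrightarrow> Q s'"
  shows "wp B M (scale c) Q s"
proof -
  let ?s = "zupd s 1 0 (zmul (snd s 1 0) c)"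
  have "mat ?s = mat s" by (intro ext) (simp add: mat_def)
  moreover have "acc ?s = acc s * zvalue c" by (simp add: acc_def zvalue_zmul)
  ultimately have "represents ?s (\<lambda>y. P y * zvalue c)" using rep by (auto simp: represents_def mult_ac)
  then have "Q ?s" by (intro Q) (simp add: agree_def)
  then show ?thesis by (simp add: scale_def)
qed

lemma wp_flips:
  assumes "represents s P"
    and "\<And>x s'. x \<in> set xs \<Longrightarrow> agree {aMAT} {} s s' \<Longrightarrow> wok B s' (e x) \<and> wok B s' (g x) \<and>
      ieval s' (e x) = i x \<and> ieval s' (g x) = j x \<and> i x < D \<and> j x < D"
    and "\<And>s'. agree {aMAT} {} s s' \<Longrightarrow> represents s' (\<lambda>y. P y * (\<Prod>x\<leftarrow>xs. sg (y (i x) * y (j x)))) \<Longrightarrow> Q s'"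
  shows "wp B M (seqs (map (\<lambda>x. flip (e x) (g x)) xs)) Q s"
  using assms
proof (induction xs arbitrary: s P)
  case Nil
  have "agree {aMAT} {} s s" by (simp add: agree_def)
  then show ?case using Nil.prems(1,3) by simp
next
  case (Cons x xs)
  have "agree {aMAT} {} s s" by (simp add: agree_def)
  then have x: "wok B s (e x)" "wok B s (g x)" "ieval s (e x) = i x" "ieval s (g x) = j x" "i x < D" "j x < D"
    using Cons.prems(2)[of x s] by simp_all
  have "wp B M (flip (e x) (g x)) (wp B M (seqs (map (\<lambda>x. flip (e x) (g x)) xs)) Q) s"
  proof (rule wp_flip[OF Cons.prems(1) x])
    fix s' assume 1: "agree {aMAT} {} s s'" "represents s' (\<lambda>y. P y * sg (y (i x) * y (j x)))"
    have tr: "agree {aMAT} {} s s''" if "agree {aMAT} {} s' s''" for s''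
      using 1(1) that by (simp add: agree_def)
    show "wp B M (seqs (map (\<lambda>x. flip (e x) (g x)) xs)) Q s'"
    proof (rule Cons.IH[OF 1(2)])
      show "wok B s'' (e z) \<and> wok B s'' (g z) \<and> ieval s'' (e z) = i z \<and> ieval s'' (g z) = j z \<and> i z < D \<and> j z < D"
        if "z \<in> set xs" "agree {aMAT} {} s' s''" for z s''
        using Cons.prems(2)[OF _ tr[OF that(2)]] that(1) by simp
      show "Q s''" if "agree {aMAT} {} s' s''"
        "represents s'' (\<lambda>y. P y * sg (y (i x) * y (j x)) * (\<Prod>x\<leftarrow>xs. sg (y (i x) * y (j x))))" for s''
        using Cons.prems(3)[OF tr[OF that(1)]] that(2) by (simp add: mult.assoc)
    qed
  qed
  then show ?case by simp
qed

text \<open>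
  What the construction of the form reads: the gluing tables, the labels and the cocycle.
\<close>

definition inputs :: "state \<Rightarrow> (nat \<Rightarrow> nat) \<Rightarrow> (nat \<Rightarrow> bit) \<Rightarrow> bool" where
  "inputs s lab \<alpha> \<longleftrightarrow> tables s \<and> fst s aLAB = lab \<and> lab_ok lab \<and>
     (\<forall>i<16 * tets T. fst s aALPHA i \<le> 1 \<and> of_nat (fst s aALPHA i) = \<alpha> i)"

lemma inputs_agree:
  assumes "agree A C s s'" "inputs s lab \<alpha>" "0 \<notin> A" "aN \<notin> A" "aNBR \<notin> A" "aGP \<notin> A" "aLAB \<notin> A" "aALPHA \<notin> A"
  shows "inputs s' lab \<alpha>"
  using assms tables_agree[OF assms(1)] by (simp add: inputs_def agree_def)

lemma edge_rep_eval:
  assumes inp: "inputs s lab \<alpha>" and t: "fst s aT 0 = t" "t < tets T" and p: "fst p < 4" "snd p < 4"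
  shows "ieval s (WGet aLAB (slotE (fst p) (snd p))) = edge_rep lab t p"
    "wok B s (WGet aLAB (slotE (fst p) (snd p)))" "edge_rep lab t p < 16 * tets T" "edge_rep lab t p < B"
    "ieval s (variableE p) = 1 + edge_rep lab t p" "wok B s (variableE p)"
proof -
  note e = slot_eval[OF t p]
  show r: "edge_rep lab t p < 16 * tets T"
    using inp t p by (cases p) (auto simp: inputs_def intro: edge_rep_less)
  then show "edge_rep lab t p < B" by (rule small_index(1))
  show "ieval s (WGet aLAB (slotE (fst p) (snd p))) = edge_rep lab t p"
    "wok B s (WGet aLAB (slotE (fst p) (snd p)))"
    "ieval s (variableE p) = 1 + edge_rep lab t p" "wok B s (variableE p)"
    using e inp by (simp_all add: inputs_def edge_rep_def variableE_def)
qed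

lemma all_zero_eval:
  assumes inp: "inputs s lab \<alpha>" and t: "fst s aT 0 = t" "t < tets T" and p: "\<forall>p\<in>set ps. fst p < 4 \<and> snd p < 4"
  shows "bok B s (all_zero ps) \<and> (ibeval s (all_zero ps) \<longleftrightarrow> (\<forall>p\<in>set ps. \<alpha> (edge_rep lab t p) = 0))"
  using p
proof (induction ps)
  case (Cons p ps)
  then have p: "fst p < 4" "snd p < 4" by simp_all
  note e = edge_rep_eval[OF inp t p]
  have a: "fst s aALPHA (edge_rep lab t p) \<le> 1" "of_nat (fst s aALPHA (edge_rep lab t p)) = \<alpha> (edge_rep lab t p)"
    using inp e(3) by (simp_all add: inputs_def)
  have z: "fst s aALPHA (edge_rep lab t p) = 0 \<longleftrightarrow> \<alpha> (edge_rep lab t p) = 0"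
    using of_nat_bit_eq_iff(2)[OF a(1)] a(2) by simp
  have "bok B s (all_zero (p # ps)) \<longleftrightarrow> bok B s (all_zero ps)"
    using e by simp
  moreover have "ibeval s (all_zero (p # ps)) \<longleftrightarrow> \<alpha> (edge_rep lab t p) = 0 \<and> ibeval s (all_zero ps)"
    using e(1) z by simp
  ultimately show ?case using Cons by simp
qed simp

lemma face_edges_less: "p \<in> set (face_edges f) \<Longrightarrow> fst p < 4 \<and> snd p < 4"
  by (auto simp: face_edges_def face_vertices_def split: if_splits)

lemma tet_edges_less: "p \<in> set tet_edges \<Longrightarrow> fst p < 4 \<and> snd p < 4"
  by (auto simp: tet_edges_def)

lemma wp_clear_matrix:
  assumes Ds: "fst s aD 0 = D"
    and Q: "\<And>s'. agree {aI, aJ, aMAT} {1} s s' \<Longrightarrow> represents s' (\<lambda>_. 1) \<Longrightarrow> Q s'"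
  shows "wp B M clear_matrix Q s"
proof -
  let ?s1 = "zupd s 1 0 (ZSqrt2 1 0)"
  have "wp B M (SFor aI aD (SFor aJ aD (SW aMAT (indexE aD (V aI) (V aJ)) (WConst 0)))) Q ?s1"
  proof (rule wp_For_agree[where A = "{aJ, aMAT}" and C = "{}" and
        I = "\<lambda>i s'. \<forall>a<i. \<forall>b<D. fst s' aMAT (a * D + b) = 0"])
    fix i s'
    assume 1: "i < fst ?s1 aD 0" "agree {aI, aJ, aMAT} {} ?s1 s'" "fst s' aI 0 = i"
      and I: "\<forall>a<i. \<forall>b<D. fst s' aMAT (a * D + b) = 0"
    have i: "i < D" using 1(1) Ds by simp
    have f: "fst s' aD 0 = D" using 1(2) Ds by (simp add: agree_def)
    show "wp B M (SFor aJ aD (SW aMAT (indexE aD (V aI) (V aJ)) (WConst 0)))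
      (\<lambda>s''. \<forall>a<Suc i. \<forall>b<D. fst (wupd s'' aI 0 (Suc i)) aMAT (a * D + b) = 0) s'"
    proof (rule wp_map_loop[where idx = "\<lambda>j. i * D + j" and val = "\<lambda>_. 0" and n = D])
      fix j s2 assume j: "j < D" "agree {aJ, aMAT} {} s' s2" "fst s2 aJ 0 = j"
      then show "wok B s2 (indexE aD (V aI) (V aJ)) \<and> wok B s2 (WConst 0) \<and>
        ieval s2 (indexE aD (V aI) (V aJ)) = i * D + j \<and> i * D + j < B \<and> ieval s2 (WConst 0) = 0 \<and> 0 \<le> M"
        using 1(3) f matrix_index[OF i j(1)] by (simp add: indexE_def agree_def)
    next
      fix s2 :: state
      assume v: "\<And>j. j < D \<Longrightarrow> fst s2 aMAT (i * D + j) = 0"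
        and un: "\<And>k. k \<notin> (\<lambda>j. i * D + j) ` {..<D} \<Longrightarrow> fst s2 aMAT k = fst s' aMAT k"
      have "fst s2 aMAT (a * D + b) = 0" if "a < i" "b < D" for a b
      proof -
        have "a * D + b \<notin> (\<lambda>j. i * D + j) ` {..<D}"
          using that index_inj[OF that(2), of _ a i] by auto
        then have "fst s2 aMAT (a * D + b) = fst s' aMAT (a * D + b)" by (rule un)
        then show ?thesis using I that by simp
      qed
      then show "\<forall>a<Suc i. \<forall>b<D. fst (wupd s2 aI 0 (Suc i)) aMAT (a * D + b) = 0"
        using v by (simp add: less_Suc_eq)
    qed (use f in \<open>auto simp: inj_on_def\<close>)
  next
    fix s' assume ag: "agree {aI, aJ, aMAT} {} ?s1 s'" and I: "\<forall>a<fst ?s1 aD 0. \<forall>b<D. fst s' aMAT (a * D + b) = 0"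
    have z: "fst s' aMAT (a * D + b) = 0" if "a < D" "b < D" for a b using I Ds that by simp
    have "qf (mat s') {..<D} y = 0" for y
      unfolding qf_def by (intro sum.neutral ballI) (simp only: mat_def z lessThan_iff of_nat_0 mult_zero_left)
    moreover have "snd s' 1 0 = ZSqrt2 1 0" "fst s' aD 0 = D" using ag Ds by (simp_all add: agree_def)
    ultimately have "represents s' (\<lambda>_. 1)" using z by (simp add: represents_def acc_def)
    moreover have "agree {aI, aJ, aMAT} {1} s s'" using ag by (simp add: agree_def)
    ultimately show "Q s'" by (intro Q)
  qed auto
  then show ?thesis by (simp add: clear_matrix_def)
qed

lemma wp_add_edge:
  assumes rep: "represents s P" and inp: "inputs s lab \<alpha>" and i: "fst s aI 0 = i" "i < 16 * tets T"
    and Q: "\<And>s'. agree {aMAT} {1} s s' \<Longrightarrow>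
      represents s' (\<lambda>y. P y * edge_piece (- zvalue c) lab \<alpha> i (y (1 + i)) (y (1 + 16 * tets T + i))) \<Longrightarrow> Q s'"
  shows "wp B M (add_edge c) Q s"
proof -
  let ?N = "16 * tets T"
  let ?e = "WAdd (WConst 1) (V aI)" and ?f = "WAdd (WConst 1) (WAdd (V aN) (V aI))"
  have N: "fst s aN 0 = ?N" and lab: "fst s aLAB = lab" and a: "fst s aALPHA i \<le> 1" "of_nat (fst s aALPHA i) = \<alpha> i"
    using inp i by (simp_all add: inputs_def tables_def)
  have iB: "i < B" using small_index(1)[OF i(2)] .
  have fl: "wp B M (flip ?e ?f) R z"
    if "represents z P'" "agree {} {1} s z" "\<And>z'. agree {aMAT} {1} s z' \<Longrightarrow> represents z' (\<lambda>y. P' y * sg (y (1 + i) * y (1 + ?N + i))) \<Longrightarrow> R z'"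
    for z P' R
  proof (rule wp_flip[OF that(1), of _ _ "1 + i" "1 + ?N + i"])
    fix z' assume 1: "agree {aMAT} {} z z'" and 2: "represents z' (\<lambda>y. P' y * sg (y (1 + i) * y (1 + ?N + i)))"
    have "agree {aMAT} {1} s z'" using 1 that(2) by (simp add: agree_def)
    then show "R z'" using 2 by (rule that(3))
  qed (use that(2) i N in \<open>simp_all add: agree_def\<close>)
  have one: "fst s aALPHA i = 1 \<longleftrightarrow> \<alpha> i = 1" using of_nat_bit_eq_iff(1)[OF a(1)] a(2) by simp
  have ss: "agree {} {1} s s" "agree {aMAT} {1} s s" by (simp_all add: agree_def)
  consider "lab i \<noteq> i" | "lab i = i" "\<alpha> i = 1" | "lab i = i" "\<alpha> i \<noteq> 1" by blast
  then show ?thesis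
  proof cases
    case 1
    have "wp B M (flip ?e ?f) Q s"
      by (rule fl[OF rep ss(1)]) (rule Q, use 1 in \<open>simp_all add: edge_piece_def\<close>)
    then show ?thesis using 1 iB i lab by (simp add: add_edge_def Let_def)
  next
    case 2
    have "wp B M (scale c) (wp B M (flip ?e ?f) Q) s"
    proof (rule wp_scale[OF rep])
      fix z assume z: "agree {} {1} s z" "represents z (\<lambda>y. P y * zvalue c)"
      show "wp B M (flip ?e ?f) Q z"
        by (rule fl[OF z(2,1)]) (rule Q, use 2 in \<open>simp_all add: edge_piece_def mult.assoc\<close>)
    qed
    then show ?thesis using 2 iB i lab one by (simp add: add_edge_def Let_def)
  next
    case 3
    have "Q s" by (rule Q[OF ss(2)]) (use 3 rep in \<open>simp add: edge_piece_def\<close>)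
    then show ?thesis using 3 iB i lab one by (simp add: add_edge_def Let_def)
  qed
qed

lemma wp_add_face:
  assumes rep: "represents s P" and inp: "inputs s lab \<alpha>" and t: "fst s aT 0 = t" "t < tets T" and f: "f < 4"
    and Q: "\<And>s'. agree {aX1, aMAT} {1} s s' \<Longrightarrow>
      represents s' (\<lambda>y. P y * face_piece (- zvalue c) lab \<alpha> (\<lambda>i. y (1 + i)) t f (y (1 + 32 * tets T + (4 * t + f)))) \<Longrightarrow> Q s'"
  shows "wp B M (add_face c f) Q s"
proof -
  let ?ps = "face_edges f" and ?m = "1 + 32 * tets T + (4 * t + f)"
  let ?P1 = "\<lambda>y. P y * (if integral_face lab \<alpha> t f then sg (y ?m * face_sum lab (\<lambda>i. y (1 + i)) t f) else 1)"
  have ps: "\<forall>p\<in>set ?ps. fst p < 4 \<and> snd p < 4" using face_edges_less by blast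
  have az: "bok B s (all_zero ?ps)" "ibeval s (all_zero ?ps) \<longleftrightarrow> integral_face lab \<alpha> t f"
    using all_zero_eval[OF inp t ps] by (simp_all add: integral_face_def)
  let ?snd = "SIf (BLess (WAdd (WMul (WConst 4) (V aT)) (WConst f)) (WAdd (WMul (WConst 4) (nbrE f)) (gpE f f)))
        (SSeq (seqs (map (\<lambda>p. flip (WConst 0) (variableE p)) ?ps))
           (SIf (BEq (V aX1) (WConst 1)) (scale (ZSqrt2 2 0)) (scale c)))
        (scale (ZSqrt2 2 0))"
  have second: "wp B M ?snd Q z"
    if ag: "agree {aX1, aMAT} {} s z" and r: "represents z ?P1"
      and x: "fst z aX1 0 = (if integral_face lab \<alpha> t f then 1 else 0)" for z
  proof -
    have inpz: "inputs z lab \<alpha>" by (rule inputs_agree[OF ag inp]) auto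
    have tz: "fst z aT 0 = t" using ag t by (simp add: agree_def)
    have tabz: "tables z" using inpz by (simp add: inputs_def)
    note ev = nbr_eval[OF tabz tz t(2) f] gp_eval[OF tabz tz t(2) f f]
    let ?b = "BLess (WAdd (WMul (WConst 4) (V aT)) (WConst f)) (WAdd (WMul (WConst 4) (nbrE f)) (gpE f f))"
    have b: "bok B z ?b" "ibeval z ?b \<longleftrightarrow> leading_face t f"
      using ev tz by (simp_all add: leading_face_def)
    show ?thesis
    proof (cases "leading_face t f")
      case True
      have "wp B M (seqs (map (\<lambda>p. flip (WConst 0) (variableE p)) ?ps))
        (wp B M (SIf (BEq (V aX1) (WConst 1)) (scale (ZSqrt2 2 0)) (scale c)) Q) z"
      proof (rule wp_flips[OF r, where i = "\<lambda>_. 0" and j = "\<lambda>p. 1 + edge_rep lab t p"])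
        fix p z' assume p: "p \<in> set ?ps" and agz: "agree {aMAT} {} z z'"
        have "inputs z' lab \<alpha>" "fst z' aT 0 = t"
          by (rule inputs_agree[OF agz inpz]; simp) (use agz tz in \<open>simp add: agree_def\<close>)
        note e = edge_rep_eval[OF this t(2)]
        show "wok B z' (WConst 0) \<and> wok B z' (variableE p) \<and> ieval z' (WConst 0) = 0 \<and>
          ieval z' (variableE p) = 1 + edge_rep lab t p \<and> 0 < D \<and> 1 + edge_rep lab t p < D"
          using e[of p] ps p by auto
      next
        fix z' assume agz: "agree {aMAT} {} z z'"
          and r': "represents z' (\<lambda>y. ?P1 y * (\<Prod>p\<leftarrow>?ps. sg (y 0 * y (1 + edge_rep lab t p))))"
        have r2: "represents z' (\<lambda>y. ?P1 y * sg (face_sum lab (\<lambda>i. y (1 + i)) t f))"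
          by (rule represents_cong[OF r']) (simp add: face_sum_def sg_sum_list)
        let ?k = "if integral_face lab \<alpha> t f then ZSqrt2 2 0 else c"
        have "wp B M (scale ?k) Q z'"
        proof (rule wp_scale[OF r2])
          fix z2 assume ag2: "agree {} {1} z' z2"
            and r3: "represents z2 (\<lambda>y. ?P1 y * sg (face_sum lab (\<lambda>i. y (1 + i)) t f) * zvalue ?k)"
          have "agree {aX1, aMAT} {1} s z2" using ag agz ag2 by (simp add: agree_def)
          moreover have "represents z2 (\<lambda>y. P y * face_piece (- zvalue c) lab \<alpha> (\<lambda>i. y (1 + i)) t f (y ?m))"
            by (rule represents_cong[OF r3]) (use True in \<open>simp add: face_piece_def mult.assoc\<close>)
          ultimately show "Q z2" by (rule Q)
        qed
        moreover have "fst z' aX1 0 = (if integral_face lab \<alpha> t f then 1 else 0)" using agz x by (simp add: agree_def)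
        ultimately show "wp B M (SIf (BEq (V aX1) (WConst 1)) (scale (ZSqrt2 2 0)) (scale c)) Q z'"
          by (simp split: if_splits)
      qed
      then show ?thesis using b True by (simp only: wp_simps if_True simp_thms)
    next
      case False
      have "wp B M (scale (ZSqrt2 2 0)) Q z"
      proof (rule wp_scale[OF r])
        fix z2 assume ag2: "agree {} {1} z z2" and r3: "represents z2 (\<lambda>y. ?P1 y * zvalue (ZSqrt2 2 0))"
        have "agree {aX1, aMAT} {1} s z2" using ag ag2 by (simp add: agree_def)
        moreover have "represents z2 (\<lambda>y. P y * face_piece (- zvalue c) lab \<alpha> (\<lambda>i. y (1 + i)) t f (y ?m))"
          by (rule represents_cong[OF r3]) (use False in \<open>simp add: face_piece_def mult.assoc\<close>)
        ultimately show "Q z2" by (rule Q)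
      qed
      then show ?thesis using b False by (simp only: wp_simps if_False simp_thms)
    qed
  qed
  show ?thesis
  proof (cases "integral_face lab \<alpha> t f")
    case True
    let ?s1 = "wupd s aX1 0 1"
    have ag1: "agree {aX1} {} s ?s1" by (simp add: agree_def)
    have inp1: "inputs ?s1 lab \<alpha>" by (rule inputs_agree[OF ag1 inp]) auto
    have r1: "represents ?s1 P" by (rule represents_agree[OF rep]) simp_all
    have "wp B M (seqs (map (\<lambda>p. flip (multiplierE f) (variableE p)) ?ps)) (wp B M ?snd Q) ?s1"
    proof (rule wp_flips[OF r1, where i = "\<lambda>_. ?m" and j = "\<lambda>p. 1 + edge_rep lab t p"])
      fix p z' assume p: "p \<in> set ?ps" and agz: "agree {aMAT} {} ?s1 z'"
      have i': "inputs z' lab \<alpha>" "fst z' aT 0 = t"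
        by (rule inputs_agree[OF agz inp1]; simp) (use agz t in \<open>simp add: agree_def\<close>)
      note e = edge_rep_eval[OF i' t(2)]
      have "fst z' 0 0 = tets T" using i'(1) by (simp add: inputs_def tables_def)
      then have "ieval z' (multiplierE f) = ?m" "wok B z' (multiplierE f)" using i'(2) by (simp_all add: multiplierE_def)
      then show "wok B z' (multiplierE f) \<and> wok B z' (variableE p) \<and> ieval z' (multiplierE f) = ?m \<and>
        ieval z' (variableE p) = 1 + edge_rep lab t p \<and> ?m < D \<and> 1 + edge_rep lab t p < D"
        using e[of p] ps p t(2) f by auto
    next
      fix z' assume agz: "agree {aMAT} {} ?s1 z'"
        and r': "represents z' (\<lambda>y. P y * (\<Prod>p\<leftarrow>?ps. sg (y ?m * y (1 + edge_rep lab t p))))"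
      have "sg (y ?m * face_sum lab (\<lambda>i. y (1 + i)) t f) = (\<Prod>p\<leftarrow>?ps. sg (y ?m * y (1 + edge_rep lab t p)))" for y
        by (simp add: face_sum_def sum_list_const_mult[symmetric] sg_sum_list)
      then have "represents z' ?P1" using r' True by simp
      moreover have "agree {aX1, aMAT} {} s z'" "fst z' aX1 0 = 1" using agz by (simp_all add: agree_def)
      ultimately show "wp B M ?snd Q z'" using True by (intro second) simp_all
    qed
    then have "wp B M (SSeq (put aX1 (WConst 1)) (seqs (map (\<lambda>p. flip (multiplierE f) (variableE p)) ?ps))) (wp B M ?snd Q) s"
      unfolding wp_simps(4) wp_simps(2) wok.simps ieval.simps using small_index(3) by simp
    then show ?thesis
      unfolding add_face_def wp_SSeq_fun[of _ _ "SIf _ _ _"]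
      by (subst wp_simps(5)) (use az True in \<open>simp only: if_True simp_thms\<close>)
  next
    case False
    have "wp B M ?snd Q (wupd s aX1 0 0)"
    proof (rule second)
      have "represents (wupd s aX1 0 0) P" by (rule represents_agree[OF rep]) simp_all
      then show "represents (wupd s aX1 0 0) ?P1" using False by simp
    qed (use False in \<open>simp_all add: agree_def\<close>)
    then have "wp B M (put aX1 (WConst 0)) (wp B M ?snd Q) s"
      by (simp only: wp_simps(2) simp_thms wok.simps ieval.simps B_pos zero_le)
    then show ?thesis
      unfolding add_face_def wp_SSeq_fun
      by (subst wp_simps(5)) (use az False in \<open>simp only: if_False simp_thms\<close>)
  qed
qed

lemma wp_add_tet:
  assumes rep: "represents s P" and inp: "inputs s lab \<alpha>" and t: "fst s aT 0 = t" "t < tets T"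
    and Q: "\<And>s'. agree {aMAT} {1} s s' \<Longrightarrow>
      represents s' (\<lambda>y. P y * tet_piece (- zvalue c) lab \<alpha> (\<lambda>i. y (1 + i)) t) \<Longrightarrow> Q s'"
  shows "wp B M (add_tet c) Q s"
proof -
  have ps: "\<forall>p\<in>set tet_edges. fst p < 4 \<and> snd p < 4" using tet_edges_less by blast
  have pairs: "fst (fst z) < 4 \<and> snd (fst z) < 4 \<and> fst (snd z) < 4 \<and> snd (snd z) < 4" if "z \<in> set tet_edge_pairs" for z
    using that by (auto simp: tet_edge_pairs_def tet_edges_def upt_rec)
  let ?r = "edge_rep lab t"
  let ?P1 = "\<lambda>y. P y * (\<Prod>p\<leftarrow>tet_edges. sg (y 0 * y (1 + ?r p)))"
  let ?P2 = "\<lambda>y. ?P1 y * (\<Prod>z\<leftarrow>tet_edge_pairs. sg (y (1 + ?r (fst z)) * y (1 + ?r (snd z))))"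
  let ?fin = "SIf (all_zero tet_edges) SSkip (scale c)"
  have fin: "wp B M ?fin Q z" if ag: "agree {aMAT} {} s z" and r: "represents z ?P2" for z
  proof -
    have inpz: "inputs z lab \<alpha>" by (rule inputs_agree[OF ag inp]) auto
    have tz: "fst z aT 0 = t" using ag t by (simp add: agree_def)
    have az: "bok B z (all_zero tet_edges)" "ibeval z (all_zero tet_edges) \<longleftrightarrow> integral_tet lab \<alpha> t"
      using all_zero_eval[OF inpz tz t(2) ps] by (simp_all add: integral_tet_def)
    have r2: "represents z (\<lambda>y. P y * sg (tet_sign lab (\<lambda>i. y (1 + i)) t))"
    proof (rule represents_cong[OF r])
      fix y :: "nat \<Rightarrow> bit" assume "y 0 = 1"
      then show "?P2 y = P y * sg (tet_sign lab (\<lambda>i. y (1 + i)) t)"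
        by (simp add: tet_edges_def tet_edge_pairs_def upt_rec tet_sign_def Let_def sext_sign_def
            distrib_left sg_add mult_ac)
    qed
    show ?thesis
    proof (cases "integral_tet lab \<alpha> t")
      case True
      have "agree {aMAT} {1} s z" using ag by (simp add: agree_def)
      then have "Q z" by (rule Q) (use r2 True in \<open>simp add: tet_piece_def\<close>)
      then show ?thesis using az True by simp
    next
      case False
      have "wp B M (scale c) Q z"
      proof (rule wp_scale[OF r2])
        fix z' assume ag': "agree {} {1} z z'" and r': "represents z' (\<lambda>y. P y * sg (tet_sign lab (\<lambda>i. y (1 + i)) t) * zvalue c)"
        have "agree {aMAT} {1} s z'" using ag ag' by (simp add: agree_def)
        then show "Q z'" by (rule Q) (use r' False in \<open>simp add: tet_piece_def mult.assoc\<close>)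
      qed
      then show ?thesis using az False by simp
    qed
  qed
  have step: "wok B z (variableE p) \<and> ieval z (variableE p) = 1 + ?r p \<and> 1 + ?r p < D"
    if "agree {aMAT} {} s z" "fst p < 4" "snd p < 4" for z p
  proof -
    have "inputs z lab \<alpha>" "fst z aT 0 = t"
      by (rule inputs_agree[OF that(1) inp]; simp) (use that(1) t in \<open>simp add: agree_def\<close>)
    from edge_rep_eval[OF this t(2) that(2,3)] show ?thesis by simp
  qed
  have "wp B M (seqs (map (\<lambda>p. flip (WConst 0) (variableE p)) tet_edges))
    (wp B M (seqs (map (\<lambda>z. flip (variableE (fst z)) (variableE (snd z))) tet_edge_pairs)) (wp B M ?fin Q)) s"
  proof (rule wp_flips[OF rep, where i = "\<lambda>_. 0" and j = "\<lambda>p. 1 + ?r p"])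
    fix z assume ag: "agree {aMAT} {} s z" and r: "represents z ?P1"
    show "wp B M (seqs (map (\<lambda>z. flip (variableE (fst z)) (variableE (snd z))) tet_edge_pairs)) (wp B M ?fin Q) z"
    proof (rule wp_flips[OF r, where i = "\<lambda>z. 1 + ?r (fst z)" and j = "\<lambda>z. 1 + ?r (snd z)"])
      fix x z' assume x: "x \<in> set tet_edge_pairs" and agz: "agree {aMAT} {} z z'"
      have "agree {aMAT} {} s z'" using ag agz by (simp add: agree_def)
      then show "wok B z' (variableE (fst x)) \<and> wok B z' (variableE (snd x)) \<and> ieval z' (variableE (fst x)) = 1 + ?r (fst x) \<and>
        ieval z' (variableE (snd x)) = 1 + ?r (snd x) \<and> 1 + ?r (fst x) < D \<and> 1 + ?r (snd x) < D"
        using step pairs[OF x] by blast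
    next
      fix z' assume agz: "agree {aMAT} {} z z'" and r': "represents z' ?P2"
      have "agree {aMAT} {} s z'" using ag agz by (simp add: agree_def)
      then show "wp B M ?fin Q z'" using r' by (rule fin)
    qed
  qed (use step ps in auto)
  then show ?thesis by (simp only: add_tet_def wp_SSeq_fun)
qed

lemma mods_pieces:
  "wmods (add_edge c) = {aMAT}" "zmods (add_edge c) = {1}"
  "wmods (add_face c f) \<subseteq> {aX1, aMAT}" "zmods (add_face c f) \<subseteq> {1}"
  "wmods (add_tet c) \<subseteq> {aMAT}" "zmods (add_tet c) \<subseteq> {1}"
  by (auto simp: add_edge_def add_face_def add_tet_def Let_def scale_def flip_def seqs_simps)

text \<open>
  Each of the three loops multiplies the represented function by one family of pieces.
\<close>

lemma wp_build_form:
  assumes inp: "inputs s lab \<alpha>" and Ds: "fst s aD 0 = D"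
    and Q: "\<And>s'. agree {aI, aJ, aT, aX1, aMAT} {1} s s' \<Longrightarrow>
      represents s' (piece_product (- zvalue c) lab \<alpha>) \<Longrightarrow> Q s'"
  shows "wp B M (build_form c) Q s"
proof -
  let ?N = "16 * tets T"
  let ?E = "\<lambda>k y. \<Prod>i<k. edge_piece (- zvalue c) lab \<alpha> i (y (1 + i)) (y (1 + ?N + i))"
  let ?fp = "\<lambda>t f y. face_piece (- zvalue c) lab \<alpha> (\<lambda>i. y (1 + i)) t f (y (1 + 32 * tets T + (4 * t + f)))"
  let ?F = "\<lambda>k y. \<Prod>t<k. \<Prod>f<4. ?fp t f y"
  let ?G = "\<lambda>k y. \<Prod>t<k. tet_piece (- zvalue c) lab \<alpha> (\<lambda>i. y (1 + i)) t"
  have tets: "wp B M (SFor aT 0 (add_tet c)) Q z"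
    if ag: "agree {aI, aJ, aT, aX1, aMAT} {1} s z" and r: "represents z (\<lambda>y. ?E ?N y * ?F (tets T) y)" for z
  proof (rule wp_For_agree[where A = "{aMAT}" and C = "{1}" and I = "\<lambda>t s'. represents s' (\<lambda>y. ?E ?N y * ?F (tets T) y * ?G t y)"])
    have inpz: "inputs z lab \<alpha>" by (rule inputs_agree[OF ag inp]) auto
    show "represents (wupd z aT 0 0) (\<lambda>y. ?E ?N y * ?F (tets T) y * ?G 0 y)"
      by (rule represents_agree[where s = z]) (use r in simp_all)
    { fix t z' assume t: "t < fst z 0 0" "fst z' aT 0 = t" and agz: "agree {aT, aMAT} {1} z z'"
        and I: "represents z' (\<lambda>y. ?E ?N y * ?F (tets T) y * ?G t y)"
      have tt: "t < tets T" using t inpz by (simp add: inputs_def tables_def)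
      have "inputs z' lab \<alpha>" by (rule inputs_agree[OF agz inpz]) auto
      then show "wp B M (add_tet c) (\<lambda>s''. represents (wupd s'' aT 0 (Suc t)) (\<lambda>y. ?E ?N y * ?F (tets T) y * ?G (Suc t) y)) z'"
      proof (rule wp_add_tet[OF I _ t(2) tt])
        fix z2 assume r2: "represents z2 (\<lambda>y. ?E ?N y * ?F (tets T) y * ?G t y * tet_piece (- zvalue c) lab \<alpha> (\<lambda>i. y (1 + i)) t)"
        have "represents z2 (\<lambda>y. ?E ?N y * ?F (tets T) y * ?G (Suc t) y)"
          by (rule represents_cong[OF r2]) (simp only: prod.lessThan_Suc mult.assoc)
        then show "represents (wupd z2 aT 0 (Suc t)) (\<lambda>y. ?E ?N y * ?F (tets T) y * ?G (Suc t) y)"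
          by (rule represents_agree) simp_all
      qed }
    fix z' assume agz: "agree {aT, aMAT} {1} z z'"
      and I: "represents z' (\<lambda>y. ?E ?N y * ?F (tets T) y * ?G (fst z 0 0) y)"
    have "agree {aI, aJ, aT, aX1, aMAT} {1} s z'" using ag agz by (simp add: agree_def)
    moreover have "fst z 0 0 = tets T" using inpz by (simp add: inputs_def tables_def)
    then have "represents z' (piece_product (- zvalue c) lab \<alpha>)"
      using I unfolding piece_product_def[abs_def] by simp
    ultimately show "Q z'" by (rule Q)
  qed (use mods_pieces[of c] in auto)
  have faces: "wp B M (SFor aT 0 (seqs (map (add_face c) [0, 1, 2, 3]))) (wp B M (SFor aT 0 (add_tet c)) Q) z"
    if ag: "agree {aI, aJ, aMAT} {1} s z" and r: "represents z (?E ?N)" for z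
  proof (rule wp_For_agree[where A = "{aX1, aMAT}" and C = "{1}" and I = "\<lambda>t s'. represents s' (\<lambda>y. ?E ?N y * ?F t y)"])
    have inpz: "inputs z lab \<alpha>" by (rule inputs_agree[OF ag inp]) auto
    have nz: "fst z 0 0 = tets T" using inpz by (simp add: inputs_def tables_def)
    show "represents (wupd z aT 0 0) (\<lambda>y. ?E ?N y * ?F 0 y)"
      by (rule represents_agree[where s = z]) (use r in simp_all)
    { fix t z' assume t: "t < fst z 0 0" "fst z' aT 0 = t" and agz: "agree {aT, aX1, aMAT} {1} z z'"
        and I: "represents z' (\<lambda>y. ?E ?N y * ?F t y)"
      have tt: "t < tets T" using t nz by simp
      have inpz': "inputs z' lab \<alpha>" by (rule inputs_agree[OF agz inpz]) auto
      show "wp B M (seqs (map (add_face c) [0, 1, 2, 3])) (\<lambda>s''. represents (wupd s'' aT 0 (Suc t)) (\<lambda>y. ?E ?N y * ?F (Suc t) y)) z'"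
      proof (rule wp_seqs_agree[where A = "{aX1, aMAT}" and C = "{1}" and
            I = "\<lambda>ys s''. represents s'' (\<lambda>y. ?E ?N y * ?F t y * (\<Prod>f\<leftarrow>ys. ?fp t f y))"])
        fix ys f zs z2 assume sp: "[0, 1, 2, 3] = ys @ f # zs" and ag2: "agree {aX1, aMAT} {1} z' z2"
          and I2: "represents z2 (\<lambda>y. ?E ?N y * ?F t y * (\<Prod>f\<leftarrow>ys. ?fp t f y))"
        have "f \<in> set [0, 1, 2, 3]" unfolding sp by simp
        then have f: "f < 4" by auto
        show "wp B M (add_face c f) (\<lambda>s''. represents s'' (\<lambda>y. ?E ?N y * ?F t y * (\<Prod>f\<leftarrow>ys @ [f]. ?fp t f y))) z2"
        proof (rule wp_add_face[OF I2 _ _ tt f])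
          show "inputs z2 lab \<alpha>" by (rule inputs_agree[OF ag2 inpz']) auto
          show "fst z2 aT 0 = t" using ag2 t(2) by (simp add: agree_def)
          show "represents z3 (\<lambda>y. ?E ?N y * ?F t y * (\<Prod>f\<leftarrow>ys @ [f]. ?fp t f y))"
            if "represents z3 (\<lambda>y. ?E ?N y * ?F t y * (\<Prod>f\<leftarrow>ys. ?fp t f y) * ?fp t f y)" for z3
            by (rule represents_cong[OF that]) (simp add: mult.assoc)
        qed
      next
        fix z2 assume I2: "represents z2 (\<lambda>y. ?E ?N y * ?F t y * (\<Prod>f\<leftarrow>[0, 1, 2, 3]. ?fp t f y))"
        have four: "(\<Prod>f<4. g f) = (\<Prod>f\<leftarrow>[0, 1, 2, 3]. g f)" for g :: "nat \<Rightarrow> real"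
          by (simp add: eval_nat_numeral mult_ac)
        have "represents z2 (\<lambda>y. ?E ?N y * ?F (Suc t) y)"
          by (rule represents_cong[OF I2]) (simp only: prod.lessThan_Suc[of _ t] four mult.assoc)
        then show "represents (wupd z2 aT 0 (Suc t)) (\<lambda>y. ?E ?N y * ?F (Suc t) y)"
          by (rule represents_agree) simp_all
      qed (use I mods_pieces[of c] in auto) }
    fix z' assume agz: "agree {aT, aX1, aMAT} {1} z z'" and I: "represents z' (\<lambda>y. ?E ?N y * ?F (fst z 0 0) y)"
    show "wp B M (SFor aT 0 (add_tet c)) Q z'"
      by (rule tets) (use ag agz I nz in \<open>simp_all add: agree_def\<close>)
  qed (use mods_pieces[of c] in auto)
  have edges: "wp B M (SFor aI aN (add_edge c)) (wp B M (SFor aT 0 (seqs (map (add_face c) [0, 1, 2, 3])))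
      (wp B M (SFor aT 0 (add_tet c)) Q)) z"
    if ag: "agree {aI, aJ, aMAT} {1} s z" and r: "represents z (\<lambda>_. 1)" for z
  proof (rule wp_For_agree[where A = "{aMAT}" and C = "{1}" and I = "\<lambda>k s'. represents s' (?E k)"])
    have inpz: "inputs z lab \<alpha>" by (rule inputs_agree[OF ag inp]) auto
    have nz: "fst z aN 0 = ?N" using inpz by (simp add: inputs_def tables_def)
    show "represents (wupd z aI 0 0) (?E 0)"
      by (rule represents_agree[where s = z]) (use r in simp_all)
    { fix i z' assume i: "i < fst z aN 0" "fst z' aI 0 = i" and agz: "agree {aI, aMAT} {1} z z'"
        and I: "represents z' (?E i)"
      have ii: "i < ?N" using i nz by simp
      have "inputs z' lab \<alpha>" by (rule inputs_agree[OF agz inpz]) auto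
      then show "wp B M (add_edge c) (\<lambda>s''. represents (wupd s'' aI 0 (Suc i)) (?E (Suc i))) z'"
      proof (rule wp_add_edge[OF I _ i(2) ii])
        fix z2 assume r2: "represents z2 (\<lambda>y. ?E i y * edge_piece (- zvalue c) lab \<alpha> i (y (1 + i)) (y (1 + ?N + i)))"
        have "represents z2 (?E (Suc i))"
          by (rule represents_cong[OF r2]) (simp only: prod.lessThan_Suc)
        then show "represents (wupd z2 aI 0 (Suc i)) (?E (Suc i))"
          by (rule represents_agree) simp_all
      qed }
    fix z' assume agz: "agree {aI, aMAT} {1} z z'" and I: "represents z' (?E (fst z aN 0))"
    show "wp B M (SFor aT 0 (seqs (map (add_face c) [0, 1, 2, 3]))) (wp B M (SFor aT 0 (add_tet c)) Q) z'"
      by (rule faces) (use ag agz I nz in \<open>simp_all add: agree_def\<close>)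
  qed (use mods_pieces[of c] in auto)
  show ?thesis
    unfolding build_form_def wp_SSeq_fun by (rule wp_clear_matrix[OF Ds edges])
qed

end

section \<open>Evaluation of the Gauss sum\<close>

definition matE :: "wexp \<Rightarrow> wexp \<Rightarrow> wexp" where
  "matE e f = WGet aMAT (indexE aD e f)"

text \<open>
  The coefficients \<open>lf\<close> of row \<open>w\<close>; the diagonal entry is added at position \<open>0\<close> afterwards.
\<close>

definition form_row :: "nat \<Rightarrow> nat \<Rightarrow> stm" where
  "form_row A w = SSeq
     (SFor aJ aV (SW A (V aJ) (xorE (matE (V w) (V aJ)) (matE (V aJ) (V w)))))
     (SW A (WConst 0) (xorE (WGet A (WConst 0)) (matE (V w) (V w))))"

text \<open>
  Position \<open>0\<close> is the constant coordinate and cannot be a pivot, so \<open>0\<close> encodes failure.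
\<close>

definition find_pivot :: stm where
  "find_pivot = SSeq (put aPIV (WConst 0))
     (SFor aJ aV (SIf (BAnd (BLess (WConst 0) (V aJ)) (BEq (WGet aLF (V aJ)) (WConst 1))) (put aPIV (V aJ)) SSkip))"

definition rank_one :: stm where
  "rank_one = SFor aJ aV (SFor aK aV (SW aMAT (indexE aD (V aJ) (V aK))
     (xorE (matE (V aJ) (V aK)) (WMul (WGet aLF (V aJ)) (WGet aMF (V aK))))))"

definition clear_pivot :: stm where
  "clear_pivot = SSeq (SFor aJ aV (SW aMAT (indexE aD (V aPIV) (V aJ)) (WConst 0)))
     (SFor aJ aV (SW aMAT (indexE aD (V aJ) (V aPIV)) (WConst 0)))"

text \<open>
  Removes the last variable \<open>v = 36 n - i\<close>.  Without a pivot the accumulator is multiplied by \<open>2\<close> or by \<open>0\<close>;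
  with a pivot the matrix is updated as in \<open>gauss_insert_pivot\<close>.
\<close>

definition sum_variable :: stm where
  "sum_variable = SSeq (put aV (WSub (V aP) (V aI))) (SSeq (form_row aLF aV) (SSeq find_pivot
     (SIf (BEq (V aPIV) (WConst 0))
        (SIf (BEq (WGet aLF (WConst 0)) (WConst 0)) (scale (ZSqrt2 2 0)) (scale (ZSqrt2 0 0)))
        (SSeq (form_row aMF aPIV) (SSeq rank_one clear_pivot)))))"

definition evaluate :: stm where
  "evaluate = SSeq (put aP (WSub (V aD) (WConst 1))) (SSeq (SFor aI aP sum_variable)
     (SIf (BEq (WGet aMAT (WConst 0)) (WConst 1)) (scale (ZSqrt2 (- 1) 0)) SSkip))"

context machine
begin

text \<open>
  The entries of the upper left square of size \<open>v\<close> are bits; this is the part that is still to be eliminated.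
\<close>

definition mat_bits :: "state \<Rightarrow> nat \<Rightarrow> bool" where
  "mat_bits s v \<longleftrightarrow> fst s aD 0 = D \<and> (\<forall>i<v. \<forall>j<v. fst s aMAT (i * D + j) \<le> 1)"

lemma index_notin_row: "a \<noteq> i \<Longrightarrow> b < D \<Longrightarrow> v \<le> D \<Longrightarrow> a * D + b \<notin> (\<lambda>j. i * D + j) ` {..<v}"
proof
  assume 1: "a \<noteq> i" "b < D" "v \<le> D" "a * D + b \<in> (\<lambda>j. i * D + j) ` {..<v}"
  then obtain x where x: "x < v" "a * D + b = i * D + x" by blast
  then have "x < D" using 1(3) by linarith
  with x(2) 1(1,2) show False using index_inj[of b D x a i] by blast
qed

lemma small_index_D: "i < D \<Longrightarrow> i < B" "i \<le> D \<Longrightarrow> i \<le> M"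
proof -
  show "i < B" if "i < D" using that tets_pos by (intro less_B) linarith
  show "i \<le> M" if "i \<le> D" using that tets_pos by (simp add: M_def)
qed

lemma matE_eval:
  assumes "fst s aD 0 = D" "ieval s e = i" "ieval s f = j" "wok B s e" "wok B s f" "i < D" "j < D"
  shows "ieval s (matE e f) = fst s aMAT (i * D + j)" "wok B s (matE e f)"
  using assms matrix_index[OF assms(6,7)] by (simp_all add: matE_def indexE_def)

lemma wp_form_row:
  assumes mb: "mat_bits s n" and v: "fst s aV 0 = v" "0 < v" "v < n" and w: "fst s w 0 = u" "u < n" and n: "n \<le> D"
    and A: "A \<in> {aLF, aMF}" "w \<in> {aV, aPIV}"
    and Q: "\<And>s'. agree {aJ, A} {} s s' \<Longrightarrow>
      (\<And>j. j < v \<Longrightarrow> fst s' A j \<le> 1 \<and> of_nat (fst s' A j) = lf (mat s) u j) \<Longrightarrow> Q s'"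
  shows "wp B M (form_row A w) Q s"
proof -
  have Ds: "fst s aD 0 = D" and bits: "\<And>i j. i < n \<Longrightarrow> j < n \<Longrightarrow> fst s aMAT (i * D + j) \<le> Suc 0"
    using mb by (auto simp: mat_bits_def)
  have neq: "A \<noteq> aMAT" "A \<noteq> aD" "A \<noteq> aJ" "A \<noteq> w" "A \<noteq> aV" "w \<noteq> aJ" using A by auto
  let ?val = "\<lambda>j. bxor (fst s aMAT (u * D + j)) (fst s aMAT (j * D + u))"
  have "wp B M (SFor aJ aV (SW A (V aJ) (xorE (matE (V w) (V aJ)) (matE (V aJ) (V w)))))
     (wp B M (SW A (WConst 0) (xorE (WGet A (WConst 0)) (matE (V w) (V w)))) Q) s"
  proof (rule wp_map_loop[where idx = "\<lambda>j. j" and val = ?val and n = v])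
    fix j s2
    assume j: "j < v" "agree {aJ, A} {} s s2" "fst s2 aJ 0 = j"
    have f: "fst s2 aD 0 = D" "fst s2 w 0 = u" "fst s2 aMAT = fst s aMAT"
      using j(2) neq Ds w by (simp_all add: agree_def)
    have l: "j < n" "u < D" "j < D" using j(1) v(3) w n by simp_all
    have e: "ieval s2 (V w) = u" "ieval s2 (V aJ) = j" "wok B s2 (V w)" "wok B s2 (V aJ)" using f j(3) by simp_all
    have "?val j \<le> M" using xor_bits(1)[OF bits[OF w(2) l(1)] bits[OF l(1) w(2)]] small_index(3) by linarith
    then show "wok B s2 (V aJ) \<and> wok B s2 (xorE (matE (V w) (V aJ)) (matE (V aJ) (V w))) \<and> ieval s2 (V aJ) = j \<and> j < B \<and>
      ieval s2 (xorE (matE (V w) (V aJ)) (matE (V aJ) (V w))) = ?val j \<and> ?val j \<le> M"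
      using matE_eval[OF f(1) e(1,2,3,4) l(2,3)] matE_eval[OF f(1) e(2,1,4,3) l(3,2)] e small_index_D(1)[OF l(3)] f(3)
      by simp
  next
    fix s2
    assume ag: "agree {aJ, A} {} s s2" and val: "\<And>j. j < v \<Longrightarrow> fst s2 A j = ?val j"
    have f: "fst s2 aD 0 = D" "fst s2 w 0 = u" "fst s2 aMAT = fst s aMAT"
      using ag neq Ds w by (simp_all add: agree_def)
    have l: "u < D" using w n by simp
    let ?x = "bxor (fst s2 A 0) (fst s aMAT (u * D + u))"
    have bv: "?val j \<le> Suc 0" if "j < v" for j using that bits[of u j] bits[of j u] v w by (simp add: xor_bits)
    have bx: "?x \<le> Suc 0" "of_nat ?x = (of_nat (fst s2 A 0) + of_nat (fst s aMAT (u * D + u)) :: bit)"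
      using xor_bits[of "fst s2 A 0" "fst s aMAT (u * D + u)"] bits[OF w(2) w(2)] val[OF v(2)] bv[OF v(2)] by simp_all
    let ?s3 = "wupd s2 A 0 ?x"
    have "Q ?s3"
    proof (rule Q)
      show "agree {aJ, A} {} s ?s3" using ag by (simp add: agree_def)
      fix j assume j: "j < v"
      have base: "of_nat (?val j) = (mat s u j + mat s j u)"
        using xor_bits(2)[of "fst s aMAT (u * D + j)" "fst s aMAT (j * D + u)"] bits[of u j] bits[of j u] j v w
        by (simp add: mat_def)
      show "fst ?s3 A j \<le> 1 \<and> of_nat (fst ?s3 A j) = lf (mat s) u j"
      proof (cases "j = 0")
        case True
        have "of_nat (fst s2 A 0) = mat s u 0 + mat s 0 u"
          using base val[OF j] unfolding True by (simp only:)
        moreover have "of_nat ?x = (of_nat (fst s2 A 0) + mat s u u :: bit)"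
          unfolding bx(2) mat_def ..
        ultimately have "of_nat ?x = lf (mat s) u 0" by (simp only: lf_def simp_thms if_True)
        moreover have "fst ?s3 A j = ?x" using True by simp
        ultimately show ?thesis using bx(1) True by (simp only: One_nat_def)
      next
        case False
        have "fst ?s3 A j = ?val j" using False val[OF j] by simp
        then show ?thesis using bv[OF j] base False by (simp only: One_nat_def lf_def if_False add_0_right)
      qed
    qed
    moreover have "?x \<le> M" using bx(1) small_index(3) by linarith
    moreover have "ieval s2 (V w) = u" "wok B s2 (V w)" using f by simp_all
    note matE_eval[OF f(1) this(1,1) this(2,2) l l]
    ultimately show "wp B M (SW A (WConst 0) (xorE (WGet A (WConst 0)) (matE (V w) (V w)))) Q s2"
      using f(3) by simp
  qed (use neq v in auto)
  then show ?thesis by (simp only: form_row_def wp_simps)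
qed

lemma wp_find_pivot:
  assumes v: "fst s aV 0 = v" "v \<le> D"
    and Q: "\<And>s' u. agree {aJ, aPIV} {} s s' \<Longrightarrow> fst s' aPIV 0 = u \<Longrightarrow>
      u = 0 \<and> (\<forall>j<v. j \<noteq> 0 \<longrightarrow> fst s aLF j \<noteq> 1) \<or> 0 < u \<and> u < v \<and> fst s aLF u = 1 \<Longrightarrow> Q s'"
  shows "wp B M find_pivot Q s"
proof -
  let ?s1 = "wupd s aPIV 0 0"
  let ?I = "\<lambda>i s'. fst s' aPIV 0 = 0 \<and> (\<forall>j<i. j \<noteq> 0 \<longrightarrow> fst s aLF j \<noteq> 1) \<or>
    0 < fst s' aPIV 0 \<and> fst s' aPIV 0 < i \<and> fst s aLF (fst s' aPIV 0) = 1"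
  have "wp B M (SFor aJ aV (SIf (BAnd (BLess (WConst 0) (V aJ)) (BEq (WGet aLF (V aJ)) (WConst 1))) (put aPIV (V aJ)) SSkip)) Q ?s1"
  proof (rule wp_For_agree[where A = "{aPIV}" and C = "{}" and I = ?I])
    fix i s'
    assume 1: "i < fst ?s1 aV 0" "agree {aJ, aPIV} {} ?s1 s'" "fst s' aJ 0 = i" and I: "?I i s'"
    have i: "i < D" using 1(1) v by simp
    have "fst s' aLF = fst s aLF" using 1(2) by (simp add: agree_def)
    then show "wp B M (SIf (BAnd (BLess (WConst 0) (V aJ)) (BEq (WGet aLF (V aJ)) (WConst 1))) (put aPIV (V aJ)) SSkip)
      (\<lambda>s''. ?I (Suc i) (wupd s'' aJ 0 (Suc i))) s'"
      using I 1(3) small_index_D(1)[OF i] small_index_D(2)[of i] i by (auto simp: less_Suc_eq)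
  next
    fix s' assume "agree {aJ, aPIV} {} ?s1 s'" "?I (fst ?s1 aV 0) s'"
    then show "Q s'" using v by (intro Q[of s' "fst s' aPIV 0"]) (auto simp: agree_def)
  qed auto
  then show ?thesis by (simp add: find_pivot_def)
qed

lemma wp_rank_one:
  assumes Ds: "fst s aD 0 = D" and v: "fst s aV 0 = v" "v \<le> D"
    and bits: "\<And>i j. i < v \<Longrightarrow> j < v \<Longrightarrow> fst s aMAT (i * D + j) \<le> 1"
    and lm: "\<And>j. j < v \<Longrightarrow> fst s aLF j \<le> 1" "\<And>j. j < v \<Longrightarrow> fst s aMF j \<le> 1"
    and Q: "\<And>s'. agree {aJ, aK, aMAT} {} s s' \<Longrightarrow>
      (\<And>i j. i < v \<Longrightarrow> j < v \<Longrightarrow> fst s' aMAT (i * D + j) = bxor (fst s aMAT (i * D + j)) (fst s aLF i * fst s aMF j)) \<Longrightarrow> Q s'"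
  shows "wp B M rank_one Q s"
  unfolding rank_one_def
proof -
  let ?new = "\<lambda>i j. bxor (fst s aMAT (i * D + j)) (fst s aLF i * fst s aMF j)"
  let ?I = "\<lambda>i s'. \<forall>a<v. \<forall>b<v. fst s' aMAT (a * D + b) = (if a < i then ?new a b else fst s aMAT (a * D + b))"
  let ?in = "SFor aK aV (SW aMAT (indexE aD (V aJ) (V aK))
     (xorE (matE (V aJ) (V aK)) (WMul (WGet aLF (V aJ)) (WGet aMF (V aK)))))"
  have prod: "fst s aLF i * fst s aMF j \<le> Suc 0" if "i < v" "j < v" for i j
    using lm(1)[OF that(1)] lm(2)[OF that(2)] mult_le_mono[of _ 1 _ 1] by fastforce
  show "wp B M (SFor aJ aV ?in) Q s"
  proof (rule wp_For_agree[where A = "{aK, aMAT}" and C = "{}" and I = ?I])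
    fix i s'
    assume 1: "i < fst s aV 0" "agree {aJ, aK, aMAT} {} s s'" "fst s' aJ 0 = i" and I: "?I i s'"
    have i: "i < v" "i < D" using 1(1) v by simp_all
    have f: "fst s' aD 0 = D" "fst s' aV 0 = v" "fst s' aLF = fst s aLF" "fst s' aMF = fst s aMF"
      using 1(2) Ds v by (simp_all add: agree_def)
    show "wp B M ?in (\<lambda>s''. ?I (Suc i) (wupd s'' aJ 0 (Suc i))) s'"
    proof (rule wp_map_loop[where idx = "\<lambda>j. i * D + j" and val = "?new i" and n = v])
      fix j s2
      assume j: "j < v" "agree {aK, aMAT} {} s' s2" "fst s2 aK 0 = j"
        and un: "\<And>k. k \<notin> (\<lambda>j. i * D + j) ` {..<j} \<Longrightarrow> fst s2 aMAT k = fst s' aMAT k"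
      have jD: "j < D" using j(1) v by simp
      have g: "fst s2 aD 0 = D" "fst s2 aJ 0 = i" "fst s2 aLF = fst s aLF" "fst s2 aMF = fst s aMF"
        using j(2) f 1(3) by (simp_all add: agree_def)
      have e: "ieval s2 (V aJ) = i" "ieval s2 (V aK) = j" "wok B s2 (V aJ)" "wok B s2 (V aK)" using g j(3) by simp_all
      have "fst s2 aMAT (i * D + j) = fst s' aMAT (i * D + j)" by (rule un) auto
      also have "\<dots> = fst s aMAT (i * D + j)" using I i(1) j(1) by simp
      finally have r: "fst s2 aMAT (i * D + j) = fst s aMAT (i * D + j)" .
      have "?new i j \<le> Suc 0" using bits[OF i(1) j(1)] prod[OF i(1) j(1)] by (simp add: xor_bits)
      then have "?new i j \<le> M" using small_index(3) by linarith
      then show "wok B s2 (indexE aD (V aJ) (V aK)) \<and>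
        wok B s2 (xorE (matE (V aJ) (V aK)) (WMul (WGet aLF (V aJ)) (WGet aMF (V aK)))) \<and>
        ieval s2 (indexE aD (V aJ) (V aK)) = i * D + j \<and> i * D + j < B \<and>
        ieval s2 (xorE (matE (V aJ) (V aK)) (WMul (WGet aLF (V aJ)) (WGet aMF (V aK)))) = ?new i j \<and> ?new i j \<le> M"
        using matE_eval[OF g(1) e(1,2,3,4) i(2) jD] e g r matrix_index[OF i(2) jD] small_index_D(1)[OF i(2)] small_index_D(1)[OF jD]
        by (simp add: indexE_def)
    next
      fix s2 :: state
      assume val: "\<And>j. j < v \<Longrightarrow> fst s2 aMAT (i * D + j) = ?new i j"
        and un: "\<And>k. k \<notin> (\<lambda>j. i * D + j) ` {..<v} \<Longrightarrow> fst s2 aMAT k = fst s' aMAT k"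
      have other: "fst s2 aMAT (a * D + b) = fst s' aMAT (a * D + b)" if "a \<noteq> i" "b < v" for a b
      proof (rule un)
        show "a * D + b \<notin> (\<lambda>j. i * D + j) ` {..<v}"
          by (rule index_notin_row) (use that v in simp_all)
      qed
      show "?I (Suc i) (wupd s2 aJ 0 (Suc i))"
      proof (intro allI impI)
        fix a b assume ab: "a < v" "b < v"
        show "fst (wupd s2 aJ 0 (Suc i)) aMAT (a * D + b) = (if a < Suc i then ?new a b else fst s aMAT (a * D + b))"
          using val[OF ab(2)] other[of a b] I ab by (cases "a = i") (auto simp: less_Suc_eq)
      qed
    qed (use f in \<open>auto simp: inj_on_def\<close>)
  next
    fix s' assume ag: "agree {aJ, aK, aMAT} {} s s'" and I: "?I (fst s aV 0) s'"
    show "Q s'" by (rule Q[OF ag]) (use I v in simp)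
  qed auto
qed

lemma wp_clear_pivot:
  assumes Ds: "fst s aD 0 = D" and v: "fst s aV 0 = v" "v \<le> D" and u: "fst s aPIV 0 = u" "u < v"
    and Q: "\<And>s'. agree {aJ, aMAT} {} s s' \<Longrightarrow>
      (\<And>i j. i < v \<Longrightarrow> j < v \<Longrightarrow> fst s' aMAT (i * D + j) = (if i = u \<or> j = u then 0 else fst s aMAT (i * D + j))) \<Longrightarrow> Q s'"
  shows "wp B M clear_pivot Q s"
proof -
  have uD: "u < D" using u v by simp
  have "wp B M (SFor aJ aV (SW aMAT (indexE aD (V aPIV) (V aJ)) (WConst 0)))
    (wp B M (SFor aJ aV (SW aMAT (indexE aD (V aJ) (V aPIV)) (WConst 0))) Q) s"
  proof (rule wp_map_loop[where idx = "\<lambda>j. u * D + j" and val = "\<lambda>_. 0" and n = v])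
    fix j s2 assume j: "j < v" "agree {aJ, aMAT} {} s s2" "fst s2 aJ 0 = j"
    then have jD: "j < D" using v by simp
    show "wok B s2 (indexE aD (V aPIV) (V aJ)) \<and> wok B s2 (WConst 0) \<and>
      ieval s2 (indexE aD (V aPIV) (V aJ)) = u * D + j \<and> u * D + j < B \<and> ieval s2 (WConst 0) = 0 \<and> 0 \<le> M"
      using j Ds u matrix_index[OF uD jD] by (simp add: indexE_def agree_def)
  next
    fix s2 assume ag2: "agree {aJ, aMAT} {} s s2" and v2: "\<And>j. j < v \<Longrightarrow> fst s2 aMAT (u * D + j) = 0"
      and un2: "\<And>k. k \<notin> (\<lambda>j. u * D + j) ` {..<v} \<Longrightarrow> fst s2 aMAT k = fst s aMAT k"
    have f2: "fst s2 aD 0 = D" "fst s2 aV 0 = v" "fst s2 aPIV 0 = u" using ag2 Ds v u by (simp_all add: agree_def)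
    have inj: "inj_on (\<lambda>j. j * D + u) {..<v}"
      by (rule inj_onI) (use index_inj[OF uD uD] in blast)
    show "wp B M (SFor aJ aV (SW aMAT (indexE aD (V aJ) (V aPIV)) (WConst 0))) Q s2"
    proof (rule wp_map_loop[where idx = "\<lambda>j. j * D + u" and val = "\<lambda>_. 0" and n = v])
      fix j s3 assume j: "j < v" "agree {aJ, aMAT} {} s2 s3" "fst s3 aJ 0 = j"
      then have jD: "j < D" using v by simp
      show "wok B s3 (indexE aD (V aJ) (V aPIV)) \<and> wok B s3 (WConst 0) \<and>
        ieval s3 (indexE aD (V aJ) (V aPIV)) = j * D + u \<and> j * D + u < B \<and> ieval s3 (WConst 0) = 0 \<and> 0 \<le> M"
        using j f2 matrix_index[OF jD uD] by (simp add: indexE_def agree_def)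
    next
      fix s3 assume ag3: "agree {aJ, aMAT} {} s2 s3" and v3: "\<And>j. j < v \<Longrightarrow> fst s3 aMAT (j * D + u) = 0"
        and un3: "\<And>k. k \<notin> (\<lambda>j. j * D + u) ` {..<v} \<Longrightarrow> fst s3 aMAT k = fst s2 aMAT k"
      show "Q s3"
      proof (rule Q)
        show "agree {aJ, aMAT} {} s s3" using ag2 ag3 by (simp add: agree_def)
        fix i j assume ij: "i < v" "j < v"
        then have jD: "j < D" using v by simp
        have 3: "fst s3 aMAT (i * D + j) = fst s2 aMAT (i * D + j)" if "j \<noteq> u"
        proof (rule un3)
          show "i * D + j \<notin> (\<lambda>j. j * D + u) ` {..<v}" using that index_inj[OF jD uD, of i] by auto
        qed
        have 2: "fst s2 aMAT (i * D + j) = fst s aMAT (i * D + j)" if "i \<noteq> u"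
        proof (rule un2)
          show "i * D + j \<notin> (\<lambda>j. u * D + j) ` {..<v}"
            by (rule index_notin_row[OF that jD v(2)])
        qed
        show "fst s3 aMAT (i * D + j) = (if i = u \<or> j = u then 0 else fst s aMAT (i * D + j))"
          using 2 3 v3[OF ij(1)] v2[OF ij(2)] by (cases "j = u"; cases "i = u") simp_all
      qed
    qed (rule inj | simp add: f2)+
  qed (use v in \<open>auto simp: inj_on_def\<close>)
  then show ?thesis by (simp only: clear_pivot_def wp_simps)
qed

text \<open>
  The product of the accumulator and the Gauss sum of the remaining matrix is the invariant of the
  elimination.
\<close>

lemma wp_sum_variable:
  assumes mb: "mat_bits s (Suc v)" and v: "0 < v" "v < D" "fst s aP 0 - fst s aI 0 = v"
    and Q: "\<And>s'. agree {aV, aLF, aJ, aPIV, aMF, aK, aMAT} {1} s s' \<Longrightarrow> mat_bits s' v \<Longrightarrow>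
      acc s' * gauss (mat s') {..<v} = acc s * gauss (mat s) {..<Suc v} \<Longrightarrow> Q s'"
  shows "wp B M sum_variable Q s"
proof -
  let ?A = "mat s"
  let ?s1 = "wupd s aV 0 v"
  have Ds: "fst s aD 0 = D" and bits: "\<And>i j. i < Suc v \<Longrightarrow> j < Suc v \<Longrightarrow> fst s aMAT (i * D + j) \<le> 1"
    using mb by (auto simp: mat_bits_def)
  have mb1: "mat_bits ?s1 (Suc v)" using mb by (simp add: mat_bits_def)
  have mat1: "mat ?s1 = ?A" by (intro ext) (simp add: mat_def)
  have S: "{..<Suc v} = insert v {..<v}" "v \<notin> {..<v}" "0 \<in> {..<v}" using v by auto
  let ?br = "SIf (BEq (V aPIV) (WConst 0))
        (SIf (BEq (WGet aLF (WConst 0)) (WConst 0)) (scale (ZSqrt2 2 0)) (scale (ZSqrt2 0 0)))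
        (SSeq (form_row aMF aPIV) (SSeq rank_one clear_pivot))"
  have "wp B M (form_row aLF aV) (wp B M find_pivot (wp B M ?br Q)) ?s1"
  proof (rule wp_form_row[OF mb1, where v = v and u = v])
    fix s2 assume ag2: "agree {aJ, aLF} {} ?s1 s2"
      and l: "\<And>j. j < v \<Longrightarrow> fst s2 aLF j \<le> 1 \<and> of_nat (fst s2 aLF j) = lf (mat ?s1) v j"
    have V2: "fst s2 aV 0 = v" using ag2 by (simp add: agree_def)
    show "wp B M find_pivot (wp B M ?br Q) s2"
    proof (rule wp_find_pivot[OF V2])
      fix s3 u assume ag3: "agree {aJ, aPIV} {} s2 s3" and u: "fst s3 aPIV 0 = u"
        and alt: "u = 0 \<and> (\<forall>j<v. j \<noteq> 0 \<longrightarrow> fst s2 aLF j \<noteq> 1) \<or> 0 < u \<and> u < v \<and> fst s2 aLF u = 1"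
      have ag: "agree {aV, aLF, aJ, aPIV} {} s s3" using ag2 ag3 by (simp add: agree_def)
      have f3: "fst s3 aD 0 = D" "fst s3 aV 0 = v" "fst s3 aMAT = fst s aMAT" "fst s3 aLF = fst s2 aLF" "snd s3 = snd s"
        using ag ag3 V2 Ds by (auto simp: agree_def)
      have mat3: "mat s3 = ?A" "acc s3 = acc s" by (intro ext, simp add: mat_def f3(3), simp only: acc_def f3(5))
      have l3: "fst s3 aLF j \<le> 1" "of_nat (fst s3 aLF j) = lf ?A v j" "fst s3 aLF j = 1 \<longleftrightarrow> lf ?A v j = 1"
        "fst s3 aLF j = 0 \<longleftrightarrow> lf ?A v j = 0" if "j < v" for j
        using l[OF that] of_nat_bit_eq_iff[of "fst s2 aLF j"] unfolding mat1 f3(4) by simp_all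
      have mb3: "mat_bits s3 (Suc v)" using mb f3(1,3) by (simp add: mat_bits_def)
      then have mb3v: "mat_bits s3 v" by (simp add: mat_bits_def)
      show "wp B M ?br Q s3"
      proof (cases "u = 0")
        case True
        then have np: "lf ?A v j = 0" if "j \<in> {..<v}" "j \<noteq> 0" for j
          using alt l3(3)[of j] that f3(4) bit_cases[of "lf ?A v j"] by auto
        have G: "gauss ?A {..<Suc v} = (if lf ?A v 0 = 0 then 2 * gauss ?A {..<v} else 0)"
          unfolding S(1) by (rule gauss_insert_no_pivot[OF finite_lessThan S(2,3) np])
        let ?k = "if lf ?A v 0 = 0 then ZSqrt2 2 0 else ZSqrt2 0 0"
        let ?s4 = "zupd s3 1 0 (zmul (snd s3 1 0) ?k)"
        have "mat ?s4 = ?A" using mat3(1) by (simp add: fun_eq_iff mat_def)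
        moreover have "acc ?s4 = acc s * zvalue ?k" using mat3(2) by (simp add: acc_def zvalue_zmul)
        ultimately have "acc ?s4 * gauss (mat ?s4) {..<v} = acc s * gauss ?A {..<Suc v}"
          unfolding G by simp
        moreover have "mat_bits ?s4 v" using mb3v by (simp add: mat_bits_def)
        moreover have "agree {aV, aLF, aJ, aPIV, aMF, aK, aMAT} {1} s ?s4" using ag by (simp add: agree_def)
        ultimately have "Q ?s4" by (intro Q)
        then show ?thesis using True u l3(4)[OF v(1)] by (auto simp: scale_def split: if_splits)
      next
        case False
        then have uv: "0 < u" "u < v" "lf ?A v u = 1" using alt l3(3)[of u] f3(4) by auto
        have "wp B M (form_row aMF aPIV) (wp B M rank_one (wp B M clear_pivot Q)) s3"
        proof (rule wp_form_row[OF mb3 f3(2), where u = u])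
          fix s4 assume ag4: "agree {aJ, aMF} {} s3 s4"
            and m: "\<And>j. j < v \<Longrightarrow> fst s4 aMF j \<le> 1 \<and> of_nat (fst s4 aMF j) = lf (mat s3) u j"
          have f4: "fst s4 aD 0 = D" "fst s4 aV 0 = v" "fst s4 aMAT = fst s aMAT" "fst s4 aLF = fst s3 aLF" "fst s4 aPIV 0 = u"
            using ag4 f3 u by (simp_all add: agree_def)
          show "wp B M rank_one (wp B M clear_pivot Q) s4"
          proof (rule wp_rank_one[OF f4(1,2)])
            fix s5 assume ag5: "agree {aJ, aK, aMAT} {} s4 s5"
              and r5: "\<And>i j. i < v \<Longrightarrow> j < v \<Longrightarrow> fst s5 aMAT (i * D + j) = bxor (fst s4 aMAT (i * D + j)) (fst s4 aLF i * fst s4 aMF j)"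
            have f5: "fst s5 aD 0 = D" "fst s5 aV 0 = v" "fst s5 aPIV 0 = u"
              using ag5 f4 by (simp_all add: agree_def)
            show "wp B M clear_pivot Q s5"
            proof (rule wp_clear_pivot[OF f5(1,2) _ f5(3)])
              fix s6 assume ag6: "agree {aJ, aMAT} {} s5 s6"
                and r6: "\<And>i j. i < v \<Longrightarrow> j < v \<Longrightarrow> fst s6 aMAT (i * D + j) = (if i = u \<or> j = u then 0 else fst s5 aMAT (i * D + j))"
              have e: "fst s5 aMAT (i * D + j) \<le> Suc 0 \<and> of_nat (fst s5 aMAT (i * D + j)) = ?A i j + lf ?A v i * lf ?A u j"
                if ij: "i < v" "j < v" for i j
              proof -
                have a: "fst s aMAT (i * D + j) \<le> Suc 0" using bits[of i j] ij by simp
                have li: "fst s4 aLF i \<le> 1" "of_nat (fst s4 aLF i) = lf ?A v i" using l3(1,2)[OF ij(1)] by (simp_all add: f4(4))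
                have mj: "fst s4 aMF j \<le> 1" "of_nat (fst s4 aMF j) = lf ?A u j" using m[OF ij(2)] by (simp_all add: mat3)
                have b: "fst s4 aLF i * fst s4 aMF j \<le> Suc 0" using mult_le_mono[OF li(1) mj(1)] by simp
                have "of_nat (fst s5 aMAT (i * D + j)) = (of_nat (fst s aMAT (i * D + j)) + of_nat (fst s4 aLF i * fst s4 aMF j) :: bit)"
                  unfolding r5[OF ij] f4(3) by (rule xor_bits(2)[OF a b])
                also have "\<dots> = ?A i j + lf ?A v i * lf ?A u j" by (simp only: of_nat_mult li(2) mj(2) mat_def)
                finally show ?thesis using xor_bits(1)[OF a b] r5[OF ij] f4(3) by simp
              qed
              have "gauss ?A {..<Suc v} = gauss (mat s6) {..<v}"
                unfolding S(1)
              proof (rule gauss_insert_pivot[OF finite_lessThan S(2,3) _ _ uv(3)])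
                fix i j assume "i \<in> {..<v}" "j \<in> {..<v}"
                then show "mat s6 i j = (if i = u \<or> j = u then 0 else ?A i j + lf ?A v i * lf ?A u j)"
                  using r6[of i j] e[of i j] by (simp add: mat_def)
              qed (use uv in auto)
              moreover have "snd s6 = snd s" using ag4 ag5 ag6 f3(5) by (auto simp: agree_def)
              then have "acc s6 = acc s" by (simp only: acc_def)
              moreover have "mat_bits s6 v"
                unfolding mat_bits_def
              proof (intro conjI allI impI)
                show "fst s6 aD 0 = D" using ag6 f5 by (simp add: agree_def)
                fix i j assume "i < v" "j < v"
                then show "fst s6 aMAT (i * D + j) \<le> 1" using r6[of i j] e[of i j] by simp
              qed
              moreover have "agree {aV, aLF, aJ, aPIV, aMF, aK, aMAT} {1} s s6"
                using ag ag4 ag5 ag6 by (simp add: agree_def)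
              ultimately show "Q s6" by (intro Q) simp_all
            qed (use uv v in auto)
          next
            show "fst s4 aMAT (i * D + j) \<le> 1" if "i < v" "j < v" for i j using bits[of i j] that f4(3) by simp
            show "fst s4 aLF j \<le> 1" "fst s4 aMF j \<le> 1" if "j < v" for j
              using l3(1)[OF that] m[OF that] f4(4) by simp_all
          qed (use v in auto)
        qed (use u uv v in auto)
        then show ?thesis using False u by (simp only: wp_SSeq_fun wp_simps(5) bok.simps wok.simps ibeval.simps ieval.simps B_pos if_False simp_thms)
      qed
    qed (use v in auto)
  qed (use v in auto)
  then have "wp B M (put aV (WSub (V aP) (V aI))) (wp B M (form_row aLF aV) (wp B M find_pivot (wp B M ?br Q))) s"
    using v(3) small_index_D(2)[of v] v(2) by (simp only: wp_simps(2) wok.simps ieval.simps B_pos simp_thms)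
  then show ?thesis by (simp only: sum_variable_def wp_SSeq_fun)
qed

lemma mods_sum_variable:
  "wmods sum_variable = {aV, aLF, aJ, aPIV, aMF, aK, aMAT}" "zmods sum_variable = {1}"
  by (auto simp: sum_variable_def form_row_def find_pivot_def rank_one_def clear_pivot_def scale_def)

lemma wp_evaluate:
  assumes mb: "mat_bits s D"
    and Q: "\<And>s'. agree {aP, aI, aV, aLF, aJ, aPIV, aMF, aK, aMAT} {1} s s' \<Longrightarrow>
      acc s' = acc s * gauss (mat s) {..<D} \<Longrightarrow> Q s'"
  shows "wp B M evaluate Q s"
proof -
  let ?P = "36 * tets T"
  let ?s1 = "wupd s aP 0 ?P"
  let ?fin = "SIf (BEq (WGet aMAT (WConst 0)) (WConst 1)) (scale (ZSqrt2 (- 1) 0)) SSkip"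
  let ?tot = "acc s * gauss (mat s) {..<D}"
  have Ds: "fst s aD 0 = D" using mb by (simp add: mat_bits_def)
  have "wp B M (SFor aI aP sum_variable) (wp B M ?fin Q) ?s1"
  proof (rule wp_For_agree[where A = "{aV, aLF, aJ, aPIV, aMF, aK, aMAT}" and C = "{1}" and
        I = "\<lambda>i s'. mat_bits s' (D - i) \<and> acc s' * gauss (mat s') {..<D - i} = ?tot"])
    have "mat (wupd ?s1 aI 0 0) = mat s" by (intro ext) (simp add: mat_def)
    then show "mat_bits (wupd ?s1 aI 0 0) (D - 0) \<and> acc (wupd ?s1 aI 0 0) * gauss (mat (wupd ?s1 aI 0 0)) {..<D - 0} = ?tot"
      using mb by (simp add: mat_bits_def acc_def)
  next
    fix i s'
    assume 1: "i < fst ?s1 aP 0" "agree {aI, aV, aLF, aJ, aPIV, aMF, aK, aMAT} {1} ?s1 s'" "fst s' aI 0 = i"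
      and I: "mat_bits s' (D - i) \<and> acc s' * gauss (mat s') {..<D - i} = ?tot"
    have i: "i < ?P" using 1(1) by simp
    let ?v = "?P - i"
    have Dv: "D - i = Suc ?v" "D - Suc i = ?v" using i by simp_all
    have "fst s' aP 0 = ?P" using 1(2) by (simp add: agree_def)
    then show "wp B M sum_variable (\<lambda>s''. mat_bits (wupd s'' aI 0 (Suc i)) (D - Suc i) \<and>
      acc (wupd s'' aI 0 (Suc i)) * gauss (mat (wupd s'' aI 0 (Suc i))) {..<D - Suc i} = ?tot) s'"
      unfolding Dv
    proof (intro wp_sum_variable[where v = ?v])
      fix s2 assume 2: "mat_bits s2 ?v" "acc s2 * gauss (mat s2) {..<?v} = acc s' * gauss (mat s') {..<Suc ?v}"
      have "mat (wupd s2 aI 0 (Suc i)) = mat s2" by (intro ext) (simp add: mat_def)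
      then show "mat_bits (wupd s2 aI 0 (Suc i)) ?v \<and>
        acc (wupd s2 aI 0 (Suc i)) * gauss (mat (wupd s2 aI 0 (Suc i))) {..<?v} = ?tot"
        using 2 I Dv by (simp add: mat_bits_def acc_def)
    qed (use i I Dv 1(3) in auto)
  next
    fix s2 assume ag: "agree {aI, aV, aLF, aJ, aPIV, aMF, aK, aMAT} {1} ?s1 s2"
      and I: "mat_bits s2 (D - fst ?s1 aP 0) \<and> acc s2 * gauss (mat s2) {..<D - fst ?s1 aP 0} = ?tot"
    have one: "{..<1::nat} = {0}" by auto
    have I2: "fst s2 aMAT 0 \<le> 1" "acc s2 * sg (mat s2 0 0) = ?tot"
      using I by (simp_all add: mat_bits_def one gauss_singleton[unfolded One_nat_def] lessThan_Suc gauss_singleton)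
    have m0: "fst s2 aMAT 0 = 1 \<longleftrightarrow> mat s2 0 0 = 1" "fst s2 aMAT 0 \<noteq> 1 \<longleftrightarrow> mat s2 0 0 = 0"
      using of_nat_bit_eq_iff[OF I2(1)] I2(1) by (auto simp: mat_def)
    have ag': "agree {aP, aI, aV, aLF, aJ, aPIV, aMF, aK, aMAT} {1} s s2" using ag by (simp add: agree_def)
    show "wp B M ?fin Q s2"
    proof (cases "fst s2 aMAT 0 = 1")
      case True
      let ?s3 = "zupd s2 1 0 (zmul (snd s2 1 0) (ZSqrt2 (- 1) 0))"
      have "acc ?s3 = ?tot" using I2(2) m0(1) True by (simp add: acc_def zvalue_zmul)
      moreover have "agree {aP, aI, aV, aLF, aJ, aPIV, aMF, aK, aMAT} {1} s ?s3" using ag' by (simp add: agree_def)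
      ultimately have "Q ?s3" by (intro Q)
      then show ?thesis using True by (simp add: scale_def)
    next
      case False
      then have "acc s2 = ?tot" using I2(2) m0(2) by simp
      then have "Q s2" using ag' by (intro Q)
      then show ?thesis using False by simp
    qed
  qed (auto simp: mods_sum_variable)
  then have "wp B M (put aP (WSub (V aD) (WConst 1))) (wp B M (SFor aI aP sum_variable) (wp B M ?fin Q)) s"
    using Ds small_index_D(2)[of ?P] by (simp only: wp_simps(2) wok.simps ieval.simps B_pos simp_thms) simp
  then show ?thesis by (simp only: evaluate_def wp_SSeq_fun)
qed

end

section \<open>Enumeration of the cocycles\<close>

definition add_to_alpha :: stm where
  "add_to_alpha = SFor aJ aN (SW aALPHA (V aJ) (xorE (WGet aALPHA (V aJ)) (rowE aI aJ)))"

definition compute_alpha :: stm where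
  "compute_alpha = SSeq (SFor aI aN (SW aALPHA (V aI) (WConst 0)))
     (SFor aI aL (SIf (BEq (WGet aCTR (V aI)) (WConst 1)) add_to_alpha SSkip))"

text \<open>
  Increment of a binary number: the carry turns ones into zeros up to the first zero.
\<close>

definition carry_step :: stm where
  "carry_step = SIf (BEq (V aCARRY) (WConst 1))
     (SIf (BEq (WGet aCTR (V aI)) (WConst 1)) (SW aCTR (V aI) (WConst 0))
        (SSeq (SW aCTR (V aI) (WConst 1)) (put aCARRY (WConst 0)))) SSkip"

text \<open>
  A carry out of the last digit means that all coefficient vectors have been visited.
\<close>

definition next_counter :: stm where
  "next_counter = SSeq (put aCARRY (WConst 1)) (SSeq (SFor aI aL carry_step) (put aDONE (V aCARRY)))"

definition process_cocycle :: "zsqrt2 \<Rightarrow> stm" where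
  "process_cocycle c = SSeq compute_alpha (SSeq (build_form c) (SSeq evaluate
     (SSeq (SZ 0 (WConst 0) (ZAdd (ZGet 0 (WConst 0)) (ZGet 1 (WConst 0)))) next_counter)))"

definition prepare :: stm where
  "prepare = SSeq (put aN (WMul (WConst 16) (V 0))) (SSeq (put aD (WAdd (WMul (WConst 36) (V 0)) (WConst 1)))
     (SSeq label_edges find_basis))"

definition finish :: stm where
  "finish = put 0 (WMul (WConst 48) (V 0))"

definition main_loop :: "zsqrt2 \<Rightarrow> com" where
  "main_loop c = While (BEq (V aDONE) (WConst 0)) (compile (process_cocycle c))"

definition tv4_program :: "zsqrt2 \<Rightarrow> com" where
  "tv4_program c = Seq (compile prepare) (Seq (main_loop c) (compile finish))"

lemma sum_update_power:
  fixes f :: "nat \<Rightarrow> nat"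
  assumes "i < L"
  shows "(\<Sum>r<L. (f(i := x)) r * 2 ^ r) + f i * 2 ^ i = (\<Sum>r<L. f r * 2 ^ r) + x * 2 ^ i"
proof -
  have "(\<Sum>r<L. g r) = g i + (\<Sum>r\<in>{..<L} - {i}. g r)" for g :: "nat \<Rightarrow> nat"
    using assms by (simp add: sum.remove)
  moreover have "(\<Sum>r\<in>{..<L} - {i}. (f(i := x)) r * 2 ^ r) = (\<Sum>r\<in>{..<L} - {i}. f r * 2 ^ r)"
    by (rule sum.cong) auto
  ultimately show ?thesis by simp
qed

context machine
begin

definition counter :: "state \<Rightarrow> nat \<Rightarrow> bit" where
  "counter s r = (if r < fst s aL 0 then of_nat (fst s aCTR r) else 0)"

definition counter_bits :: "state \<Rightarrow> bool" where
  "counter_bits s \<longleftrightarrow> (\<forall>r<fst s aL 0. fst s aCTR r \<le> 1)"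

lemma counter_in_bitfun: "counter s \<in> bitfun {..<fst s aL 0}"
  by (simp add: counter_def bitfun_def)

lemma binval_counter:
  assumes "counter_bits s"
  shows "binval (fst s aL 0) (counter s) = (\<Sum>r<fst s aL 0. fst s aCTR r * 2 ^ r)"
  unfolding binval_def
proof (rule sum.cong[OF refl])
  fix r assume "r \<in> {..<fst s aL 0}"
  then have r: "r < fst s aL 0" "fst s aCTR r \<le> 1" using assms by (simp_all add: counter_bits_def)
  then have "fst s aCTR r = 0 \<or> fst s aCTR r = 1" by linarith
  then show "(if counter s r = 1 then 2 ^ r else 0) = fst s aCTR r * 2 ^ r"
    using r(1) by (auto simp: counter_def)
qed

lemma wp_compute_alpha:
  assumes N: "fst s aN 0 = 16 * tets T" and inv: "rows_inv s X" and cb: "counter_bits s"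
    and Q: "\<And>s'. agree {aI, aJ, aALPHA} {} s s' \<Longrightarrow>
      (\<And>k. k < 16 * tets T \<Longrightarrow> fst s' aALPHA k \<le> 1 \<and>
         of_nat (fst s' aALPHA k) = comb (rows s) {..<fst s aL 0} (counter s) k) \<Longrightarrow> Q s'"
  shows "wp B M compute_alpha Q s"
proof -
  let ?N = "16 * tets T" and ?L = "fst s aL 0"
  have L: "?L \<le> ?N" and bits: "\<And>r i. r < ?L \<Longrightarrow> i < ?N \<Longrightarrow> fst s aROWS (r * ?N + i) \<le> Suc 0"
    using inv by (auto simp: rows_inv_def)
  let ?I = "\<lambda>i s'. \<forall>k<?N. fst s' aALPHA k \<le> Suc 0 \<and> of_nat (fst s' aALPHA k) = (\<Sum>r<i. counter s r * rows s r k)"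
  let ?body = "SIf (BEq (WGet aCTR (V aI)) (WConst 1)) add_to_alpha SSkip"
  have "wp B M (SFor aI aN (SW aALPHA (V aI) (WConst 0))) (wp B M (SFor aI aL ?body) Q) s"
  proof (rule wp_map_loop[where idx = "\<lambda>j. j" and val = "\<lambda>_. 0" and n = ?N])
    fix j s2 assume "j < ?N" "agree {aI, aALPHA} {} s s2" "fst s2 aI 0 = j"
    then show "wok B s2 (V aI) \<and> wok B s2 (WConst 0) \<and> ieval s2 (V aI) = j \<and> j < B \<and> ieval s2 (WConst 0) = 0 \<and> 0 \<le> M"
      using small_index(1)[of j] by simp
  next
    fix s1 assume ag1: "agree {aI, aALPHA} {} s s1" and z: "\<And>j. j < ?N \<Longrightarrow> fst s1 aALPHA j = 0"
    have f1: "fst s1 aL 0 = ?L" "fst s1 aN 0 = ?N" using ag1 N by (simp_all add: agree_def)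
    show "wp B M (SFor aI aL ?body) Q s1"
    proof (rule wp_For_agree[where A = "{aJ, aALPHA}" and C = "{}" and I = ?I])
      fix i s'
      assume 1: "i < fst s1 aL 0" "agree {aI, aJ, aALPHA} {} s1 s'" "fst s' aI 0 = i" and I: "?I i s'"
      have i: "i < ?L" "i < ?N" using 1(1) f1 L by simp_all
      have f: "fst s' aN 0 = ?N" "fst s' aROWS = fst s aROWS" "fst s' aCTR = fst s aCTR"
        using 1(2) ag1 f1 by (simp_all add: agree_def)
      have iB: "i < B" using small_index(1)[OF i(2)] .
      have ci: "fst s aCTR i \<le> 1" "counter s i = of_nat (fst s aCTR i)"
        using cb i(1) by (simp_all add: counter_bits_def counter_def)
      show "wp B M ?body (\<lambda>s''. ?I (Suc i) (wupd s'' aI 0 (Suc i))) s'"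
      proof (cases "fst s aCTR i = 1")
        case True
        have "wp B M add_to_alpha (\<lambda>s''. ?I (Suc i) (wupd s'' aI 0 (Suc i))) s'"
          unfolding add_to_alpha_def
        proof (rule wp_map_loop[where idx = "\<lambda>j. j" and n = ?N and
              val = "\<lambda>j. bxor (fst s' aALPHA j) (fst s aROWS (i * ?N + j))"])
          fix j s2 assume j: "j < ?N" "agree {aJ, aALPHA} {} s' s2" "fst s2 aJ 0 = j"
            and un: "\<And>k. k \<notin> (\<lambda>j. j) ` {..<j} \<Longrightarrow> fst s2 aALPHA k = fst s' aALPHA k"
          have g: "fst s2 aN 0 = ?N" "fst s2 aI 0 = i" "fst s2 aROWS = fst s aROWS"
            using j(2) f 1(3) by (simp_all add: agree_def)
          have "fst s2 aALPHA j = fst s' aALPHA j" by (rule un) auto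
          moreover have "bxor (fst s' aALPHA j) (fst s aROWS (i * ?N + j)) \<le> Suc 0"
            using I j(1) bits[OF i(1) j(1)] by (simp add: xor_bits)
          then have "bxor (fst s' aALPHA j) (fst s aROWS (i * ?N + j)) \<le> M" using small_index(3) by linarith
          ultimately show "wok B s2 (V aJ) \<and> wok B s2 (xorE (WGet aALPHA (V aJ)) (rowE aI aJ)) \<and>
            ieval s2 (V aJ) = j \<and> j < B \<and>
            ieval s2 (xorE (WGet aALPHA (V aJ)) (rowE aI aJ)) = bxor (fst s' aALPHA j) (fst s aROWS (i * ?N + j)) \<and>
            bxor (fst s' aALPHA j) (fst s aROWS (i * ?N + j)) \<le> M"
            using g j(3) small_index(1)[OF j(1)] row_index[OF i(2) j(1)] by (simp add: rowE_def indexE_def)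
        next
          fix s2 :: state assume v: "\<And>j. j < ?N \<Longrightarrow> fst s2 aALPHA j = bxor (fst s' aALPHA j) (fst s aROWS (i * ?N + j))"
          show "?I (Suc i) (wupd s2 aI 0 (Suc i))"
          proof (intro allI impI)
            fix k assume k: "k < ?N"
            have a: "fst s' aALPHA k \<le> Suc 0" "of_nat (fst s' aALPHA k) = (\<Sum>r<i. counter s r * rows s r k)"
              using I k by blast+
            have b: "of_nat (fst s aROWS (i * ?N + k)) = counter s i * rows s i k"
              using ci True k by (simp add: rows_def)
            show "fst (wupd s2 aI 0 (Suc i)) aALPHA k \<le> Suc 0 \<and>
              of_nat (fst (wupd s2 aI 0 (Suc i)) aALPHA k) = (\<Sum>r<Suc i. counter s r * rows s r k)"
              using xor_bits[OF a(1) bits[OF i(1) k]] v[OF k] a(2) b by simp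
          qed
        qed (use f in auto)
        then show ?thesis using True f 1(3) iB by simp
      next
        case False
        then have "counter s i = 0" using ci by (cases "fst s aCTR i") auto
        then have "?I (Suc i) (wupd s' aI 0 (Suc i))" using I by simp
        then show ?thesis using False f 1(3) iB by simp
      qed
    next
      fix s' assume ag': "agree {aI, aJ, aALPHA} {} s1 s'" and I: "?I (fst s1 aL 0) s'"
      have "agree {aI, aJ, aALPHA} {} s s'" using ag1 ag' by (simp add: agree_def)
      then show "Q s'" by (rule Q) (use I f1 in \<open>simp add: comb_def\<close>)
    qed (use z in \<open>auto simp: add_to_alpha_def\<close>)
  qed (use N in auto)
  then show ?thesis by (simp only: compute_alpha_def wp_SSeq_fun)
qed

text \<open>
  The number shown by the digits plus the weighted carry stays equal to the old number plus one.
\<close>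

lemma wp_next_counter:
  assumes L: "fst s aL 0 \<le> 16 * tets T" and cb: "counter_bits s"
    and Q: "\<And>s'. agree {aI, aCTR, aCARRY, aDONE} {} s s' \<Longrightarrow> counter_bits s' \<Longrightarrow>
      fst s' aDONE 0 = 1 \<and> Suc (binval (fst s aL 0) (counter s)) = 2 ^ fst s aL 0 \<or>
      fst s' aDONE 0 = 0 \<and> binval (fst s aL 0) (counter s') = Suc (binval (fst s aL 0) (counter s)) \<Longrightarrow> Q s'"
  shows "wp B M next_counter Q s"
proof -
  let ?L = "fst s aL 0"
  let ?val = "\<lambda>s'. \<Sum>r<?L. fst s' aCTR r * 2 ^ r"
  let ?s1 = "wupd s aCARRY 0 1"
  let ?I = "\<lambda>i s'. (\<forall>r<?L. fst s' aCTR r \<le> 1) \<and> fst s' aCARRY 0 \<le> 1 \<and> ?val s' + fst s' aCARRY 0 * 2 ^ i = Suc (?val s)"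
  have "wp B M (SFor aI aL carry_step) (wp B M (put aDONE (V aCARRY)) Q) ?s1"
  proof (rule wp_For_agree[where A = "{aCTR, aCARRY}" and C = "{}" and I = ?I])
    show "?I 0 (wupd ?s1 aI 0 0)" using cb by (simp add: counter_bits_def)
  next
    fix i and s' :: state
    assume 1: "i < fst ?s1 aL 0" "fst s' aI 0 = i" and I: "?I i s'"
    have i: "i < ?L" "i < B" using 1(1) small_index(1)[of i] L by simp_all
    have bi: "fst s' aCTR i = 0 \<or> fst s' aCTR i = 1" "fst s' aCARRY 0 = 0 \<or> fst s' aCARRY 0 = 1"
      using I i(1) le_less_Suc_eq by (auto simp: le_Suc_eq)
    note up = sum_update_power[OF i(1), of "fst s' aCTR"]
    consider "fst s' aCARRY 0 = 0" | "fst s' aCARRY 0 = 1" "fst s' aCTR i = 0" | "fst s' aCARRY 0 = 1" "fst s' aCTR i = 1"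
      using bi by (elim disjE) simp_all
    then show "wp B M carry_step (\<lambda>s''. ?I (Suc i) (wupd s'' aI 0 (Suc i))) s'"
    proof cases
      case 1
      then show ?thesis using I by (simp add: carry_step_def)
    next
      case 2
      have "(\<Sum>r<?L. ((fst s' aCTR)(i := 1)) r * 2 ^ r) = Suc (?val s)" using up[of 1] 2 I by simp
      then show ?thesis using I 2 \<open>fst s' aI 0 = i\<close> i small_index(3) by (simp add: carry_step_def)
    next
      case 3
      have "(\<Sum>r<?L. ((fst s' aCTR)(i := 0)) r * 2 ^ r) + 2 * 2 ^ i = Suc (?val s)" using up[of 0] 3 I by simp
      then show ?thesis using I 3 \<open>fst s' aI 0 = i\<close> i small_index(3) by (simp add: carry_step_def)
    qed
  next
    fix s' :: state assume ag: "agree {aI, aCTR, aCARRY} {} ?s1 s'" and I: "?I (fst ?s1 aL 0) s'"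
    let ?s2 = "wupd s' aDONE 0 (fst s' aCARRY 0)"
    have L': "fst s' aL 0 = ?L" using ag by (simp add: agree_def)
    have cb2: "counter_bits ?s2" using I L' by (simp add: counter_bits_def)
    have c2: "fst ?s2 aL 0 = ?L" using L' by simp
    have b2: "binval ?L (counter ?s2) = ?val s'" using binval_counter[OF cb2] unfolding c2 by simp
    have lt: "binval ?L (counter s) < 2 ^ ?L" by (rule binval_less)
    have b: "binval ?L (counter s) = ?val s" using binval_counter[OF cb] .
    have eq: "?val s' + fst s' aCARRY 0 * 2 ^ ?L = Suc (?val s)" using I by simp
    have "fst s' aCARRY 0 = 0 \<or> fst s' aCARRY 0 = 1" using I by (auto simp: le_Suc_eq)
    then have "fst ?s2 aDONE 0 = 1 \<and> Suc (binval ?L (counter s)) = 2 ^ ?L \<or>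
      fst ?s2 aDONE 0 = 0 \<and> binval ?L (counter ?s2) = Suc (binval ?L (counter s))"
    proof
      assume "fst s' aCARRY 0 = 0"
      then show ?thesis using eq unfolding b b2 by simp
    next
      assume c: "fst s' aCARRY 0 = 1"
      then have "Suc (?val s) = 2 ^ ?L" using eq lt b by simp
      then show ?thesis using c b by simp
    qed
    moreover have "agree {aI, aCTR, aCARRY, aDONE} {} s ?s2" using ag by (simp add: agree_def)
    ultimately have "Q ?s2" using cb2 by (intro Q)
    moreover have "fst s' aCARRY 0 \<le> M" using I small_index(3) by linarith
    ultimately show "wp B M (put aDONE (V aCARRY)) Q s'" by simp
  qed (auto simp: carry_step_def)
  then show ?thesis using small_index(3) by (simp add: next_counter_def)
qed

text \<open>
  The Gauss sum belonging to one cocycle.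
\<close>

definition cocycle_value :: "zsqrt2 \<Rightarrow> (nat \<Rightarrow> nat) \<Rightarrow> (nat \<Rightarrow> bit) \<Rightarrow> real" where
  "cocycle_value c lab \<alpha> = (\<Sum>y\<in>bitfun {1..<1 + 36 * tets T}. piece_product (- zvalue c) lab \<alpha> y)"

lemma gauss_piece_product:
  assumes "represents s (piece_product r lab \<alpha>)"
  shows "acc s * gauss (mat s) {..<D} = (\<Sum>y\<in>bitfun {1..<1 + 36 * tets T}. piece_product r lab \<alpha> y)"
proof -
  have "acc s * sg (qf (mat s) {..<D} (y(0 := 1))) = piece_product r lab \<alpha> y" for y
  proof -
    have "acc s * sg (qf (mat s) {..<D} (y(0 := 1))) = piece_product r lab \<alpha> (y(0 := 1))"
      using assms by (simp add: represents_def)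
    also have "\<dots> = piece_product r lab \<alpha> y"
      by (simp add: piece_product_def)
    finally show ?thesis .
  qed
  moreover have "{..<D} - {0} = {1..<1 + 36 * tets T}" by auto
  ultimately show ?thesis unfolding gauss_def by (simp add: sum_distrib_left)
qed

text \<open>
  The invariant of the loop over the cocycles.
\<close>

definition ready :: "state \<Rightarrow> (nat \<Rightarrow> nat) \<Rightarrow> bool" where
  "ready s lab \<longleftrightarrow> tables s \<and> fst s aD 0 = D \<and> fst s aLAB = lab \<and> lab_ok lab \<and>
     rows_inv s (slot_cocycles lab) \<and> counter_bits s"

lemma wp_process_cocycle:
  assumes rd: "ready s lab"
    and Q: "\<And>s'. ready s' lab \<Longrightarrow> fst s' aL 0 = fst s aL 0 \<Longrightarrow> rows s' = rows s \<Longrightarrow>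
      zvalue (snd s' 0 0) = zvalue (snd s 0 0) + cocycle_value c lab (comb (rows s) {..<fst s aL 0} (counter s)) \<Longrightarrow>
      fst s' aDONE 0 = 1 \<and> Suc (binval (fst s aL 0) (counter s)) = 2 ^ fst s aL 0 \<or>
      fst s' aDONE 0 = 0 \<and> binval (fst s aL 0) (counter s') = Suc (binval (fst s aL 0) (counter s)) \<Longrightarrow> Q s'"
  shows "wp B M (process_cocycle c) Q s"
proof -
  let ?\<alpha> = "comb (rows s) {..<fst s aL 0} (counter s)"
  have tab: "tables s" and Ds: "fst s aD 0 = D" and lab: "fst s aLAB = lab" "lab_ok lab"
    and ri: "rows_inv s (slot_cocycles lab)" and cb: "counter_bits s" using rd by (simp_all add: ready_def)
  have N: "fst s aN 0 = 16 * tets T" using tab by (simp add: tables_def)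
  have L: "fst s aL 0 \<le> 16 * tets T" using ri by (simp add: rows_inv_def)
  let ?add = "SZ 0 (WConst 0) (ZAdd (ZGet 0 (WConst 0)) (ZGet 1 (WConst 0)))"
  have "wp B M compute_alpha (wp B M (build_form c) (wp B M evaluate (wp B M ?add (wp B M next_counter Q)))) s"
  proof (rule wp_compute_alpha[OF N ri cb])
    fix s1 assume ag1: "agree {aI, aJ, aALPHA} {} s s1"
      and al: "\<And>k. k < 16 * tets T \<Longrightarrow> fst s1 aALPHA k \<le> 1 \<and> of_nat (fst s1 aALPHA k) = ?\<alpha> k"
    have "tables s1" by (rule tables_agree[OF ag1 tab]) auto
    then have inp: "inputs s1 lab ?\<alpha>" using al lab ag1 by (simp add: inputs_def agree_def)
    show "wp B M (build_form c) (wp B M evaluate (wp B M ?add (wp B M next_counter Q))) s1"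
    proof (rule wp_build_form[OF inp])
      show "fst s1 aD 0 = D" using ag1 Ds by (simp add: agree_def)
      fix s2 assume ag2: "agree {aI, aJ, aT, aX1, aMAT} {1} s1 s2"
        and rep: "represents s2 (piece_product (- zvalue c) lab ?\<alpha>)"
      have mb: "mat_bits s2 D" using rep by (simp add: represents_def mat_bits_def)
      show "wp B M evaluate (wp B M ?add (wp B M next_counter Q)) s2"
      proof (rule wp_evaluate[OF mb])
        fix s3 assume ag3: "agree {aP, aI, aV, aLF, aJ, aPIV, aMF, aK, aMAT} {1} s2 s3"
          and val: "acc s3 = acc s2 * gauss (mat s2) {..<D}"
        let ?s4 = "zupd s3 0 0 (zadd (snd s3 0 0) (snd s3 1 0))"
        let ?A = "{aI, aJ, aALPHA, aT, aX1, aMAT, aP, aV, aLF, aPIV, aMF, aK}"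
        have ag4: "agree ?A {0, 1} s ?s4" using ag1 ag2 ag3 by (simp add: agree_def)
        have "snd s3 0 = snd s 0" using ag1 ag2 ag3 by (simp add: agree_def)
        then have z4: "zvalue (snd ?s4 0 0) = zvalue (snd s 0 0) + cocycle_value c lab ?\<alpha>"
          using val gauss_piece_product[OF rep] by (simp add: zvalue_zadd acc_def cocycle_value_def)
        have L4: "fst ?s4 aL 0 = fst s aL 0" and c4: "fst ?s4 aCTR = fst s aCTR" using ag4 by (simp_all add: agree_def)
        have ctr4: "counter ?s4 = counter s" by (intro ext) (simp only: counter_def L4 c4)
        have cb4: "counter_bits ?s4" using cb by (simp only: counter_bits_def L4 c4)
        have "wp B M next_counter Q ?s4"
        proof (rule wp_next_counter[OF _ cb4])
          show "fst ?s4 aL 0 \<le> 16 * tets T" using L L4 by simp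
          fix s5 assume ag5: "agree {aI, aCTR, aCARRY, aDONE} {} ?s4 s5" and cb5: "counter_bits s5"
            and alt: "fst s5 aDONE 0 = 1 \<and> Suc (binval (fst ?s4 aL 0) (counter ?s4)) = 2 ^ fst ?s4 aL 0 \<or>
              fst s5 aDONE 0 = 0 \<and> binval (fst ?s4 aL 0) (counter s5) = Suc (binval (fst ?s4 aL 0) (counter ?s4))"
          let ?A5 = "{aI, aJ, aALPHA, aT, aX1, aMAT, aP, aV, aLF, aPIV, aMF, aK, aCTR, aCARRY, aDONE}"
          have ag: "agree ?A5 {0, 1} s s5" using ag4 ag5 by (simp add: agree_def)
          have r5: "fst s5 aROWS = fst s aROWS" "fst s5 aL = fst s aL" using ag by (simp_all add: agree_def)
          have "rows s5 = rows s" by (intro ext) (simp add: rows_def r5)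
          moreover have "tables s5" by (rule tables_agree[OF ag tab]) auto
          then have "ready s5 lab"
            using ag Ds lab cb5 rows_inv_agree[OF ri r5(2,1)] by (simp add: ready_def agree_def)
          moreover have "zvalue (snd s5 0 0) = zvalue (snd s 0 0) + cocycle_value c lab ?\<alpha>"
            using z4 ag5 by (simp add: agree_def)
          moreover have "fst s5 aL 0 = fst s aL 0" using r5 by simp
          ultimately show "Q s5" using alt unfolding L4 ctr4 by (intro Q)
        qed
        then show "wp B M ?add (wp B M next_counter Q) s3" by simp
      qed
    qed
  qed
  then show ?thesis by (simp only: process_cocycle_def wp_SSeq_fun)
qed

lemma input_tables:
  "fst (input_state T) 0 0 = tets T"
  "t < tets T \<Longrightarrow> f < 4 \<Longrightarrow> fst (input_state T) aNBR (4 * t + f) = nbr T t f"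
  "t < tets T \<Longrightarrow> f < 4 \<Longrightarrow> a < 4 \<Longrightarrow> fst (input_state T) aGP (16 * t + (4 * f + a)) = gperm T t f a"
proof -
  show "fst (input_state T) 0 0 = tets T" by (simp add: input_state_def)
  show "fst (input_state T) aNBR (4 * t + f) = nbr T t f" if "t < tets T" "f < 4"
  proof -
    have "4 * t + f < 4 * tets T" "(4 * t + f) div 4 = t" "(4 * t + f) mod 4 = f" using that by simp_all
    then show ?thesis by (simp add: input_state_def)
  qed
  show "fst (input_state T) aGP (16 * t + (4 * f + a)) = gperm T t f a" if "t < tets T" "f < 4" "a < 4"
  proof -
    have i: "16 * t + (4 * f + a) = slot t f a" by (simp add: slot_def)
    show ?thesis unfolding i using that by (simp add: input_state_def slot_parts slot_less)
  qed
qed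

lemma mem_le_input: "mem_le M (input_state T)"
proof -
  have "nbr T (i div 4) (i mod 4) \<le> M" if "i < 4 * tets T" for i
  proof -
    have "i div 4 < tets T" "i mod 4 < 4" using that by (simp_all add: less_mult_imp_div_less mult.commute)
    then have "nbr T (i div 4) (i mod 4) < tets T" by (rule gluing_props(1))
    then show ?thesis by (simp add: M_def)
  qed
  moreover have "gperm T (i div 16) (i div 4 mod 4) (i mod 4) \<le> M" if "i < 16 * tets T" for i
  proof -
    have "i div 16 < tets T" "i div 4 mod 4 < 4" "i mod 4 < 4" using that by (simp_all add: less_mult_imp_div_less mult.commute)
    then have "gperm T (i div 16) (i div 4 mod 4) (i mod 4) < 4" by (rule gperm_less)
    then show ?thesis using tets_pos by (simp add: M_def)
  qed
  ultimately show ?thesis by (simp add: mem_le_def input_state_def M_def)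
qed

lemma wp_prepare:
  assumes Q: "\<And>s' lab. ready s' lab \<Longrightarrow> labelling lab slot_cell \<Longrightarrow> counter s' = (\<lambda>_. 0) \<Longrightarrow>
      fst s' aDONE 0 = 0 \<Longrightarrow> snd s' 0 0 = ZSqrt2 0 0 \<Longrightarrow> Q s'"
  shows "wp B M prepare Q (input_state T)"
proof -
  let ?s = "input_state T"
  let ?s1 = "wupd ?s aN 0 (16 * tets T)"
  let ?s2 = "wupd ?s1 aD 0 D"
  have tab: "tables ?s2" by (simp add: tables_def input_tables input_tables[unfolded One_nat_def])
  have zero: "fst ?s a = (\<lambda>_. 0)" if "a > 2" for a using that by (auto simp: input_state_def fun_eq_iff)
  have "wp B M label_edges (wp B M find_basis Q) ?s2"
  proof (rule wp_label_edges[OF tab])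
    fix s3 assume ag3: "agree {aX1, aX2, aI, aT, aLAB} {} ?s2 s3" and li: "label_inv (fst s3 aLAB)"
      and gl: "\<And>t z. t < tets T \<Longrightarrow> z \<in> set all_corners \<Longrightarrow> glued_labels (fst s3 aLAB) t z"
    let ?lab = "fst s3 aLAB"
    have tab3: "tables s3" by (rule tables_agree[OF ag3 tab]) auto
    have z3: "fst s3 aROWS = (\<lambda>_. 0)" using ag3 zero[of aROWS] by (simp add: agree_def)
    have ok: "lab_ok ?lab" using li by (simp add: lab_ok_def label_inv_def)
    show "wp B M find_basis Q s3"
    proof (rule wp_find_basis[OF tab3 z3 refl ok])
      fix s4 assume ag4: "agree {aT, aX1, aX2, aX3, aI, aU, aPV, aJ, aROWS, aL} {} s3 s4"
        and ri: "rows_inv s4 (slot_cocycles ?lab)"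
      have f4: "fst s4 aCTR = (\<lambda>_. 0)" "fst s4 aDONE = (\<lambda>_. 0)" "fst s4 aLAB = ?lab" "fst s4 aD 0 = D" "snd s4 0 0 = ZSqrt2 0 0"
        using ag3 ag4 zero[of aCTR] zero[of aDONE] by (simp_all add: agree_def input_state_def)
      have "tables s4" by (rule tables_agree[OF ag4 tab3]) auto
      then have "ready s4 ?lab" using f4 ok ri by (simp add: ready_def counter_bits_def)
      moreover have "labelling ?lab slot_cell" by (rule labelling_slot_cell[OF li gl])
      moreover have "counter s4 = (\<lambda>_. 0)" by (simp add: counter_def fun_eq_iff f4)
      ultimately show "Q s4" using f4 by (intro Q) simp_all
    qed
  qed
  moreover have "16 * tets T \<le> M" "D \<le> M" using small_index_D(2)[of D] by (simp_all add: M_def)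
  ultimately show ?thesis
    unfolding prepare_def wp_SSeq_fun by (simp add: input_tables)
qed

end

section \<open>Running time and memory of the program\<close>

lemma finite_sarrs: "finite (sarrs c)"
proof -
  have w: "finite (warrs e)" for e by (induction e) auto
  have "finite (barrs b)" for b by (induction b) (auto simp: w)
  moreover have "finite (zarrs z)" for z by (induction z) (auto simp: w)
  ultimately show ?thesis by (induction c) (auto simp: w)
qed

lemma well_formed_label_edges: "wf_stm label_edges" "loop_depth label_edges \<le> 3"
proof -
  have r: "wf_stm (relabel z)" "loop_depth (relabel z) \<le> 2" "0 \<notin> wmods (relabel z)" for z
    by (cases z; simp add: relabel_def relabel_loop_def)+
  have i: "wf_stm (init_label p)" "loop_depth (init_label p) \<le> 2" "0 \<notin> wmods (init_label p)" for p
    by (cases p; simp add: init_label_def)+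
  have "loop_depth (seqs (map relabel all_corners)) \<le> 2" "loop_depth (seqs (map init_label all_pairs)) \<le> 2"
    by (simp_all add: seqs_simps r i)
  then show "wf_stm label_edges" "loop_depth label_edges \<le> 3"
    by (simp_all add: label_edges_def init_labels_def seqs_simps r i)
qed

lemma well_formed_find_basis: "wf_stm find_basis" "loop_depth find_basis \<le> 3"
proof -
  have e: "wf_stm (eliminate f)" "loop_depth (eliminate f) \<le> 2" "0 \<notin> wmods (eliminate f)" for f
    by (cases "face_vertices f";
      simp add: eliminate_def scan_rows_def reduce_rows_def add_rows_def add_row_def copy_row_def)+
  have "loop_depth (seqs (map eliminate [0, 1, 2, 3])) \<le> 2"
    by (simp add: seqs_simps(4) e del: list.map)
  then show "wf_stm find_basis" "loop_depth find_basis \<le> 3"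
    by (simp_all add: find_basis_def init_rows_def seqs_simps(1-3) e)
qed

lemma well_formed_build_form: "wf_stm (build_form c)" "loop_depth (build_form c) \<le> 3"
proof -
  have f: "wf_stm (add_face c f)" "loop_depth (add_face c f) \<le> 2" "0 \<notin> wmods (add_face c f)" for f
    by (auto simp: add_face_def seqs_simps flip_def scale_def)
  have t: "wf_stm (add_tet c)" "loop_depth (add_tet c) \<le> 2" "0 \<notin> wmods (add_tet c)"
    by (auto simp: add_tet_def seqs_simps flip_def scale_def)
  have e: "wf_stm (add_edge c)" "loop_depth (add_edge c) \<le> 2" "aN \<notin> wmods (add_edge c)"
    by (auto simp: add_edge_def Let_def flip_def scale_def)
  have "loop_depth (seqs (map (add_face c) [0, 1, 2, 3])) \<le> 2"
    by (simp add: seqs_simps(4) f del: list.map)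
  then show "wf_stm (build_form c)" "loop_depth (build_form c) \<le> 3"
    using f t e by (simp_all add: build_form_def clear_matrix_def seqs_simps(1-3) del: list.map)
qed

lemma well_formed_evaluate: "wf_stm evaluate" "loop_depth evaluate \<le> 3"
  by (simp_all add: evaluate_def sum_variable_def form_row_def find_pivot_def rank_one_def clear_pivot_def scale_def)

lemma well_formed_prepare: "wf_stm prepare" "loop_depth prepare \<le> 3"
  by (simp_all add: prepare_def well_formed_label_edges well_formed_find_basis)

lemma well_formed_process_cocycle: "wf_stm (process_cocycle c)" "loop_depth (process_cocycle c) \<le> 3"
  by (simp_all add: process_cocycle_def well_formed_build_form well_formed_evaluate
      compute_alpha_def add_to_alpha_def next_counter_def carry_step_def)

definition program_arrays :: "zsqrt2 \<Rightarrow> arr set" where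
  "program_arrays c = insert (WArr aDONE) (sarrs prepare \<union> sarrs (process_cocycle c) \<union> sarrs finish)"

text \<open>
  Three parts with at most cubic cost each, and \<open>12\<close> for the sequential compositions and the tests of
  the main loop.
\<close>

definition program_cost :: "zsqrt2 \<Rightarrow> nat" where
  "program_cost c = scost prepare + scost (process_cocycle c) + scost finish + 12"

definition program_size :: "zsqrt2 \<Rightarrow> nat" where
  "program_size c = ssize prepare + ssize (process_cocycle c) + ssize finish"

lemma finite_program_arrays: "finite (program_arrays c)"
  by (simp add: program_arrays_def finite_sarrs)

context machine
begin

lemma M_ge_2: "2 \<le> M"
  using tets_pos by (simp add: M_def)

text \<open>
  From correctness of a structured program to a run of its compiled form, with a common time bound for
  all programs of loop depth at most three.
\<close>

lemma exec_of_wp: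
  assumes "wp B M c Q s" "wf_stm c" "loop_depth c \<le> 3" "mem_le M s" "M ^ K < 2 ^ w" "ssize c \<le> K"
  obtains s' m A where "Q s'" "mem_le M s'" "exec w (compile c) s m A s'" "m \<le> scost c * M ^ 3"
    "A \<subseteq> sarrs c \<times> {..<B}"
proof -
  have "M ^ ssize c < 2 ^ w" by (rule power_less_mono_exp[OF assms(5,6) M_ge_2])
  then obtain m A where 1: "mem_le M (sem c s)" "exec w (compile c) s m A (sem c s)"
      "m \<le> scost c * M ^ loop_depth c" "A \<subseteq> sarrs c \<times> {..<B}"
    using exec_compile[OF M_ge_2 assms(2) _ assms(4)] assms(1) unfolding wp_def by blast
  have "M ^ loop_depth c \<le> M ^ 3" using assms(3) M_ge_2 by (intro power_increasing) simp_all
  then have "m \<le> scost c * M ^ 3" using 1(3) by (meson le_trans mult_le_mono2)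
  then show thesis using that 1 assms(1) unfolding wp_def by blast
qed

text \<open>
  The contribution of the cocycle whose coefficients are the binary digits of \<open>k\<close>.
\<close>

definition numbered_value :: "zsqrt2 \<Rightarrow> (nat \<Rightarrow> nat) \<Rightarrow> (nat \<Rightarrow> nat \<Rightarrow> bit) \<Rightarrow> nat \<Rightarrow> nat \<Rightarrow> real" where
  "numbered_value c lab R L k =
     cocycle_value c lab (comb R {..<L} (inv_into (bitfun {..<L}) (binval L) k))"

text \<open>
  The while loop is not a counting loop, because its number of iterations does not fit into a word.  Its
  run is therefore built by induction on the number \<open>d\<close> of cocycles that remain after the current one.
\<close>

lemma exec_main_loop:
  assumes w: "M ^ program_size c < 2 ^ w"
  shows "\<lbrakk>ready s lab; fst s aDONE 0 = 0; mem_le M s; 2 ^ fst s aL 0 = binval (fst s aL 0) (counter s) + Suc d\<rbrakk> \<Longrightarrow>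
    \<exists>s' m A. exec w (main_loop c) s m A s' \<and> mem_le M s' \<and> ready s' lab \<and>
      m \<le> Suc d * (scost (process_cocycle c) * M ^ 3 + 5) + 5 \<and> A \<subseteq> program_arrays c \<times> {..<B} \<and>
      zvalue (snd s' 0 0) = zvalue (snd s 0 0) +
        (\<Sum>k\<in>{binval (fst s aL 0) (counter s)..<2 ^ fst s aL 0}. numbered_value c lab (rows s) (fst s aL 0) k)"
proof (induction d arbitrary: s rule: less_induct)
  case (less d s)
  let ?L = "fst s aL 0" and ?b = "BEq (V aDONE) (WConst 0)" and ?c = "scost (process_cocycle c) * M ^ 3"
  let ?k = "binval ?L (counter s)" and ?v = "numbered_value c lab (rows s) ?L"
  have guard: "beval w z ?b \<longleftrightarrow> fst z aDONE 0 = 0" "bcost ?b = 4" "blocs w z ?b \<subseteq> program_arrays c \<times> {..<B}" for z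
    by (auto simp: program_arrays_def)
  let ?Q = "\<lambda>s'. ready s' lab \<and> fst s' aL 0 = ?L \<and> rows s' = rows s \<and>
    zvalue (snd s' 0 0) = zvalue (snd s 0 0) + cocycle_value c lab (comb (rows s) {..<?L} (counter s)) \<and>
    (fst s' aDONE 0 = 1 \<and> Suc ?k = 2 ^ ?L \<or> fst s' aDONE 0 = 0 \<and> binval ?L (counter s') = Suc ?k)"
  have "wp B M (process_cocycle c) ?Q s"
    by (rule wp_process_cocycle[OF less.prems(1), where c = c]) blast
  then obtain s1 m1 A1 where Q: "?Q s1" and s1: "mem_le M s1" "exec w (compile (process_cocycle c)) s m1 A1 s1"
      "m1 \<le> ?c" "A1 \<subseteq> sarrs (process_cocycle c) \<times> {..<B}"
    by (rule exec_of_wp[OF _ well_formed_process_cocycle less.prems(3) w]) (auto simp: program_size_def)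
  have A1: "A1 \<subseteq> program_arrays c \<times> {..<B}" using s1(4) by (auto simp: program_arrays_def)
  have "inv_into (bitfun {..<?L}) (binval ?L) ?k = counter s"
    by (rule inv_into_f_f[OF bij_betw_imp_inj_on[OF bij_betw_binval] counter_in_bitfun])
  then have z1: "zvalue (snd s1 0 0) = zvalue (snd s 0 0) + ?v ?k"
    using Q by (simp add: numbered_value_def)
  have lt: "?k < 2 ^ ?L" by (rule binval_less)
  from Q have "fst s1 aDONE 0 = 1 \<and> Suc ?k = 2 ^ ?L \<or> fst s1 aDONE 0 = 0 \<and> binval ?L (counter s1) = Suc ?k"
    by blast
  then show ?case
  proof (elim disjE conjE)
    assume last: "fst s1 aDONE 0 = 1" "Suc ?k = 2 ^ ?L"
    have "exec w (main_loop c) s1 (Suc (bcost ?b)) (blocs w s1 ?b) s1"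
      unfolding main_loop_def by (rule exec.WhileFalse) (simp add: last)
    then have "exec w (main_loop c) s (Suc (bcost ?b + m1 + Suc (bcost ?b))) (blocs w s ?b \<union> A1 \<union> blocs w s1 ?b) s1"
      unfolding main_loop_def using s1(2) less.prems(2) by (intro exec.WhileTrue) (simp_all only: guard)
    moreover have "Suc (bcost ?b + m1 + Suc (bcost ?b)) \<le> Suc d * (?c + 5) + 5"
      using s1(3) unfolding guard by simp
    moreover have "blocs w s ?b \<union> A1 \<union> blocs w s1 ?b \<subseteq> program_arrays c \<times> {..<B}"
      using A1 guard(3) by blast
    moreover have "{?k..<2 ^ ?L} = {?k}" using last(2) by auto
    then have "zvalue (snd s1 0 0) = zvalue (snd s 0 0) + (\<Sum>k\<in>{?k..<2 ^ ?L}. ?v k)" using z1 by simp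
    moreover have "ready s1 lab" using Q by blast
    ultimately show ?thesis using s1(1) by blast
  next
    assume going: "fst s1 aDONE 0 = 0" "binval ?L (counter s1) = Suc ?k"
    have L1: "fst s1 aL 0 = ?L" and R1: "rows s1 = rows s" using Q by simp_all
    have "Suc ?k < 2 ^ ?L" using binval_less[of ?L "counter s1"] going(2) by simp
    then obtain d' where d: "d = Suc d'" using less.prems(4) by (cases d) auto
    have "\<exists>s' m A. exec w (main_loop c) s1 m A s' \<and> mem_le M s' \<and> ready s' lab \<and>
      m \<le> Suc d' * (?c + 5) + 5 \<and> A \<subseteq> program_arrays c \<times> {..<B} \<and>
      zvalue (snd s' 0 0) = zvalue (snd s1 0 0) +
        (\<Sum>k\<in>{binval (fst s1 aL 0) (counter s1)..<2 ^ fst s1 aL 0}. numbered_value c lab (rows s1) (fst s1 aL 0) k)"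
      by (rule less.IH) (use Q s1 d going less.prems(4) in simp_all)
    then obtain s' m A where ex: "exec w (main_loop c) s1 m A s'" and s': "mem_le M s'" "ready s' lab"
        "m \<le> Suc d' * (?c + 5) + 5" "A \<subseteq> program_arrays c \<times> {..<B}"
        "zvalue (snd s' 0 0) = zvalue (snd s1 0 0) + (\<Sum>k\<in>{Suc ?k..<2 ^ ?L}. ?v k)"
      unfolding L1 R1 going(2) by blast
    have "exec w (main_loop c) s (Suc (bcost ?b + m1 + m)) (blocs w s ?b \<union> A1 \<union> A) s'"
      using s1(2) less.prems(2) ex unfolding main_loop_def by (intro exec.WhileTrue) (simp_all only: guard)
    moreover have "Suc (bcost ?b + m1 + m) \<le> Suc d * (?c + 5) + 5"
      using s1(3) s'(3) unfolding guard d by simp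
    moreover have "blocs w s ?b \<union> A1 \<union> A \<subseteq> program_arrays c \<times> {..<B}"
      using A1 guard(3) s'(4) by blast
    moreover have "(\<Sum>k\<in>{?k..<2 ^ ?L}. ?v k) = ?v ?k + (\<Sum>k\<in>{Suc ?k..<2 ^ ?L}. ?v k)"
      using lt by (rule sum.atLeast_Suc_lessThan)
    then have "zvalue (snd s' 0 0) = zvalue (snd s 0 0) + (\<Sum>k\<in>{?k..<2 ^ ?L}. ?v k)" using s'(5) z1 by simp
    ultimately show ?thesis using s'(1,2) by blast
  qed
qed

lemma sum_numbered_value:
  assumes "rows_inv s (slot_cocycles lab)"
  shows "(\<Sum>k<2 ^ fst s aL 0. numbered_value c lab (rows s) (fst s aL 0) k) = (\<Sum>\<alpha>\<in>slot_cocycles lab. cocycle_value c lab \<alpha>)"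
proof -
  let ?L = "fst s aL 0" and ?g = "\<lambda>d. cocycle_value c lab (comb (rows s) {..<fst s aL 0} d)"
  have "(\<Sum>k<2 ^ ?L. numbered_value c lab (rows s) ?L k) = (\<Sum>d\<in>bitfun {..<?L}. ?g d)"
    unfolding numbered_value_def
    by (rule sum.reindex_bij_betw[OF bij_betw_inv_into[OF bij_betw_binval], of ?g])
  also have "\<dots> = (\<Sum>\<alpha>\<in>slot_cocycles lab. cocycle_value c lab \<alpha>)"
    by (rule sum.reindex_bij_betw) (use assms in \<open>simp add: rows_inv_def parametrises_def\<close>)
  finally show ?thesis .
qed

lemma exec_tv4_program:
  assumes q: "q \<in> {1, 3}" and v: "one_vertex T" and w: "M ^ program_size c < 2 ^ w"
    and c: "- zvalue c = bracket2 q"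
  obtains m A s' where "exec w (tv4_program c) (input_state T) m A s'"
    "TV4 q T = of_real (1 / 4 * output_value s')"
    "m \<le> program_cost c * (2 ^ betti1 T * M ^ 3)" "A \<subseteq> program_arrays c \<times> {..<B}"
proof -
  let ?Q = "\<lambda>s. \<exists>lab. ready s lab \<and> labelling lab slot_cell \<and> counter s = (\<lambda>_. 0) \<and>
    fst s aDONE 0 = 0 \<and> snd s 0 0 = ZSqrt2 0 0"
  have "wp B M prepare ?Q (input_state T)" by (rule wp_prepare) blast
  then obtain s1 m1 A1 where "?Q s1" and s1: "mem_le M s1" "exec w (compile prepare) (input_state T) m1 A1 s1"
      "m1 \<le> scost prepare * M ^ 3" "A1 \<subseteq> sarrs prepare \<times> {..<B}"
    by (rule exec_of_wp[OF _ well_formed_prepare mem_le_input w]) (auto simp: program_size_def)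
  then obtain lab where rd: "ready s1 lab" and lab: "labelling lab slot_cell" and ctr: "counter s1 = (\<lambda>_. 0)"
    and going: "fst s1 aDONE 0 = 0" and zero: "snd s1 0 0 = ZSqrt2 0 0" by blast
  let ?L = "fst s1 aL 0"
  have ri: "rows_inv s1 (slot_cocycles lab)" and ok: "lab_ok lab" using rd by (simp_all add: ready_def)
  have "card (slot_cocycles lab) = 2 ^ ?L"
    using card_parametrises[of "rows s1" "{..<?L}"] ri by (simp add: rows_inv_def)
  then have L: "2 ^ ?L = (2::nat) ^ betti1 T" using card_slot_cocycles[OF lab v] by simp
  have k0: "binval ?L (counter s1) = 0" by (simp add: ctr binval_def)
  have "\<exists>s' m A. exec w (main_loop c) s1 m A s' \<and> mem_le M s' \<and> ready s' lab \<and>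
      m \<le> Suc (2 ^ ?L - 1) * (scost (process_cocycle c) * M ^ 3 + 5) + 5 \<and> A \<subseteq> program_arrays c \<times> {..<B} \<and>
      zvalue (snd s' 0 0) = zvalue (snd s1 0 0) +
        (\<Sum>k\<in>{binval ?L (counter s1)..<2 ^ ?L}. numbered_value c lab (rows s1) ?L k)"
    by (rule exec_main_loop[OF w rd going s1(1)]) (simp add: k0)
  then obtain s2 m2 A2 where s2: "exec w (main_loop c) s1 m2 A2 s2" "mem_le M s2" "ready s2 lab"
      "m2 \<le> 2 ^ ?L * (scost (process_cocycle c) * M ^ 3 + 5) + 5" "A2 \<subseteq> program_arrays c \<times> {..<B}"
    and z2: "zvalue (snd s2 0 0) = (\<Sum>\<alpha>\<in>slot_cocycles lab. cocycle_value c lab \<alpha>)"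
    unfolding k0 atLeast0LessThan sum_numbered_value[OF ri] zero by auto
  have n2: "fst s2 0 0 = tets T" using s2(3) by (simp add: ready_def tables_def)
  have "wp B M finish (\<lambda>s. fst s 0 0 = 48 * tets T \<and> snd s = snd s2) s2"
    by (simp add: finish_def n2 M_def)
  then obtain s3 m3 A3 where s3: "fst s3 0 0 = 48 * tets T \<and> snd s3 = snd s2" "mem_le M s3"
      "exec w (compile finish) s2 m3 A3 s3" "m3 \<le> scost finish * M ^ 3" "A3 \<subseteq> sarrs finish \<times> {..<B}"
    by (rule exec_of_wp[OF _ _ _ s2(2) w]) (auto simp: program_size_def finish_def)
  have run: "exec w (tv4_program c) (input_state T) (Suc (m1 + Suc (m2 + m3))) (A1 \<union> (A2 \<union> A3)) s3"
    unfolding tv4_program_def by (rule exec.Seq[OF s1(2) exec.Seq[OF s2(1) s3(3)]])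
  have "TV4 q T = of_real (1 / 4 * ((\<Sum>\<alpha>\<in>slot_cocycles lab. cocycle_value c lab \<alpha>) / sqrt 2 ^ (48 * tets T)))"
    by (rule TV4_gauss_sum[OF q v lab]) (use ok in \<open>simp_all add: lab_ok_def cocycle_value_def c\<close>)
  then have val: "TV4 q T = of_real (1 / 4 * output_value s3)"
    using s3(1) z2 by (simp add: output_value_def Let_def)
  let ?P = "2 ^ betti1 T * M ^ 3"
  have P: "M ^ 3 \<le> ?P" "1 \<le> ?P" "2 ^ betti1 T \<le> ?P" using M_ge_2 by simp_all
  have "m1 \<le> scost prepare * ?P" "m3 \<le> scost finish * ?P"
    using s1(3) s3(4) P(1) by (meson le_trans mult_le_mono2)+
  moreover have "m2 \<le> scost (process_cocycle c) * ?P + 5 * 2 ^ betti1 T + 5"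
    using s2(4) unfolding L by (simp add: algebra_simps)
  ultimately have "Suc (m1 + Suc (m2 + m3)) \<le> program_cost c * ?P"
    using P(2,3) unfolding program_cost_def add_mult_distrib by linarith
  moreover have "A1 \<union> (A2 \<union> A3) \<subseteq> program_arrays c \<times> {..<B}"
    using s1(4) s2(5) s3(5) by (auto simp: program_arrays_def)
  ultimately show thesis using that run val by blast
qed

end

text \<open>
  \<open>64 * n \<le> (n + 1) ^ 7\<close> and \<open>n + 1 \<le> 2 ^ \<lceil>log 2 (n + 1)\<rceil>\<close>, so powers of the largest word fit into
  words of logarithmic length.
\<close>

lemma less_two_power_word_length:
  assumes "0 < n"
  shows "(64 * n) ^ K < 2 ^ word_length (7 * K + 1) n"
proof -
  let ?b = "nat \<lceil>log 2 (real n + 1)\<rceil>"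
  have "real n + 1 = 2 powr log 2 (real n + 1)" by simp
  also have "\<dots> \<le> 2 powr real ?b" by (intro powr_mono) (simp_all add: real_nat_ceiling_ge)
  also have "2 powr real ?b = 2 ^ ?b" by (rule powr_realpow) simp
  finally have "real (Suc n) \<le> real (2 ^ ?b)" by simp
  then have b: "Suc n \<le> 2 ^ ?b" by (simp only: of_nat_le_iff)
  have "64 * n \<le> 2 ^ 6 * Suc n" by simp
  also have "\<dots> \<le> Suc n ^ 6 * Suc n" using assms by (intro mult_right_mono power_mono) simp_all
  also have "\<dots> = Suc n ^ 7" by (simp add: power_numeral_reduce del: power_Suc)
  finally have "64 * n \<le> Suc n ^ 7" .
  also have "\<dots> \<le> (2 ^ ?b) ^ 7" by (intro power_mono b) simp
  finally have "(64 * n) ^ K \<le> ((2 ^ ?b) ^ 7) ^ K" by (rule power_mono) simp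
  also have "\<dots> = 2 ^ (?b * (7 * K))" by (simp flip: power_mult)
  also have "\<dots> < 2 ^ (?b * (7 * K + 1))"
  proof -
    have "?b \<noteq> 0" using b assms by (intro notI) simp
    then show ?thesis by (intro power_strict_increasing) simp_all
  qed
  finally show ?thesis by (simp add: word_length_def mult.commute)
qed

lemma space_used_le:
  assumes "A \<subseteq> R \<times> {..<B}" "finite R"
  shows "space_used A \<le> card R * B"
proof -
  have R: "fst ` A \<subseteq> R" using assms(1) by auto
  have "Suc (Max {i. (a, i) \<in> A}) \<le> B" if "a \<in> fst ` A" for a
  proof -
    have "finite {i. (a, i) \<in> A}" by (rule finite_subset[of _ "{..<B}"]) (use assms(1) in auto)
    moreover have "{i. (a, i) \<in> A} \<noteq> {}" using that by force
    ultimately have "Max {i. (a, i) \<in> A} \<in> {i. (a, i) \<in> A}" by (rule Max_in)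
    then show ?thesis using assms(1) by auto
  qed
  then have "space_used A \<le> (\<Sum>a\<in>fst ` A. B)" unfolding space_used_def by (rule sum_mono)
  also have "\<dots> \<le> card R * B" using card_mono[OF assms(2) R] by simp
  finally show ?thesis .
qed

theorem theorem1:
  fixes q :: nat
  assumes "q \<in> {1, 3}"
  shows "\<exists>(prog :: com) (k :: nat) (C :: real) (D :: real).
    \<forall>T. triangulates_closed_3_manifold T \<and> one_vertex T \<longrightarrow>
      (\<exists>time locs final.
         exec (word_length k (tets T)) prog (input_state T) time locs final \<and>
         TV4 q T = of_real (1 / 4 * output_value final) \<and>
         real time \<le> C * (2 ^ betti1 T * real (tets T) ^ 3) \<and>
         real (space_used locs) \<le> D * real (tets T) ^ 2)"
proof -
  (* the element - [2] of the ring *)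
  define c where "c = ZSqrt2 0 (if q = 1 then - 1 else 1)"
  (* 64 ^ 3 and 64 ^ 2 come from M = 64 n in the bounds M ^ 3 and M ^ 2 *)
  let ?k = "7 * program_size c + 1" and ?C = "real (program_cost c) * 64 ^ 3"
    and ?D = "real (card (program_arrays c)) * 64 ^ 2"
  have "\<exists>time locs final. exec (word_length ?k (tets T)) (tv4_program c) (input_state T) time locs final \<and>
         TV4 q T = of_real (1 / 4 * output_value final) \<and>
         real time \<le> ?C * (2 ^ betti1 T * real (tets T) ^ 3) \<and>
         real (space_used locs) \<le> ?D * real (tets T) ^ 2"
    if "triangulates_closed_3_manifold T" and v: "one_vertex T" for T
  proof -
    have "cells T 0 \<noteq> {}" using v by (auto simp: one_vertex_def)
    then have n: "0 < tets T" by (auto simp: cells_def)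
    let ?M = "64 * tets T"
    interpret machine T "?M * ?M" ?M
      by unfold_locales (use that n in \<open>auto simp: triangulates_closed_3_manifold_def\<close>)
    have "- zvalue c = bracket2 q" using assms by (auto simp: c_def bracket2_def)
    then obtain m A s where run: "exec (word_length ?k (tets T)) (tv4_program c) (input_state T) m A s"
        "TV4 q T = of_real (1 / 4 * output_value s)"
      and m: "m \<le> program_cost c * (2 ^ betti1 T * ?M ^ 3)" and A: "A \<subseteq> program_arrays c \<times> {..<?M * ?M}"
      by (rule exec_tv4_program[OF assms v less_two_power_word_length[OF n]])
    have "real m \<le> real (program_cost c * (2 ^ betti1 T * ?M ^ 3))" using m by (simp only: of_nat_le_iff)
    also have "\<dots> = ?C * (2 ^ betti1 T * real (tets T) ^ 3)" by (simp add: power_mult_distrib)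
    finally have "real m \<le> ?C * (2 ^ betti1 T * real (tets T) ^ 3)" .
    moreover have "real (space_used A) \<le> real (card (program_arrays c) * (?M * ?M))"
      using space_used_le[OF A finite_program_arrays] by (simp only: of_nat_le_iff)
    then have "real (space_used A) \<le> ?D * real (tets T) ^ 2" by (simp add: power2_eq_square)
    ultimately show ?thesis using run by blast
  qed
  then show ?thesis by blast
qed

end
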